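(* Let $v:\mathbb R^2\to\mathbb R$ be smooth, compactly supported, non-positive and radial, with a unique non-degenerate minimum $v_0<0$ at $0$; write $v(r)$ for its radial profile and let $a>0$ be the smallest positive number with $\mathrm{supp}(v)\subset\overline B(0,a)$. Let $B>0$ and $L>a$. Let $\varphi$ be the normalized, radial, real-valued ground state of $(-ih\nabla-\mathbf A^{\mathrm{rad}})^2+v$ on $L^2(\mathbb R^2)$, where $\mathbf A^{\mathrm{rad}}(x,y)=\frac B2(-y,x)$, and define \[\varphi_\ell(x,y)=e^{-i\sigma_\ell/h}\varphi(x+L,y),\quad \varphi_r(x,y)=e^{-i\sigma_r/h}\varphi(x-L,y),\] with $\sigma_\ell(x,y)=\frac B2y(L-x)$, $\sigma_r(x,y)=-\frac B2y(L+x)$. Let \[w_h=\int_{\mathbb R^2}v(x+L,y)\,\varphi_\ell(x,y)\,\overline{\varphi_r(x,y)}\,dx\,dy.\] Then there exists a constant $C(B,L,v)>0$ such that \[w_h=-C(B,L,v)\,h^{1/2}e^{-S/h}(1+o(1))\quad\text{as }h\to0,\] with \[S=2d(0,L)+\int_0^L\Big(\sqrt{\tfrac{B^2(2L-r)^2}{4}-v_0}-\sqrt{\tfrac{B^2r^2}{4}-v_0}\Big)dr,\qquad d(0,L)=\int_0^L\sqrt{\tfrac{B^2r^2}{4}+v(r)-v_0}\,dr.\]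
   Context: $\varphi_\ell$ and $\varphi_r$ are the normalized ground states of $(-ih\nabla-\mathbf A)^2+v(x+L,y)$ and $(-ih\nabla-\mathbf A)^2+v(x-L,y)$ respectively, where $\mathbf A(x,y)=(0,Bx)$; $w_h$ is called the hopping coefficient. *)

theory Defs
  imports "HOL-Analysis.Analysis"
begin

definition pdx :: "(real \<times> real \<Rightarrow> 'b::real_normed_vector) \<Rightarrow> real \<times> real \<Rightarrow> 'b" where
  "pdx f p = vector_derivative (\<lambda>t. f (t, snd p)) (at (fst p))"

definition pdy :: "(real \<times> real \<Rightarrow> 'b::real_normed_vector) \<Rightarrow> real \<times> real \<Rightarrow> 'b" where
  "pdy f p = vector_derivative (\<lambda>t. f (fst p, t)) (at (snd p))"

fun pd :: "bool list \<Rightarrow> (real \<times> real \<Rightarrow> 'b::real_normed_vector) \<Rightarrow> real \<times> real \<Rightarrow> 'b" where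
  "pd [] f = f"
| "pd (b # bs) f = (if b then pdx else pdy) (pd bs f)"

definition smooth2 :: "(real \<times> real \<Rightarrow> 'b::real_normed_vector) \<Rightarrow> bool" where
  "smooth2 f \<longleftrightarrow> (\<forall>bs. continuous_on UNIV (pd bs f) \<and>
     (\<forall>p. (\<lambda>t. pd bs f (t, snd p)) differentiable (at (fst p)) \<and>
          (\<lambda>t. pd bs f (fst p, t)) differentiable (at (snd p))))"

definition compact_supp :: "(real \<times> real \<Rightarrow> 'b::real_normed_vector) \<Rightarrow> bool" where
  "compact_supp f \<longleftrightarrow> compact (closure {p. f p \<noteq> 0})"

definition radial :: "(real \<times> real \<Rightarrow> 'b) \<Rightarrow> bool" where
  "radial f \<longleftrightarrow> (\<forall>p q. norm p = norm q \<longrightarrow> f p = f q)"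

text \<open>Magnetic momentum components for A^rad(x,y) = (B/2)(-y,x):
  P_1 u = -i h d_x u - A_1 u,  P_2 u = -i h d_y u - A_2 u.\<close>
definition magP1 :: "real \<Rightarrow> real \<Rightarrow> (real \<times> real \<Rightarrow> complex) \<Rightarrow> real \<times> real \<Rightarrow> complex" where
  "magP1 B h u p = - (\<i> * of_real h) * pdx u p - of_real (- (B / 2) * snd p) * u p"

definition magP2 :: "real \<Rightarrow> real \<Rightarrow> (real \<times> real \<Rightarrow> complex) \<Rightarrow> real \<times> real \<Rightarrow> complex" where
  "magP2 B h u p = - (\<i> * of_real h) * pdy u p - of_real ((B / 2) * fst p) * u p"

definition magH :: "real \<Rightarrow> real \<Rightarrow> (real \<times> real \<Rightarrow> real) \<Rightarrow> (real \<times> real \<Rightarrow> complex) \<Rightarrow> real \<times> real \<Rightarrow> complex" where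
  "magH B h v u p = magP1 B h (magP1 B h u) p + magP2 B h (magP2 B h u) p + of_real (v p) * u p"

definition magQ :: "real \<Rightarrow> real \<Rightarrow> (real \<times> real \<Rightarrow> real) \<Rightarrow> (real \<times> real \<Rightarrow> complex) \<Rightarrow> real" where
  "magQ B h v u = (LINT p|lborel. (cmod (magP1 B h u p))\<^sup>2 + (cmod (magP2 B h u p))\<^sup>2 + v p * (cmod (u p))\<^sup>2)"

text \<open>Bottom of the spectrum of the (self-adjoint) operator: infimum of the Rayleigh
  quotient over the form core C_c^infinity(R^2; C).\<close>
definition spec_bottom :: "real \<Rightarrow> real \<Rightarrow> (real \<times> real \<Rightarrow> real) \<Rightarrow> real" where
  "spec_bottom B h v = Inf {magQ B h v u / (LINT p|lborel. (cmod (u p))\<^sup>2) | u.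
      smooth2 u \<and> compact_supp u \<and> (\<exists>p. u p \<noteq> 0)}"

definition ground_state :: "real \<Rightarrow> real \<Rightarrow> (real \<times> real \<Rightarrow> real) \<Rightarrow> (real \<times> real \<Rightarrow> real) \<Rightarrow> bool" where
  "ground_state B h v \<phi> \<longleftrightarrow> smooth2 \<phi> \<and> integrable lborel (\<lambda>p. (\<phi> p)\<^sup>2) \<and>
     (LINT p|lborel. (\<phi> p)\<^sup>2) = 1 \<and>
     (\<forall>p. magH B h v (\<lambda>q. complex_of_real (\<phi> q)) p = of_real (spec_bottom B h v * \<phi> p))"

definition hop :: "real \<Rightarrow> real \<Rightarrow> real \<Rightarrow> (real \<times> real \<Rightarrow> real) \<Rightarrow> (real \<times> real \<Rightarrow> real) \<Rightarrow> complex" where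
  "hop B L h v \<phi> = (LINT p|lborel. (case p of (x, y) \<Rightarrow>
      of_real (v (x + L, y))
      * (cis (- (B / 2 * y * (L - x)) / h) * of_real (\<phi> (x + L, y)))
      * cnj (cis (- (- (B / 2) * y * (L + x)) / h) * of_real (\<phi> (x - L, y)))))"

definition dist_agmon :: "real \<Rightarrow> real \<Rightarrow> (real \<times> real \<Rightarrow> real) \<Rightarrow> real" where
  "dist_agmon B L v = integral {0..L} (\<lambda>r. sqrt (B\<^sup>2 * r\<^sup>2 / 4 + v (r, 0) - v (0, 0)))"

definition tunnel_S :: "real \<Rightarrow> real \<Rightarrow> (real \<times> real \<Rightarrow> real) \<Rightarrow> real" where
  "tunnel_S B L v = 2 * dist_agmon B L v +
     integral {0..L} (\<lambda>r. sqrt (B\<^sup>2 * (2 * L - r)\<^sup>2 / 4 - v (0, 0)) - sqrt (B\<^sup>2 * r\<^sup>2 / 4 - v (0, 0)))"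

end

theory Submission
  imports Defs "HOL-Real_Asymp.Real_Asymp" "HOL-Probability.Distributions"
begin

text \<open>
  On radial functions the operator reduces to \<open>- h\<^sup>2 \<Delta> + B\<^sup>2 r\<^sup>2 / 4 + v\<close>. The ground state profile
  \<open>f\<close> is compared, through the monotonicity of Wronskians, with the quasimode
  \<open>g = exp (\<B> - \<Phi> / h)\<close> and its multiples \<open>r powr (\<plusminus> \<tau> h) g\<close>, which are sub- and supersolutions for
  \<open>r \<ge> sqrt h\<close>; a Gaussian trial state gives the energy up to \<open>O(h\<^sup>2)\<close>. Hence \<open>f / f(0) = g (1 + o(1))\<close> and
  \<open>h f(0)\<^sup>2\<close> converges.

  In the hopping integral the factor \<open>v \<phi>\<close> is radial, so the translated ground state may be replaced by
  its average \<open>G\<close> over circles. Since \<open>a < L\<close>, the translate solves the free magnetic equation on the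
  support of \<open>v\<close>, and \<open>G\<close> is the regular solution of the free radial equation with
  \<open>G(0) = \<phi>(2L)\<close>. The equation for \<open>f\<close> turns \<open>\<integral> v f G r dr\<close> into the Wronskian of
  \<open>f\<close> and \<open>G\<close> at \<open>r = L\<close>, and \<open>G\<close> is controlled by Langer's approximation with the Bessel function \<open>I0\<close>.
\<close>

subsection \<open>Radial integrals in the plane\<close>

text \<open>The leading constant of an exponentially small quantity is wanted, so all comparisons
  are made for logarithmic derivatives: an error O(h/r) integrates to a factor 1 + o(1). This fixes
  the threshold sqrt h. The correction by powers \<tau> h of r leaves a term \<tau>^2 h^2 / r^2,
  bounded only for r^2 >= h; from sqrt h outward the error in the logarithm is of order h ln(r /
  sqrt h), which still tends to 0. Positivity of the ground state is not part of its definition and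
  is derived from the energy bounds.

  The exponent S has three sources: decay of f up to L, decay of f up to 2L (the value G(0)), and
  growth of G from 0 to L, which enters negatively. At L one function decays and the other grows, so
  the two terms of the Wronskian add up. The growth of G depends on the exact energy; the shift 2
  \<omega> h changes its exponent by a bounded amount and leaves a constant factor. Powers of h: 2
  from the Wronskian identity, -1 from f(0)^2, -1 from the logarithmic derivatives, 1/2 from the
  Bessel function. All limits depend on B, L, v only, so one constant serves every family of ground
  states.\<close>

lemma distr_norm_square:
  "distr lborel borel (\<lambda>p::real \<times> real. - (norm p)\<^sup>2) =
   density lborel (\<lambda>s. ennreal (pi * indicator {..0} s))"
proof (rule measure_eqI_lessThan)
  \<comment> \<open>The minus sign makes preimages of upper half-lines bounded: they are balls, of
    finite measure, as the uniqueness criterion on half-lines requires.\<close>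
  have e: "emeasure (distr lborel borel (\<lambda>p::real \<times> real. - (norm p)\<^sup>2)) {x<..} = ennreal (pi * max 0 (-x))" for x
  proof -
    have "emeasure (distr lborel borel (\<lambda>p::real \<times> real. - (norm p)\<^sup>2)) {x<..} =
        emeasure lborel ((\<lambda>p::real \<times> real. - (norm p)\<^sup>2) -` {x<..})"
      by (subst emeasure_distr) auto
    also have "(\<lambda>p::real \<times> real. - (norm p)\<^sup>2) -` {x<..} = ball 0 (sqrt (max 0 (- x)))"
    proof (intro set_eqI)
      fix p :: "real \<times> real"
      have "x < - (norm p)\<^sup>2 \<longleftrightarrow> norm p < sqrt (max 0 (-x))"
      proof (cases "x < 0")
        case True
        have "norm p < sqrt (- x) \<longleftrightarrow> (norm p)\<^sup>2 < - x"
          by (metis norm_ge_zero real_sqrt_less_iff real_sqrt_unique)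
        with True show ?thesis by (auto simp: max_def)
      next
        case False
        have "(norm p)\<^sup>2 \<ge> 0" by simp
        with False have "\<not> x < - (norm p)\<^sup>2" by linarith
        with False show ?thesis by (simp add: max_def not_less)
      qed
      then show "p \<in> (\<lambda>p::real \<times> real. - (norm p)\<^sup>2) -` {x<..} \<longleftrightarrow> p \<in> ball 0 (sqrt (max 0 (- x)))"
        by simp
    qed
    also have "emeasure lborel (ball (0::real \<times> real) (sqrt (max 0 (- x)))) = ennreal (pi * max 0 (-x))"
      by (subst emeasure_ball) (auto simp: unit_ball_vol_2)
    finally show ?thesis .
  qed
  show "emeasure (distr lborel borel (\<lambda>p::real \<times> real. - (norm p)\<^sup>2)) {x<..} < \<infinity>" for x
    by (simp add: e)
  show "emeasure (distr lborel borel (\<lambda>p::real \<times> real. - (norm p)\<^sup>2)) {x<..} =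
        emeasure (density lborel (\<lambda>s. ennreal (pi * indicator {..0} s))) {x<..}" for x
  proof -
    have "emeasure (density lborel (\<lambda>s. ennreal (pi * indicator {..0} s))) {x<..} =
       (\<integral>\<^sup>+s. ennreal (pi * indicator {..0} s) * indicator {x<..} s \<partial>lborel)"
      by (subst emeasure_density) auto
    also have "\<dots> = (\<integral>\<^sup>+s. ennreal pi * indicator {x<..0} s \<partial>lborel)"
      by (intro nn_integral_cong) (auto simp: indicator_def)
    also have "\<dots> = ennreal pi * emeasure lborel {x<..0}"
      by (subst nn_integral_cmult_indicator) auto
    also have "\<dots> = ennreal (pi * max 0 (-x))"
    proof (cases "x \<le> 0")
      case True
      then show ?thesis by (simp add: ennreal_mult[symmetric] max_def)
    qed (auto simp: max_def)
    finally show ?thesis by (simp add: e)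
  qed
qed auto

text \<open>In the variable s = |p|^2 the planar measure has the constant density pi on the
  half-line, so no Jacobian has to be carried along. This is why radial integrals are written in s
  throughout.\<close>

lemma radial_integral:
  fixes F :: "real \<Rightarrow> real"
  assumes [measurable]: "F \<in> borel_measurable borel"
  shows integrable_radial: "integrable lborel (\<lambda>p::real \<times> real. F ((norm p)\<^sup>2)) \<longleftrightarrow> set_integrable lborel {0..} F"
    and integral_radial: "(LINT p|lborel. F ((norm (p::real \<times> real))\<^sup>2)) = pi * (LINT s:{0..}|lborel. F s)"
proof -
  have i1: "integrable lborel (\<lambda>p::real \<times> real. F ((norm p)\<^sup>2)) \<longleftrightarrow>
     integrable (distr lborel borel (\<lambda>p::real \<times> real. - (norm p)\<^sup>2)) (\<lambda>s. F (-s))"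
    by (subst integrable_distr_eq) auto
  have i2: "integrable (distr lborel borel (\<lambda>p::real \<times> real. - (norm p)\<^sup>2)) (\<lambda>s. F (-s)) \<longleftrightarrow>
      integrable lborel (\<lambda>s. (pi * indicator {..0} s) * F (- s))"
    unfolding distr_norm_square by (subst integrable_density) auto
  have i3: "integrable lborel (\<lambda>s. (pi * indicator {..0} s) * F (- s)) \<longleftrightarrow>
      integrable lborel (\<lambda>s. (pi * indicator {..0} (-s)) * F s)"
    using lborel_integrable_real_affine_iff[of "-1" "\<lambda>s. (pi * indicator {..0} s) * F (- s)" 0] by simp
  have c: "(\<lambda>s. (pi * indicator {..0} (-s)) * F s) = (\<lambda>s. pi * (indicator {0..} s * F s))"
    by (auto simp: indicator_def)
  show "integrable lborel (\<lambda>p::real \<times> real. F ((norm p)\<^sup>2)) \<longleftrightarrow> set_integrable lborel {0..} F"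
    unfolding i1 i2 i3 c by (simp add: set_integrable_def)
  have "(LINT p|lborel. F ((norm (p::real \<times> real))\<^sup>2)) =
     (LINT s|distr lborel borel (\<lambda>p::real \<times> real. - (norm p)\<^sup>2). F (-s))"
    by (subst integral_distr) auto
  also have "\<dots> = (LINT s|lborel. (pi * indicator {..0} s) * F (- s))"
    unfolding distr_norm_square by (subst integral_density) auto
  also have "\<dots> = (LINT s|lborel. (pi * indicator {..0} (-s)) * F s)"
    by (subst lborel_integral_real_affine[where c="-1" and t=0]) auto
  finally show "(LINT p|lborel. F ((norm (p::real \<times> real))\<^sup>2)) = pi * (LINT s:{0..}|lborel. F s)"
    unfolding c by (simp add: set_lebesgue_integral_def)
qed

section \<open>Invariance of planar Lebesgue measure under shears and rotations; averages over
  circles\<close>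

lemma nn_integral_shear_fst:
  fixes F :: "real \<times> real \<Rightarrow> ennreal"
  assumes [measurable]: "F \<in> borel_measurable borel"
  shows "(\<integral>\<^sup>+p. F (fst p + m * snd p, snd p) \<partial>lborel) = (\<integral>\<^sup>+p. F p \<partial>lborel)"
proof -
  have [measurable]: "F \<in> borel_measurable (lborel \<Otimes>\<^sub>M lborel)"
    by (simp add: lborel_prod)
  have "(\<lambda>p::real \<times> real. (fst p + m * snd p, snd p)) \<in> borel_measurable borel"
    by (intro borel_measurable_continuous_onI continuous_intros)
  from measurable_compose[OF this assms]
  have [measurable]: "(\<lambda>p. F (fst p + m * snd p, snd p)) \<in> borel_measurable (lborel \<Otimes>\<^sub>M lborel)"
    by (simp add: lborel_prod)
  have "(\<integral>\<^sup>+p. F (fst p + m * snd p, snd p) \<partial>lborel) = (\<integral>\<^sup>+y. \<integral>\<^sup>+x. F (x + m * y, y) \<partial>lborel \<partial>lborel)"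
    by (subst lborel_prod[symmetric], subst lborel_pair.nn_integral_snd[symmetric]) auto
  also have "\<dots> = (\<integral>\<^sup>+y. \<integral>\<^sup>+x. F (x, y) \<partial>lborel \<partial>lborel)"
  proof (rule nn_integral_cong)
    fix y :: real
    show "(\<integral>\<^sup>+x. F (x + m * y, y) \<partial>lborel) = (\<integral>\<^sup>+x. F (x, y) \<partial>lborel)"
      by (subst nn_integral_real_affine[where c=1 and t="m*y" and f = "\<lambda>x. F (x,y)"]) (auto simp: add.commute)
  qed
  also have "\<dots> = (\<integral>\<^sup>+p. F p \<partial>lborel)"
    by (subst lborel_pair.nn_integral_snd) (auto simp: lborel_prod)
  finally show ?thesis .
qed

lemma nn_integral_shear_snd:
  fixes F :: "real \<times> real \<Rightarrow> ennreal"
  assumes [measurable]: "F \<in> borel_measurable borel"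
  shows "(\<integral>\<^sup>+p. F (fst p, snd p + m * fst p) \<partial>lborel) = (\<integral>\<^sup>+p. F p \<partial>lborel)"
proof -
  have [measurable]: "F \<in> borel_measurable (lborel \<Otimes>\<^sub>M lborel)"
    by (simp add: lborel_prod)
  have "(\<lambda>p::real \<times> real. (fst p, snd p + m * fst p)) \<in> borel_measurable borel"
    by (intro borel_measurable_continuous_onI continuous_intros)
  from measurable_compose[OF this assms]
  have [measurable]: "(\<lambda>p. F (fst p, snd p + m * fst p)) \<in> borel_measurable (lborel \<Otimes>\<^sub>M lborel)"
    by (simp add: lborel_prod)
  have "(\<integral>\<^sup>+p. F (fst p, snd p + m * fst p) \<partial>lborel) = (\<integral>\<^sup>+x. \<integral>\<^sup>+y. F (x, y + m * x) \<partial>lborel \<partial>lborel)"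
    by (subst lborel_prod[symmetric], subst lborel.nn_integral_fst[symmetric]) auto
  also have "\<dots> = (\<integral>\<^sup>+x. \<integral>\<^sup>+y. F (x, y) \<partial>lborel \<partial>lborel)"
  proof (rule nn_integral_cong)
    fix x :: real
    show "(\<integral>\<^sup>+y. F (x, y + m * x) \<partial>lborel) = (\<integral>\<^sup>+y. F (x, y) \<partial>lborel)"
      by (subst nn_integral_real_affine[where c=1 and t="m*x" and f = "\<lambda>y. F (x,y)"]) (auto simp: add.commute)
  qed
  also have "\<dots> = (\<integral>\<^sup>+p. F p \<partial>lborel)"
    by (subst lborel.nn_integral_fst) (auto simp: lborel_prod)
  finally show ?thesis .
qed

definition rot2 :: "real \<Rightarrow> real \<times> real \<Rightarrow> real \<times> real" where
  "rot2 \<theta> p = (cos \<theta> * fst p - sin \<theta> * snd p, sin \<theta> * fst p + cos \<theta> * snd p)"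

lemma rot2_measurable [measurable]: "rot2 \<theta> \<in> borel_measurable borel"
  unfolding rot2_def by (intro borel_measurable_continuous_onI continuous_intros)

lemma norm_rot2 [simp]: "norm (rot2 \<theta> p) = norm p"
proof -
  have "(cos \<theta> * fst p - sin \<theta> * snd p)\<^sup>2 + (sin \<theta> * fst p + cos \<theta> * snd p)\<^sup>2 = (fst p)\<^sup>2 + (snd p)\<^sup>2"
    using sin_cos_squared_add[of \<theta>] by algebra
  then show ?thesis by (simp add: rot2_def norm_prod_def)
qed

text \<open>A rotation by an angle other than \<open>\<pi>\<close> is a product of three shears.\<close>

lemma distr_rot2:
  assumes "cos \<theta> \<noteq> - 1"
  shows "distr lborel lborel (rot2 \<theta>) = lborel"
proof (rule measure_eqI)
  fix A :: "(real \<times> real) set" assume "A \<in> sets (distr lborel lborel (rot2 \<theta>))"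
  then have [measurable]: "A \<in> sets borel" by simp
  \<comment> \<open>This is -tan(\<theta>/2), the slope of the first and third shear; the middle one
    has slope sin \<theta>.\<close>
  define t where "t = - sin \<theta> / (1 + cos \<theta>)"
  have c: "1 + cos \<theta> \<noteq> 0" using assms by auto
  have tc: "t * (1 + cos \<theta>) = - sin \<theta>" using c by (simp add: t_def)
  have e1: "1 + t * sin \<theta> = cos \<theta>"
  proof -
    have "(1 + cos \<theta>) * (1 + t * sin \<theta>) = (1 + cos \<theta>) * cos \<theta>"
      using tc sin_cos_squared_add[of \<theta>] by algebra
    then show ?thesis using c by simp
  qed
  have rot: "rot2 \<theta> p = (fst p + t * snd p + t * (snd p + sin \<theta> * (fst p + t * snd p)), snd p + sin \<theta> * (fst p + t * snd p))" for p
  proof -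
    have "cos \<theta> * fst p - sin \<theta> * snd p = fst p + t * snd p + t * (snd p + sin \<theta> * (fst p + t * snd p))"
      using tc e1 by algebra
    moreover have "sin \<theta> * fst p + cos \<theta> * snd p = snd p + sin \<theta> * (fst p + t * snd p)"
      unfolding e1[symmetric] by (simp add: algebra_simps)
    ultimately show ?thesis by (simp add: rot2_def)
  qed
  let ?I = "indicator A :: real \<times> real \<Rightarrow> ennreal"
  have im: "(\<lambda>p. ?I (T p)) \<in> borel_measurable borel" if "continuous_on UNIV T" for T :: "real \<times> real \<Rightarrow> real \<times> real"
    by (rule measurable_compose[OF borel_measurable_continuous_onI[OF that]]) simp
  have im1: "(\<lambda>p. ?I (fst p + t * (snd p + sin \<theta> * fst p), snd p + sin \<theta> * fst p)) \<in> borel_measurable borel"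
    by (intro im continuous_intros)
  have im2: "(\<lambda>p. ?I (fst p + t * snd p, snd p)) \<in> borel_measurable borel"
    by (intro im continuous_intros)
  have "emeasure (distr lborel lborel (rot2 \<theta>)) A = (\<integral>\<^sup>+p. ?I (rot2 \<theta> p) \<partial>lborel)"
    by (subst nn_integral_indicator[symmetric], simp, subst nn_integral_distr) auto
  also have "\<dots> = (\<integral>\<^sup>+p. ?I (fst p + t * snd p, snd p) \<partial>lborel)"
  proof -
    have "(\<integral>\<^sup>+p. ?I (fst p + t * (snd p + sin \<theta> * fst p), snd p + sin \<theta> * fst p) \<partial>lborel) =
       (\<integral>\<^sup>+p. ?I (rot2 \<theta> p) \<partial>lborel)"
      using nn_integral_shear_fst[OF im1, of t]
      by (simp add: rot)
    moreover have "(\<integral>\<^sup>+p. ?I (fst p + t * (snd p + sin \<theta> * fst p), snd p + sin \<theta> * fst p) \<partial>lborel) =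
        (\<integral>\<^sup>+p. ?I (fst p + t * snd p, snd p) \<partial>lborel)"
      using nn_integral_shear_snd[OF im2, of "sin \<theta>"] by simp
    ultimately show ?thesis by simp
  qed
  also have "\<dots> = emeasure lborel A"
    by (subst nn_integral_shear_fst) auto
  finally show "emeasure (distr lborel lborel (rot2 \<theta>)) A = emeasure lborel A" .
qed simp

lemma integral_periodic_shift:
  fixes D :: "real \<Rightarrow> real"
  assumes D: "continuous_on UNIV D" and per: "\<And>t. D (t + 2 * pi) = D t" and \<alpha>: "0 \<le> \<alpha>" "\<alpha> \<le> 2 * pi"
  shows "integral {0..2 * pi} (\<lambda>t. D (t + \<alpha>)) = integral {0..2 * pi} D"
proof -
  have int: "D integrable_on {x..y}" for x y
    by (rule integrable_continuous_real) (rule continuous_on_subset[OF D], simp)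
  have sh: "integral {x..y} (\<lambda>t. D (t + c)) = integral {x + c..y + c} D" for x y c
    using integral_shift[where a=x and b=y and f=D and c=c] D by (auto simp: continuous_on_subset o_def)
  have "integral {0..2 * pi} (\<lambda>t. D (t + \<alpha>)) = integral {\<alpha>..2 * pi + \<alpha>} D"
    using sh[of 0 "2 * pi" \<alpha>] by (simp add: add.commute)
  also have "\<dots> = integral {\<alpha>..2 * pi} D + integral {2 * pi..2 * pi + \<alpha>} D"
    by (rule Henstock_Kurzweil_Integration.integral_combine[symmetric]) (use \<alpha> int in auto)
  also have "integral {2 * pi..2 * pi + \<alpha>} D = integral {0..\<alpha>} D"
    using sh[of 0 \<alpha> "2 * pi"] by (simp add: per add.commute)
  also have "integral {\<alpha>..2 * pi} D + integral {0..\<alpha>} D = integral {0..2 * pi} D"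
    using Henstock_Kurzweil_Integration.integral_combine[of 0 \<alpha> "2 * pi" D] \<alpha> int by simp
  finally show ?thesis .
qed

text \<open>A radial weight does not notice a rotation, so the integral is unchanged when \<psi> is
  rotated by any angle; averaging over the angle and exchanging the integrals produces the circle
  mean. The bounded support of w makes the integrand on angle times plane integrable.\<close>

lemma radial_integral_circle_average:
  fixes w \<psi> :: "real \<times> real \<Rightarrow> real"
  assumes w: "continuous_on UNIV w" "radial w" and w0: "\<And>p. norm p > R \<Longrightarrow> w p = 0"
    and \<psi>: "continuous_on UNIV \<psi>"
  shows "(LINT p|lborel. w p * \<psi> p) =
    (LINT p|lborel. w p * (integral {0..2 * pi} (\<lambda>\<theta>. \<psi> (norm p * cos \<theta>, norm p * sin \<theta>)) / (2 * pi)))"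
proof -
  define I where "I = (LINT p|lborel. w p * \<psi> p)"
  define K where "K = {0..2 * pi} \<times> cball (0::real \<times> real) R"
  define H where "H = (\<lambda>z. indicator K z *\<^sub>R (w (snd z) * \<psi> (rot2 (fst z) (snd z))))"
  have wm [measurable]: "w \<in> borel_measurable borel" and pm [measurable]: "\<psi> \<in> borel_measurable borel"
    using w \<psi> by (auto intro: borel_measurable_continuous_onI)
  have rotc: "continuous_on A (\<lambda>z. rot2 (fst z) (snd z))" for A
    unfolding rot2_def by (intro continuous_intros)
  have Hint: "integrable lborel H"
    unfolding H_def
  proof (rule borel_integrable_compact)
    show "compact K" unfolding K_def by (intro compact_Times) auto
    show "continuous_on K (\<lambda>z. w (snd z) * \<psi> (rot2 (fst z) (snd z)))"
      by (intro continuous_intros continuous_on_compose2[OF w(1)] continuous_on_compose2[OF \<psi>] rotc) auto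
  qed
  have Hval: "H (\<theta>, p) = indicator {0..2 * pi} \<theta> * (w p * \<psi> (rot2 \<theta> p))" for \<theta> p
    using w0[of p] by (auto simp: H_def K_def indicator_def not_le)
  have fub: "(LINT \<theta>|lborel. LINT p|lborel. H (\<theta>, p)) = (LINT p|lborel. LINT \<theta>|lborel. H (\<theta>, p))"
    using lborel_pair.Fubini_integral[of "\<lambda>\<theta> p. H (\<theta>, p)"] Hint by (simp add: lborel_prod)
  \<comment> \<open>The shear factorisation fails at the single angle pi, a null set for the outer
    integral.\<close>
  have in\<theta>: "(LINT p|lborel. H (\<theta>, p)) = indicator {0..2 * pi} \<theta> * I" if "\<theta> \<noteq> pi" for \<theta>
  proof (cases "\<theta> \<in> {0..2 * pi}")
    case True
    have "cos \<theta> \<noteq> - 1"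
    proof
      assume "cos \<theta> = -1"
      then have "cos (\<theta> - pi) = 1" by (simp add: cos_diff)
      then obtain n :: int where "\<theta> - pi = of_int n * 2 * pi" using cos_one_2pi_int[of "\<theta> - pi"] by blast
      then have n: "\<theta> = pi * (2 * of_int n + 1)" by (simp add: algebra_simps)
      have "n \<noteq> 0" using n that by auto
      then consider "n \<ge> 1" | "n \<le> -1" by linarith
      then show False
      proof cases
        case 1
        then have "(2 * real_of_int n + 1) > 2" by linarith
        then have "pi * (2 * real_of_int n + 1) > pi * 2" by (intro mult_strict_left_mono) auto
        with n True show False by auto
      next
        case 2
        then have "(2 * real_of_int n + 1) < 0" by linarith
        then have "pi * (2 * real_of_int n + 1) < 0" by (simp add: mult_pos_neg)
        with n True show False by auto
      qed
    qed
    note d = distr_rot2[OF this]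
    have "I = (LINT p|distr lborel lborel (rot2 \<theta>). w p * \<psi> p)"
      by (simp only: d I_def)
    also have "\<dots> = (LINT p|lborel. w (rot2 \<theta> p) * \<psi> (rot2 \<theta> p))"
      by (subst integral_distr) auto
    also have "\<dots> = (LINT p|lborel. w p * \<psi> (rot2 \<theta> p))"
    proof -
      have "w (rot2 \<theta> p) = w p" for p
        using w(2) norm_rot2 unfolding radial_def by blast
      then show ?thesis by simp
    qed
    finally show ?thesis using True by (simp add: Hval)
  next
    case False
    then show ?thesis by (simp add: Hval)
  qed
  have "(LINT \<theta>|lborel. LINT p|lborel. H (\<theta>, p)) = (LINT \<theta>|lborel. indicator {0..2 * pi} \<theta> * I)"
  proof (rule integral_cong_AE)
    have "AE \<theta> in lborel. \<theta> \<noteq> pi"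
      by (rule AE_lborel_singleton)
    then show "AE \<theta> in lborel. (LINT p|lborel. H (\<theta>, p)) = indicator {0..2 * pi} \<theta> * I"
      by eventually_elim (rule in\<theta>)
    show "(\<lambda>\<theta>. LINT p|lborel. H (\<theta>, p)) \<in> borel_measurable lborel"
      using lborel_pair.integrable_fst[of "\<lambda>\<theta> p. H (\<theta>, p)"] Hint
      by (simp add: lborel_prod borel_measurable_integrable)
  qed auto
  also have "\<dots> = 2 * pi * I"
    by simp
  finally have e1: "(LINT p|lborel. LINT \<theta>|lborel. H (\<theta>, p)) = 2 * pi * I" using fub by simp
  have inp: "(LINT \<theta>|lborel. H (\<theta>, p)) = w p * integral {0..2 * pi} (\<lambda>\<theta>. \<psi> (norm p * cos \<theta>, norm p * sin \<theta>))" for p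
  proof -
    \<comment> \<open>With a polar angle of p, rotating p becomes a shift of the angle, and
      periodicity removes the shift from the full-circle integral.\<close>
    obtain \<alpha> where \<alpha>: "0 \<le> \<alpha>" "\<alpha> \<le> 2 * pi" "fst p = norm p * cos \<alpha>" "snd p = norm p * sin \<alpha>"
    proof (cases "p = 0")
      case True
      then show ?thesis using that[of 0] by simp
    next
      case False
      have "(fst p / norm p)\<^sup>2 + (snd p / norm p)\<^sup>2 = 1"
        using False by (simp add: power_divide add_divide_distrib[symmetric] norm_prod_def)
          (simp add: prod_eq_iff sum_power2_eq_zero_iff)
      from sincos_total_2pi[OF this] obtain t where "0 \<le> t" "t < 2 * pi" "fst p / norm p = cos t" "snd p / norm p = sin t"
        by metis
      then show ?thesis using False that[of t] by (simp add: field_simps)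
    qed
    define D where "D = (\<lambda>\<theta>. \<psi> (norm p * cos \<theta>, norm p * sin \<theta>))"
    have rp: "\<psi> (rot2 \<theta> p) = D (\<theta> + \<alpha>)" for \<theta>
      unfolding D_def rot2_def \<alpha>(3,4) by (simp add: cos_add sin_add algebra_simps)
    have cD: "continuous_on UNIV D" unfolding D_def
      by (intro continuous_on_compose2[OF \<psi>] continuous_intros) auto
    have cD': "continuous_on {0..2*pi} (\<lambda>\<theta>. D (\<theta> + \<alpha>))"
      by (intro continuous_on_compose2[OF cD] continuous_intros) auto
    have "(LINT \<theta>|lborel. H (\<theta>, p)) = w p * (LINT \<theta>:{0..2 * pi}|lborel. D (\<theta> + \<alpha>))"
      by (simp add: Hval rp set_lebesgue_integral_def mult.left_commute)
    also have "(LINT \<theta>:{0..2 * pi}|lborel. D (\<theta> + \<alpha>)) = integral {0..2 * pi} (\<lambda>\<theta>. D (\<theta> + \<alpha>))"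
      by (rule set_borel_integral_eq_integral(2)) (rule borel_integrable_atLeastAtMost'[OF cD'])
    also have "\<dots> = integral {0..2 * pi} D"
      by (rule integral_periodic_shift[OF cD _ \<alpha>(1,2)]) (simp add: D_def)
    finally show ?thesis by (simp add: D_def)
  qed
  have "I = (LINT p|lborel. LINT \<theta>|lborel. H (\<theta>, p)) / (2 * pi)"
    using e1 by simp
  then show ?thesis unfolding inp I_def by simp
qed

text \<open>Up to normalisation the integrand is the Erlang density, whose total mass is 1.\<close>

lemma exp_moment:
  fixes \<alpha> :: real
  assumes "\<alpha> > 0"
  shows "has_bochner_integral lborel (\<lambda>s. indicator {0..} s *\<^sub>R (s ^ n * exp (- \<alpha> * s))) (fact n / \<alpha> ^ Suc n)"
proof -
  have pr: "prob_space (density lborel (erlang_density n \<alpha>))" by (rule prob_space_erlang_density[OF assms])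
  have "(\<integral>\<^sup>+x. ennreal (erlang_density n \<alpha> x) \<partial>lborel) = 1"
    using prob_space.emeasure_space_1[OF pr] by (simp add: emeasure_density)
  then have "has_bochner_integral lborel (erlang_density n \<alpha>) 1"
    using assms by (intro has_bochner_integral_nn_integral) (auto simp: erlang_density_def)
  then have "has_bochner_integral lborel (\<lambda>x. erlang_density n \<alpha> x * (fact n / \<alpha> ^ Suc n)) (1 * (fact n / \<alpha> ^ Suc n))"
    by (rule has_bochner_integral_mult_left)
  moreover have "(\<lambda>x. erlang_density n \<alpha> x * (fact n / \<alpha> ^ Suc n)) = (\<lambda>s. indicator {0..} s *\<^sub>R (s ^ n * exp (- \<alpha> * s)))"
    using assms by (auto simp: fun_eq_iff erlang_density_def indicator_def field_simps)
  ultimately show ?thesis by simp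
qed

subsection \<open>Radial ground states\<close>

lemma smooth2_dx:
  assumes "smooth2 f"
  shows "((\<lambda>t. pd bs f (t, y)) has_vector_derivative pd (True # bs) f (x, y)) (at x)"
proof -
  have "(\<lambda>t. pd bs f (t, snd (x, y))) differentiable (at (fst (x, y)))"
    using assms unfolding smooth2_def by blast
  then show ?thesis by (simp add: vector_derivative_works pdx_def)
qed

lemma smooth2_dy:
  assumes "smooth2 f"
  shows "((\<lambda>t. pd bs f (x, t)) has_vector_derivative pd (False # bs) f (x, y)) (at y)"
proof -
  have "(\<lambda>t. pd bs f (fst (x, y), t)) differentiable (at (snd (x, y)))"
    using assms unfolding smooth2_def by blast
  then show ?thesis by (simp add: vector_derivative_works pdy_def)
qed

lemma smooth2_dx_real:
  fixes f :: "real \<times> real \<Rightarrow> real"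
  assumes "smooth2 f"
  shows "((\<lambda>t. pd bs f (t, y)) has_real_derivative pd (True # bs) f (x, y)) (at x)"
  using smooth2_dx[OF assms] by (simp add: has_real_derivative_iff_has_vector_derivative)

lemma smooth2_dy_real:
  fixes f :: "real \<times> real \<Rightarrow> real"
  assumes "smooth2 f"
  shows "((\<lambda>t. pd bs f (x, t)) has_real_derivative pd (False # bs) f (x, y)) (at y)"
  using smooth2_dy[OF assms] by (simp add: has_real_derivative_iff_has_vector_derivative)

lemma smooth2_cont: "smooth2 f \<Longrightarrow> continuous_on UNIV (pd bs f)"
  unfolding smooth2_def by blast

text \<open>Differentiation flips parity. Iterated with c = (-1)^n it kills the odd derivatives of
  an even profile at 0, which is why the potential has no cubic term.\<close>

lemma deriv_of_parity:
  fixes f f1 :: "real \<Rightarrow> real"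
  assumes "\<And>r. f (- r) = c * f r" "\<And>r. (f has_real_derivative f1 r) (at r)"
  shows "f1 (- r) = - c * f1 r"
proof -
  have "((\<lambda>r. f (- r)) has_real_derivative f1 (- r) * (- 1)) (at r)"
    by (rule DERIV_chain2[where g = uminus, OF assms(2)]) (auto intro!: derivative_eq_intros)
  moreover have "((\<lambda>r. f (- r)) has_real_derivative c * f1 r) (at r)"
    unfolding assms(1) by (rule DERIV_cmult[OF assms(2)])
  ultimately have "f1 (- r) * (- 1) = c * f1 r" by (rule DERIV_unique)
  then show ?thesis by simp
qed

lemma radial_norm:
  assumes "radial f" shows "f p = f (norm p, 0)"
proof -
  have "norm p = norm (norm p, 0 :: real)" by (simp add: norm_prod_def)
  then show ?thesis using assms unfolding radial_def by blast
qed

lemma radial_even: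
  assumes "radial f" shows "f (- r, 0) = f (r, 0)"
proof -
  have "norm (- r, 0 :: real) = norm (r, 0 :: real)" by (simp add: norm_prod_def)
  then show ?thesis using assms unfolding radial_def by blast
qed

text \<open>On the vertical line through (r, 0) the function is its profile composed with sqrt(r^2 +
  t^2), which has first derivative 0 and second derivative 1/r at t = 0. So at (r, 0) the Laplacian
  is f'' + f'/r, and it need not be computed anywhere else.\<close>

lemma radial_dyy:
  fixes f :: "real \<times> real \<Rightarrow> real"
  assumes sm: "smooth2 f" and rad: "radial f" and r: "r > 0"
  shows "pd [False, False] f (r, 0) = pd [True] f (r, 0) / r"
proof -
  let ?f = "\<lambda>r. f (r, 0)" let ?f1 = "\<lambda>r. pd [True] f (r, 0)" let ?f2 = "\<lambda>r. pd [True, True] f (r, 0)"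
  have d1: "(?f has_real_derivative ?f1 x) (at x)" for x using smooth2_dx_real[OF sm, of "[]" 0 x] by simp
  have d2: "(?f1 has_real_derivative ?f2 x) (at x)" for x using smooth2_dx_real[OF sm, of "[True]" 0 x] by simp
  define \<rho> where "\<rho> = (\<lambda>t. sqrt (r\<^sup>2 + t\<^sup>2))"
  have \<rho>p: "\<rho> t > 0" for t using r by (simp add: \<rho>_def add_pos_nonneg)
  have d\<rho>: "(\<rho> has_real_derivative t / \<rho> t) (at t)" for t
  proof -
    have p: "r\<^sup>2 + t\<^sup>2 > 0" using r by (simp add: add_pos_nonneg)
    have "((\<lambda>t. sqrt (r\<^sup>2 + t\<^sup>2)) has_real_derivative (inverse (sqrt (r\<^sup>2 + t\<^sup>2)) / 2) * (2 * t)) (at t)"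
      by (rule DERIV_chain2[where f = sqrt and g = "\<lambda>t. r\<^sup>2 + t\<^sup>2"])
        (use p in \<open>auto intro!: derivative_eq_intros DERIV_real_sqrt\<close>)
    then show ?thesis by (simp add: \<rho>_def[abs_def] \<rho>_def field_simps)
  qed
  have eq: "f (r, t) = ?f (\<rho> t)" for t
    using radial_norm[OF rad, of "(r, t)"] by (simp add: norm_prod_def \<rho>_def)
  have y1: "pd [False] f (r, t) = ?f1 (\<rho> t) * (t / \<rho> t)" for t
  proof (rule DERIV_unique)
    show "((\<lambda>t. f (r, t)) has_real_derivative pd [False] f (r, t)) (at t)"
      using smooth2_dy_real[OF sm, of "[]" r t] by simp
    show "((\<lambda>t. f (r, t)) has_real_derivative ?f1 (\<rho> t) * (t / \<rho> t)) (at t)"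
      unfolding eq by (rule DERIV_chain2[OF d1 d\<rho>])
  qed
  have \<rho>0: "\<rho> 0 = r" using r by (simp add: \<rho>_def)
  have a: "((\<lambda>t. ?f1 (\<rho> t) * (t / \<rho> t)) has_real_derivative ?f1 r / r) (at 0)"
  proof -
    have "((\<lambda>t. ?f1 (\<rho> t) * (t / \<rho> t)) has_real_derivative
       (?f2 (\<rho> 0) * (0 / \<rho> 0)) * (0 / \<rho> 0) + ((1 * \<rho> 0 - 0 * (0 / \<rho> 0)) / (\<rho> 0 * \<rho> 0)) * ?f1 (\<rho> 0)) (at 0)"
      by (rule DERIV_mult[OF DERIV_chain2[OF d2 d\<rho>] DERIV_divide[OF DERIV_ident d\<rho>]]) (use \<rho>p[of 0] in auto)
    then show ?thesis using r by (simp add: \<rho>0)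
  qed
  have b: "((\<lambda>t. ?f1 (\<rho> t) * (t / \<rho> t)) has_real_derivative pd [False, False] f (r, 0)) (at 0)"
    using smooth2_dy_real[OF sm, of "[False]" r 0] by (simp only: y1)
  show ?thesis by (rule DERIV_unique[OF b a])
qed

lemma pdx_eqI:
  assumes "((\<lambda>t. u (t, snd q)) has_vector_derivative d) (at (fst q))"
  shows "pdx u q = d"
  using vector_derivative_at[OF assms] by (simp add: pdx_def)

lemma pdy_eqI:
  assumes "((\<lambda>t. u (fst q, t)) has_vector_derivative d) (at (snd q))"
  shows "pdy u q = d"
  using vector_derivative_at[OF assms] by (simp add: pdy_def)

lemma has_vector_derivative_complex_of_real:
  "(f has_real_derivative d) (at x) \<Longrightarrow> ((\<lambda>t. complex_of_real (f t)) has_vector_derivative complex_of_real d) (at x)"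
  using bounded_linear.has_vector_derivative[OF bounded_linear_of_real]
  by (simp add: has_real_derivative_iff_has_vector_derivative)

lemma magP_of_real:
  fixes \<phi> :: "real \<times> real \<Rightarrow> real"
  assumes sm: "smooth2 \<phi>"
  shows "magP1 B h (\<lambda>q. complex_of_real (\<phi> q)) (x, y) = Complex (B / 2 * y * \<phi> (x, y)) (- h * pdx \<phi> (x, y))"
    and "magP2 B h (\<lambda>q. complex_of_real (\<phi> q)) (x, y) = Complex (- (B / 2 * x * \<phi> (x, y))) (- h * pdy \<phi> (x, y))"
proof -
  have x: "pdx (\<lambda>q. complex_of_real (\<phi> q)) (x, y) = complex_of_real (pdx \<phi> (x, y))"
    by (rule pdx_eqI) (use has_vector_derivative_complex_of_real[OF smooth2_dx_real[OF sm, of "[]" y x]] in simp)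
  have y: "pdy (\<lambda>q. complex_of_real (\<phi> q)) (x, y) = complex_of_real (pdy \<phi> (x, y))"
    by (rule pdy_eqI) (use has_vector_derivative_complex_of_real[OF smooth2_dy_real[OF sm, of "[]" x y]] in simp)
  show "magP1 B h (\<lambda>q. complex_of_real (\<phi> q)) (x, y) = Complex (B / 2 * y * \<phi> (x, y)) (- h * pdx \<phi> (x, y))"
    by (simp add: magP1_def x complex_eq_iff)
  show "magP2 B h (\<lambda>q. complex_of_real (\<phi> q)) (x, y) = Complex (- (B / 2 * x * \<phi> (x, y))) (- h * pdy \<phi> (x, y))"
    by (simp add: magP2_def y complex_eq_iff)
qed

lemma has_vector_derivative_Complex:
  assumes "(f has_real_derivative a) (at x)" "(g has_real_derivative b) (at x)"
  shows "((\<lambda>t. Complex (f t) (g t)) has_vector_derivative Complex a b) (at x)"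
proof -
  have "((\<lambda>t. complex_of_real (f t) + \<i> * complex_of_real (g t)) has_vector_derivative complex_of_real a + \<i> * complex_of_real b) (at x)"
    by (intro has_vector_derivative_add has_vector_derivative_mult_right has_vector_derivative_complex_of_real assms)
  then show ?thesis by (simp add: Complex_eq)
qed

text \<open>On a real function the first-order part of the magnetic operator is purely imaginary.
  Taking real parts therefore leaves a plain Schroedinger operator with the added potential B^2
  |p|^2 / 4.\<close>

lemma Re_magH_of_real:
  fixes \<phi> :: "real \<times> real \<Rightarrow> real"
  assumes sm: "smooth2 \<phi>"
  shows "Re (magH B h v (\<lambda>q. complex_of_real (\<phi> q)) (x, y)) =
    - h\<^sup>2 * (pd [True, True] \<phi> (x, y) + pd [False, False] \<phi> (x, y)) + (B\<^sup>2 * (x\<^sup>2 + y\<^sup>2) / 4 + v (x, y)) * \<phi> (x, y)"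
proof -
  let ?u = "\<lambda>q. complex_of_real (\<phi> q)"
  have dx0: "((\<lambda>t. \<phi> (t, y)) has_real_derivative pdx \<phi> (x, y)) (at x)" using smooth2_dx_real[OF sm, of "[]" y x] by simp
  have dx1: "((\<lambda>t. pdx \<phi> (t, y)) has_real_derivative pd [True, True] \<phi> (x, y)) (at x)" using smooth2_dx_real[OF sm, of "[True]" y x] by simp
  have dy0: "((\<lambda>t. \<phi> (x, t)) has_real_derivative pdy \<phi> (x, y)) (at y)" using smooth2_dy_real[OF sm, of "[]" x y] by simp
  have dy1: "((\<lambda>t. pdy \<phi> (x, t)) has_real_derivative pd [False, False] \<phi> (x, y)) (at y)" using smooth2_dy_real[OF sm, of "[False]" x y] by simp
  have 1: "pdx (magP1 B h ?u) (x, y) = Complex (B / 2 * y * pdx \<phi> (x, y)) (- h * pd [True, True] \<phi> (x, y))"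
    by (rule pdx_eqI) (simp only: fst_conv snd_conv magP_of_real[OF sm], rule has_vector_derivative_Complex[OF DERIV_cmult[OF dx0] DERIV_cmult[OF dx1]])
  have e2: "- (B / 2 * x * \<phi> (x, t)) = - (B / 2 * x) * \<phi> (x, t)" for t by simp
  have 2: "pdy (magP2 B h ?u) (x, y) = Complex (- (B / 2 * x) * pdy \<phi> (x, y)) (- h * pd [False, False] \<phi> (x, y))"
    by (rule pdy_eqI) (simp only: fst_conv snd_conv magP_of_real[OF sm] e2, rule has_vector_derivative_Complex[OF DERIV_cmult[OF dy0] DERIV_cmult[OF dy1]])
  have e: "magH B h v ?u (x, y) =
     - (\<i> * of_real h) * Complex (B / 2 * y * pdx \<phi> (x, y)) (- h * pd [True, True] \<phi> (x, y))
     - of_real (- (B / 2) * y) * Complex (B / 2 * y * \<phi> (x, y)) (- h * pdx \<phi> (x, y))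
     + (- (\<i> * of_real h) * Complex (- (B / 2) * x * pdy \<phi> (x, y)) (- h * pd [False, False] \<phi> (x, y))
     - of_real (B / 2 * x) * Complex (- (B / 2 * x * \<phi> (x, y))) (- h * pdy \<phi> (x, y)))
     + of_real (v (x, y)) * of_real (\<phi> (x, y))"
    unfolding magH_def magP1_def[of B h "magP1 B h ?u"] magP2_def[of B h "magP2 B h ?u"] 1 2 magP_of_real[OF sm]
    by simp
  show ?thesis unfolding e by (simp add: power2_eq_square algebra_simps)
qed

lemma ground_state_radial_ode:
  assumes gs: "ground_state B h v \<phi>" and rad: "radial \<phi>" and h: "h > 0" and r: "r > 0"
  shows "pd [True, True] \<phi> (r, 0) + pd [True] \<phi> (r, 0) / r = (B\<^sup>2 * r\<^sup>2 / 4 + v (r, 0) - spec_bottom B h v) / h\<^sup>2 * \<phi> (r, 0)"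
proof -
  have sm: "smooth2 \<phi>" using gs by (simp add: ground_state_def)
  have "Re (magH B h v (\<lambda>q. complex_of_real (\<phi> q)) (r, 0)) = spec_bottom B h v * \<phi> (r, 0)"
    using gs by (simp add: ground_state_def)
  then have "- h\<^sup>2 * (pd [True, True] \<phi> (r, 0) + pd [True] \<phi> (r, 0) / r) + (B\<^sup>2 * r\<^sup>2 / 4 + v (r, 0)) * \<phi> (r, 0) = spec_bottom B h v * \<phi> (r, 0)"
    unfolding Re_magH_of_real[OF sm] radial_dyy[OF sm rad r] by simp
  then have "h\<^sup>2 * (pd [True, True] \<phi> (r, 0) + pd [True] \<phi> (r, 0) / r) = (B\<^sup>2 * r\<^sup>2 / 4 + v (r, 0) - spec_bottom B h v) * \<phi> (r, 0)"
    by (simp add: left_diff_distrib)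
  moreover have "a = b / h\<^sup>2 * c" if "h\<^sup>2 * a = b * c" for a b c using that h by (simp add: field_simps)
  ultimately show ?thesis by blast
qed

lemma ground_state_norm:
  assumes gs: "ground_state B h v \<phi>" and rad: "radial \<phi>"
  shows "set_integrable lborel {0..} (\<lambda>s. (\<phi> (sqrt s, 0))\<^sup>2)"
    and "pi * (LINT s:{0..}|lborel. (\<phi> (sqrt s, 0))\<^sup>2) = 1"
proof -
  have sm: "smooth2 \<phi>" using gs by (simp add: ground_state_def)
  have c: "continuous_on UNIV \<phi>" using smooth2_cont[OF sm, of "[]"] by simp
  have "continuous_on UNIV (\<lambda>s. (\<phi> (sqrt s, 0))\<^sup>2)"
    by (intro continuous_intros continuous_on_compose2[OF c]) auto
  then have m: "(\<lambda>s. (\<phi> (sqrt s, 0))\<^sup>2) \<in> borel_measurable borel" by (rule borel_measurable_continuous_onI)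
  have e: "(\<phi> (sqrt ((norm p)\<^sup>2), 0))\<^sup>2 = (\<phi> p)\<^sup>2" for p using radial_norm[OF rad, of p] by simp
  show "set_integrable lborel {0..} (\<lambda>s. (\<phi> (sqrt s, 0))\<^sup>2)"
    using integrable_radial[OF m] gs unfolding e by (simp add: ground_state_def)
  show "pi * (LINT s:{0..}|lborel. (\<phi> (sqrt s, 0))\<^sup>2) = 1"
    using integral_radial[OF m] gs unfolding e by (simp add: ground_state_def)
qed

text \<open>Square integrability gives no pointwise decay by itself, but it excludes a positive
  lower bound on a half-line in s = r^2. This weak form is all that \<open>radial_ode_decay\<close>
  asks for.\<close>

lemma ground_state_small:
  assumes gs: "ground_state B h v \<phi>" and rad: "radial \<phi>" and \<epsilon>: "\<epsilon> > 0"
  shows "\<exists>r \<ge> R. (\<phi> (r, 0))\<^sup>2 < \<epsilon>"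
proof (rule ccontr)
  assume "\<not> (\<exists>r \<ge> R. (\<phi> (r, 0))\<^sup>2 < \<epsilon>)"
  then have b: "\<And>r. r \<ge> R \<Longrightarrow> \<epsilon> \<le> (\<phi> (r, 0))\<^sup>2" by (auto simp: not_less)
  have "set_integrable lborel {R\<^sup>2..} (\<lambda>s. \<epsilon>)"
  proof (rule set_integrable_bound)
    show "set_integrable lborel {R\<^sup>2..} (\<lambda>s. (\<phi> (sqrt s, 0))\<^sup>2)"
      by (rule set_integrable_subset[OF ground_state_norm(1)[OF gs rad]]) (auto intro: order_trans[OF zero_le_power2])
    have "norm \<epsilon> \<le> norm ((\<phi> (sqrt s, 0))\<^sup>2)" if "s \<in> {R\<^sup>2..}" for s
    proof -
      have "R \<le> sqrt s" using that by (intro real_le_rsqrt) auto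
      then show ?thesis using b[of "sqrt s"] \<epsilon> by simp
    qed
    then show "AE s in lborel. s \<in> {R\<^sup>2..} \<longrightarrow> norm \<epsilon> \<le> norm ((\<phi> (sqrt s, 0))\<^sup>2)" by simp
    show "set_borel_measurable lborel {R\<^sup>2..} (\<lambda>s. \<epsilon>)" by (simp add: set_borel_measurable_def)
  qed
  then have "integrable lborel (\<lambda>s. indicator {R\<^sup>2..} s * \<epsilon> :: real)" by (simp add: set_integrable_def)
  then have "integrable lborel (\<lambda>s. (indicator {R\<^sup>2..} s * \<epsilon>) * (1 / \<epsilon>) :: real)" by (rule integrable_mult_left)
  then have "integrable lborel (indicator {R\<^sup>2..} :: real \<Rightarrow> real)" using \<epsilon> by simp
  then have "emeasure lborel {R\<^sup>2..} < \<infinity>" by (simp add: integrable_indicator_iff)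
  then obtain c where c: "c \<ge> 0" "emeasure lborel {R\<^sup>2..} = ennreal c"
    by (cases "emeasure lborel {R\<^sup>2..}") auto
  have "emeasure lborel {R\<^sup>2..R\<^sup>2 + (c + 1)} \<le> emeasure lborel {R\<^sup>2..}" by (intro emeasure_mono) auto
  then show False using c by simp
qed

lemma ground_state_nonzero:
  assumes gs: "ground_state B h v \<phi>" and rad: "radial \<phi>"
  shows "\<exists>r > 0. \<phi> (r, 0) \<noteq> 0"
proof (rule ccontr)
  assume n: "\<not> (\<exists>r > 0. \<phi> (r, 0) \<noteq> 0)"
  have "(LINT s:{0..}|lborel. (\<phi> (sqrt s, 0))\<^sup>2) = (LINT s|(lborel :: real measure). (0::real))"
    unfolding set_lebesgue_integral_def
  proof (rule integral_cong_AE)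
    have "AE s in lborel. s \<noteq> (0::real)" by (rule AE_lborel_singleton)
    then show "AE s in lborel. indicator {0..} s *\<^sub>R (\<phi> (sqrt s, 0))\<^sup>2 = (0::real)"
      by eventually_elim (use n in \<open>auto simp: indicator_def\<close>)
  qed (use ground_state_norm(1)[OF gs rad] in \<open>auto simp: set_integrable_def\<close>)
  then show False using ground_state_norm(2)[OF gs rad] by simp
qed

subsection \<open>Wronskian comparison\<close>

text \<open>Monotonicity of G - f and G + f. It replaces the integration of estimates and asks for
  derivatives only inside the interval, which suits functions that are differentiated for r > 0 and
  merely continuous at 0.\<close>

lemma abs_diff_le_by_derivs:
  fixes f G f' G' :: "real \<Rightarrow> real"
  assumes "a \<le> b" and cf: "continuous_on {a..b} f" and cg: "continuous_on {a..b} G"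
    and df: "\<And>x. a < x \<Longrightarrow> x < b \<Longrightarrow> (f has_real_derivative f' x) (at x)"
    and dg: "\<And>x. a < x \<Longrightarrow> x < b \<Longrightarrow> (G has_real_derivative G' x) (at x)"
    and le: "\<And>x. a < x \<Longrightarrow> x < b \<Longrightarrow> \<bar>f' x\<bar> \<le> G' x"
  shows "\<bar>f b - f a\<bar> \<le> G b - G a"
proof -
  have "(\<lambda>x. G x - f x) a \<le> (\<lambda>x. G x - f x) b"
  proof (rule DERIV_nonneg_imp_increasing_open[OF \<open>a \<le> b\<close>])
    fix x assume x: "a < x" "x < b"
    have "((\<lambda>x. G x - f x) has_real_derivative G' x - f' x) (at x)"
      using df[OF x] dg[OF x] by (auto intro!: derivative_eq_intros)
    then show "\<exists>y. ((\<lambda>x. G x - f x) has_real_derivative y) (at x) \<and> 0 \<le> y"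
      using le[OF x] by (intro exI[of _ "G' x - f' x"]) auto
  qed (intro continuous_intros cf cg)
  moreover have "(\<lambda>x. G x + f x) a \<le> (\<lambda>x. G x + f x) b"
  proof (rule DERIV_nonneg_imp_increasing_open[OF \<open>a \<le> b\<close>])
    fix x assume x: "a < x" "x < b"
    have "((\<lambda>x. G x + f x) has_real_derivative G' x + f' x) (at x)"
      using df[OF x] dg[OF x] by (auto intro!: derivative_eq_intros)
    then show "\<exists>y. ((\<lambda>x. G x + f x) has_real_derivative y) (at x) \<and> 0 \<le> y"
      using le[OF x] by (intro exI[of _ "G' x + f' x"]) auto
  qed (intro continuous_intros cf cg)
  ultimately show ?thesis by simp
qed

lemma integral_has_derivative_Ioi:
  fixes q :: "real \<Rightarrow> real"
  assumes "continuous_on {0..} q" "r > 0"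
  shows "((\<lambda>x. integral {0..x} q) has_real_derivative q r) (at r)"
proof -
  have "((\<lambda>x. integral {0..x} q) has_real_derivative q r) (at r within {0..r + 1})"
    by (rule integral_has_real_derivative) (use assms in \<open>auto intro: continuous_on_subset\<close>)
  moreover have "at r within {0..r + 1} = at r"
    using assms(2) by (intro at_within_interior) (simp add: interior_atLeastAtMost_real)
  ultimately show ?thesis by simp
qed

lemma integral_continuous_Ici:
  fixes q :: "real \<Rightarrow> real"
  assumes "continuous_on {0..} q"
  shows "continuous_on {0..} (\<lambda>x. integral {0..x} q)"
proof (rule continuous_on_subset)
  have "continuous (at r within {0..}) (\<lambda>x. integral {0..x} q)" if "r \<ge> 0" for r
  proof -
    have "continuous_on {0..r+1} (\<lambda>x. integral {0..x} q)"
      by (intro indefinite_integral_continuous_1 integrable_continuous_real continuous_on_subset[OF assms]) auto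
    then have "continuous (at r within {0..r+1}) (\<lambda>x. integral {0..x} q)"
      using that by (auto simp: continuous_on_eq_continuous_within)
    moreover have "at r within {0..r+1} = at r within {0..}"
    proof (rule at_within_nhd[of r "{..<r+1}"])
      show "{0..r + 1} \<inter> {..<r + 1} - {r} = {0..} \<inter> {..<r + 1} - {r}" by auto
    qed auto
    ultimately show ?thesis by simp
  qed
  then show "continuous_on {0..} (\<lambda>x. integral {0..x} q)"
    by (auto simp: continuous_on_eq_continuous_within)
qed simp

lemma nondecreasing_tendsto_zero_le:
  fixes w :: "real \<Rightarrow> real"
  assumes "\<And>r. r > r1 \<Longrightarrow> (w has_real_derivative w1 r) (at r)" "\<And>r. r > r1 \<Longrightarrow> w1 r \<ge> 0"
    and lim: "(w \<longlongrightarrow> 0) at_top" and r: "r > r1"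
  shows "w r \<le> 0"
proof (rule tendsto_lowerbound[OF lim])
  show "eventually (\<lambda>x. w r \<le> w x) at_top"
    using eventually_ge_at_top[of r]
  proof eventually_elim
    case (elim x)
    show ?case
    proof (rule DERIV_nonneg_imp_nondecreasing[OF elim])
      fix t assume "r \<le> t" "t \<le> x"
      then show "\<exists>y. (w has_real_derivative y) (at t) \<and> 0 \<le> y"
        using assms(1,2)[of t] r by (intro exI[of _ "w1 t"]) auto
    qed
  qed
qed simp

text \<open>The differentiated function is r times the Wronskian of f and \<gamma>, written with the
  logarithmic derivative l of \<gamma>. Then l' + l^2 + l/r is the coefficient for which \<gamma>
  would solve the radial equation exactly, and only its distance from A matters; second derivatives
  of \<gamma> do not appear.\<close>

lemma wronskian_deriv:
  fixes f f1 f2 \<gamma> l l1 :: "real \<Rightarrow> real"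
  assumes "r \<noteq> 0" "(f has_real_derivative f1 r) (at r)" "(f1 has_real_derivative f2 r) (at r)"
    "(\<gamma> has_real_derivative \<gamma> r * l r) (at r)" "(l has_real_derivative l1 r) (at r)"
    "f2 r + f1 r / r = A * f r"
  shows "((\<lambda>r. r * \<gamma> r * (f1 r - f r * l r)) has_real_derivative
     r * \<gamma> r * f r * (A - (l1 r + (l r)\<^sup>2 + l r / r))) (at r)"
proof -
  have "((\<lambda>r. r * \<gamma> r * (f1 r - f r * l r)) has_real_derivative
     (\<gamma> r + \<gamma> r * l r * r) * (f1 r - f r * l r) + (f2 r - (f1 r * l r + l1 r * f r)) * (r * \<gamma> r)) (at r)"
    by (rule derivative_eq_intros assms refl | simp)+
  moreover have f2: "f2 r = A * f r - f1 r / r" using assms(6) by simp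
  have "(\<gamma> r + \<gamma> r * l r * r) * (f1 r - f r * l r) + (f2 r - (f1 r * l r + l1 r * f r)) * (r * \<gamma> r) =
     r * \<gamma> r * f r * (A - (l1 r + (l r)\<^sup>2 + l r / r))"
    unfolding f2 using \<open>r \<noteq> 0\<close> by (simp add: field_simps power2_eq_square)
  ultimately show ?thesis by simp
qed

text \<open>A one-sided Riccati inequality makes the weighted Wronskian monotone, and its vanishing
  at infinity then fixes its sign on the whole half-line. Comparing from infinity selects the
  decaying solution.\<close>

lemma log_derivative_compare:
  fixes f f1 f2 \<gamma> l l1 :: "real \<Rightarrow> real"
  assumes r1: "r1 \<ge> 0"
    and f: "\<And>r. r > r1 \<Longrightarrow> (f has_real_derivative f1 r) (at r)" "\<And>r. r > r1 \<Longrightarrow> (f1 has_real_derivative f2 r) (at r)"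
    and \<gamma>: "\<And>r. r > r1 \<Longrightarrow> (\<gamma> has_real_derivative \<gamma> r * l r) (at r)" "\<And>r. r > r1 \<Longrightarrow> (l has_real_derivative l1 r) (at r)"
    and pos: "\<And>r. r > r1 \<Longrightarrow> f r > 0" "\<And>r. r > r1 \<Longrightarrow> \<gamma> r > 0"
    and ode: "\<And>r. r > r1 \<Longrightarrow> f2 r + f1 r / r = A r * f r"
    and lim: "((\<lambda>r. r * \<gamma> r * (f1 r - f r * l r)) \<longlongrightarrow> 0) at_top"
    and r: "r > r1"
  shows "(\<And>r. r > r1 \<Longrightarrow> l1 r + (l r)\<^sup>2 + l r / r \<le> A r) \<Longrightarrow> f1 r \<le> f r * l r"
    and "(\<And>r. r > r1 \<Longrightarrow> A r \<le> l1 r + (l r)\<^sup>2 + l r / r) \<Longrightarrow> f r * l r \<le> f1 r"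
proof -
  define w where "w = (\<lambda>r. r * \<gamma> r * (f1 r - f r * l r))"
  have dw: "(w has_real_derivative r * \<gamma> r * f r * (A r - (l1 r + (l r)\<^sup>2 + l r / r))) (at r)" if "r > r1" for r
    unfolding w_def by (rule wronskian_deriv) (use that r1 f \<gamma> ode in auto)
  have rg: "r * \<gamma> r > 0" using r r1 pos by simp
  {
    assume a: "\<And>r. r > r1 \<Longrightarrow> l1 r + (l r)\<^sup>2 + l r / r \<le> A r"
    have "w r \<le> 0"
    proof (rule nondecreasing_tendsto_zero_le[OF dw _ _ r])
      show "0 \<le> r * \<gamma> r * f r * (A r - (l1 r + (l r)\<^sup>2 + l r / r))" if "r > r1" for r
        using a[OF that] pos[OF that] r1 that by (intro mult_nonneg_nonneg) auto
      show "(w \<longlongrightarrow> 0) at_top" using lim by (simp add: w_def)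
    qed
    then have "r * \<gamma> r * (f1 r - f r * l r) \<le> 0" by (simp add: w_def)
    then show "f1 r \<le> f r * l r" using rg by (metis diff_gt_0_iff_gt mult_pos_pos not_le)
  next
    assume a: "\<And>r. r > r1 \<Longrightarrow> A r \<le> l1 r + (l r)\<^sup>2 + l r / r"
    have "- w r \<le> 0"
    proof (rule nondecreasing_tendsto_zero_le[where w = "\<lambda>r. - w r", OF _ _ _ r])
      show "((\<lambda>r. - w r) has_real_derivative - (r * \<gamma> r * f r * (A r - (l1 r + (l r)\<^sup>2 + l r / r)))) (at r)" if "r > r1" for r
        using dw[OF that] by (rule DERIV_minus)
      show "0 \<le> - (r * \<gamma> r * f r * (A r - (l1 r + (l r)\<^sup>2 + l r / r)))" if "r > r1" for r
      proof -
        have "0 \<le> r * \<gamma> r * f r * ((l1 r + (l r)\<^sup>2 + l r / r) - A r)"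
          using a[OF that] pos[OF that] r1 that by (intro mult_nonneg_nonneg) auto
        then show ?thesis by (simp add: algebra_simps)
      qed
      show "((\<lambda>r. - w r) \<longlongrightarrow> 0) at_top" using tendsto_minus[OF lim] by (simp add: w_def)
    qed
    then have "0 \<le> r * \<gamma> r * (f1 r - f r * l r)" by (simp add: w_def)
    then show "f r * l r \<le> f1 r" using rg by (metis diff_less_0_iff_less mult_pos_neg not_le)
  }
qed

text \<open>Uniqueness by a Gronwall argument: f^2 + f'^2 times a sufficiently fast exponential is
  nondecreasing, so its zero at R forces zeros before R.\<close>

lemma radial_ode_zero_backward:
  fixes f f1 f2 Q :: "real \<Rightarrow> real"
  assumes d: "\<And>r. r > 0 \<Longrightarrow> (f has_real_derivative f1 r) (at r)" "\<And>r. r > 0 \<Longrightarrow> (f1 has_real_derivative f2 r) (at r)"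
    and ode: "\<And>r. r > 0 \<Longrightarrow> f2 r + f1 r / r = Q r * f r"
    and Q: "continuous_on {0<..} Q"
    and z: "f R = 0" "f1 R = 0" and r: "0 < r" "r \<le> R"
  shows "f r = 0"
proof -
  have "bounded (Q ` {r..R})"
    by (intro compact_imp_bounded compact_continuous_image continuous_on_subset[OF Q]) (use r in auto)
  then obtain C where C: "\<And>x. x \<in> {r..R} \<Longrightarrow> \<bar>Q x\<bar> \<le> C"
    unfolding bounded_iff by (metis image_eqI real_norm_def)
  have C0: "C \<ge> 0" using C[of r] r by auto
  \<comment> \<open>The summands pay in turn for 2 f f', for 2 Q f f', and for the term with 2 f'^2
    / x that comes from the first-order part of the equation.\<close>
  define D where "D = 1 + C + 2 / r"
  define e where "e = (\<lambda>r. ((f r)\<^sup>2 + (f1 r)\<^sup>2) * exp (D * r))"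
  have "e r \<le> e R"
  proof (rule DERIV_nonneg_imp_nondecreasing[OF r(2)])
    fix x assume x: "r \<le> x" "x \<le> R"
    then have x0: "x > 0" using r by simp
    define y where "y = (2 * f x * f1 x + 2 * f1 x * f2 x) * exp (D * x) + ((f x)\<^sup>2 + (f1 x)\<^sup>2) * (D * exp (D * x))"
    have "(e has_real_derivative y) (at x)"
      unfolding e_def y_def by (rule derivative_eq_intros d[OF x0] refl | simp)+
    moreover have "y \<ge> 0"
    proof -
      have f2: "f2 x = Q x * f x - f1 x / x" using ode[OF x0] by simp
      have 1: "\<bar>2 * f x * f1 x\<bar> \<le> (f x)\<^sup>2 + (f1 x)\<^sup>2"
        using zero_le_power2[of "f x - f1 x"] zero_le_power2[of "f x + f1 x"] by (simp add: power2_eq_square algebra_simps abs_le_iff)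
      have "\<bar>Q x * (2 * f x * f1 x)\<bar> \<le> C * ((f x)\<^sup>2 + (f1 x)\<^sup>2)"
        unfolding abs_mult[of "Q x"] using C[of x] x 1 C0 by (intro mult_mono) auto
      moreover have "(f1 x)\<^sup>2 * (2 / x) \<le> ((f x)\<^sup>2 + (f1 x)\<^sup>2) * (2 / r)"
        using x r x0 by (intro mult_mono) (auto simp: field_simps)
      moreover have "2 * f x * f1 x + 2 * f1 x * f2 x + ((f x)\<^sup>2 + (f1 x)\<^sup>2) * D =
         2 * f x * f1 x + Q x * (2 * f x * f1 x) - (f1 x)\<^sup>2 * (2 / x) +
           (((f x)\<^sup>2 + (f1 x)\<^sup>2) + C * ((f x)\<^sup>2 + (f1 x)\<^sup>2) + ((f x)\<^sup>2 + (f1 x)\<^sup>2) * (2 / r))"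
        unfolding f2 D_def using x0 by (simp add: algebra_simps power2_eq_square)
      ultimately have "0 \<le> 2 * f x * f1 x + 2 * f1 x * f2 x + ((f x)\<^sup>2 + (f1 x)\<^sup>2) * D"
        using 1 by linarith
      then have "0 \<le> (2 * f x * f1 x + 2 * f1 x * f2 x + ((f x)\<^sup>2 + (f1 x)\<^sup>2) * D) * exp (D * x)"
        by simp
      then show ?thesis unfolding y_def by (simp add: algebra_simps)
    qed
    ultimately show "\<exists>y. (e has_real_derivative y) (at x) \<and> 0 \<le> y" by blast
  qed
  also have "e R = 0" using z by (simp add: e_def)
  finally have "(f r)\<^sup>2 + (f1 r)\<^sup>2 \<le> 0" by (simp add: e_def mult_le_0_iff)
  then show ?thesis by (simp add: sum_power2_le_zero_iff)
qed

text \<open>Where Q >= 0 the function r f f' is nondecreasing. Were it positive somewhere, f^2 would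
  increase from there on, against \<open>small\<close>; hence |f| decreases. A zero would then
  persist and spread back to \<open>r0\<close> by uniqueness, so f keeps one sign \<sigma>. Finally
  \<sigma> r f' is nondecreasing and nonpositive, hence bounded.\<close>

lemma radial_ode_decay:
  fixes f f1 f2 Q :: "real \<Rightarrow> real"
  assumes d: "\<And>r. r > 0 \<Longrightarrow> (f has_real_derivative f1 r) (at r)" "\<And>r. r > 0 \<Longrightarrow> (f1 has_real_derivative f2 r) (at r)"
    and ode: "\<And>r. r > 0 \<Longrightarrow> f2 r + f1 r / r = Q r * f r"
    and Q: "continuous_on {0<..} Q" and R: "R > 0" and Qpos: "\<And>r. r \<ge> R \<Longrightarrow> Q r \<ge> 0"
    and small: "\<And>\<epsilon> R. \<epsilon> > 0 \<Longrightarrow> \<exists>r \<ge> R. (f r)\<^sup>2 < \<epsilon>"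
    and nz: "r0 > 0" "f r0 \<noteq> 0"
  shows "\<exists>\<sigma> \<in> {1, -1}. \<exists>C \<ge> 0. \<forall>r \<ge> R. \<sigma> * f r > 0 \<and> \<bar>f r\<bar> \<le> C \<and> \<bar>r * f1 r\<bar> \<le> C"
proof -
  define m where "m = (\<lambda>r. r * (f r * f1 r))"
  have dm: "\<exists>y. (m has_real_derivative y) (at x) \<and> 0 \<le> y" if "x \<ge> R" for x
  proof -
    have x: "x > 0" using that R by simp
    have "(m has_real_derivative f x * f1 x + (f1 x * f1 x + f2 x * f x) * x) (at x)"
      unfolding m_def by (rule derivative_eq_intros d[OF x] refl | simp)+
    moreover have f2: "f2 x = Q x * f x - f1 x / x" using ode[OF x] by simp
    have "f x * f1 x + (f1 x * f1 x + f2 x * f x) * x = x * (f1 x)\<^sup>2 + Q x * (x * (f x)\<^sup>2)"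
      unfolding f2 using x by (simp add: field_simps power2_eq_square)
    ultimately show ?thesis using Qpos[OF that] x by (intro exI[of _ "x * (f1 x)\<^sup>2 + Q x * (x * (f x)\<^sup>2)"]) auto
  qed
  have mmono: "m x \<le> m y" if "R \<le> x" "x \<le> y" for x y
    by (rule DERIV_nonneg_imp_nondecreasing[OF that(2)]) (use dm that in auto)
  have df2: "((\<lambda>r. (f r)\<^sup>2) has_real_derivative 2 * (f x * f1 x)) (at x)" if "x > 0" for x
    using d(1)[OF that] by (auto intro!: derivative_eq_intros)
  have ff: "f r * f1 r \<le> 0" if r: "r \<ge> R" for r
  proof (rule ccontr)
    assume "\<not> f r * f1 r \<le> 0"
    then have mp: "m r > 0" and fr: "f r \<noteq> 0" using r R by (auto simp: m_def)
    have "(f r)\<^sup>2 \<le> (f x)\<^sup>2" if x: "x \<ge> r" for x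
    proof (rule DERIV_nonneg_imp_nondecreasing[OF x])
      fix t assume t: "r \<le> t" "t \<le> x"
      then have "m t > 0" using mmono[of r t] mp r by linarith
      then have "f t * f1 t > 0" using t r R by (simp add: m_def zero_less_mult_iff)
      then show "\<exists>y. ((\<lambda>r. (f r)\<^sup>2) has_real_derivative y) (at t) \<and> 0 \<le> y"
        using df2[of t] t r R by (intro exI[of _ "2 * (f t * f1 t)"]) auto
    qed
    then show False using small[of "(f r)\<^sup>2" r] fr by (meson not_le zero_less_power2)
  qed
  have fdec: "(f y)\<^sup>2 \<le> (f x)\<^sup>2" if "R \<le> x" "x \<le> y" for x y
  proof (rule DERIV_nonpos_imp_nonincreasing[OF that(2)])
    fix t assume t: "x \<le> t" "t \<le> y"
    then show "\<exists>y. ((\<lambda>r. (f r)\<^sup>2) has_real_derivative y) (at t) \<and> y \<le> 0"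
      using df2[of t] ff[of t] that R by (intro exI[of _ "2 * (f t * f1 t)"]) auto
  qed
  have fnz: "f r \<noteq> 0" if r: "r \<ge> R" for r
  proof
    assume f0: "f r = 0"
    have z: "f x = 0" if "x \<ge> r" for x using fdec[of r x] that r f0 by auto
    have z1: "f1 x = 0" if "x > r" for x
    proof (rule DERIV_unique)
      show "(f has_real_derivative f1 x) (at x)" using d that r R by auto
      show "(f has_real_derivative 0) (at x)"
      proof (rule has_field_derivative_transform_within_open[where f = "\<lambda>_. 0" and S = "{r<..}"])
        show "((\<lambda>_. 0) has_real_derivative 0) (at x)" by simp
        show "\<And>t. t \<in> {r<..} \<Longrightarrow> 0 = f t" using z by simp
      qed (use that in auto)
    qed
    \<comment> \<open>A point beyond the zero, where f and f' both vanish, and at or beyond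
      \<open>r0\<close>, so that uniqueness reaches \<open>r0\<close>.\<close>
    define R' where "R' = max (r + 1) r0"
    have "f r0 = 0"
      by (rule radial_ode_zero_backward[OF d ode Q, where R=R']) (use z z1 nz in \<open>auto simp: R'_def\<close>)
    with nz show False by simp
  qed
  define \<sigma> where "\<sigma> = sgn (f R)"
  have \<sigma>: "\<sigma> \<in> {1, -1}" using fnz[of R] by (auto simp: \<sigma>_def sgn_if)
  have cf: "continuous_on {R..x} f" for x
    by (intro continuous_at_imp_continuous_on ballI DERIV_isCont[OF d(1)]) (use R in auto)
  have fpos: "\<sigma> * f r > 0" if r: "r \<ge> R" for r
  proof (rule ccontr)
    assume "\<not> \<sigma> * f r > 0"
    moreover have "\<sigma> * f R \<ge> 0" by (simp add: \<sigma>_def sgn_if)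
    moreover have "continuous_on {R..r} (\<lambda>x. \<sigma> * f x)" by (intro continuous_intros cf)
    ultimately obtain x where "R \<le> x" "x \<le> r" "\<sigma> * f x = 0"
      using IVT2'[of "\<lambda>x. \<sigma> * f x" r 0 R] r by (auto simp: not_less)
    then show False using fnz[of x] \<sigma> by auto
  qed
  have s2: "\<sigma> * \<sigma> = 1" using \<sigma> by auto
  have f1neg: "\<sigma> * f1 r \<le> 0" if r: "r \<ge> R" for r
  proof -
    have "(\<sigma> * f r) * (\<sigma> * f1 r) = f r * f1 r" using s2 by algebra
    then have "(\<sigma> * f r) * (\<sigma> * f1 r) \<le> 0" using ff[OF r] by (simp only:)
    then show ?thesis using fpos[OF r] by (metis mult_pos_pos not_le)
  qed
  have rf1: "\<sigma> * (R * f1 R) \<le> \<sigma> * (r * f1 r)" if r: "r \<ge> R" for r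
  proof (rule DERIV_nonneg_imp_nondecreasing[OF r])
    fix t assume t: "R \<le> t" "t \<le> r"
    then have t0: "t > 0" using R by simp
    have "((\<lambda>r. \<sigma> * (r * f1 r)) has_real_derivative \<sigma> * (f1 t + f2 t * t)) (at t)"
      by (rule derivative_eq_intros d[OF t0] refl | simp)+
    moreover have f2: "f2 t = Q t * f t - f1 t / t" using ode[OF t0] by simp
    have "\<sigma> * (f1 t + f2 t * t) = t * Q t * (\<sigma> * f t)" unfolding f2 using t0 by (simp add: field_simps)
    ultimately show "\<exists>y. ((\<lambda>r. \<sigma> * (r * f1 r)) has_real_derivative y) (at t) \<and> 0 \<le> y"
      using t0 Qpos[OF t(1)] fpos[OF t(1)] by (intro exI[of _ "t * Q t * (\<sigma> * f t)"]) auto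
  qed
  define C where "C = \<bar>f R\<bar> + \<bar>R * f1 R\<bar>"
  show ?thesis
  proof (intro bexI[OF _ \<sigma>] exI[of _ C] conjI allI impI)
    show "C \<ge> 0" by (simp add: C_def)
    fix r assume r: "r \<ge> R"
    show "\<sigma> * f r > 0" by (rule fpos[OF r])
    have "\<bar>f r\<bar> \<le> \<bar>f R\<bar>" using fdec[of R r] r by (simp add: abs_le_square_iff)
    then show "\<bar>f r\<bar> \<le> C" unfolding C_def by linarith
    have "\<sigma> * (r * f1 r) \<le> 0" using mult_nonneg_nonpos[of r, OF _ f1neg[OF r]] r R by (simp add: mult.left_commute)
    with rf1[OF r] have "\<bar>\<sigma> * (r * f1 r)\<bar> \<le> \<bar>\<sigma> * (R * f1 R)\<bar>" by linarith
    then have "\<bar>r * f1 r\<bar> \<le> \<bar>R * f1 R\<bar>" using \<sigma> by (auto simp: abs_mult)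
    then show "\<bar>r * f1 r\<bar> \<le> C" unfolding C_def by linarith
  qed
qed

text \<open>The left end of the outermost interval of positivity. Whether it is 0 or a zero of f,
  the weighted Wronskian of f with the quasimode is nonnegative there, which starts the argument in
  \<open>eigenvalue_lower\<close>.\<close>

lemma last_zero_exists:
  fixes f :: "real \<Rightarrow> real"
  assumes c: "continuous_on {0..} f" and pos: "\<And>r. r \<ge> R \<Longrightarrow> f r > 0" and R: "R > 0"
  shows "\<exists>r1 \<ge> 0. (\<forall>r > r1. f r > 0) \<and> (r1 = 0 \<or> f r1 = 0)"
proof (cases "\<exists>r \<in> {0..R}. f r \<le> 0")
  case False
  have "f r > 0" if "r > 0" for r using False pos[of r] that by (cases "r \<le> R") (auto simp: not_le)
  then show ?thesis by (intro exI[of _ 0]) auto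
next
  case True
  define S where "S = {r \<in> {0..R}. f r \<le> 0}"
  have "closed S" unfolding S_def
    using continuous_closed_preimage[of "{0..R}" f "{..0}"] continuous_on_subset[OF c, of "{0..R}"]
    by (auto simp: vimage_def Int_def)
  moreover have "bounded S" unfolding S_def by (rule bounded_subset[of "{0..R}"]) auto
  ultimately have S: "compact S" by (simp add: compact_eq_bounded_closed)
  have "S \<noteq> {}" using True by (auto simp: S_def)
  from compact_attains_sup[OF S this] obtain r1 where r1: "r1 \<in> S" "\<And>r. r \<in> S \<Longrightarrow> r \<le> r1"
    by auto
  have r1': "0 \<le> r1" "r1 \<le> R" "f r1 \<le> 0" using r1(1) by (auto simp: S_def)
  obtain x where x: "r1 \<le> x" "x \<le> R" "f x = 0"
    using IVT'[of f r1 0 R] r1' pos[of R] continuous_on_subset[OF c, of "{r1..R}"] by auto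
  then have "x \<in> S" using r1' by (auto simp: S_def)
  then have "x = r1" using r1(2) x by (simp add: antisym)
  moreover have "f r > 0" if "r > r1" for r
    using r1(2)[of r] that pos[of r] r1' by (cases "r \<le> R") (force simp: S_def not_le)+
  ultimately show ?thesis using r1' x by (intro exI[of _ r1]) auto
qed

lemma continuous_on_Ici_if_bound_at_0:
  fixes u :: "real \<Rightarrow> real"
  assumes d: "\<And>r. r > 0 \<Longrightarrow> (u has_real_derivative u' r) (at r)" and b: "\<And>r. r > 0 \<Longrightarrow> \<bar>u r - u 0\<bar> \<le> K * r"
  shows "continuous_on {0..} u"
proof -
  have "continuous (at r within {0..}) u" if "r \<ge> 0" for r
  proof (cases "r = 0")
    case True
    have "((\<lambda>r. u r - u 0) \<longlongrightarrow> 0) (at 0 within {0..})"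
    proof (rule Lim_null_comparison)
      show "eventually (\<lambda>r. norm (u r - u 0) \<le> K * r) (at 0 within {0..})"
        using b by (auto simp: eventually_at intro!: exI[of _ 1])
      have "((\<lambda>r. K * r) \<longlongrightarrow> K * 0) (at 0 within {0..})" by (intro tendsto_intros)
      then show "((\<lambda>r. K * r) \<longlongrightarrow> 0) (at 0 within {0..})" by simp
    qed
    then show ?thesis using True by (simp add: continuous_within LIM_zero_iff)
  next
    case False
    then have "isCont u r" using d[of r] that by (intro DERIV_isCont) auto
    then show ?thesis by (rule continuous_at_imp_continuous_at_within)
  qed
  then show ?thesis by (auto simp: continuous_on_eq_continuous_within)
qed

subsection \<open>The quasimode at the bottom of the well\<close>

text \<open>V stands for B^2 r^2 / 4 + v(r) - v(0), with 2 \<omega>^2 its second derivative at 0 and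
  c = B/2. The Taylor assumptions express that after the quadratic term the next one has order four.
  All bounds are global in r, so the estimates below hold on the whole half-line and not just near
  the well.\<close>

locale well_potential =
  fixes V V1 V2 :: "real \<Rightarrow> real" and \<omega> c K :: real
  assumes V_deriv: "\<And>r. (V has_real_derivative V1 r) (at r)"
    and V1_deriv: "\<And>r. (V1 has_real_derivative V2 r) (at r)"
    and omega_pos: "\<omega> > 0" and c_pos: "c > 0" and K_pos: "K > 0"
    and V_lower: "\<And>r. c\<^sup>2 * r\<^sup>2 \<le> V r"
    and V_upper: "\<And>r. V r \<le> K * r\<^sup>2"
    and V1_bound: "\<And>r. r \<ge> 0 \<Longrightarrow> \<bar>V1 r\<bar> \<le> K * r"
    and V_taylor: "\<And>r. r \<ge> 0 \<Longrightarrow> \<bar>V r - \<omega>\<^sup>2 * r\<^sup>2\<bar> \<le> K * r ^ 4"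
    and V1_taylor: "\<And>r. r \<ge> 0 \<Longrightarrow> \<bar>V1 r - 2 * \<omega>\<^sup>2 * r\<bar> \<le> K * r ^ 3"
    and V2_taylor: "\<And>r. r \<ge> 0 \<Longrightarrow> \<bar>V2 r - 2 * \<omega>\<^sup>2\<bar> \<le> K * r\<^sup>2"
begin

definition p :: "real \<Rightarrow> real" where "p r = sqrt (V r)"
definition p1 :: "real \<Rightarrow> real" where "p1 r = V1 r / (2 * p r)"
definition p2 :: "real \<Rightarrow> real" where "p2 r = (V2 r / 2 - (p1 r)\<^sup>2) / p r"
definition \<delta> :: "real \<Rightarrow> real" where "\<delta> r = p1 r + p r / r - 2 * \<omega>"
definition \<delta>1 :: "real \<Rightarrow> real" where "\<delta>1 r = p2 r + (p1 r - p r / r) / r"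
definition \<beta> :: "real \<Rightarrow> real" where "\<beta> r = - \<delta> r / (2 * p r)"
definition \<beta>1 :: "real \<Rightarrow> real" where "\<beta>1 r = - \<delta>1 r / (2 * p r) + \<delta> r * p1 r / (2 * (p r)\<^sup>2)"

lemma p_lower: "r \<ge> 0 \<Longrightarrow> c * r \<le> p r"
  unfolding p_def using V_lower[of r] c_pos by (intro real_le_rsqrt) (simp add: power_mult_distrib)

lemma p_pos: "r > 0 \<Longrightarrow> p r > 0"
  using p_lower[of r] c_pos by (meson less_eq_real_def less_le_trans mult_pos_pos)

lemma V_nonneg: "V r \<ge> 0"
  using V_lower[of r] by (meson mult_nonneg_nonneg order_trans zero_le_power2)

lemma p_sq: "(p r)\<^sup>2 = V r"
  unfolding p_def using V_nonneg by simp

lemma p_nonneg [simp]: "p r \<ge> 0"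
  unfolding p_def using V_nonneg by simp

lemma p_upper: "r \<ge> 0 \<Longrightarrow> p r \<le> sqrt K * r"
  unfolding p_def using V_upper[of r] by (metis abs_of_nonneg real_sqrt_abs real_sqrt_le_iff real_sqrt_mult)

lemma p_zero [simp]: "p 0 = 0"
  using V_upper[of 0] V_nonneg[of 0] by (simp add: p_def)

lemma p_cont: "continuous_on A p"
  unfolding p_def using V_deriv
  by (intro continuous_intros continuous_at_imp_continuous_on ballI DERIV_isCont) auto

lemma p_deriv:
  assumes "r > 0"
  shows "(p has_real_derivative p1 r) (at r)"
proof -
  have "V r > 0" using p_pos[OF assms] by (simp add: p_def)
  then have "((\<lambda>r. sqrt (V r)) has_real_derivative (inverse (sqrt (V r)) / 2) * V1 r) (at r)"
    by (intro DERIV_chain2[OF DERIV_real_sqrt V_deriv]) auto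
  then show ?thesis
    unfolding p_def[abs_def] p1_def by (simp add: field_simps p_def)
qed

lemma p1_deriv:
  assumes "r > 0"
  shows "(p1 has_real_derivative p2 r) (at r)"
proof -
  have "((\<lambda>r. V1 r / (2 * p r)) has_real_derivative (V2 r * (2 * p r) - V1 r * (2 * p1 r)) / (2 * p r * (2 * p r))) (at r)"
    using p_pos[OF assms] by (auto intro!: derivative_eq_intros V1_deriv p_deriv assms)
  moreover have "(V2 r * (2 * p r) - V1 r * (2 * p1 r)) / (2 * p r * (2 * p r)) = p2 r"
    using p_pos[OF assms] by (simp add: p2_def p1_def field_simps power2_eq_square)
  ultimately show ?thesis by (simp add: p1_def[abs_def])
qed

lemma \<delta>_deriv:
  assumes "r > 0"
  shows "(\<delta> has_real_derivative \<delta>1 r) (at r)"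
  unfolding \<delta>_def[abs_def] \<delta>1_def using assms
  by (auto intro!: derivative_eq_intros p_deriv p1_deriv simp: field_simps power2_eq_square)

lemma \<beta>_deriv:
  assumes "r > 0"
  shows "(\<beta> has_real_derivative \<beta>1 r) (at r)"
  unfolding \<beta>_def[abs_def] \<beta>1_def using p_pos[OF assms]
  by (auto intro!: derivative_eq_intros \<delta>_deriv p_deriv assms simp: field_simps power2_eq_square)

text \<open>Difference of squares: p - \<omega> r equals V - \<omega>^2 r^2 divided by p + \<omega>
  r, and this denominator is at least c r.\<close>

lemma p_taylor:
  assumes "r > 0"
  shows "\<bar>p r - \<omega> * r\<bar> \<le> K / c * r ^ 3"
proof -
  have "p r + \<omega> * r \<ge> c * r" using p_lower[of r] omega_pos assms
    by (smt (verit) mult_pos_pos)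
  moreover have "c * r > 0" using c_pos assms by simp
  ultimately have q: "p r + \<omega> * r > 0" by linarith
  have "(p r - \<omega> * r) * (p r + \<omega> * r) = V r - \<omega>\<^sup>2 * r\<^sup>2"
    unfolding p_sq[of r, symmetric] by (simp add: algebra_simps power2_eq_square)
  then have "\<bar>p r - \<omega> * r\<bar> * (p r + \<omega> * r) \<le> K * r ^ 4"
    using V_taylor[of r] assms q by (metis abs_mult abs_of_pos less_eq_real_def)
  then have "\<bar>p r - \<omega> * r\<bar> * (c * r) \<le> K * r ^ 4"
    using \<open>p r + \<omega> * r \<ge> c * r\<close> by (smt (verit) abs_ge_zero mult_left_mono)
  also have "K * r ^ 4 = (K / c * r ^ 3) * (c * r)"
    using c_pos by (simp add: eval_nat_numeral)
  finally show ?thesis using \<open>c * r > 0\<close> by (rule mult_right_le_imp_le)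
qed

lemma p1_taylor: "\<exists>M \<ge> 0. \<forall>r > 0. \<bar>p1 r - \<omega>\<bar> \<le> M * r\<^sup>2"
proof (intro exI conjI allI impI)
  let ?M = "(K + 2 * \<omega> * (K / c)) / (2 * c)"
  show "?M \<ge> 0" using K_pos c_pos omega_pos by simp
  fix r :: real assume r: "r > 0"
  have pp: "p r > 0" by (rule p_pos[OF r])
  have "p1 r - \<omega> = (V1 r - 2 * \<omega>\<^sup>2 * r - 2 * \<omega> * (p r - \<omega> * r)) / (2 * p r)"
    using pp by (simp add: p1_def field_simps power2_eq_square)
  then have "\<bar>p1 r - \<omega>\<bar> = \<bar>V1 r - 2 * \<omega>\<^sup>2 * r - 2 * \<omega> * (p r - \<omega> * r)\<bar> / (2 * p r)"
    using pp by simp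
  also have "\<dots> \<le> (K * r ^ 3 + 2 * \<omega> * (K / c * r ^ 3)) / (2 * (c * r))"
  proof (rule frac_le)
    have "\<bar>2 * \<omega> * (p r - \<omega> * r)\<bar> \<le> 2 * \<omega> * (K / c * r ^ 3)"
      unfolding abs_mult using p_taylor[OF r] omega_pos by (intro mult_mono) auto
    then show "\<bar>V1 r - 2 * \<omega>\<^sup>2 * r - 2 * \<omega> * (p r - \<omega> * r)\<bar> \<le> K * r ^ 3 + 2 * \<omega> * (K / c * r ^ 3)"
      using V1_taylor[of r] r by linarith
    show "0 \<le> K * r ^ 3 + 2 * \<omega> * (K / c * r ^ 3)" using K_pos omega_pos c_pos r by simp
    show "0 < 2 * (c * r)" using c_pos r by simp
    show "2 * (c * r) \<le> 2 * p r" using p_lower[of r] r by simp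
  qed
  also have "\<dots> = ?M * r\<^sup>2" using r c_pos by (simp add: field_simps eval_nat_numeral)
  finally show "\<bar>p1 r - \<omega>\<bar> \<le> ?M * r\<^sup>2" .
qed

lemma p1_bounded: "r > 0 \<Longrightarrow> \<bar>p1 r\<bar> \<le> K / (2 * c)"
proof -
  assume r: "r > 0"
  have "\<bar>p1 r\<bar> = \<bar>V1 r\<bar> / (2 * p r)" using p_pos[OF r] by (simp add: p1_def)
  also have "\<dots> \<le> (K * r) / (2 * (c * r))"
    by (rule frac_le) (use V1_bound[of r] p_lower[of r] r c_pos K_pos in auto)
  finally show ?thesis using r by simp
qed

text \<open>The amplitude \<open>\<beta>\<close> is chosen so that the transport equation
  \<open>2 p \<beta> + p' + p/r = 2\<omega>\<close> holds; the remainder \<open>\<beta>' + \<beta>\<^sup>2 + \<beta>/r\<close> then stays bounded up to the origin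
  because \<open>V\<close> has no cubic term there.\<close>

lemma transport: "r > 0 \<Longrightarrow> 2 * p r * \<beta> r + p1 r + p r / r = 2 * \<omega>"
  using p_pos[of r] by (simp add: \<beta>_def \<delta>_def)

text \<open>Two regimes are combined. Near 0 the Taylor bounds give \<delta> = O(r^2), which
  survives the division by p >= c r; far out the linear bounds on p and V' keep \<delta> bounded.
  The derivative of \<beta> is bounded because both p'' and (p' - p/r)/r are O(r).\<close>

lemma \<beta>_bounds:
  "\<exists>M > 0. \<forall>r > 0. \<bar>\<beta> r\<bar> \<le> M * r \<and> \<bar>\<beta> r\<bar> \<le> M \<and> \<bar>\<beta>1 r + (\<beta> r)\<^sup>2 + \<beta> r / r\<bar> \<le> M"
proof -
  obtain M1 where M1: "M1 \<ge> 0" "\<And>r. r > 0 \<Longrightarrow> \<bar>p1 r - \<omega>\<bar> \<le> M1 * r\<^sup>2"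
    using p1_taylor by blast
  have pr: "\<bar>p r / r - \<omega>\<bar> \<le> K / c * r\<^sup>2" if r: "r > 0" for r
  proof -
    have "\<bar>p r / r - \<omega>\<bar> = \<bar>p r - \<omega> * r\<bar> / r" using r by (simp add: field_simps abs_divide[symmetric] del: abs_divide)
        (simp add: abs_divide field_simps)
    also have "\<dots> \<le> K / c * r ^ 3 / r" using p_taylor[OF r] r by (intro divide_right_mono) auto
    also have "\<dots> = K / c * r\<^sup>2" using r by (simp add: eval_nat_numeral)
    finally show ?thesis .
  qed
  define A where "A = M1 + K / c"
  have A0: "A \<ge> 0" using M1 K_pos c_pos by (simp add: A_def)
  have d: "\<bar>\<delta> r\<bar> \<le> A * r\<^sup>2" if r: "r > 0" for r
    using M1(2)[OF r] pr[OF r] unfolding \<delta>_def A_def by (simp add: ring_distribs)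
  define A' where "A' = K / (2 * c) + sqrt K + 2 * \<omega>"
  have A'0: "A' \<ge> 0" using K_pos c_pos omega_pos by (simp add: A'_def)
  have d': "\<bar>\<delta> r\<bar> \<le> A'" if r: "r > 0" for r
  proof -
    have "\<bar>p r / r\<bar> \<le> sqrt K" using p_upper[of r] r by (simp add: field_simps)
    then show ?thesis using p1_bounded[OF r] omega_pos unfolding \<delta>_def A'_def by linarith
  qed
  have d'': "\<bar>\<delta> r\<bar> \<le> (A + A') * r" if r: "r > 0" for r
  proof (cases "r \<le> 1")
    case True
    have "A * r\<^sup>2 \<le> A * r" using True r A0 by (intro mult_left_mono) (auto simp: power2_eq_square mult_left_le)
    also have "\<dots> \<le> (A + A') * r" using A'0 r by (intro mult_right_mono) auto
    finally show ?thesis using d[OF r] by linarith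
  next
    case False
    have "A' \<le> A' * r" using mult_left_mono[of 1 r A'] False A'0 by simp
    also have "\<dots> \<le> (A + A') * r" using A0 r by (intro mult_right_mono) auto
    finally show ?thesis using d'[OF r] by linarith
  qed
  have b: "\<bar>\<beta> r\<bar> \<le> A / (2 * c) * r" if r: "r > 0" for r
  proof -
    have "\<bar>\<beta> r\<bar> = \<bar>\<delta> r\<bar> / (2 * p r)" using p_pos[OF r] by (simp add: \<beta>_def)
    also have "\<dots> \<le> A * r\<^sup>2 / (2 * (c * r))"
      by (rule frac_le) (use d[OF r] p_lower[of r] r c_pos A0 in auto)
    finally show ?thesis using r by (simp add: power2_eq_square)
  qed
  have b': "\<bar>\<beta> r\<bar> \<le> (A + A') / (2 * c)" if r: "r > 0" for r
  proof -
    have "\<bar>\<beta> r\<bar> = \<bar>\<delta> r\<bar> / (2 * p r)" using p_pos[OF r] by (simp add: \<beta>_def)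
    also have "\<dots> \<le> (A + A') * r / (2 * (c * r))"
      by (rule frac_le) (use d''[OF r] p_lower[of r] r c_pos A0 A'0 in auto)
    finally show ?thesis using r by (simp add: power2_eq_square)
  qed
  define C where "C = (K / 2 + M1 * (K / (2 * c) + \<omega>)) / c"
  have p2: "\<bar>p2 r\<bar> \<le> C * r" if r: "r > 0" for r
  proof -
    \<comment> \<open>Both V''/2 and p'^2 have the value \<omega>^2 at the origin; after this
      cancellation the numerator is O(r^2), so p'' is O(r) in spite of the division by p.\<close>
    have "V2 r / 2 - (p1 r)\<^sup>2 = (V2 r - 2 * \<omega>\<^sup>2) / 2 - (p1 r - \<omega>) * (p1 r + \<omega>)"
      by (simp add: field_simps power2_eq_square)
    moreover have "\<bar>(p1 r - \<omega>) * (p1 r + \<omega>)\<bar> \<le> (M1 * r\<^sup>2) * (K / (2 * c) + \<omega>)"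
      unfolding abs_mult using M1 M1(2)[OF r] p1_bounded[OF r] omega_pos by (intro mult_mono) auto
    ultimately have "\<bar>V2 r / 2 - (p1 r)\<^sup>2\<bar> \<le> K * r\<^sup>2 / 2 + (M1 * r\<^sup>2) * (K / (2 * c) + \<omega>)"
      using V2_taylor[OF less_imp_le[OF r]] by (simp only: abs_le_iff) argo
    then have n: "\<bar>V2 r / 2 - (p1 r)\<^sup>2\<bar> \<le> (K / 2 + M1 * (K / (2 * c) + \<omega>)) * r\<^sup>2"
      by (simp add: algebra_simps)
    have "\<bar>p2 r\<bar> = \<bar>V2 r / 2 - (p1 r)\<^sup>2\<bar> / p r" using p_pos[OF r] by (simp add: p2_def)
    also have "\<dots> \<le> ((K / 2 + M1 * (K / (2 * c) + \<omega>)) * r\<^sup>2) / (c * r)"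
      by (rule frac_le) (use n p_lower[of r] r c_pos K_pos M1 omega_pos in auto)
    finally show ?thesis using r by (simp add: power2_eq_square C_def)
  qed
  have d1: "\<bar>\<delta>1 r\<bar> \<le> (C + A) * r" if r: "r > 0" for r
  proof -
    have "\<bar>p1 r - p r / r\<bar> \<le> A * r\<^sup>2"
      using M1(2)[OF r] pr[OF r] unfolding A_def by (simp add: ring_distribs)
    then have "\<bar>(p1 r - p r / r) / r\<bar> \<le> A * r" using r by (simp add: field_simps power2_eq_square)
    moreover have "(C + A) * r = C * r + A * r" by (simp add: ring_distribs)
    ultimately show ?thesis using p2[OF r] unfolding \<delta>1_def by linarith
  qed
  have C0: "C \<ge> 0" using K_pos M1 omega_pos c_pos by (simp add: C_def)
  have b1: "\<bar>\<beta>1 r\<bar> \<le> (C + A) / (2 * c) + A * (K / (2 * c)) / (2 * c\<^sup>2)" if r: "r > 0" for r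
  proof -
    have "\<bar>\<delta>1 r / (2 * p r)\<bar> = \<bar>\<delta>1 r\<bar> / (2 * p r)" using p_pos[OF r] by simp
    also have "\<dots> \<le> (C + A) * r / (2 * (c * r))"
      by (rule frac_le) (use d1[OF r] p_lower[of r] r c_pos C0 A0 in auto)
    finally have 1: "\<bar>\<delta>1 r / (2 * p r)\<bar> \<le> (C + A) / (2 * c)" using r by simp
    have "\<bar>\<delta> r * p1 r / (2 * (p r)\<^sup>2)\<bar> = \<bar>\<delta> r\<bar> * \<bar>p1 r\<bar> / (2 * (p r)\<^sup>2)" by (simp add: abs_mult)
    also have "\<dots> \<le> (A * r\<^sup>2) * (K / (2 * c)) / (2 * (c * r)\<^sup>2)"
    proof (rule frac_le)
      show "\<bar>\<delta> r\<bar> * \<bar>p1 r\<bar> \<le> (A * r\<^sup>2) * (K / (2 * c))"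
        using d[OF r] p1_bounded[OF r] A0 by (intro mult_mono) auto
      show "2 * (c * r)\<^sup>2 \<le> 2 * (p r)\<^sup>2"
        using p_lower[of r] r c_pos by (intro mult_left_mono power_mono) auto
    qed (use r c_pos K_pos A0 in auto)
    finally have "\<bar>\<delta> r * p1 r / (2 * (p r)\<^sup>2)\<bar> \<le> A * (K / (2 * c)) / (2 * c\<^sup>2)"
      using r by (simp add: power_mult_distrib)
    with 1 show ?thesis unfolding \<beta>1_def minus_divide_left[symmetric] by linarith
  qed
  define M where "M = 1 + A / (2 * c) + (A + A') / (2 * c) + ((C + A) / (2 * c) + A * (K / (2 * c)) / (2 * c\<^sup>2) + ((A + A') / (2 * c))\<^sup>2)"
  have nn: "0 \<le> A / (2 * c)" "0 \<le> (A + A') / (2 * c)" "0 \<le> (C + A) / (2 * c) + A * (K / (2 * c)) / (2 * c\<^sup>2)"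
      "0 \<le> ((A + A') / (2 * c))\<^sup>2"
    using A0 A'0 C0 c_pos K_pos by auto
  show ?thesis
  proof (intro exI[of _ M] conjI allI impI)
    show "M > 0" using nn unfolding M_def by linarith
    fix r :: real assume r: "r > 0"
    have "A / (2 * c) * r \<le> M * r" using nn r unfolding M_def by (intro mult_right_mono) linarith+
    then show "\<bar>\<beta> r\<bar> \<le> M * r" using b[OF r] by linarith
    show "\<bar>\<beta> r\<bar> \<le> M" using b'[OF r] nn unfolding M_def by linarith
    have "(\<beta> r)\<^sup>2 \<le> ((A + A') / (2 * c))\<^sup>2"
      using power_mono[OF b'[OF r], of 2] by simp
    moreover have "\<bar>\<beta> r / r\<bar> \<le> A / (2 * c)" using b[OF r] r by (simp add: field_simps)
    moreover have "(\<beta> r)\<^sup>2 \<ge> 0" by simp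
    ultimately show "\<bar>\<beta>1 r + (\<beta> r)\<^sup>2 + \<beta> r / r\<bar> \<le> M"
      using b1[OF r] nn unfolding M_def by linarith
  qed
qed

definition M :: real where
  "M = (SOME M. M > 0 \<and> (\<forall>r > 0. \<bar>\<beta> r\<bar> \<le> M * r \<and> \<bar>\<beta> r\<bar> \<le> M \<and> \<bar>\<beta>1 r + (\<beta> r)\<^sup>2 + \<beta> r / r\<bar> \<le> M))"

lemma M_pos: "M > 0"
  and \<beta>_le: "r > 0 \<Longrightarrow> \<bar>\<beta> r\<bar> \<le> M * r"
  and \<beta>_le': "r > 0 \<Longrightarrow> \<bar>\<beta> r\<bar> \<le> M"
  and riccati_\<beta>: "r > 0 \<Longrightarrow> \<bar>\<beta>1 r + (\<beta> r)\<^sup>2 + \<beta> r / r\<bar> \<le> M"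
  using someI_ex[OF \<beta>_bounds] unfolding M_def[symmetric] by auto

lemma \<beta>_zero [simp]: "\<beta> 0 = 0"
  by (simp add: \<beta>_def)

lemma \<beta>_cont: "continuous_on {0..} \<beta>"
  by (rule continuous_on_Ici_if_bound_at_0[OF \<beta>_deriv, where K = M]) (simp_all add: \<beta>_le)

definition \<Phi> :: "real \<Rightarrow> real" where "\<Phi> r = integral {0..r} p"
definition \<B> :: "real \<Rightarrow> real" where "\<B> r = integral {0..r} \<beta>"

lemma \<Phi>_deriv: "r > 0 \<Longrightarrow> (\<Phi> has_real_derivative p r) (at r)"
  unfolding \<Phi>_def[abs_def] by (rule integral_has_derivative_Ioi[OF p_cont])

lemma \<B>_deriv: "r > 0 \<Longrightarrow> (\<B> has_real_derivative \<beta> r) (at r)"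
  unfolding \<B>_def[abs_def] by (rule integral_has_derivative_Ioi[OF \<beta>_cont])

lemma \<Phi>_cont: "continuous_on {0..} \<Phi>"
  unfolding \<Phi>_def[abs_def] by (rule integral_continuous_Ici[OF p_cont])

lemma \<B>_cont: "continuous_on {0..} \<B>"
  unfolding \<B>_def[abs_def] by (rule integral_continuous_Ici[OF \<beta>_cont])

lemma \<Phi>_zero [simp]: "\<Phi> 0 = 0" and \<B>_zero [simp]: "\<B> 0 = 0"
  by (simp_all add: \<Phi>_def \<B>_def)

lemma \<B>_bound:
  assumes "r \<ge> 0" shows "\<bar>\<B> r\<bar> \<le> M * r\<^sup>2 / 2"
proof -
  have "\<bar>\<B> r - \<B> 0\<bar> \<le> M * r\<^sup>2 / 2 - M * 0\<^sup>2 / 2"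
  proof (rule abs_diff_le_by_derivs[OF assms, where f' = \<beta> and G' = "\<lambda>r. M * r"])
    show "continuous_on {0..r} \<B>" by (rule continuous_on_subset[OF \<B>_cont]) auto
  qed (auto intro!: derivative_eq_intros continuous_intros \<B>_deriv \<beta>_le)
  then show ?thesis by simp
qed

lemma \<Phi>_taylor:
  assumes "r \<ge> 0" shows "\<bar>\<Phi> r - \<omega> * r\<^sup>2 / 2\<bar> \<le> K / c * r ^ 4"
proof -
  have "\<bar>(\<Phi> r - \<omega> * r\<^sup>2 / 2) - (\<Phi> 0 - \<omega> * 0\<^sup>2 / 2)\<bar> \<le> K / c * (r ^ 4 / 4) - K / c * (0 ^ 4 / 4)"
  proof (rule abs_diff_le_by_derivs[OF assms, where f' = "\<lambda>r. p r - \<omega> * r" and G' = "\<lambda>r. K / c * r ^ 3"])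
    show "continuous_on {0..r} (\<lambda>r. \<Phi> r - \<omega> * r\<^sup>2 / 2)"
      by (intro continuous_intros continuous_on_subset[OF \<Phi>_cont]) auto
    show "((\<lambda>r. \<Phi> r - \<omega> * r\<^sup>2 / 2) has_real_derivative p x - \<omega> * x) (at x)" if "0 < x" for x
      using that by (auto intro!: derivative_eq_intros \<Phi>_deriv)
    show "((\<lambda>r. K / c * (r ^ 4 / 4)) has_real_derivative K / c * x ^ 3) (at x)" for x
      using c_pos by (auto intro!: derivative_eq_intros)
    show "continuous_on {0..r} (\<lambda>r. K / c * (r ^ 4 / 4))" by (intro continuous_intros) (use c_pos in auto)
  qed (rule p_taylor)
  then have "\<bar>\<Phi> r - \<omega> * r\<^sup>2 / 2\<bar> \<le> K / c * r ^ 4 / 4" by simp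
  also have "\<dots> \<le> K / c * r ^ 4" using K_pos c_pos by (simp add: field_simps)
  finally show ?thesis .
qed

lemma \<Phi>_lower:
  assumes "r \<ge> 0" shows "c * r\<^sup>2 / 2 \<le> \<Phi> r"
proof -
  have "(\<lambda>r. \<Phi> r - c * r\<^sup>2 / 2) 0 \<le> (\<lambda>r. \<Phi> r - c * r\<^sup>2 / 2) r"
  proof (rule DERIV_nonneg_imp_increasing_open[OF assms])
    fix x assume x: "0 < x" "x < r"
    have "((\<lambda>r. \<Phi> r - c * r\<^sup>2 / 2) has_real_derivative p x - c * x) (at x)"
      using x by (auto intro!: derivative_eq_intros \<Phi>_deriv)
    then show "\<exists>y. ((\<lambda>r. \<Phi> r - c * r\<^sup>2 / 2) has_real_derivative y) (at x) \<and> 0 \<le> y"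
      using p_lower[of x] x by (intro exI[of _ "p x - c * x"]) auto
  qed (intro continuous_intros continuous_on_subset[OF \<Phi>_cont]; auto)
  then show ?thesis by simp
qed

lemma \<Phi>_upper:
  assumes "r \<ge> 0" shows "\<Phi> r \<le> sqrt K * r\<^sup>2 / 2"
proof -
  have "(\<lambda>r. sqrt K * r\<^sup>2 / 2 - \<Phi> r) 0 \<le> (\<lambda>r. sqrt K * r\<^sup>2 / 2 - \<Phi> r) r"
  proof (rule DERIV_nonneg_imp_increasing_open[OF assms])
    fix x assume x: "0 < x" "x < r"
    have "((\<lambda>r. sqrt K * r\<^sup>2 / 2 - \<Phi> r) has_real_derivative sqrt K * x - p x) (at x)"
      using x by (auto intro!: derivative_eq_intros \<Phi>_deriv)
    then show "\<exists>y. ((\<lambda>r. sqrt K * r\<^sup>2 / 2 - \<Phi> r) has_real_derivative y) (at x) \<and> 0 \<le> y"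
      using p_upper[of x] x by (intro exI[of _ "sqrt K * x - p x"]) auto
  qed (intro continuous_intros continuous_on_subset[OF \<Phi>_cont]; auto)
  then show ?thesis by simp
qed

section \<open>The quasimode and its Riccati equation\<close>

definition g :: "real \<Rightarrow> real \<Rightarrow> real" where "g h r = exp (\<B> r - \<Phi> r / h)"
definition lg :: "real \<Rightarrow> real \<Rightarrow> real" where "lg h r = \<beta> r - p r / h"

lemma g_pos [simp]: "g h r > 0" by (simp add: g_def)
lemma g_nonzero [simp]: "g h r \<noteq> 0" by (simp add: g_def)
lemma g_zero [simp]: "g h 0 = 1" by (simp add: g_def)

lemma g_deriv: "r > 0 \<Longrightarrow> (g h has_real_derivative g h r * lg h r) (at r)"
  unfolding g_def[abs_def] lg_def divide_inverse
  by (rule derivative_eq_intros \<B>_deriv \<Phi>_deriv refl | assumption | simp)+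

lemma g_cont: "continuous_on {0..} (g h)"
  unfolding g_def[abs_def] divide_inverse by (intro continuous_intros \<B>_cont \<Phi>_cont)

lemma lg_cont: "continuous_on {0..} (lg h)"
  unfolding lg_def[abs_def] divide_inverse by (intro continuous_intros \<beta>_cont p_cont)

lemma lg_deriv: "r > 0 \<Longrightarrow> (lg h has_real_derivative \<beta>1 r - p1 r / h) (at r)"
  unfolding lg_def[abs_def] divide_inverse
  by (rule derivative_eq_intros \<beta>_deriv p_deriv refl | assumption | simp)+

text \<open>Sorted by powers of 1/h: order two gives p^2 = V, order one gives the transport
  expression 2 \<omega>, order zero is the bounded remainder. Thus g solves the radial equation at
  energy 2 \<omega> h up to an error of order h^2 in the energy.\<close>

lemma riccati_lg:
  assumes "r > 0" "h > 0"
  shows "(\<beta>1 r - p1 r / h) + (lg h r)\<^sup>2 + lg h r / r = (V r - 2 * \<omega> * h) / h\<^sup>2 + (\<beta>1 r + (\<beta> r)\<^sup>2 + \<beta> r / r)"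
proof -
  have t: "2 * \<omega> = 2 * p r * \<beta> r + p1 r + p r / r" using transport[OF assms(1)] by simp
  show ?thesis
    using assms unfolding lg_def t p_sq[of r, symmetric] by (simp add: field_simps power2_eq_square)
qed

text \<open>\<Phi> / h is at least c r^2 / (2 h), while the amplitude exponent is at most M r^2 / 2;
  the condition on h lets it consume no more than half of the decay.\<close>

lemma g_le:
  assumes "h > 0" "2 * M * h \<le> c" "r \<ge> 0"
  shows "g h r \<le> exp (- (c / (4 * h)) * r\<^sup>2)"
proof -
  have "\<B> r \<le> M * r\<^sup>2 / 2" using \<B>_bound[OF assms(3)] by simp
  also have "\<dots> \<le> c / (4 * h) * r\<^sup>2"
    using mult_right_mono[OF assms(2), of "r\<^sup>2"] assms(1) by (simp add: field_simps)
  finally have "\<B> r \<le> c / (4 * h) * r\<^sup>2" .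
  moreover have "\<Phi> r / h \<ge> (c * r\<^sup>2 / 2) / h" using \<Phi>_lower[OF assms(3)] assms(1) by (intro divide_right_mono) auto
  moreover have "(c * r\<^sup>2 / 2) / h = 2 * (c / (4 * h) * r\<^sup>2)" by simp
  ultimately show ?thesis unfolding g_def by simp
qed

text \<open>The logarithmic derivative of g grows linearly and \<open>r powr s\<close> is at most r,
  so everything except g contributes a cubic bound, which the Gaussian decay of g overwhelms.
  Boundedness of f and r f' is enough.\<close>

lemma wronskian_tendsto:
  assumes h: "h > 0" "2 * M * h \<le> c" and s: "\<bar>s\<bar> \<le> 1" and C: "C \<ge> 0"
    and f: "\<And>r. r \<ge> R \<Longrightarrow> \<bar>f r\<bar> \<le> C" "\<And>r. r \<ge> R \<Longrightarrow> \<bar>r * f1 r\<bar> \<le> C"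
  shows "((\<lambda>r. r * (r powr s * g h r) * (f1 r - f r * (lg h r + s / r))) \<longlongrightarrow> 0) at_top"
proof (rule Lim_null_comparison)
  define k where "k = c / (4 * h)"
  define D where "D = C * (2 + M + sqrt K / h)"
  have k: "k > 0" using h c_pos by (simp add: k_def)
  show "((\<lambda>r. D * r ^ 3 * exp (- k * r\<^sup>2)) \<longlongrightarrow> 0) at_top"
    using k by real_asymp
  show "eventually (\<lambda>r. norm (r * (r powr s * g h r) * (f1 r - f r * (lg h r + s / r))) \<le> D * r ^ 3 * exp (- k * r\<^sup>2)) at_top"
    using eventually_ge_at_top[of "max 1 R"]
  proof eventually_elim
    case (elim r)
    then have r: "r \<ge> 1" "r \<ge> R" by auto
    have ps: "r powr s \<le> r" using powr_mono[of s 1 r] r s by simp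
    have gl: "g h r \<le> exp (- k * r\<^sup>2)" unfolding k_def by (rule g_le[OF h]) (use r in auto)
    have 1: "r powr s * g h r \<le> r * exp (- k * r\<^sup>2)"
      using ps gl r by (intro mult_mono) (auto intro: less_imp_le)
    have lb: "\<bar>r * lg h r + s\<bar> \<le> (M + sqrt K / h + 1) * r\<^sup>2"
    proof -
      have r2: "1 \<le> r\<^sup>2" using r by (simp add: one_le_power)
      have "\<bar>r * \<beta> r\<bar> \<le> M * r\<^sup>2"
        using \<beta>_le[of r] r by (simp add: abs_mult power2_eq_square mult_left_mono mult.left_commute)
      moreover have "\<bar>r * (p r / h)\<bar> \<le> sqrt K / h * r\<^sup>2"
        using p_upper[of r] r h by (simp add: abs_mult power2_eq_square field_simps mult_left_mono)
      moreover have "\<bar>s\<bar> \<le> r\<^sup>2" using s r2 by linarith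
      moreover have e1: "r * lg h r + s = r * \<beta> r - r * (p r / h) + s" by (simp add: lg_def algebra_simps)
      moreover have e2: "(M + sqrt K / h + 1) * r\<^sup>2 = M * r\<^sup>2 + sqrt K / h * r\<^sup>2 + r\<^sup>2" by (simp add: algebra_simps)
      ultimately show ?thesis unfolding e1 e2 by (simp only: abs_le_iff) argo
    qed
    have e: "r * (f1 r - f r * (lg h r + s / r)) = r * f1 r - f r * (r * lg h r + s)"
      using r by (simp add: field_simps)
    have "\<bar>f r * (r * lg h r + s)\<bar> \<le> C * ((M + sqrt K / h + 1) * r\<^sup>2)"
      unfolding abs_mult using f(1)[OF r(2)] lb C by (intro mult_mono) auto
    moreover have "C \<le> C * r\<^sup>2" using C r mult_left_mono[of 1 "r\<^sup>2" C] by (simp add: one_le_power)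
    ultimately have 2: "\<bar>r * (f1 r - f r * (lg h r + s / r))\<bar> \<le> D * r\<^sup>2"
      unfolding e D_def using f(2)[OF r(2)] by (simp add: algebra_simps)
    have "norm (r * (r powr s * g h r) * (f1 r - f r * (lg h r + s / r))) =
       (r powr s * g h r) * \<bar>r * (f1 r - f r * (lg h r + s / r))\<bar>"
      by (simp add: abs_mult less_imp_le)
    also have "\<dots> \<le> (r * exp (- k * r\<^sup>2)) * (D * r\<^sup>2)"
      by (rule mult_mono[OF 1 2]) (use r in \<open>auto intro: less_imp_le\<close>)
    also have "\<dots> = D * r ^ 3 * exp (- k * r\<^sup>2)" by (simp add: eval_nat_numeral)
    finally show ?case .
  qed
qed

section \<open>Comparison of radial eigenfunctions with the quasimode\<close>

definition eigenfunction :: "real \<Rightarrow> real \<Rightarrow> (real \<Rightarrow> real) \<Rightarrow> (real \<Rightarrow> real) \<Rightarrow> (real \<Rightarrow> real) \<Rightarrow> bool" where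
  "eigenfunction h E f f1 f2 \<longleftrightarrow>
     (\<forall>r. (f has_real_derivative f1 r) (at r)) \<and> (\<forall>r. (f1 has_real_derivative f2 r) (at r)) \<and>
     (\<forall>r > 0. f2 r + f1 r / r = (V r - E) / h\<^sup>2 * f r) \<and>
     (\<exists>r > 0. f r \<noteq> 0) \<and> (\<forall>\<epsilon> > 0. \<forall>R. \<exists>r \<ge> R. (f r)\<^sup>2 < \<epsilon>)"

text \<open>The last clause of \<open>eigenfunction\<close> is the trace left by square
  integrability; together with V - E >= 0 far out it yields a fixed sign and boundedness. For r
  beyond the chosen R one has r >= 1, hence c^2 r^2 >= c^2 R >= |E|.\<close>

lemma eigenfunction_decay:
  assumes "h > 0" "eigenfunction h E f f1 f2"
  shows "\<exists>\<sigma> \<in> {1, -1}. \<exists>C \<ge> 0. \<exists>R > 0. \<forall>r \<ge> R. \<sigma> * f r > 0 \<and> \<bar>f r\<bar> \<le> C \<and> \<bar>r * f1 r\<bar> \<le> C"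
proof -
  define R where "R = 1 + \<bar>E\<bar> / c\<^sup>2"
  have R: "R > 0" by (simp add: R_def add_pos_nonneg)
  have pos: "(V r - E) / h\<^sup>2 \<ge> 0" if "r \<ge> R" for r
  proof -
    have "\<bar>E\<bar> \<le> c\<^sup>2 * R" using c_pos by (simp add: R_def algebra_simps)
    also have "\<dots> \<le> c\<^sup>2 * r\<^sup>2"
    proof (rule mult_left_mono)
      have "r \<ge> 1" using that unfolding R_def by (smt (verit) divide_nonneg_nonneg zero_le_power2 abs_ge_zero)
      then have "r \<le> r\<^sup>2" by (simp add: power2_eq_square)
      then show "R \<le> r\<^sup>2" using that by linarith
    qed simp
    finally show ?thesis using V_lower[of r] by simp
  qed
  have "\<exists>\<sigma> \<in> {1, -1}. \<exists>C \<ge> 0. \<forall>r \<ge> R. \<sigma> * f r > 0 \<and> \<bar>f r\<bar> \<le> C \<and> \<bar>r * f1 r\<bar> \<le> C"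
  proof -
    obtain r0 where r0: "r0 > 0" "f r0 \<noteq> 0" using assms(2) unfolding eigenfunction_def by blast
    show ?thesis
    proof (rule radial_ode_decay[where f = f and ?f1.0 = f1 and Q = "\<lambda>r. (V r - E) / h\<^sup>2" and ?f2.0 = f2, OF _ _ _ _ R pos _ r0])
      have "continuous_on {0<..} V" using V_deriv by (intro continuous_at_imp_continuous_on ballI DERIV_isCont) auto
      then show "continuous_on {0<..} (\<lambda>r. (V r - E) / h\<^sup>2)" unfolding divide_inverse by (intro continuous_intros)
    qed (use assms(2) in \<open>auto simp: eigenfunction_def\<close>)
  qed
  then show ?thesis using R by blast
qed

text \<open>On the outermost interval where f > 0 a too small E would make the weighted Wronskian
  with g strictly increasing. It starts at a nonnegative value: at r1 = 0 because of the factor r,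
  at a zero of f because f' >= 0 there. But it must tend to 0 at infinity. The sign of f further
  inside does not matter for this.\<close>

lemma eigenvalue_lower:
  assumes h: "h > 0" "2 * M * h \<le> c" and ef: "eigenfunction h E f f1 f2"
    and C: "C \<ge> 0" and b: "\<And>r. r \<ge> R \<Longrightarrow> \<bar>f r\<bar> \<le> C" "\<And>r. r \<ge> R \<Longrightarrow> \<bar>r * f1 r\<bar> \<le> C"
    and r1: "r1 \<ge> 0" "\<And>r. r > r1 \<Longrightarrow> f r > 0" "r1 = 0 \<or> f r1 = 0"
  shows "2 * \<omega> * h - M * h\<^sup>2 \<le> E"
proof (rule ccontr)
  assume "\<not> 2 * \<omega> * h - M * h\<^sup>2 \<le> E"
  then have E: "E < 2 * \<omega> * h - M * h\<^sup>2" by simp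
  have df: "\<And>r. (f has_real_derivative f1 r) (at r)" "\<And>r. (f1 has_real_derivative f2 r) (at r)"
    and ode: "\<And>r. r > 0 \<Longrightarrow> f2 r + f1 r / r = (V r - E) / h\<^sup>2 * f r"
    using ef by (auto simp: eigenfunction_def)
  define w where "w = (\<lambda>r. r * g h r * (f1 r - f r * lg h r))"
  define w1 where "w1 = (\<lambda>r. r * g h r * f r * ((V r - E) / h\<^sup>2 - ((\<beta>1 r - p1 r / h) + (lg h r)\<^sup>2 + lg h r / r)))"
  have dw: "(w has_real_derivative w1 r) (at r)" if r: "r > 0" for r
    unfolding w_def w1_def
    by (rule wronskian_deriv[where f = f and ?f1.0 = f1 and ?f2.0 = f2 and \<gamma> = "g h" and l = "lg h" and ?l1.0 = "\<lambda>r. \<beta>1 r - p1 r / h", OF _ df g_deriv lg_deriv ode]) (use r in auto)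
  have w1pos: "w1 r > 0" if "r > r1" for r
  proof -
    have r: "r > 0" using that r1 by simp
    have "(V r - E) / h\<^sup>2 - ((\<beta>1 r - p1 r / h) + (lg h r)\<^sup>2 + lg h r / r) =
       (2 * \<omega> * h - E) / h\<^sup>2 - (\<beta>1 r + (\<beta> r)\<^sup>2 + \<beta> r / r)"
      unfolding riccati_lg[OF r h(1)] by (simp add: diff_divide_distrib)
    moreover have "(2 * \<omega> * h - E) / h\<^sup>2 > M" using E h by (simp add: field_simps)
    ultimately have "(V r - E) / h\<^sup>2 - ((\<beta>1 r - p1 r / h) + (lg h r)\<^sup>2 + lg h r / r) > 0"
      using riccati_\<beta>[OF r] by linarith
    then show ?thesis unfolding w1_def using r r1(2)[OF that] by (intro mult_pos_pos) auto
  qed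
  have lim: "(w \<longlongrightarrow> 0) at_top"
  proof (rule Lim_transform_eventually)
    show "((\<lambda>r. r * (r powr 0 * g h r) * (f1 r - f r * (lg h r + 0 / r))) \<longlongrightarrow> 0) at_top"
      by (rule wronskian_tendsto[OF h _ C b]) simp_all
    show "eventually (\<lambda>r. r * (r powr 0 * g h r) * (f1 r - f r * (lg h r + 0 / r)) = w r) at_top"
      using eventually_gt_at_top[of 0] by eventually_elim (simp add: w_def)
  qed
  have wle: "w r \<le> 0" if "r > r1" for r
    by (rule nondecreasing_tendsto_zero_le[OF dw _ lim that]) (use r1 w1pos in \<open>auto intro: less_imp_le\<close>)
  have cw: "continuous_on {0..} w" unfolding w_def
    using df by (intro continuous_intros g_cont lg_cont) (auto intro!: continuous_at_imp_continuous_on DERIV_isCont)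
  have "w (r1 + 1) < w (r1 + 2)"
  proof (rule DERIV_pos_imp_increasing[where f = w])
    show "\<exists>y. (w has_real_derivative y) (at x) \<and> 0 < y" if "r1 + 1 \<le> x" "x \<le> r1 + 2" for x
      using dw[of x] w1pos[of x] that r1 by (intro exI[of _ "w1 x"]) auto
  qed simp
  then have neg: "w (r1 + 1) < 0" using wle[of "r1 + 2"] by simp
  have "w r1 \<le> w (r1 + 1)"
  proof (rule DERIV_nonneg_imp_increasing_open[where f = w])
    show "\<exists>y. (w has_real_derivative y) (at x) \<and> 0 \<le> y" if "r1 < x" "x < r1 + 1" for x
      using dw[of x] w1pos[of x] that r1 by (intro exI[of _ "w1 x"]) auto
    show "continuous_on {r1..r1 + 1} w" by (rule continuous_on_subset[OF cw]) (use r1 in auto)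
  qed simp
  moreover have "w r1 \<ge> 0"
  proof (cases "r1 = 0")
    case False
    then have f0: "f r1 = 0" using r1 by simp
    have "f1 r1 \<ge> 0"
    proof (rule ccontr)
      assume "\<not> f1 r1 \<ge> 0"
      then obtain d where d: "d > 0" "\<And>t. 0 < t \<Longrightarrow> t < d \<Longrightarrow> f (r1 + t) < f r1"
        using DERIV_neg_dec_right[OF df(1), of r1] by (auto simp: not_le)
      show False using d(2)[of "d / 2"] d(1) r1(2)[of "r1 + d / 2"] f0 by simp
    qed
    then show ?thesis using r1(1) f0 by (simp add: w_def less_imp_le)
  qed (simp add: w_def)
  ultimately show False using neg by simp
qed

text \<open>Multiplying g by r to the power s = \<tau> h or -\<tau> h changes its Riccati expression
  by 2 s lg / r + s^2 / r^2. The main part of this, -2 (s / h) p / r, has modulus at least 2 \<tau>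
  c, independent of h, and so dominates the defect M + D for \<tau> large: one sign gives a bound
  from above, the other from below. The term s^2 / r^2 is singular at 0 and restricts the comparison
  to r^2 >= h.\<close>

lemma eigenfunction_outer:
  assumes h: "h > 0" "2 * M * h \<le> c" and ef: "eigenfunction h E f f1 f2"
    and C: "C \<ge> 0" and b: "\<And>r. r \<ge> R \<Longrightarrow> \<bar>f r\<bar> \<le> C" "\<And>r. r \<ge> R \<Longrightarrow> \<bar>r * f1 r\<bar> \<le> C"
    and E: "\<bar>E - 2 * \<omega> * h\<bar> \<le> D * h\<^sup>2" and \<tau>: "\<tau> > 0" "M + D \<le> \<tau> * c" and h\<tau>: "2 * \<tau> * h * M + \<tau>\<^sup>2 * h \<le> \<tau> * c" "\<tau> * h \<le> 1"
    and r1: "r1 \<ge> sqrt h" "\<And>r. r > r1 \<Longrightarrow> f r > 0" and r: "r > r1"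
  shows "\<bar>f1 r / f r - lg h r\<bar> \<le> \<tau> * h / r"
proof -
  have df: "\<And>r. (f has_real_derivative f1 r) (at r)" "\<And>r. (f1 has_real_derivative f2 r) (at r)"
    and ode: "\<And>r. r > 0 \<Longrightarrow> f2 r + f1 r / r = (V r - E) / h\<^sup>2 * f r"
    using ef by (auto simp: eigenfunction_def)
  have r10: "r1 \<ge> 0" using r1(1) h real_sqrt_ge_zero[of h] by linarith
  have pos: "x > 0" if "x > r1" for x using that r10 by simp
  define \<epsilon> where "\<epsilon> = (E - 2 * \<omega> * h) / h\<^sup>2"
  have \<epsilon>: "\<bar>\<epsilon>\<bar> \<le> D" using E h by (simp add: \<epsilon>_def field_simps)
  have A: "(V r - E) / h\<^sup>2 = (V r - 2 * \<omega> * h) / h\<^sup>2 - \<epsilon>" for r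
    unfolding \<epsilon>_def by (simp add: diff_divide_distrib)
  define l1 where "l1 = (\<lambda>s r. (\<beta>1 r - p1 r / h) - s / r\<^sup>2)"
  have ric: "l1 s r + (lg h r + s / r)\<^sup>2 + (lg h r + s / r) / r =
      (V r - 2 * \<omega> * h) / h\<^sup>2 + (\<beta>1 r + (\<beta> r)\<^sup>2 + \<beta> r / r) + 2 * s * (\<beta> r / r) - 2 * s / h * (p r / r) + s\<^sup>2 / r\<^sup>2"
    if r: "r > 0" for s r
  proof -
    have "l1 s r + (lg h r + s / r)\<^sup>2 + (lg h r + s / r) / r =
       ((\<beta>1 r - p1 r / h) + (lg h r)\<^sup>2 + lg h r / r) + 2 * s * lg h r / r + s\<^sup>2 / r\<^sup>2"
      using r unfolding l1_def by (simp add: field_simps power2_eq_square)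
    also have "2 * s * lg h r / r = 2 * s * (\<beta> r / r) - 2 * s / h * (p r / r)"
      using r h unfolding lg_def by (simp add: field_simps)
    finally show ?thesis unfolding riccati_lg[OF r h(1)] by simp
  qed
  \<comment> \<open>Of the available 2 \<tau> c, one half pays for M + D and the other for the two
    terms carrying h.\<close>
  have est: "M + D + 2 * \<tau> * h * \<bar>\<beta> x / x\<bar> + (\<tau> * h)\<^sup>2 / x\<^sup>2 \<le> 2 * \<tau> * (p x / x)" if x: "x > r1" for x
  proof -
    have x0: "x > 0" using pos[OF x] .
    have "\<bar>\<beta> x / x\<bar> \<le> M" using \<beta>_le[OF x0] x0 by (simp add: field_simps)
    then have 1: "2 * \<tau> * h * \<bar>\<beta> x / x\<bar> \<le> 2 * \<tau> * h * M" using \<tau> h by (intro mult_left_mono) auto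
    have "h \<le> x\<^sup>2" using power_mono[of "sqrt h" x 2] r1(1) x h by simp
    then have "(\<tau> * h)\<^sup>2 / x\<^sup>2 \<le> (\<tau> * h)\<^sup>2 / h" using h x0 by (intro divide_left_mono) auto
    also have "\<dots> = \<tau>\<^sup>2 * h" using h by (simp add: power2_eq_square)
    finally have 2: "(\<tau> * h)\<^sup>2 / x\<^sup>2 \<le> \<tau>\<^sup>2 * h" .
    have "c \<le> p x / x" using p_lower[of x] x0 by (simp add: field_simps)
    then have "2 * \<tau> * c \<le> 2 * \<tau> * (p x / x)" using \<tau> by (intro mult_left_mono) auto
    then show ?thesis using 1 2 h\<tau>(1) \<tau>(2) by linarith
  qed
  have dg: "((\<lambda>r. r powr s * g h r) has_real_derivative (r powr s * g h r) * (lg h r + s / r)) (at r)" if "r > 0" for s r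
  proof -
    have "((\<lambda>r. r powr s * g h r) has_real_derivative s * r powr (s - 1) * g h r + (g h r * lg h r) * r powr s) (at r)"
      by (rule DERIV_mult[OF has_real_derivative_powr g_deriv]) (use that in auto)
    moreover have "r powr (s - 1) = r powr s / r" using that by (simp add: powr_diff)
    ultimately show ?thesis by (simp add: algebra_simps)
  qed
  have dl: "((\<lambda>r. lg h r + s / r) has_real_derivative l1 s r) (at r)" if "r > 0" for s r
    unfolding l1_def using that
    by (auto intro!: derivative_eq_intros lg_deriv simp: power2_eq_square)
  have gp: "r powr s * g h r > 0" if "r > 0" for s r using that by simp
  have lim: "((\<lambda>r. r * (r powr s * g h r) * (f1 r - f r * (lg h r + s / r))) \<longlongrightarrow> 0) at_top" if "\<bar>s\<bar> \<le> 1" for s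
    by (rule wronskian_tendsto[OF h that C b])
  have "f1 r \<le> f r * (lg h r + (\<tau> * h) / r)"
  proof (rule log_derivative_compare(1)[OF r10 df dg dl r1(2) gp ode lim r])
    show "l1 (\<tau> * h) x + (lg h x + (\<tau> * h) / x)\<^sup>2 + (lg h x + (\<tau> * h) / x) / x \<le> (V x - E) / h\<^sup>2" if x: "x > r1" for x
    proof -
      have x0: "x > 0" using pos[OF x] .
      have "2 * (\<tau> * h) * (\<beta> x / x) \<le> 2 * \<tau> * h * \<bar>\<beta> x / x\<bar>"
        unfolding mult.assoc[symmetric] using \<tau> h by (intro mult_left_mono abs_ge_self) auto
      moreover have "2 * (\<tau> * h) / h * (p x / x) = 2 * \<tau> * (p x / x)" using h by simp
      moreover have "v + k + b - q + s \<le> v - e"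
        if "b \<le> b'" "q = q'" "m + D + b' + s \<le> q'" "\<bar>k\<bar> \<le> m" "\<bar>e\<bar> \<le> D" for v k b q s e b' q' m :: real
        using that by linarith
      ultimately show ?thesis unfolding ric[OF x0] A using est[OF x] riccati_\<beta>[OF x0] \<epsilon> by blast
    qed
  qed (use pos h\<tau> \<tau> h in auto)
  moreover have "f r * (lg h r + (- \<tau> * h) / r) \<le> f1 r"
  proof (rule log_derivative_compare(2)[OF r10 df dg dl r1(2) gp ode lim r])
    show "(V x - E) / h\<^sup>2 \<le> l1 (- \<tau> * h) x + (lg h x + (- \<tau> * h) / x)\<^sup>2 + (lg h x + (- \<tau> * h) / x) / x" if x: "x > r1" for x
    proof -
      have x0: "x > 0" using pos[OF x] .
      have "2 * (- \<tau> * h) * (\<beta> x / x) \<ge> - (2 * \<tau> * h * \<bar>\<beta> x / x\<bar>)"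
      proof -
        have "(2 * \<tau> * h) * (\<beta> x / x) \<le> (2 * \<tau> * h) * \<bar>\<beta> x / x\<bar>" using \<tau> h by (intro mult_left_mono abs_ge_self) auto
        then show ?thesis by simp
      qed
      moreover have "2 * (- \<tau> * h) / h * (p x / x) = - (2 * \<tau> * (p x / x))" using h by simp
      moreover have "(- \<tau> * h)\<^sup>2 / x\<^sup>2 \<ge> 0" "(\<tau> * h)\<^sup>2 / x\<^sup>2 \<ge> 0" by simp_all
      moreover have "v - e \<le> v + k + b - q + s"
        if "b \<ge> - b'" "q = - q'" "s \<ge> 0" "s' \<ge> 0" "m + D + b' + s' \<le> q'" "\<bar>k\<bar> \<le> m" "\<bar>e\<bar> \<le> D"
        for v k b q s e b' q' m s' :: real
        using that by linarith
      ultimately show ?thesis unfolding ric[OF x0] A using est[OF x] riccati_\<beta>[OF x0] \<epsilon> by blast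
    qed
  qed (use pos h\<tau> \<tau> h in auto)
  moreover have "f r > 0" using r1(2)[OF r] .
  ultimately have "f1 r / f r \<le> lg h r + (\<tau> * h) / r" "lg h r + (- \<tau> * h) / r \<le> f1 r / f r"
    by (simp_all add: pos_divide_le_eq pos_le_divide_eq mult.commute)
  then show ?thesis by (simp add: abs_le_iff)
qed

text \<open>For r^2 <= h both \<Phi> / h and the amplitude exponent are bounded independently of h,
  so g is comparable with 1 there.\<close>

lemma g_inner_bounds:
  assumes "0 < h" "h \<le> 1" "0 \<le> r" "r \<le> sqrt h"
  shows "g h r \<le> exp (sqrt K + M)" "exp (- (sqrt K + M)) \<le> g h r"
proof -
  have r2: "r\<^sup>2 \<le> h" using assms by (metis real_sqrt_pow2 less_imp_le power_mono)
  have "M * r\<^sup>2 / 2 \<le> M * 1 / 2" using r2 assms M_pos by (intro divide_right_mono mult_left_mono) auto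
  then have 1: "\<bar>\<B> r\<bar> \<le> M" using \<B>_bound[OF assms(3)] M_pos by linarith
  have "\<Phi> r / h \<le> (sqrt K * r\<^sup>2 / 2) / h" using \<Phi>_upper[OF assms(3)] assms(1) by (intro divide_right_mono) auto
  also have "\<dots> \<le> (sqrt K * h / 2) / h" using r2 assms K_pos by (intro divide_right_mono mult_left_mono) auto
  also have "\<dots> \<le> sqrt K" using assms K_pos by simp
  finally have 2: "\<Phi> r / h \<le> sqrt K" .
  have "0 \<le> \<Phi> r"
    using \<Phi>_lower[OF assms(3)] c_pos by (smt (verit) divide_nonneg_pos mult_nonneg_nonneg zero_le_power2)
  then have 3: "0 \<le> \<Phi> r / h" using assms by simp
  show "g h r \<le> exp (sqrt K + M)" "exp (- (sqrt K + M)) \<le> g h r"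
    unfolding g_def using 1 2 3 by (simp_all add: abs_le_iff)
qed

text \<open>Here the comparison starts at the origin, where the weighted Wronskian vanishes because
  of its factor r. Its derivative is O(r max |f|), so it is O(r^2 max |f|), and (f/g)' = w / (r g^2)
  is O(r max |f|). Integration up to sqrt h gains the factor h. The exponent 3 in N collects one
  bound for g and two for 1/g.\<close>

lemma eigenfunction_inner:
  assumes h: "0 < h" "h \<le> 1" and ef: "eigenfunction h E f f1 f2"
    and E: "\<bar>E - 2 * \<omega> * h\<bar> \<le> D * h\<^sup>2" and nz: "f (sqrt h) \<noteq> 0"
    and N: "N = (M + D) * exp (3 * (sqrt K + M))" "N * h \<le> exp (- (sqrt K + M)) / 2"
    and r: "0 \<le> r" "r \<le> sqrt h"
  shows "f 0 \<noteq> 0 \<and> \<bar>f r / (f 0 * g h r) - 1\<bar> \<le> 2 * N * exp (sqrt K + M) * h"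
proof -
  have df: "\<And>r. (f has_real_derivative f1 r) (at r)" "\<And>r. (f1 has_real_derivative f2 r) (at r)"
    and ode: "\<And>r. r > 0 \<Longrightarrow> f2 r + f1 r / r = (V r - E) / h\<^sup>2 * f r"
    using ef by (auto simp: eigenfunction_def)
  define T where "T = sqrt K + M"
  have cf: "continuous_on A f" "continuous_on A f1" for A
    using df by (auto intro!: continuous_at_imp_continuous_on DERIV_isCont)
  have sh: "sqrt h > 0" using h by simp
  obtain x0 where x0: "x0 \<in> {0..sqrt h}" and x0m: "\<And>x. x \<in> {0..sqrt h} \<Longrightarrow> \<bar>f x\<bar> \<le> \<bar>f x0\<bar>"
  proof -
    have "continuous_on {0..sqrt h} (\<lambda>x. \<bar>f x\<bar>)" by (intro continuous_intros cf)
    then obtain x0 where "x0 \<in> {0..sqrt h}" "\<forall>y\<in>{0..sqrt h}. \<bar>f y\<bar> \<le> \<bar>f x0\<bar>"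
      using continuous_attains_sup[of "{0..sqrt h}" "\<lambda>x. \<bar>f x\<bar>"] sh by auto
    then show ?thesis using that by blast
  qed
  define S where "S = \<bar>f x0\<bar>"
  have S: "S > 0" using x0m[of "sqrt h"] nz sh by (auto simp: S_def)
  have D0: "D \<ge> 0" using E h by (smt (verit) mult_neg_pos zero_less_power)
  define w where "w = (\<lambda>r. r * g h r * (f1 r - f r * lg h r))"
  define w1 where "w1 = (\<lambda>r. r * g h r * f r * ((V r - E) / h\<^sup>2 - ((\<beta>1 r - p1 r / h) + (lg h r)\<^sup>2 + lg h r / r)))"
  have dw: "(w has_real_derivative w1 r) (at r)" if r: "r > 0" for r
    unfolding w_def w1_def
    by (rule wronskian_deriv[where f = f and ?f1.0 = f1 and ?f2.0 = f2 and \<gamma> = "g h" and l = "lg h" and ?l1.0 = "\<lambda>r. \<beta>1 r - p1 r / h", OF _ df g_deriv lg_deriv ode]) (use r in auto)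
  have cw: "continuous_on {0..} w" unfolding w_def
    by (intro continuous_intros g_cont lg_cont cf)
  define B where "B = exp T * S * (D + M)"
  have B0: "B \<ge> 0" using S D0 M_pos by (simp add: B_def)
  have w1b: "\<bar>w1 x\<bar> \<le> B * x" if x: "0 < x" "x < sqrt h" for x
  proof -
    have "(V x - E) / h\<^sup>2 - ((\<beta>1 x - p1 x / h) + (lg h x)\<^sup>2 + lg h x / x) =
       - ((E - 2 * \<omega> * h) / h\<^sup>2) - (\<beta>1 x + (\<beta> x)\<^sup>2 + \<beta> x / x)"
      unfolding riccati_lg[OF x(1) h(1)] by (simp add: diff_divide_distrib)
    moreover have "\<bar>(E - 2 * \<omega> * h) / h\<^sup>2\<bar> \<le> D" using E h by (simp add: field_simps)
    ultimately have 1: "\<bar>(V x - E) / h\<^sup>2 - ((\<beta>1 x - p1 x / h) + (lg h x)\<^sup>2 + lg h x / x)\<bar> \<le> D + M"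
      using riccati_\<beta>[OF x(1)] by linarith
    have gx: "\<bar>g h x\<bar> \<le> exp T" using g_inner_bounds(1)[OF h, of x] x less_imp_le[OF g_pos, of h x] by (simp add: T_def)
    have "\<bar>f x\<bar> \<le> S" using x0m[of x] x by (simp add: S_def)
    then have "\<bar>g h x * f x * ((V x - E) / h\<^sup>2 - ((\<beta>1 x - p1 x / h) + (lg h x)\<^sup>2 + lg h x / x))\<bar> \<le> exp T * S * (D + M)"
      unfolding abs_mult using 1 gx S by (intro mult_mono) auto
    then have "\<bar>g h x * f x * ((V x - E) / h\<^sup>2 - ((\<beta>1 x - p1 x / h) + (lg h x)\<^sup>2 + lg h x / x))\<bar> * x \<le> B * x"
      unfolding B_def using x by (intro mult_right_mono) auto
    then show ?thesis unfolding w1_def using x by (simp add: abs_mult mult_ac)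
  qed
  have wb: "\<bar>w x\<bar> \<le> B * x\<^sup>2" if x: "0 \<le> x" "x \<le> sqrt h" for x
  proof -
    have "\<bar>w x - w 0\<bar> \<le> B * x\<^sup>2 / 2 - B * 0\<^sup>2 / 2"
    proof (rule abs_diff_le_by_derivs[OF x(1), where f' = w1 and G' = "\<lambda>x. B * x"])
      show "continuous_on {0..x} w" by (rule continuous_on_subset[OF cw]) auto
    qed (use x in \<open>auto intro!: derivative_eq_intros continuous_intros dw w1b\<close>)
    moreover have "B * x\<^sup>2 \<ge> 0" using B0 by simp
    ultimately show ?thesis by (simp add: w_def)
  qed
  define q where "q = (\<lambda>x. f x / g h x)"
  have dq: "(q has_real_derivative w x / (x * (g h x)\<^sup>2)) (at x)" if x: "x > 0" for x
  proof -
    have gn: "g h x \<noteq> 0" by simp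
    have "(q has_real_derivative (f1 x * g h x - f x * (g h x * lg h x)) / (g h x * g h x)) (at x)"
      unfolding q_def by (rule DERIV_divide[OF df(1) g_deriv[OF x] gn])
    moreover have "(f1 x * g h x - f x * (g h x * lg h x)) / (g h x * g h x) = w x / (x * (g h x)\<^sup>2)"
      using x gn by (simp add: w_def field_simps power2_eq_square)
    ultimately show ?thesis by simp
  qed
  have qb: "\<bar>w x / (x * (g h x)\<^sup>2)\<bar> \<le> N * S * x" if x: "0 < x" "x < sqrt h" for x
  proof -
    have gl: "exp (- T) \<le> g h x" using g_inner_bounds(2)[OF h, of x] x by (simp add: T_def)
    have "\<bar>w x / (x * (g h x)\<^sup>2)\<bar> = \<bar>w x\<bar> / (x * (g h x)\<^sup>2)" using x by (simp add: abs_mult)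
    also have "\<dots> \<le> (B * x\<^sup>2) / (x * (exp (- T))\<^sup>2)"
    proof (rule frac_le)
      show "x * (exp (- T))\<^sup>2 \<le> x * (g h x)\<^sup>2" using gl x by (intro mult_left_mono power_mono) auto
    qed (use wb[of x] x B0 in auto)
    also have "\<dots> = B * x * (exp T)\<^sup>2" using x by (simp add: exp_minus field_simps power2_eq_square)
    also have "\<dots> = N * S * x"
    proof -
      have "exp (3 * T) = exp T * exp T * exp T" by (simp add: exp_add[symmetric])
      then show ?thesis unfolding B_def N(1) T_def[symmetric] by (simp add: power2_eq_square)
    qed
    finally show ?thesis .
  qed
  have N0: "N \<ge> 0" using D0 M_pos by (simp add: N(1))
  have cq: "continuous_on {0..} q" unfolding q_def
    by (intro continuous_intros cf g_cont) auto
  have qd: "\<bar>q x - f 0\<bar> \<le> N * S * h" if x: "0 \<le> x" "x \<le> sqrt h" for x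
  proof -
    have "\<bar>q x - q 0\<bar> \<le> N * S * x\<^sup>2 / 2 - N * S * 0\<^sup>2 / 2"
    proof (rule abs_diff_le_by_derivs[OF x(1), where f' = "\<lambda>x. w x / (x * (g h x)\<^sup>2)" and G' = "\<lambda>x. N * S * x"])
      show "continuous_on {0..x} q" by (rule continuous_on_subset[OF cq]) auto
      show "\<bar>w t / (t * (g h t)\<^sup>2)\<bar> \<le> N * S * t" if "0 < t" "t < x" for t
        by (rule qb) (use that x in auto)
    qed (use x in \<open>auto intro!: derivative_eq_intros continuous_intros dq\<close>)
    moreover have "x\<^sup>2 \<le> h" using x h by (metis real_sqrt_pow2 less_imp_le power_mono)
    then have "N * S * x\<^sup>2 \<le> N * S * h" using N0 S by (intro mult_left_mono) auto
    moreover have "N * S * h \<ge> 0" using N0 S h by simp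
    ultimately show ?thesis by (simp add: q_def)
  qed
  \<comment> \<open>Where |f| is maximal, f/g is at least S e^(-T); the smallness of N h limits the
    variation of f/g to half of that. So f(0) is comparable with the maximum S, which turns the
    error into a relative one.\<close>
  have "\<bar>q x0\<bar> \<ge> S * exp (- T)"
  proof -
    have "g h x0 \<le> exp T" using g_inner_bounds(1)[OF h, of x0] x0 by (simp add: T_def)
    then have "S / exp T \<le> S / g h x0" using S by (intro divide_left_mono) auto
    then show ?thesis using less_imp_le[OF g_pos, of h x0] by (simp add: q_def S_def exp_minus field_simps)
  qed
  moreover have "N * S * h \<le> S * exp (- T) / 2" using mult_left_mono[OF N(2), of S] S by (simp add: T_def algebra_simps)
  ultimately have f0: "\<bar>f 0\<bar> \<ge> S * exp (- T) / 2" using qd[of x0] x0 by auto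
  have Sp: "S * exp (- T) / 2 > 0" using S by simp
  then have f0p: "\<bar>f 0\<bar> > 0" using f0 by linarith
  have "f r / (f 0 * g h r) - 1 = (q r - f 0) / f 0" using f0p by (simp add: q_def field_simps)
  then have "\<bar>f r / (f 0 * g h r) - 1\<bar> = \<bar>q r - f 0\<bar> / \<bar>f 0\<bar>" by simp
  also have "\<dots> \<le> (N * S * h) / (S * exp (- T) / 2)"
    by (rule frac_le) (use qd[OF r] f0 Sp N0 S h in auto)
  also have "\<dots> = 2 * N * exp T * h" using S by (simp add: exp_minus field_simps)
  finally show ?thesis using f0p by (simp add: T_def)
qed

text \<open>No sign of f is known in advance. \<open>eigenvalue_lower\<close> and the assumed upper
  bound pin E to 2 \<omega> h + O(h^2), which is what both comparisons need. The outer one excludes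
  zeros beyond sqrt h, the inner one excludes zeros up to sqrt h, and positivity of f / f(0)
  results.\<close>

theorem eigenfunction_asymptotics:
  "\<exists>N > 0. \<exists>h0 > 0. \<forall>h E f f1 f2. 0 < h \<and> h < h0 \<and> eigenfunction h E f f1 f2 \<and> E \<le> 2 * \<omega> * h + K1 * h\<^sup>2 \<longrightarrow>
     \<bar>E - 2 * \<omega> * h\<bar> \<le> N * h\<^sup>2 \<and> f 0 \<noteq> 0 \<and> (\<forall>r \<ge> 0. f r / f 0 > 0) \<and>
     (\<forall>r. 0 \<le> r \<and> r \<le> sqrt h \<longrightarrow> \<bar>f r / (f 0 * g h r) - 1\<bar> \<le> N * h) \<and>
     (\<forall>r > sqrt h. \<bar>f1 r / f r - lg h r\<bar> \<le> N * h / r)"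
proof -
  define D where "D = M + \<bar>K1\<bar>"
  define \<tau> where "\<tau> = (M + D) / c"
  define N0 where "N0 = (M + D) * exp (3 * (sqrt K + M))"
  define N where "N = 2 * N0 * exp (sqrt K + M) + \<tau> + D"
  have D: "D > 0" using M_pos by (simp add: D_def)
  have \<tau>: "\<tau> > 0" using M_pos D c_pos by (simp add: \<tau>_def)
  have N0: "N0 > 0" using M_pos D by (simp add: N0_def)
  have N: "N > 0" unfolding N_def using N0 \<tau> D by (simp add: add_pos_pos)
  \<comment> \<open>In order: h <= 1 for the inner region; 2 M h <= c; the two conditions on \<tau>
    and h in \<open>eigenfunction_outer\<close>; the smallness condition of
    \<open>eigenfunction_inner\<close>; and N h < 1, which makes f / (f(0) g) positive.\<close>
  define h0 where "h0 = min 1 (min (c / (2 * M)) (min (\<tau> * c / (2 * \<tau> * M + \<tau>\<^sup>2)) (min (1 / \<tau>) (min (exp (- (sqrt K + M)) / 2 / N0) (1 / N)))))"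
  have h0: "h0 > 0" unfolding h0_def min_less_iff_conj using M_pos c_pos \<tau> N0 N
    by (intro conjI divide_pos_pos mult_pos_pos add_pos_pos) auto
  show ?thesis
  proof (rule exI[of _ N], rule conjI[OF N], rule exI[of _ h0], rule conjI[OF h0], intro conjI allI impI)
    fix h E f f1 f2
    assume "0 < h \<and> h < h0 \<and> eigenfunction h E f f1 f2 \<and> E \<le> 2 * \<omega> * h + K1 * h\<^sup>2"
    then have h: "0 < h" "h < h0" and ef0: "eigenfunction h E f f1 f2" and E1: "E \<le> 2 * \<omega> * h + K1 * h\<^sup>2" by auto
    have hs: "h < 1" "h < c / (2 * M)" "h < \<tau> * c / (2 * \<tau> * M + \<tau>\<^sup>2)" "h < 1 / \<tau>" "h < exp (- (sqrt K + M)) / 2 / N0" "h < 1 / N"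
      using h(2) unfolding h0_def min_less_iff_conj by auto
    have h2: "2 * M * h \<le> c" using hs(2) M_pos by (simp add: field_simps)
    have h3: "2 * \<tau> * h * M + \<tau>\<^sup>2 * h \<le> \<tau> * c"
    proof -
      have "2 * \<tau> * M + \<tau>\<^sup>2 > 0" using \<tau> M_pos by (simp add: add_pos_pos)
      then show ?thesis using hs(3) by (simp add: pos_less_divide_eq algebra_simps)
    qed
    have h4: "\<tau> * h \<le> 1" using hs(4) \<tau> by (simp add: field_simps)
    have h5: "N0 * h \<le> exp (- (sqrt K + M)) / 2" using hs(5) N0 by (simp add: field_simps)
    have h6: "N * h < 1" using hs(6) N by (simp add: field_simps)
    obtain \<sigma> C R where \<sigma>: "\<sigma> \<in> {1, -1::real}" and C: "C \<ge> 0" and R: "R > 0"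
      and dec: "\<And>r. r \<ge> R \<Longrightarrow> \<sigma> * f r > 0 \<and> \<bar>f r\<bar> \<le> C \<and> \<bar>r * f1 r\<bar> \<le> C"
      using eigenfunction_decay[OF h(1) ef0] by blast
    define F where "F = (\<lambda>r. \<sigma> * f r)"
    define F1 where "F1 = (\<lambda>r. \<sigma> * f1 r)"
    define F2 where "F2 = (\<lambda>r. \<sigma> * f2 r)"
    have s2: "\<sigma>\<^sup>2 = 1" "\<bar>\<sigma>\<bar> = 1" "\<sigma> \<noteq> 0" using \<sigma> by auto
    have ef: "eigenfunction h E F F1 F2"
    proof -
      have "\<sigma> * f2 r + \<sigma> * f1 r / r = (V r - E) / h\<^sup>2 * (\<sigma> * f r)" if "f2 r + f1 r / r = (V r - E) / h\<^sup>2 * f r" for r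
      proof -
        have "\<sigma> * (f2 r + f1 r / r) = \<sigma> * ((V r - E) / h\<^sup>2 * f r)" using that by simp
        then show ?thesis by (simp add: algebra_simps)
      qed
      then show ?thesis using ef0 s2 unfolding eigenfunction_def F_def F1_def F2_def
        by (auto intro!: DERIV_cmult simp: power_mult_distrib)
    qed
    have b: "\<And>r. r \<ge> R \<Longrightarrow> \<bar>F r\<bar> \<le> C" "\<And>r. r \<ge> R \<Longrightarrow> \<bar>r * F1 r\<bar> \<le> C"
      using dec s2 by (auto simp: F_def F1_def abs_mult)
    have dF: "\<And>r. (F has_real_derivative F1 r) (at r)" using ef by (auto simp: eigenfunction_def)
    have cF: "continuous_on A F" for A
      using dF by (auto intro!: continuous_at_imp_continuous_on DERIV_isCont)
    have Fp: "F r > 0" if "r \<ge> R" for r using dec[OF that] by (simp add: F_def)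
    obtain r1 where r1: "r1 \<ge> 0" "\<And>r. r > r1 \<Longrightarrow> F r > 0" "r1 = 0 \<or> F r1 = 0"
      using last_zero_exists[OF cF Fp R] by blast
    have El: "2 * \<omega> * h - M * h\<^sup>2 \<le> E"
      by (rule eigenvalue_lower[OF h(1) h2 ef C b r1])
    have E: "\<bar>E - 2 * \<omega> * h\<bar> \<le> D * h\<^sup>2"
    proof -
      have "M * h\<^sup>2 \<le> D * h\<^sup>2" "K1 * h\<^sup>2 \<le> D * h\<^sup>2"
        using M_pos by (auto intro!: mult_right_mono simp: D_def)
      then show ?thesis using El E1 by (simp add: abs_le_iff)
    qed
    have \<tau>c: "M + D \<le> \<tau> * c" using c_pos by (simp add: \<tau>_def)
    have sh: "sqrt h > 0" using h by simp
    \<comment> \<open>Otherwise the outer estimate holds all the way down to the zero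
      \<open>r1\<close> and keeps f'/f below some \<Lambda> just to its right; then f e^(-\<Lambda>
      r) decreases from the value 0, against f > 0.\<close>
    have r1s: "r1 < sqrt h"
    proof (rule ccontr)
      assume "\<not> r1 < sqrt h"
      then have r1h: "r1 \<ge> sqrt h" by simp
      then have r10: "r1 > 0" using sh by linarith
      then have F0: "F r1 = 0" using r1(3) by simp
      have "continuous_on {r1..r1+1} (\<lambda>r. lg h r + \<tau> * h / r)"
        by (intro continuous_intros continuous_on_subset[OF lg_cont]) (use r10 in auto)
      then have "bounded ((\<lambda>r. lg h r + \<tau> * h / r) ` {r1..r1+1})"
        by (intro compact_imp_bounded compact_continuous_image) auto
      then obtain \<Lambda> where "\<forall>y \<in> (\<lambda>r. lg h r + \<tau> * h / r) ` {r1..r1+1}. norm y \<le> \<Lambda>"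
        unfolding bounded_iff by blast
      then have \<Lambda>: "\<bar>lg h r + \<tau> * h / r\<bar> \<le> \<Lambda>" if "r \<in> {r1..r1+1}" for r
        using that by auto
      have "(\<lambda>r. F r * exp (- \<Lambda> * r)) (r1 + 1) \<le> (\<lambda>r. F r * exp (- \<Lambda> * r)) r1"
      proof (rule DERIV_nonpos_imp_decreasing_open[where f = "\<lambda>r. F r * exp (- \<Lambda> * r)"])
        fix x assume x: "r1 < x" "x < r1 + 1"
        have "((\<lambda>r. F r * exp (- \<Lambda> * r)) has_real_derivative (F1 x - \<Lambda> * F x) * exp (- \<Lambda> * x)) (at x)"
          using dF[of x] by (auto intro!: derivative_eq_intros simp: algebra_simps)
        moreover have "F1 x / F x - lg h x \<le> \<tau> * h / x"
          using eigenfunction_outer[OF h(1) h2 ef C b E \<tau> \<tau>c h3 h4 r1h r1(2) x(1)] by (simp add: abs_le_iff)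
        then have "F1 x / F x \<le> \<Lambda>" using \<Lambda>[of x] x by auto
        then have "F1 x - \<Lambda> * F x \<le> 0" using r1(2)[OF x(1)] by (simp add: pos_divide_le_eq)
        ultimately show "\<exists>y. ((\<lambda>r. F r * exp (- \<Lambda> * r)) has_real_derivative y) (at x) \<and> y \<le> 0"
          by (intro exI[of _ "(F1 x - \<Lambda> * F x) * exp (- \<Lambda> * x)"]) (auto simp: mult_le_0_iff)
      qed (auto intro!: continuous_intros cF)
      then have "F (r1 + 1) \<le> 0" using F0 by (simp add: mult_le_0_iff)
      then show False using r1(2)[of "r1 + 1"] by simp
    qed
    have Fs: "F (sqrt h) > 0" using r1(2)[OF r1s] .
    have inner: "F 0 \<noteq> 0 \<and> \<bar>F r / (F 0 * g h r) - 1\<bar> \<le> 2 * N0 * exp (sqrt K + M) * h" if "0 \<le> r" "r \<le> sqrt h" for r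
      by (rule eigenfunction_inner[OF h(1) _ ef E _ N0_def h5 that]) (use hs Fs in auto)
    have inner': "\<bar>F r / (F 0 * g h r) - 1\<bar> \<le> N * h" if "0 \<le> r" "r \<le> sqrt h" for r
    proof -
      have "2 * N0 * exp (sqrt K + M) * h \<le> N * h" using h \<tau> D by (intro mult_right_mono) (auto simp: N_def)
      then show ?thesis using inner[OF that] by linarith
    qed
    have rat: "F r / (F 0 * g h r) > 0" if "0 \<le> r" "r \<le> sqrt h" for r
      using inner'[OF that] h6 by linarith
    have "0 < F (sqrt h) / (F 0 * g h (sqrt h))" by (rule rat) (use sh in auto)
    then have "0 < F 0 * g h (sqrt h)" unfolding zero_less_divide_iff using Fs by (auto simp del: zero_less_mult_iff)
    then have F0: "F 0 > 0" by (rule zero_less_mult_pos2) simp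
    have Fpos: "F r > 0" if "r \<ge> 0" for r
    proof (cases "r \<le> sqrt h")
      case True
      have "F 0 * g h r > 0" using F0 by (intro mult_pos_pos) auto
      then show ?thesis using rat[OF that True] zero_less_divide_iff[of "F r" "F 0 * g h r"] by linarith
    next
      case False
      then show ?thesis using r1(2)[of r] r1s by simp
    qed
    have fF: "f r / (f 0 * y) = F r / (F 0 * y)" "f r / f 0 = F r / F 0" "f1 r / f r = F1 r / F r" for r y
      using s2 by (auto simp: F_def F1_def)
    show "f 0 \<noteq> 0" using F0 by (auto simp: F_def)
    show "\<bar>E - 2 * \<omega> * h\<bar> \<le> N * h\<^sup>2"
    proof -
      have "D * h\<^sup>2 \<le> N * h\<^sup>2" using N0 \<tau> by (intro mult_right_mono) (auto simp: N_def)
      then show ?thesis using E by linarith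
    qed
    show "f r / f 0 > 0" if "r \<ge> 0" for r unfolding fF using Fpos[OF that] F0 by simp
    show "\<bar>f r / (f 0 * g h r) - 1\<bar> \<le> N * h" if "0 \<le> r \<and> r \<le> sqrt h" for r
      unfolding fF using inner' that by simp
    show "\<bar>f1 r / f r - lg h r\<bar> \<le> N * h / r" if r: "r > sqrt h" for r
    proof -
      have r0: "r > 0" using r sh by linarith
      have Fp': "F r > 0" if "r > sqrt h" for r by (rule Fpos) (use that sh in linarith)
      have "\<bar>F1 r / F r - lg h r\<bar> \<le> \<tau> * h / r"
        by (rule eigenfunction_outer[OF h(1) h2 ef C b E \<tau> \<tau>c h3 h4 order_refl Fp' r])
      moreover have "\<tau> * h / r \<le> N * h / r" using N0 D h r0 by (intro divide_right_mono mult_right_mono) (auto simp: N_def)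
      ultimately show ?thesis unfolding fF by linarith
    qed
  qed
qed

end

subsection \<open>Normalization\<close>

lemma abs_ln_le:
  fixes x :: real assumes "\<bar>x - 1\<bar> \<le> \<delta>" "\<delta> \<le> 1 / 2" shows "x > 0" "\<bar>ln x\<bar> \<le> 2 * \<delta>"
proof -
  show x: "x > 0" using assms by linarith
  have d: "\<delta> \<ge> 0" using assms(1) by linarith
  have "ln x \<le> x - 1" by (rule ln_le_minus_one[OF x])
  then have 1: "ln x \<le> 2 * \<delta>" using assms d by linarith
  have "ln (1 / x) \<le> 1 / x - 1" using x by (intro ln_le_minus_one) simp
  then have "- ln x \<le> (1 - x) / x" using x by (simp add: ln_div field_simps)
  also have "\<dots> \<le> \<delta> / (1 / 2)"
    using assms d x by (intro frac_le) (auto simp: abs_le_iff)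
  finally show "\<bar>ln x\<bar> \<le> 2 * \<delta>" using 1 by (simp add: abs_le_iff)
qed

lemma eventually_small_at_right:
  fixes N e :: real
  assumes "e > 0"
  shows "\<forall>\<^sub>F h in at_right (0::real). h > 0 \<and> N * h \<le> e"
proof -
  have "((\<lambda>h. N * h) \<longlongrightarrow> N * 0) (at_right 0)" by (intro tendsto_intros)
  then have "\<forall>\<^sub>F h in at_right 0. N * h < e" using assms by (intro order_tendstoD(2)[of _ 0]) auto
  then show ?thesis using eventually_at_right_less[of "0::real"] by eventually_elim auto
qed

context well_potential begin

definition wkb :: "real \<Rightarrow> real \<Rightarrow> (real \<Rightarrow> real) \<Rightarrow> (real \<Rightarrow> real) \<Rightarrow> bool" where
  "wkb N h f f1 \<longleftrightarrow> (\<forall>r. (f has_real_derivative f1 r) (at r)) \<and> f 0 \<noteq> 0 \<and> (\<forall>r \<ge> 0. f r / f 0 > 0) \<and>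
     (\<forall>r. 0 \<le> r \<and> r \<le> sqrt h \<longrightarrow> \<bar>f r / (f 0 * g h r) - 1\<bar> \<le> N * h) \<and>
     (\<forall>r > sqrt h. \<bar>f1 r / f r - lg h r\<bar> \<le> N * h / r)"

text \<open>The inner estimate gives the logarithm up to sqrt h; beyond, the bound N h / r on the
  difference of logarithmic derivatives is integrated and produces the logarithmic term. For fixed r
  it is of order h ln(1/h) and vanishes in the limit.\<close>

lemma wkb_ratio:
  assumes w: "wkb N h f f1" and h: "h > 0" and N: "N > 0" "2 * N * h \<le> 1" and r: "r \<ge> 0"
  shows "\<bar>ln (f r / (f 0 * g h r))\<bar> \<le> 2 * (N * h) + N * h * max 0 (ln (r / sqrt h))"
proof -
  have df: "\<And>r. (f has_real_derivative f1 r) (at r)" and f0: "f 0 \<noteq> 0" and pos: "\<And>r. r \<ge> 0 \<Longrightarrow> f r / f 0 > 0"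
    and inn: "\<And>r. 0 \<le> r \<Longrightarrow> r \<le> sqrt h \<Longrightarrow> \<bar>f r / (f 0 * g h r) - 1\<bar> \<le> N * h"
    and out: "\<And>r. r > sqrt h \<Longrightarrow> \<bar>f1 r / f r - lg h r\<bar> \<le> N * h / r"
    using w by (auto simp: wkb_def)
  have sh: "sqrt h > 0" using h by simp
  have in2: "\<bar>ln (f r / (f 0 * g h r))\<bar> \<le> 2 * (N * h)" if "0 \<le> r" "r \<le> sqrt h" for r
    by (rule abs_ln_le(2)[OF inn[OF that]]) (use N in simp)
  show ?thesis
  proof (cases "r \<le> sqrt h")
    case True
    moreover have "N * h * max 0 (ln (r / sqrt h)) \<ge> 0" using N h by simp
    ultimately show ?thesis using in2[OF r True] by linarith
  next
    case False
    define \<Lambda> where "\<Lambda> = (\<lambda>r. ln (f r / f 0) - (\<B> r - \<Phi> r / h))"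
    have lam: "ln (f r / (f 0 * g h r)) = \<Lambda> r" if "r \<ge> 0" for r
    proof -
      have "f r / (f 0 * g h r) = (f r / f 0) / g h r" by simp
      moreover have "ln ((f r / f 0) / g h r) = ln (f r / f 0) - ln (g h r)"
        using ln_divide_pos[OF pos[OF that] g_pos] .
      ultimately show ?thesis by (simp only: \<Lambda>_def g_def ln_exp)
    qed
    have fr: "f r \<noteq> 0" if "r \<ge> 0" for r using pos[OF that] by auto
    have dL: "(\<Lambda> has_real_derivative f1 x / f x - lg h x) (at x)" if "x > 0" for x
    proof -
      have "((\<lambda>r. f r / f 0) has_real_derivative f1 x / f 0) (at x)" by (rule DERIV_cdivide[OF df])
      from DERIV_chain2[where f = ln, OF DERIV_ln_divide[OF pos[of x]] this] that
      have "((\<lambda>r. ln (f r / f 0)) has_real_derivative 1 / (f x / f 0) * (f1 x / f 0)) (at x)" by simp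
      then have "((\<lambda>r. ln (f r / f 0)) has_real_derivative f1 x / f x) (at x)" using f0 by simp
      from DERIV_diff[OF this DERIV_diff[OF \<B>_deriv[OF that] DERIV_cdivide[OF \<Phi>_deriv[OF that], of h]]]
      show ?thesis by (simp add: \<Lambda>_def[abs_def] lg_def)
    qed
    have rs: "sqrt h \<le> r" using False by simp
    have "\<bar>\<Lambda> r - \<Lambda> (sqrt h)\<bar> \<le> N * h * ln r - N * h * ln (sqrt h)"
    proof (rule abs_diff_le_by_derivs[OF rs, where f' = "\<lambda>x. f1 x / f x - lg h x" and G' = "\<lambda>x. N * h * (1 / x)"])
      show "continuous_on {sqrt h..r} \<Lambda>"
        by (rule continuous_at_imp_continuous_on, rule ballI, rule DERIV_isCont, rule dL)
          (metis atLeastAtMost_iff less_le_trans sh)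
      show "continuous_on {sqrt h..r} (\<lambda>x. N * h * ln x)" using sh by (auto intro!: continuous_intros)
      show "((\<lambda>x. N * h * ln x) has_real_derivative N * h * (1 / x)) (at x)" if "sqrt h < x" for x
        using that sh by (intro DERIV_cmult DERIV_ln_divide) linarith
      show "\<bar>f1 x / f x - lg h x\<bar> \<le> N * h * (1 / x)" if "sqrt h < x" for x using out[OF that] by simp
      show "(\<Lambda> has_real_derivative f1 x / f x - lg h x) (at x)" if "sqrt h < x" for x
        by (rule dL) (use that sh in linarith)
    qed
    also have "\<dots> = N * h * ln (r / sqrt h)"
      unfolding ln_divide_pos[OF less_le_trans[OF sh rs] sh] by (simp only: right_diff_distrib)
    also have "\<dots> \<le> N * h * max 0 (ln (r / sqrt h))" using N h by (intro mult_left_mono) auto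
    finally have "\<bar>\<Lambda> r - \<Lambda> (sqrt h)\<bar> \<le> N * h * max 0 (ln (r / sqrt h))" .
    moreover have "\<bar>\<Lambda> (sqrt h)\<bar> \<le> 2 * (N * h)" using in2[of "sqrt h"] lam[of "sqrt h"] sh by simp
    ultimately show ?thesis using lam[OF r] by linarith
  qed
qed

section \<open>Limits of the profile for fixed radius and on the scale sqrt h\<close>

lemma wkb_tendsto:
  assumes w: "\<forall>\<^sub>F h in at_right 0. wkb N h (f h) (f1 h)" and N: "N > 0" and r: "r > 0"
  shows "((\<lambda>h. f h r / (f h 0 * g h r)) \<longlongrightarrow> 1) (at_right 0)"
    and "((\<lambda>h. h * (f1 h r / f h r)) \<longlongrightarrow> - p r) (at_right 0)"
    and "\<forall>\<^sub>F h in at_right 0. f h r \<noteq> 0"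
proof -
  have ev: "\<forall>\<^sub>F h in at_right 0. wkb N h (f h) (f1 h) \<and> h > 0 \<and> 2 * N * h \<le> 1"
    using w eventually_small_at_right[OF zero_less_one, of "2 * N"] by eventually_elim auto
  have l0: "((\<lambda>h. ln (f h r / (f h 0 * g h r))) \<longlongrightarrow> 0) (at_right 0)"
  proof (rule Lim_null_comparison)
    show "\<forall>\<^sub>F h in at_right 0. norm (ln (f h r / (f h 0 * g h r))) \<le> 2 * (N * h) + N * h * max 0 (ln (r / sqrt h))"
      using ev by eventually_elim (use wkb_ratio N r in auto)
    have "((\<lambda>h. h * ln (r / sqrt h)) \<longlongrightarrow> 0) (at_right 0)" using r by real_asymp
    then have "((\<lambda>h. 2 * (N * h) + N * (max 0 (h * ln (r / sqrt h)))) \<longlongrightarrow> 2 * (N * 0) + N * (max 0 0)) (at_right 0)"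
      by (intro tendsto_intros) auto
    then have "((\<lambda>h. 2 * (N * h) + N * (max 0 (h * ln (r / sqrt h)))) \<longlongrightarrow> 0) (at_right 0)" by simp
    then show "((\<lambda>h. 2 * (N * h) + N * h * max 0 (ln (r / sqrt h))) \<longlongrightarrow> 0) (at_right 0)"
    proof (rule Lim_transform_eventually)
      show "\<forall>\<^sub>F h in at_right 0. 2 * (N * h) + N * max 0 (h * ln (r / sqrt h)) = 2 * (N * h) + N * h * max 0 (ln (r / sqrt h))"
        using eventually_at_right_less[of "0::real"] by eventually_elim (simp add: max_def zero_le_mult_iff)
    qed
  qed
  have "((\<lambda>h. exp (ln (f h r / (f h 0 * g h r)))) \<longlongrightarrow> exp 0) (at_right 0)" by (intro tendsto_intros l0)
  then have "((\<lambda>h. exp (ln (f h r / (f h 0 * g h r)))) \<longlongrightarrow> 1) (at_right 0)" by simp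
  then show "((\<lambda>h. f h r / (f h 0 * g h r)) \<longlongrightarrow> 1) (at_right 0)"
  proof (rule Lim_transform_eventually)
    show "\<forall>\<^sub>F h in at_right 0. exp (ln (f h r / (f h 0 * g h r))) = f h r / (f h 0 * g h r)"
      using ev
    proof eventually_elim
      case (elim h)
      have "f h r / f h 0 > 0" using elim r by (auto simp: wkb_def)
      then have "(f h r / f h 0) / g h r > 0" by (rule divide_pos_pos) simp
      then show ?case by simp
    qed
  qed
  show "\<forall>\<^sub>F h in at_right 0. f h r \<noteq> 0"
    using ev
  proof eventually_elim
    case (elim h)
    have "f h r / f h 0 > 0" using elim r by (auto simp: wkb_def)
    then show ?case by auto
  qed
  have "((\<lambda>h. h * (f1 h r / f h r) - (h * \<beta> r - p r)) \<longlongrightarrow> 0) (at_right 0)"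
  proof (rule Lim_null_comparison)
    have "((\<lambda>h. sqrt h) \<longlongrightarrow> sqrt 0) (at_right 0)" by (intro tendsto_intros)
    then have "\<forall>\<^sub>F h in at_right 0. sqrt h < r" using r by (intro order_tendstoD(2)[of _ 0]) auto
    with ev show "\<forall>\<^sub>F h in at_right 0. norm (h * (f1 h r / f h r) - (h * \<beta> r - p r)) \<le> N * h\<^sup>2 / r"
    proof eventually_elim
      case (elim h)
      have "h * (f1 h r / f h r) - (h * \<beta> r - p r) = h * (f1 h r / f h r - lg h r)" using elim by (simp add: lg_def field_simps)
      then have "norm (h * (f1 h r / f h r) - (h * \<beta> r - p r)) = h * \<bar>f1 h r / f h r - lg h r\<bar>" using elim by (simp add: abs_mult)
      also have "\<dots> \<le> h * (N * h / r)" using elim by (intro mult_left_mono) (auto simp: wkb_def)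
      finally show ?case by (simp add: power2_eq_square mult_ac)
    qed
    have "((\<lambda>h. N * h\<^sup>2 / r) \<longlongrightarrow> N * 0\<^sup>2 / r) (at_right 0)" using r by (intro tendsto_intros) auto
    then show "((\<lambda>h. N * h\<^sup>2 / r) \<longlongrightarrow> 0) (at_right 0)" by simp
  qed
  then have "((\<lambda>h. (h * (f1 h r / f h r) - (h * \<beta> r - p r)) + (h * \<beta> r - p r)) \<longlongrightarrow> 0 + (0 * \<beta> r - p r)) (at_right 0)"
    by (intro tendsto_intros)
  then show "((\<lambda>h. h * (f1 h r / f h r)) \<longlongrightarrow> - p r) (at_right 0)" by simp
qed

text \<open>The majorant for dominated convergence after r = sqrt(h s). With N h <= 1 the
  logarithmic error costs at most e^2 max(1, s) in the square, and g^2 supplies e^(-c s /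
  2).\<close>

lemma wkb_bound:
  assumes w: "wkb N h f f1" and h: "h > 0" "2 * M * h \<le> c" and N: "N > 0" "2 * N * h \<le> 1" and s: "s > 0"
  shows "(f (sqrt (h * s)) / f 0)\<^sup>2 \<le> exp 2 * ((1 + s) * exp (- (c / 2) * s))"
proof -
  define r where "r = sqrt (h * s)"
  have r: "r > 0" using h s by (simp add: r_def)
  have rs: "r / sqrt h = sqrt s" using h by (simp add: r_def real_sqrt_mult)
  have r2: "r\<^sup>2 = h * s" using h s by (simp add: r_def)
  define x where "x = f r / (f 0 * g h r)"
  have fp: "f r / f 0 > 0" using w r by (auto simp: wkb_def)
  then have "(f r / f 0) / g h r > 0" by (rule divide_pos_pos) simp
  then have xp: "x > 0" by (simp add: x_def)
  have Nh: "N * h \<ge> 0" "N * h \<le> 1" using N h by auto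
  have "\<bar>ln x\<bar> \<le> 2 * (N * h) + N * h * max 0 (ln (sqrt s))"
    using wkb_ratio[OF w h(1) N, of r] r unfolding x_def rs by simp
  also have "\<dots> \<le> 1 + 1 * max 0 (ln (sqrt s))" using N Nh by (intro add_mono mult_right_mono) auto
  finally have "ln x \<le> 1 + max 0 (ln (sqrt s))" by simp
  then have "exp (ln x) \<le> exp (1 + max 0 (ln (sqrt s)))" by simp
  then have "x \<le> exp (1 + max 0 (ln (sqrt s)))" using xp by simp
  then have "x\<^sup>2 \<le> (exp (1 + max 0 (ln (sqrt s))))\<^sup>2" using xp by (intro power_mono) auto
  also have "\<dots> = exp (2 + 2 * max 0 (ln (sqrt s)))" by (simp add: power2_eq_square mult_exp_exp algebra_simps)
  also have "\<dots> = exp 2 * exp (max 0 (ln s))" using s by (simp add: exp_add ln_sqrt max_def)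
  also have "exp (max 0 (ln s)) \<le> 1 + s" using s by (simp add: max_def)
  finally have x2: "x\<^sup>2 \<le> exp 2 * (1 + s)" by simp
  have "g h r \<le> exp (- (c / (4 * h)) * r\<^sup>2)" by (rule g_le[OF h]) (use r in simp)
  also have "- (c / (4 * h)) * r\<^sup>2 = - (c / 4) * s" unfolding r2 using h by simp
  finally have "(g h r)\<^sup>2 \<le> (exp (- (c / 4) * s))\<^sup>2" by (intro power_mono) (auto intro: less_imp_le)
  also have "\<dots> = exp (- (c / 2) * s)" by (simp add: power2_eq_square mult_exp_exp)
  finally have g2: "(g h r)\<^sup>2 \<le> exp (- (c / 2) * s)" .
  have "(f r / f 0)\<^sup>2 = x\<^sup>2 * (g h r)\<^sup>2" by (simp add: x_def power_divide power_mult_distrib)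
  also have "\<dots> \<le> (exp 2 * (1 + s)) * exp (- (c / 2) * s)" using x2 g2 s by (intro mult_mono) auto
  finally show ?thesis by (simp add: r_def mult.assoc)
qed

text \<open>On the scale r^2 = h s the amplitude exponent is O(h), and \<Phi> / h = \<omega> s / 2 +
  O(h) because \<Phi> has no term between orders two and four.\<close>

lemma g_scaling:
  assumes s: "s > 0"
  shows "((\<lambda>h. g h (sqrt (h * s))) \<longlongrightarrow> exp (- (\<omega> * s / 2))) (at_right 0)"
proof -
  have "((\<lambda>h. (\<B> (sqrt (h * s)) - \<Phi> (sqrt (h * s)) / h) + \<omega> * s / 2) \<longlongrightarrow> 0) (at_right 0)"
  proof (rule Lim_null_comparison)
    show "\<forall>\<^sub>F h in at_right 0. norm ((\<B> (sqrt (h * s)) - \<Phi> (sqrt (h * s)) / h) + \<omega> * s / 2) \<le> M * (h * s) / 2 + K / c * (h * s\<^sup>2)"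
      using eventually_at_right_less[of "0::real"]
    proof eventually_elim
      case (elim h)
      define r where "r = sqrt (h * s)"
      have r: "r \<ge> 0" "r\<^sup>2 = h * s" using elim s by (auto simp: r_def)
      have r4: "r ^ 4 = h\<^sup>2 * s\<^sup>2" using r(2) by (metis mult_2 numeral_Bit0 power_add power2_eq_square power_mult_distrib)
      have 1: "\<bar>\<B> r\<bar> \<le> M * (h * s) / 2" using \<B>_bound[OF r(1)] r by simp
      have "\<bar>\<Phi> r - \<omega> * (h * s) / 2\<bar> / h \<le> (K / c * (h\<^sup>2 * s\<^sup>2)) / h"
        using \<Phi>_taylor[OF r(1)] elim unfolding r4 r(2) by (intro divide_right_mono) auto
      then have "\<bar>(\<Phi> r - \<omega> * (h * s) / 2) / h\<bar> \<le> K / c * (h * s\<^sup>2)" using elim by (simp add: power2_eq_square)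
      moreover have "(\<Phi> r - \<omega> * (h * s) / 2) / h = \<Phi> r / h - \<omega> * s / 2" using elim by (simp add: field_simps)
      ultimately show ?case using 1 unfolding r_def[symmetric] real_norm_def by linarith
    qed
    have "((\<lambda>h. M * (h * s) / 2 + K / c * (h * s\<^sup>2)) \<longlongrightarrow> M * (0 * s) / 2 + K / c * (0 * s\<^sup>2)) (at_right 0)"
      using c_pos by (intro tendsto_intros) auto
    then show "((\<lambda>h. M * (h * s) / 2 + K / c * (h * s\<^sup>2)) \<longlongrightarrow> 0) (at_right 0)" by simp
  qed
  then have "((\<lambda>h. ((\<B> (sqrt (h * s)) - \<Phi> (sqrt (h * s)) / h) + \<omega> * s / 2) - \<omega> * s / 2) \<longlongrightarrow> 0 - \<omega> * s / 2) (at_right 0)"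
    by (intro tendsto_intros)
  then have "((\<lambda>h. \<B> (sqrt (h * s)) - \<Phi> (sqrt (h * s)) / h) \<longlongrightarrow> - (\<omega> * s / 2)) (at_right 0)" by simp
  then show ?thesis unfolding g_def by (intro tendsto_intros)
qed

lemma wkb_scaling:
  assumes w: "\<forall>\<^sub>F h in at_right 0. wkb N h (f h) (f1 h)" and N: "N > 0" and s: "s > 0"
  shows "((\<lambda>h. (f h (sqrt (h * s)) / f h 0)\<^sup>2) \<longlongrightarrow> exp (- \<omega> * s)) (at_right 0)"
proof -
  have ev: "\<forall>\<^sub>F h in at_right 0. wkb N h (f h) (f1 h) \<and> h > 0 \<and> 2 * N * h \<le> 1"
    using w eventually_small_at_right[OF zero_less_one, of "2 * N"] by eventually_elim auto
  have l0: "((\<lambda>h. ln (f h (sqrt (h * s)) / (f h 0 * g h (sqrt (h * s))))) \<longlongrightarrow> 0) (at_right 0)"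
  proof (rule Lim_null_comparison)
    show "\<forall>\<^sub>F h in at_right 0. norm (ln (f h (sqrt (h * s)) / (f h 0 * g h (sqrt (h * s))))) \<le> 2 * (N * h) + N * h * max 0 (ln (sqrt s))"
      using ev
    proof eventually_elim
      case (elim h)
      have "sqrt (h * s) / sqrt h = sqrt s" using elim by (simp add: real_sqrt_mult)
      then show ?case using wkb_ratio[of N h "f h" "f1 h" "sqrt (h * s)"] elim N s by simp
    qed
    have "((\<lambda>h. 2 * (N * h) + N * h * max 0 (ln (sqrt s))) \<longlongrightarrow> 2 * (N * 0) + N * 0 * max 0 (ln (sqrt s))) (at_right 0)"
      by (intro tendsto_intros)
    then show "((\<lambda>h. 2 * (N * h) + N * h * max 0 (ln (sqrt s))) \<longlongrightarrow> 0) (at_right 0)" by simp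
  qed
  have "((\<lambda>h. (exp (ln (f h (sqrt (h * s)) / (f h 0 * g h (sqrt (h * s))))) * g h (sqrt (h * s)))\<^sup>2) \<longlongrightarrow> (exp 0 * exp (- (\<omega> * s / 2)))\<^sup>2) (at_right 0)"
    by (intro tendsto_intros l0 g_scaling[OF s])
  moreover have "(exp 0 * exp (- (\<omega> * s / 2)))\<^sup>2 = exp (- \<omega> * s)" by (simp add: power2_eq_square mult_exp_exp)
  ultimately have "((\<lambda>h. (exp (ln (f h (sqrt (h * s)) / (f h 0 * g h (sqrt (h * s))))) * g h (sqrt (h * s)))\<^sup>2) \<longlongrightarrow> exp (- \<omega> * s)) (at_right 0)" by simp
  then show ?thesis
  proof (rule Lim_transform_eventually)
    show "\<forall>\<^sub>F h in at_right 0. (exp (ln (f h (sqrt (h * s)) / (f h 0 * g h (sqrt (h * s))))) * g h (sqrt (h * s)))\<^sup>2 = (f h (sqrt (h * s)) / f h 0)\<^sup>2"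
      using ev
    proof eventually_elim
      case (elim h)
      have "f h (sqrt (h * s)) / f h 0 > 0" using elim s by (auto simp: wkb_def)
      then have "(f h (sqrt (h * s)) / f h 0) / g h (sqrt (h * s)) > 0" by (rule divide_pos_pos) simp
      then show ?case by simp
    qed
  qed
qed

text \<open>With r^2 = h s the normalisation says that pi h f(0)^2 times the integral of (f /
  f(0))^2 over s is 1; that integral tends to the integral of e^(-\<omega> s), which is
  1/\<omega>.\<close>

theorem normalization_limit:
  assumes meas: "\<And>h. f h \<in> borel_measurable borel"
    and w: "\<forall>\<^sub>F h in at_right 0. wkb N h (f h) (f1 h)" and N: "N > 0"
    and norm: "\<forall>\<^sub>F h in at_right 0. pi * (LINT s:{0..}|lborel. (f h (sqrt s))\<^sup>2) = 1"
  shows "((\<lambda>h. h * (f h 0)\<^sup>2) \<longlongrightarrow> \<omega> / pi) (at_right 0)"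
proof -
  define X where "X = (\<lambda>h s. indicator {0..} s *\<^sub>R (f h (sqrt (h * s)) / f h 0)\<^sup>2)"
  define b where "b = (\<lambda>s::real. exp 2 * (indicator {0..} s *\<^sub>R (s ^ 0 * exp (- (c / 2) * s)) + indicator {0..} s *\<^sub>R (s ^ 1 * exp (- (c / 2) * s))))"
  have ib: "integrable lborel b" unfolding b_def
    using integrable.intros[OF exp_moment[of "c / 2" 0]] integrable.intros[OF exp_moment[of "c / 2" 1]] c_pos
    by (intro integrable_mult_right Bochner_Integration.integrable_add) auto
  \<comment> \<open>Replacing h by 1/t turns this into a limit at infinity, the form in which
    dominated convergence is applied.\<close>
  have lim: "((\<lambda>h. LINT s|lborel. X h s) \<longlongrightarrow> (LINT s|lborel. indicator {0..} s *\<^sub>R (s ^ 0 * exp (- \<omega> * s)))) (at_right 0)"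
    unfolding filterlim_at_right_to_top
  proof (rule integral_dominated_convergence_at_top[where w = b])
    show "(\<lambda>s. indicator {0..} s *\<^sub>R (s ^ 0 * exp (- \<omega> * s))) \<in> borel_measurable lborel" by measurable
    show "X (inverse t) \<in> borel_measurable lborel" for t
      unfolding X_def using meas[of "inverse t"] by measurable
    have z: "AE s in lborel. s \<noteq> (0::real)" by (rule AE_lborel_singleton)
    show "AE s in lborel. ((\<lambda>t. X (inverse t) s) \<longlongrightarrow> indicator {0..} s *\<^sub>R (s ^ 0 * exp (- \<omega> * s))) at_top"
      using z
    proof eventually_elim
      case (elim s)
      show ?case
      proof (cases "s > 0")
        case True
        have "((\<lambda>h. X h s) \<longlongrightarrow> indicator {0..} s *\<^sub>R (s ^ 0 * exp (- \<omega> * s))) (at_right 0)"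
          using wkb_scaling[OF w N True] True by (simp add: X_def)
        then show ?thesis unfolding filterlim_at_right_to_top .
      next
        case False
        then have "s \<notin> {0..}" using elim by simp
        then show ?thesis by (simp add: X_def)
      qed
    qed
    have "\<forall>\<^sub>F h in at_right 0. AE s in lborel. norm (X h s) \<le> b s"
      using w eventually_small_at_right[OF zero_less_one, of "2 * N"] eventually_small_at_right[OF c_pos, of "2 * M"]
    proof eventually_elim
      case (elim h)
      show ?case using z
      proof eventually_elim
        case (elim s)
        show ?case
        proof (cases "s > 0")
          case True
          have "(f h (sqrt (h * s)) / f h 0)\<^sup>2 \<le> exp 2 * ((1 + s) * exp (- (c / 2) * s))"
            by (rule wkb_bound[of N h "f h" "f1 h"]) (use \<open>wkb N h (f h) (f1 h)\<close> \<open>h > 0 \<and> 2 * N * h \<le> 1\<close> \<open>h > 0 \<and> 2 * M * h \<le> c\<close> N True in auto)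
          then show ?thesis using True by (simp add: X_def b_def algebra_simps)
        next
          case False
          then have "s \<notin> {0..}" using elim by simp
          then show ?thesis by (simp add: X_def b_def)
        qed
      qed
    qed
    then show "\<forall>\<^sub>F t in at_top. AE s in lborel. norm (X (inverse t) s) \<le> b s"
      unfolding eventually_at_right_to_top .
  qed (rule ib)
  have "(LINT s|lborel. indicator {0..} s *\<^sub>R (s ^ 0 * exp (- \<omega> * s))) = 1 / \<omega>"
    using has_bochner_integral_integral_eq[OF exp_moment[OF omega_pos, of 0]] by simp
  then have lim': "((\<lambda>h. LINT s|lborel. X h s) \<longlongrightarrow> 1 / \<omega>) (at_right 0)" using lim by simp
  have "((\<lambda>h. 1 / (pi * (LINT s|lborel. X h s))) \<longlongrightarrow> 1 / (pi * (1 / \<omega>))) (at_right 0)"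
    using omega_pos by (intro tendsto_intros lim') auto
  then have "((\<lambda>h. 1 / (pi * (LINT s|lborel. X h s))) \<longlongrightarrow> \<omega> / pi) (at_right 0)" by simp
  then show ?thesis
  proof (rule Lim_transform_eventually)
    show "\<forall>\<^sub>F h in at_right 0. 1 / (pi * (LINT s|lborel. X h s)) = h * (f h 0)\<^sup>2"
      using w norm eventually_at_right_less[of "0::real"]
    proof eventually_elim
      case (elim h)
      have f0: "f h 0 \<noteq> 0" using elim by (simp add: wkb_def)
      have "(LINT s:{0..}|lborel. (f h (sqrt s))\<^sup>2) = (LINT s|lborel. indicator {0..} s *\<^sub>R (f h (sqrt s))\<^sup>2)"
        by (simp add: set_lebesgue_integral_def)
      also have "\<dots> = \<bar>h\<bar> *\<^sub>R (LINT s|lborel. indicator {0..} (0 + h * s) *\<^sub>R (f h (sqrt (0 + h * s)))\<^sup>2)"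
        by (rule lborel_integral_real_affine) (use elim in simp)
      also have "(\<lambda>s. indicator {0..} (0 + h * s) *\<^sub>R (f h (sqrt (0 + h * s)))\<^sup>2) = (\<lambda>s. X h s * (f h 0)\<^sup>2)"
        using elim f0 by (auto simp: fun_eq_iff X_def indicator_def power_divide zero_le_mult_iff)
      finally have "(LINT s:{0..}|lborel. (f h (sqrt s))\<^sup>2) = h * ((LINT s|lborel. X h s) * (f h 0)\<^sup>2)" using elim by simp
      then have "pi * (LINT s|lborel. X h s) * (h * (f h 0)\<^sup>2) = 1" using elim by (simp add: mult_ac)
      then show ?case by (metis nonzero_mult_div_cancel_left mult_eq_0_iff zero_neq_one)
    qed
  qed
qed

end

subsection \<open>The modified Bessel function of order zero\<close>

definition I0 :: "real \<Rightarrow> real" where "I0 x = integral {0..pi} (\<lambda>t. exp (x * cos t)) / pi"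
definition I1 :: "real \<Rightarrow> real" where "I1 x = integral {0..pi} (\<lambda>t. cos t * exp (x * cos t)) / pi"

lemma integral_exp_cos_deriv:
  "((\<lambda>x. integral {0..pi} (\<lambda>t. cos t ^ n * exp (x * cos t))) has_real_derivative
    integral {0..pi} (\<lambda>t. cos t ^ Suc n * exp (x * cos t))) (at x)"
proof -
  have "((\<lambda>x. integral (cbox 0 pi) (\<lambda>t. cos t ^ n * exp (x * cos t))) has_field_derivative
    integral (cbox 0 pi) (\<lambda>t. cos t ^ Suc n * exp (x * cos t))) (at x within UNIV)"
  proof (rule leibniz_rule_field_derivative)
    show "continuous_on (UNIV \<times> cbox 0 pi) (\<lambda>(x, t). cos t ^ Suc n * exp (x * cos t))"
      by (auto intro!: continuous_intros simp: split_beta)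
    show "(\<lambda>t. cos t ^ n * exp (x * cos t)) integrable_on cbox 0 pi" for x
      by (intro integrable_continuous continuous_intros)
  qed (auto intro!: derivative_eq_intros)
  then show ?thesis by simp
qed

lemma I0_deriv: "(I0 has_real_derivative I1 x) (at x)"
  using DERIV_cdivide[OF integral_exp_cos_deriv[of 0 x], of pi]
  by (simp add: I0_def[abs_def] I1_def)

text \<open>Bessel's equation in first-order form: the derivative of sin t e^(x cos t) integrates to
  0 over a half period, which expresses the integral with cos^2 through \<open>I0\<close> and
  \<open>I1\<close>.\<close>

lemma I1_deriv:
  assumes "x \<noteq> 0"
  shows "(I1 has_real_derivative I0 x - I1 x / x) (at x)"
proof -
  define J where "J = integral {0..pi} (\<lambda>t. (cos t)\<^sup>2 * exp (x * cos t))"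
  have d: "(I1 has_real_derivative J / pi) (at x)"
    using DERIV_cdivide[OF integral_exp_cos_deriv[of 1 x], of pi]
    by (simp add: I1_def[abs_def] J_def power2_eq_square)
  have "((\<lambda>t. cos t * exp (x * cos t) - x * (exp (x * cos t) - (cos t)\<^sup>2 * exp (x * cos t))) has_integral
      (sin pi * exp (x * cos pi) - sin 0 * exp (x * cos 0))) {0..pi}"
  proof (rule fundamental_theorem_of_calculus)
    fix t assume "t \<in> {0..pi}"
    have "((\<lambda>t. sin t * exp (x * cos t)) has_real_derivative
       cos t * exp (x * cos t) - x * (exp (x * cos t) - (cos t)\<^sup>2 * exp (x * cos t))) (at t)"
      by (rule derivative_eq_intros refl | simp)+
        (use sin_cos_squared_add[of t] in \<open>simp add: algebra_simps power2_eq_square, algebra\<close>)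
    then show "((\<lambda>t. sin t * exp (x * cos t)) has_vector_derivative
       cos t * exp (x * cos t) - x * (exp (x * cos t) - (cos t)\<^sup>2 * exp (x * cos t))) (at t within {0..pi})"
      by (simp add: has_real_derivative_iff_has_vector_derivative has_vector_derivative_at_within)
  qed simp
  then have "integral {0..pi} (\<lambda>t. cos t * exp (x * cos t) - x * (exp (x * cos t) - (cos t)\<^sup>2 * exp (x * cos t))) = 0"
    by (simp add: integral_unique)
  moreover have int: "(\<lambda>t. cos t * exp (x * cos t)) integrable_on {0..pi}" "(\<lambda>t. exp (x * cos t)) integrable_on {0..pi}"
      "(\<lambda>t. (cos t)\<^sup>2 * exp (x * cos t)) integrable_on {0..pi}"
    by (auto intro!: integrable_continuous_real continuous_intros)
  ultimately have "pi * I1 x - x * (pi * I0 x - J) = 0"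
    using int by (simp add: Henstock_Kurzweil_Integration.integral_diff integrable_diff integrable_on_mult_right I0_def I1_def J_def)
  then have "J / pi = I0 x - I1 x / x" using assms by (simp add: field_simps)
  then show ?thesis using d by simp
qed

lemma I0_zero [simp]: "I0 0 = 1" by (simp add: I0_def)

lemma I1_zero [simp]: "I1 0 = 0"
proof -
  have "(cos has_integral (sin pi - sin 0)) {0..pi}"
    by (rule fundamental_theorem_of_calculus)
      (auto intro!: derivative_eq_intros simp: has_real_derivative_iff_has_vector_derivative[symmetric])
  then have "integral {0..pi} cos = 0" by (simp add: integral_unique)
  moreover have "(\<lambda>t. cos t) = (cos :: real \<Rightarrow> real)" by auto
  ultimately show ?thesis by (simp add: I1_def)
qed

lemma I1_nonneg:
  assumes "x \<ge> 0" shows "I1 x \<ge> 0"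
proof -
  have "I1 0 \<le> I1 x"
  proof (rule DERIV_nonneg_imp_nondecreasing[OF assms])
    fix y
    have "(I1 has_real_derivative integral {0..pi} (\<lambda>t. cos t ^ 2 * exp (y * cos t)) / pi) (at y)"
      using DERIV_cdivide[OF integral_exp_cos_deriv[of 1 y], of pi]
      by (simp add: I1_def[abs_def] numeral_2_eq_2)
    moreover have "integral {0..pi} (\<lambda>t. cos t ^ 2 * exp (y * cos t)) \<ge> 0"
      by (intro Henstock_Kurzweil_Integration.integral_nonneg integrable_continuous_real continuous_intros) auto
    ultimately show "\<exists>D. (I1 has_real_derivative D) (at y) \<and> 0 \<le> D" by (meson divide_nonneg_pos pi_gt_zero)
  qed
  then show ?thesis by simp
qed

lemma I0_ge_1: "x \<ge> 0 \<Longrightarrow> I0 x \<ge> 1"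
proof -
  assume x: "x \<ge> 0"
  have "I0 0 \<le> I0 x"
    by (rule DERIV_nonneg_imp_nondecreasing[OF x]) (use I0_deriv I1_nonneg in blast)
  then show ?thesis by simp
qed

text \<open>Jordan's inequality for sin(t/2), from concavity of the sine. It supplies the Gaussian
  majorant in Laplace's method.\<close>

lemma one_minus_cos_ge:
  fixes t :: real assumes "0 \<le> t" "t \<le> pi"
  shows "2 * (t / pi)\<^sup>2 \<le> 1 - cos t"
proof -
  have "sin (t / 2) \<ge> t / pi"
  proof -
    have "convex_on {0..pi} (\<lambda>x. - sin x)"
      by (rule convex_on_realI[where f' = "\<lambda>x. - cos x"])
        (auto intro!: derivative_eq_intros cos_monotone_0_pi_le)
    then have "concave_on {0..pi} sin" by (simp add: concave_on_def)
    then have "(1 - t / pi) * sin 0 + t / pi * sin (pi / 2) \<le> sin ((1 - t / pi) *\<^sub>R 0 + (t / pi) *\<^sub>R (pi / 2))"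
      using assms by (intro concave_onD) auto
    then show ?thesis using pi_gt_zero by simp
  qed
  then have "(t / pi)\<^sup>2 \<le> (sin (t / 2))\<^sup>2" using assms by (intro power_mono) auto
  moreover have "1 - cos t = 2 * (sin (t / 2))\<^sup>2"
    using cos_double_sin[of "t / 2"] by simp
  ultimately show ?thesis by simp
qed

lemma half_gaussian:
  assumes "a > 0"
  shows "integrable lborel (\<lambda>t::real. indicator {0..} t * exp (- (a * t\<^sup>2)))"
    and "(LINT t|lborel. indicator {0..} t * exp (- (a * t\<^sup>2))) = sqrt pi / (2 * sqrt a)"
proof -
  have g: "has_bochner_integral lborel (\<lambda>x::real. indicator {0..} x *\<^sub>R exp (- x\<^sup>2)) (sqrt pi / 2)"
    by (rule gaussian_moment_0)
  have s: "sqrt a > 0" using assms by simp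
  have i: "indicator {0..} (sqrt a * t) = (indicator {0..} t :: real)" for t
    using s by (auto simp: indicator_def zero_le_mult_iff)
  have e: "indicator {0..} t * exp (- (a * t\<^sup>2)) = indicator {0..} (0 + sqrt a * t) *\<^sub>R exp (- (0 + sqrt a * t)\<^sup>2)" for t
    using assms by (simp add: i power_mult_distrib)
  have "integrable lborel (\<lambda>x::real. indicator {0..} x *\<^sub>R exp (- x\<^sup>2))" using g by (rule integrable.intros)
  then show "integrable lborel (\<lambda>t::real. indicator {0..} t * exp (- (a * t\<^sup>2)))"
    unfolding e using s lborel_integrable_real_affine[of "\<lambda>x::real. indicator {0..} x *\<^sub>R exp (- x\<^sup>2)" "sqrt a" 0] by simp
  have "(LINT x|lborel. indicator {0..} x *\<^sub>R exp (- x\<^sup>2)) = \<bar>sqrt a\<bar> *\<^sub>R (LINT t|lborel. indicator {0..} (0 + sqrt a * t) *\<^sub>R exp (- (0 + sqrt a * t)\<^sup>2))"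
    using s by (intro lborel_integral_real_affine) simp
  then show "(LINT t|lborel. indicator {0..} t * exp (- (a * t\<^sup>2))) = sqrt pi / (2 * sqrt a)"
    unfolding e[symmetric] has_bochner_integral_integral_eq[OF g] using s by (simp add: field_simps)
qed

text \<open>Laplace's method after the substitution \<open>t \<mapsto> t / sqrt x\<close>; only the existence and positivity of the limit matter.\<close>

lemma bessel_integral_limit:
  assumes "continuous_on UNIV k" "\<And>t. \<bar>k t\<bar> \<le> 1"
  shows "((\<lambda>x. sqrt x * exp (- x) * integral {0..pi} (\<lambda>t. k t * exp (x * cos t))) \<longlongrightarrow>
     k 0 * sqrt (pi / 2)) at_top"
proof -
  have km [measurable]: "k \<in> borel_measurable borel" using assms(1) by (rule borel_measurable_continuous_onI)
  define s where "s = (\<lambda>x t. indicator {0..pi * sqrt x} t * (k (t / sqrt x) * exp (- (x * (1 - cos (t / sqrt x))))))"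
  have eq: "sqrt x * exp (- x) * integral {0..pi} (\<lambda>t. k t * exp (x * cos t)) = (LINT t|lborel. s x t)" if x: "x > 0" for x
  proof -
    have c: "continuous_on {0..pi} (\<lambda>t. k t * exp (x * cos t))"
      by (intro continuous_intros continuous_on_subset[OF assms(1)]) auto
    have "integral {0..pi} (\<lambda>t. k t * exp (x * cos t)) = (LINT t:{0..pi}|lborel. k t * exp (x * cos t))"
      by (rule set_borel_integral_eq_integral(2)[symmetric]) (rule borel_integrable_atLeastAtMost'[OF c])
    also have "\<dots> = (LINT t|lborel. indicator {0..pi} t * (k t * exp (x * cos t)))"
      by (simp add: set_lebesgue_integral_def)
    also have "\<dots> = (1 / sqrt x) * (LINT t|lborel. indicator {0..pi} (t / sqrt x) * (k (t / sqrt x) * exp (x * cos (t / sqrt x))))"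
      using x by (subst lborel_integral_real_affine[where c = "1 / sqrt x" and t = 0]) auto
    finally have "sqrt x * exp (- x) * integral {0..pi} (\<lambda>t. k t * exp (x * cos t)) =
       exp (- x) * (LINT t|lborel. indicator {0..pi} (t / sqrt x) * (k (t / sqrt x) * exp (x * cos (t / sqrt x))))"
      using x by simp
    also have "\<dots> = (LINT t|lborel. exp (- x) * (indicator {0..pi} (t / sqrt x) * (k (t / sqrt x) * exp (x * cos (t / sqrt x)))))"
      by simp
    also have "\<dots> = (LINT t|lborel. s x t)"
    proof (rule Bochner_Integration.integral_cong)
      fix t :: real
      have "t / sqrt x \<in> {0..pi} \<longleftrightarrow> t \<in> {0..pi * sqrt x}"
        using x by (auto simp: field_simps)
      then have i: "indicator {0..pi} (t / sqrt x) = (indicator {0..pi * sqrt x} t :: real)" by (auto simp: indicator_def)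
      have e: "exp (- x) * exp (x * cos (t / sqrt x)) = exp (- (x * (1 - cos (t / sqrt x))))"
        by (simp add: mult_exp_exp algebra_simps)
      show "exp (- x) * (indicator {0..pi} (t / sqrt x) * (k (t / sqrt x) * exp (x * cos (t / sqrt x)))) = s x t"
        by (simp only: s_def i e[symmetric] mult_ac)
    qed simp
    finally show ?thesis .
  qed
  have "((\<lambda>x. LINT t|lborel. s x t) \<longlongrightarrow> (LINT t|lborel. indicator {0..} t * (k 0 * exp (- (t\<^sup>2 / 2))))) at_top"
  proof (rule integral_dominated_convergence_at_top[where w = "\<lambda>t. indicator {0..} t * exp (- (2 / pi\<^sup>2) * t\<^sup>2)"])
    show "s x \<in> borel_measurable lborel" for x unfolding s_def by measurable
    show "(\<lambda>t. indicator {0..} t * (k 0 * exp (- (t\<^sup>2 / 2)))) \<in> borel_measurable lborel" by measurable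
    show "eventually (\<lambda>x. AE t in lborel. norm (s x t) \<le> indicator {0..} t * exp (- (2 / pi\<^sup>2) * t\<^sup>2)) at_top"
      using eventually_gt_at_top[of 0]
    proof eventually_elim
      case (elim x)
      show ?case
      proof (rule AE_I2)
        fix t :: real
        show "norm (s x t) \<le> indicator {0..} t * exp (- (2 / pi\<^sup>2) * t\<^sup>2)"
        proof (cases "t \<in> {0..pi * sqrt x}")
          case True
          then have t: "0 \<le> t / sqrt x" "t / sqrt x \<le> pi" using elim by (auto simp: field_simps)
          have "x * (2 * (t / sqrt x / pi)\<^sup>2) \<le> x * (1 - cos (t / sqrt x))"
            using one_minus_cos_ge[OF t] elim by (intro mult_left_mono) auto
          moreover have "x * (2 * (t / sqrt x / pi)\<^sup>2) = (2 / pi\<^sup>2) * t\<^sup>2"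
            using elim by (simp add: power_divide power_mult_distrib)
          ultimately have "exp (- (x * (1 - cos (t / sqrt x)))) \<le> exp (- (2 / pi\<^sup>2) * t\<^sup>2)" by simp
          then have "\<bar>k (t / sqrt x)\<bar> * exp (- (x * (1 - cos (t / sqrt x)))) \<le> 1 * exp (- (2 / pi\<^sup>2) * t\<^sup>2)"
            using assms(2) by (intro mult_mono) auto
          then show ?thesis using True by (simp add: s_def abs_mult)
        qed (simp add: s_def)
      qed
    qed
    show "AE t in lborel. ((\<lambda>x. s x t) \<longlongrightarrow> indicator {0..} t * (k 0 * exp (- (t\<^sup>2 / 2)))) at_top"
    proof (rule AE_I2)
      fix t :: real
      show "((\<lambda>x. s x t) \<longlongrightarrow> indicator {0..} t * (k 0 * exp (- (t\<^sup>2 / 2)))) at_top"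
      proof (cases "t \<ge> 0")
        case True
        have "((\<lambda>x. k (t / sqrt x) * exp (- (x * (1 - cos (t / sqrt x))))) \<longlongrightarrow> k 0 * exp (- (t\<^sup>2 / 2))) at_top"
        proof (intro tendsto_intros)
          have "((\<lambda>x. t / sqrt x) \<longlongrightarrow> 0) at_top" by real_asymp
          moreover have "isCont k 0" using assms(1) by (simp add: continuous_on_eq_continuous_at)
          ultimately show "((\<lambda>x. k (t / sqrt x)) \<longlongrightarrow> k 0) at_top"
            using isCont_tendsto_compose by blast
          show "((\<lambda>x. x * (1 - cos (t / sqrt x))) \<longlongrightarrow> t\<^sup>2 / 2) at_top"
            unfolding power2_eq_square by real_asymp
        qed
        then have "((\<lambda>x. s x t) \<longlongrightarrow> k 0 * exp (- (t\<^sup>2 / 2))) at_top"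
        proof (rule Lim_transform_eventually)
          have ev: "eventually (\<lambda>x. t \<le> pi * sqrt x) at_top" using True by real_asymp
          then show "eventually (\<lambda>x. k (t / sqrt x) * exp (- (x * (1 - cos (t / sqrt x)))) = s x t) at_top"
            by eventually_elim (use True in \<open>simp add: s_def\<close>)
        qed
        then show ?thesis using True by simp
      next
        case False
        then show ?thesis by (simp add: s_def)
      qed
    qed
    show "integrable lborel (\<lambda>t::real. indicator {0..} t * exp (- (2 / pi\<^sup>2) * t\<^sup>2))"
      using half_gaussian(1)[of "2 / pi\<^sup>2"] by simp
  qed
  moreover have "(LINT t|lborel. indicator {0..} t * (k 0 * exp (- (t\<^sup>2 / 2)))) = k 0 * sqrt (pi / 2)"
  proof -
    have "(LINT t|lborel. indicator {0..} t * (k 0 * exp (- (t\<^sup>2 / 2)))) = k 0 * (LINT t|lborel. indicator {0..} t * exp (- (1 / 2 * t\<^sup>2)))"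
      by (subst integral_mult_right_zero[symmetric]) (simp add: mult_ac)
    also have "(LINT t|lborel. indicator {0..} t * exp (- (1 / 2 * t\<^sup>2))) = sqrt pi / (2 * sqrt (1 / 2))"
      by (rule half_gaussian(2)) simp
    also have "sqrt pi / (2 * sqrt (1 / 2)) = sqrt (pi / 2)"
      by (simp add: real_sqrt_divide field_simps)
    finally show ?thesis .
  qed
  ultimately have "((\<lambda>x. LINT t|lborel. s x t) \<longlongrightarrow> k 0 * sqrt (pi / 2)) at_top" by simp
  then show ?thesis
  proof (rule Lim_transform_eventually)
    show "eventually (\<lambda>x. (LINT t|lborel. s x t) = sqrt x * exp (- x) * integral {0..pi} (\<lambda>t. k t * exp (x * cos t))) at_top"
      using eventually_gt_at_top[of 0] by eventually_elim (simp add: eq)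
  qed
qed

lemma I0_asymp: "((\<lambda>x. sqrt x * exp (- x) * I0 x) \<longlongrightarrow> sqrt (pi / 2) / pi) at_top"
  using tendsto_divide[OF bessel_integral_limit[of "\<lambda>_. 1"] tendsto_const[of pi]]
  by (simp add: I0_def)

lemma I1_asymp: "((\<lambda>x. sqrt x * exp (- x) * I1 x) \<longlongrightarrow> sqrt (pi / 2) / pi) at_top"
  using tendsto_divide[OF bessel_integral_limit[of cos] tendsto_const[of pi]]
  by (simp add: I1_def continuous_on_cos)

lemma I1_I0_ratio: "((\<lambda>x. I1 x / I0 x) \<longlongrightarrow> 1) at_top"
proof -
  have "((\<lambda>x. (sqrt x * exp (- x) * I1 x) / (sqrt x * exp (- x) * I0 x)) \<longlongrightarrow> (sqrt (pi / 2) / pi) / (sqrt (pi / 2) / pi)) at_top"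
    by (intro tendsto_divide I0_asymp I1_asymp) simp
  then have "((\<lambda>x. (sqrt x * exp (- x) * I1 x) / (sqrt x * exp (- x) * I0 x)) \<longlongrightarrow> 1) at_top" by simp
  then show ?thesis
  proof (rule Lim_transform_eventually)
    show "eventually (\<lambda>x. (sqrt x * exp (- x) * I1 x) / (sqrt x * exp (- x) * I0 x) = I1 x / I0 x) at_top"
      using eventually_gt_at_top[of 0] by eventually_elim simp
  qed
qed

text \<open>Small x is covered by 1/x, large x by the ratio tending to 1. Taken at x = \<Psi> / h,
  this expression times P / h is the main part of the logarithmic derivative of r k^2, which
  therefore grows at a rate of order 1/h.\<close>

lemma I_ratio_lower: "\<exists>c > 0. \<forall>x > 0. c \<le> 1 / x + 2 * (I1 x / I0 x)"
proof -
  have "eventually (\<lambda>x. I1 x / I0 x > 1 / 2) at_top"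
    by (rule order_tendstoD(1)[OF I1_I0_ratio]) simp
  then obtain X where X: "\<And>x. x \<ge> X \<Longrightarrow> I1 x / I0 x > 1 / 2" unfolding eventually_at_top_linorder by blast
  define Y where "Y = max X 1"
  show ?thesis
  proof (intro exI[of _ "min 1 (1 / Y)"] conjI allI impI)
    show "0 < min 1 (1 / Y)" by (simp add: Y_def)
    fix x :: real assume x: "x > 0"
    show "min 1 (1 / Y) \<le> 1 / x + 2 * (I1 x / I0 x)"
    proof (cases "x \<ge> Y")
      case True
      then have "I1 x / I0 x > 1 / 2" using X by (simp add: Y_def)
      moreover have "1 / x > 0" using x by simp
      ultimately show ?thesis by linarith
    next
      case False
      then have "1 / Y \<le> 1 / x" using x by (intro divide_left_mono) (auto simp: Y_def)
      moreover have "I1 x / I0 x \<ge> 0" using I1_nonneg[of x] I0_ge_1[of x] x by simp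
      ultimately show ?thesis by linarith
    qed
  qed
qed

lemma I0_pos: "x \<ge> 0 \<Longrightarrow> I0 x > 0" using I0_ge_1[of x] by linarith

lemma isCont_I1: "isCont I1 x"
proof -
  have "(I1 has_real_derivative integral {0..pi} (\<lambda>t. cos t ^ Suc 1 * exp (x * cos t)) / pi) (at x)"
    using DERIV_cdivide[OF integral_exp_cos_deriv[of 1 x], of pi] by (simp add: I1_def[abs_def])
  then show ?thesis by (rule DERIV_isCont)
qed

subsection \<open>Growth of the regular free solution\<close>

text \<open>\<mu> will be minus the bottom of the spectrum and moves with h, whereas s0 and c1 are
  fixed. The constants \<open>A\<close>, \<open>N1\<close> and \<open>N2\<close> are built without
  \<mu>, so the final estimates are uniform in h.\<close>

locale free_growth =
  fixes B \<mu> s0 L c1 :: real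
  assumes B_pos: "B > 0" and s0_pos: "s0 > 0" and mu_ge: "s0\<^sup>2 \<le> \<mu>" and L_pos: "L > 0"
    and c1_pos: "c1 > 0" and c1: "\<And>x. x > 0 \<Longrightarrow> c1 \<le> 1 / x + 2 * (I1 x / I0 x)"
begin

definition P :: "real \<Rightarrow> real" where "P r = sqrt (B\<^sup>2 * r\<^sup>2 / 4 + \<mu>)"
definition P1 :: "real \<Rightarrow> real" where "P1 r = B\<^sup>2 * r / (4 * P r)"
definition P2 :: "real \<Rightarrow> real" where "P2 r = B\<^sup>2 / (4 * P r) - B\<^sup>2 * r * P1 r / (4 * (P r)\<^sup>2)"
definition \<Psi> :: "real \<Rightarrow> real" where "\<Psi> r = integral {0..r} P"
definition A :: real where "A = B\<^sup>2 / (4 * s0\<^sup>2)"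
definition \<eta> :: "real \<Rightarrow> real" where "\<eta> r = (P r / \<Psi> r - 1 / r - P1 r / P r) / 2"
definition \<eta>1 :: "real \<Rightarrow> real" where
  "\<eta>1 r = (P1 r / \<Psi> r - ((P r / \<Psi> r)\<^sup>2 - (1 / r)\<^sup>2) - P2 r / P r + (P1 r / P r)\<^sup>2) / 2"
text \<open>The Liouville factor of the change of variable from r to \<Psi> / h in the radial
  equation. Since \<Psi> is asymptotic to r P(0) at the origin, 1 is the limit value there.\<close>

definition amp :: "real \<Rightarrow> real" where "amp r = (if r = 0 then 1 else sqrt (\<Psi> r / (r * P r)))"
definition N1 :: real where "N1 = 4 * A + 4 * (A * L)\<^sup>2"
text \<open>\<open>N1\<close> bounds the Riccati defect of the Langer approximation, and s0 c1 / (2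
  h) is the guaranteed growth rate of r k^2; \<open>N2 * h\<close> is their quotient.\<close>

definition N2 :: real where "N2 = 2 * N1 / (s0 * c1)"

lemma A_pos: "A > 0" using B_pos s0_pos by (simp add: A_def)

lemma N1_pos: "N1 > 0" using A_pos by (simp add: N1_def add_pos_nonneg)

lemma N2_pos: "N2 > 0" using N1_pos s0_pos c1_pos by (simp add: N2_def)

lemma arg_pos: "B\<^sup>2 * r\<^sup>2 / 4 + \<mu> > 0"
  using mu_ge s0_pos by (smt (verit) divide_nonneg_pos mult_nonneg_nonneg zero_le_power2 zero_less_power)

lemma P_ge: "P r \<ge> s0"
proof -
  have "B\<^sup>2 * r\<^sup>2 / 4 \<ge> 0" by simp
  then show ?thesis unfolding P_def using mu_ge by (intro real_le_rsqrt) linarith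
qed

lemma P_pos: "P r > 0" using P_ge[of r] s0_pos by linarith

lemma P_deriv: "(P has_real_derivative P1 r) (at r)"
proof -
  have "((\<lambda>r. sqrt (B\<^sup>2 * r\<^sup>2 / 4 + \<mu>)) has_real_derivative
      (inverse (sqrt (B\<^sup>2 * r\<^sup>2 / 4 + \<mu>)) / 2) * (B\<^sup>2 * (2 * r) / 4)) (at r)"
    by (rule DERIV_chain2[where f = sqrt and g = "\<lambda>r. B\<^sup>2 * r\<^sup>2 / 4 + \<mu>"])
      (auto intro!: derivative_eq_intros DERIV_real_sqrt arg_pos)
  then show ?thesis unfolding P_def[abs_def] P1_def by (simp add: field_simps P_def)
qed

lemma P1_deriv: "(P1 has_real_derivative P2 r) (at r)"
proof -
  have "P r \<noteq> 0" using P_pos[of r] by simp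
  then have "((\<lambda>r. B\<^sup>2 * r / (4 * P r)) has_real_derivative (B\<^sup>2 * (4 * P r) - B\<^sup>2 * r * (4 * P1 r)) / (4 * P r * (4 * P r))) (at r)"
    by (auto intro!: derivative_eq_intros P_deriv)
  moreover have "(B\<^sup>2 * (4 * P r) - B\<^sup>2 * r * (4 * P1 r)) / (4 * P r * (4 * P r)) = P2 r"
    using \<open>P r \<noteq> 0\<close> by (simp add: P2_def field_simps power2_eq_square)
  ultimately show ?thesis by (simp add: P1_def[abs_def])
qed

lemma P_cont: "continuous_on S P"
  using P_deriv by (auto intro!: continuous_at_imp_continuous_on DERIV_isCont)

lemma \<Psi>_deriv: "r > 0 \<Longrightarrow> (\<Psi> has_real_derivative P r) (at r)"
  unfolding \<Psi>_def[abs_def] by (rule integral_has_derivative_Ioi[OF P_cont])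

lemma \<Psi>_cont: "continuous_on {0..} \<Psi>"
  unfolding \<Psi>_def[abs_def] by (rule integral_continuous_Ici[OF P_cont])

lemma \<Psi>_zero [simp]: "\<Psi> 0 = 0" by (simp add: \<Psi>_def)

lemma P1_bounds: "r \<ge> 0 \<Longrightarrow> 0 \<le> P1 r" "r \<ge> 0 \<Longrightarrow> P1 r \<le> A * s0 * r"
proof -
  assume r: "r \<ge> 0"
  show "0 \<le> P1 r" unfolding P1_def using r P_pos[of r] by simp
  have "P1 r \<le> B\<^sup>2 * r / (4 * s0)" unfolding P1_def
    using r P_ge[of r] s0_pos by (intro divide_left_mono) (auto simp: P_pos)
  then show "P1 r \<le> A * s0 * r" using s0_pos by (simp add: A_def power2_eq_square)
qed

lemma P1_P_bounds: assumes "r \<ge> 0" shows "0 \<le> P1 r / P r" "P1 r / P r \<le> A * r"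
proof -
  show "0 \<le> P1 r / P r" using P1_bounds(1)[OF assms] P_pos[of r] by simp
  have "P1 r / P r \<le> (A * s0 * r) / s0"
    by (rule frac_le) (use P1_bounds[OF assms] P_ge s0_pos A_pos assms in auto)
  then show "P1 r / P r \<le> A * r" using s0_pos by simp
qed

lemma P2_P_bounds: assumes "r \<ge> 0" shows "\<bar>P2 r / P r\<bar> \<le> A"
proof -
  have pp: "P r > 0" by (rule P_pos)
  have P1r: "P2 r / P r = B\<^sup>2 / (4 * (P r)\<^sup>2) * (1 - B\<^sup>2 * r\<^sup>2 / (4 * (P r)\<^sup>2))"
    unfolding P2_def P1_def using pp by (simp add: field_simps power2_eq_square)
  have "(P r)\<^sup>2 = B\<^sup>2 * r\<^sup>2 / 4 + \<mu>" unfolding P_def using arg_pos[of r] by simp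
  moreover have "\<mu> \<ge> 0" using mu_ge by (meson order_trans zero_le_power2)
  ultimately have "B\<^sup>2 * r\<^sup>2 / (4 * (P r)\<^sup>2) \<le> 1"
    using pp zero_less_power[OF pp, of 2] by (subst divide_le_eq_1_pos) auto
  moreover have "0 \<le> B\<^sup>2 * r\<^sup>2 / (4 * (P r)\<^sup>2)" by simp
  ultimately have 1: "\<bar>1 - B\<^sup>2 * r\<^sup>2 / (4 * (P r)\<^sup>2)\<bar> \<le> 1" by linarith
  have "B\<^sup>2 / (4 * (P r)\<^sup>2) \<le> A" unfolding A_def
    using P_ge[of r] s0_pos by (intro divide_left_mono mult_left_mono power_mono) (auto simp: P_pos)
  then have "\<bar>B\<^sup>2 / (4 * (P r)\<^sup>2)\<bar> * \<bar>1 - B\<^sup>2 * r\<^sup>2 / (4 * (P r)\<^sup>2)\<bar> \<le> A * 1"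
    using 1 A_pos by (intro mult_mono) auto
  then show ?thesis unfolding P1r abs_mult by simp
qed

lemma \<Psi>_ge:
  assumes "r \<ge> 0" shows "s0 * r \<le> \<Psi> r"
proof -
  have "(\<lambda>r. \<Psi> r - s0 * r) 0 \<le> (\<lambda>r. \<Psi> r - s0 * r) r"
  proof (rule DERIV_nonneg_imp_increasing_open[OF assms, where f = "\<lambda>r. \<Psi> r - s0 * r"])
    fix x assume x: "0 < x" "x < r"
    have "((\<lambda>r. \<Psi> r - s0 * r) has_real_derivative P x - s0) (at x)"
      using x by (auto intro!: derivative_eq_intros \<Psi>_deriv)
    then show "\<exists>y. ((\<lambda>r. \<Psi> r - s0 * r) has_real_derivative y) (at x) \<and> 0 \<le> y"
      using P_ge[of x] by (intro exI[of _ "P x - s0"]) auto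
  qed (intro continuous_intros continuous_on_subset[OF \<Psi>_cont]; auto)
  then show ?thesis by simp
qed

lemma \<Psi>_pos: "r > 0 \<Longrightarrow> \<Psi> r > 0"
  using \<Psi>_ge[of r] s0_pos by (meson less_eq_real_def less_le_trans mult_pos_pos)

text \<open>The derivative of r P - \<Psi> is r P', which is nonnegative and O(r^2).\<close>

lemma \<Psi>_gap:
  assumes "r \<ge> 0" shows "0 \<le> r * P r - \<Psi> r" "r * P r - \<Psi> r \<le> A * s0 * r ^ 3"
proof -
  have d: "((\<lambda>r. r * P r - \<Psi> r) has_real_derivative x * P1 x) (at x)" if "x > 0" for x
    using that by (auto intro!: derivative_eq_intros \<Psi>_deriv P_deriv simp: mult.commute)
  have c: "continuous_on {0..r} (\<lambda>r. r * P r - \<Psi> r)"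
    by (intro continuous_intros P_cont continuous_on_subset[OF \<Psi>_cont]) auto
  have "(\<lambda>r. r * P r - \<Psi> r) 0 \<le> (\<lambda>r. r * P r - \<Psi> r) r"
  proof (rule DERIV_nonneg_imp_increasing_open[OF assms _ c])
    show "\<exists>y. ((\<lambda>r. r * P r - \<Psi> r) has_real_derivative y) (at x) \<and> 0 \<le> y" if "0 < x" "x < r" for x
      using d[of x] P1_bounds[of x] that by (intro exI[of _ "x * P1 x"]) auto
  qed
  then show "0 \<le> r * P r - \<Psi> r" by simp
  have "\<bar>(\<lambda>r. r * P r - \<Psi> r) r - (\<lambda>r. r * P r - \<Psi> r) 0\<bar> \<le> A * s0 * r ^ 3 / 3 - A * s0 * 0 ^ 3 / 3"
  proof (rule abs_diff_le_by_derivs[OF assms c, where f' = "\<lambda>x. x * P1 x" and G' = "\<lambda>x. A * s0 * x\<^sup>2"])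
    show "((\<lambda>r. A * s0 * r ^ 3 / 3) has_real_derivative A * s0 * x\<^sup>2) (at x)" for x
      by (auto intro!: derivative_eq_intros)
    show "\<bar>x * P1 x\<bar> \<le> A * s0 * x\<^sup>2" if "0 < x" "x < r" for x
    proof -
      have "x * P1 x \<le> x * (A * s0 * x)" using P1_bounds(2)[of x] that by (intro mult_left_mono) auto
      then show ?thesis using P1_bounds(1)[of x] that by (simp add: power2_eq_square mult_ac)
    qed
  qed (auto intro!: continuous_intros d)
  then have "\<bar>r * P r - \<Psi> r\<bar> \<le> A * s0 * r ^ 3 / 3" by simp
  moreover have "A * s0 * r ^ 3 \<ge> 0" using A_pos s0_pos assms by simp
  ultimately show "r * P r - \<Psi> r \<le> A * s0 * r ^ 3" by linarith
qed

lemma P_\<Psi>_gap: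
  assumes "r > 0" shows "0 \<le> P r / \<Psi> r - 1 / r" "P r / \<Psi> r - 1 / r \<le> A * r"
proof -
  have e: "P r / \<Psi> r - 1 / r = (r * P r - \<Psi> r) / (r * \<Psi> r)"
    using \<Psi>_pos[OF assms] assms by (simp add: field_simps)
  show "0 \<le> P r / \<Psi> r - 1 / r" unfolding e using \<Psi>_gap[of r] \<Psi>_pos[OF assms] assms by simp
  have "(r * P r - \<Psi> r) / (r * \<Psi> r) \<le> (A * s0 * r ^ 3) / (r * (s0 * r))"
    by (rule frac_le) (use \<Psi>_gap[of r] \<Psi>_ge[of r] assms A_pos s0_pos in auto)
  also have "\<dots> = A * r" using assms s0_pos by (simp add: eval_nat_numeral)
  finally show "P r / \<Psi> r - 1 / r \<le> A * r" unfolding e .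
qed

lemma \<eta>_bound: "r > 0 \<Longrightarrow> \<bar>\<eta> r\<bar> \<le> A * r"
  using P_\<Psi>_gap[of r] P1_P_bounds[of r] unfolding \<eta>_def by simp

lemma \<eta>_deriv:
  assumes "r > 0" shows "(\<eta> has_real_derivative \<eta>1 r) (at r)"
proof -
  have nz: "\<Psi> r \<noteq> 0" "r \<noteq> 0" "P r \<noteq> 0" using \<Psi>_pos[OF assms] assms P_pos[of r] by auto
  show ?thesis
    unfolding \<eta>_def[abs_def] \<eta>1_def
    by (rule derivative_eq_intros P_deriv \<Psi>_deriv P1_deriv assms nz refl | simp add: nz)+
       (use nz in \<open>simp add: field_simps power2_eq_square\<close>)
qed

text \<open>P/\<Psi> and 1/r are each singular at the origin, but their difference x is O(r).
  Factoring the difference of squares as x (x + 2/r) leaves only bounded terms; this is what makes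
  the Bessel approximation uniform down to r = 0.\<close>

lemma riccati_\<eta>:
  assumes "0 < r" "r \<le> L"
  shows "\<bar>\<eta>1 r + (\<eta> r)\<^sup>2 + \<eta> r / r\<bar> \<le> N1"
proof -
  have Ar: "A * r \<le> A * L" "A * r \<ge> 0" using A_pos assms by auto
  then have Ar2: "(A * r)\<^sup>2 \<le> (A * L)\<^sup>2" by (intro power_mono) auto
  define x where "x = P r / \<Psi> r - 1 / r"
  have x: "0 \<le> x" "x \<le> A * r" using P_\<Psi>_gap[OF assms(1)] by (auto simp: x_def)
  have "P1 r / \<Psi> r \<le> (A * s0 * r) / (s0 * r)"
    by (rule frac_le) (use P1_bounds[of r] \<Psi>_ge[of r] assms A_pos s0_pos in auto)
  then have 1: "0 \<le> P1 r / \<Psi> r" "P1 r / \<Psi> r \<le> A"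
    using P1_bounds[of r] \<Psi>_pos[of r] assms s0_pos by auto
  have "y\<^sup>2 - z\<^sup>2 = (y - z) * ((y - z) + 2 * z)" for y z :: real by (simp add: power2_eq_square algebra_simps)
  from this[of "P r / \<Psi> r" "1 / r"] have "(P r / \<Psi> r)\<^sup>2 - (1 / r)\<^sup>2 = x * (x + 2 / r)"
    by (simp add: x_def)
  also have "\<dots> = x\<^sup>2 + 2 * (x / r)" by (simp add: power2_eq_square algebra_simps)
  finally have e: "(P r / \<Psi> r)\<^sup>2 - (1 / r)\<^sup>2 = x\<^sup>2 + 2 * (x / r)" .
  have "x\<^sup>2 \<le> (A * r)\<^sup>2" using x by (intro power_mono) auto
  moreover have "x / r \<le> A" "x / r \<ge> 0" using x assms by (auto simp: divide_le_eq)
  ultimately have 2: "0 \<le> (P r / \<Psi> r)\<^sup>2 - (1 / r)\<^sup>2" "(P r / \<Psi> r)\<^sup>2 - (1 / r)\<^sup>2 \<le> (A * L)\<^sup>2 + 2 * A"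
    unfolding e using Ar2 zero_le_power2[of x] by linarith+
  have 3: "\<bar>P2 r / P r\<bar> \<le> A" using P2_P_bounds[of r] assms by simp
  have "(P1 r / P r)\<^sup>2 \<le> (A * r)\<^sup>2" using P1_P_bounds[of r] assms by (intro power_mono) auto
  then have 4: "0 \<le> (P1 r / P r)\<^sup>2" "(P1 r / P r)\<^sup>2 \<le> (A * L)\<^sup>2" using Ar2 by auto
  have "(\<eta> r)\<^sup>2 \<le> (A * r)\<^sup>2" using \<eta>_bound[OF assms(1)] by (metis abs_ge_zero power2_abs power_mono)
  then have 5: "0 \<le> (\<eta> r)\<^sup>2" "(\<eta> r)\<^sup>2 \<le> (A * L)\<^sup>2" using Ar2 by auto
  have 6: "\<bar>\<eta> r / r\<bar> \<le> A" using \<eta>_bound[OF assms(1)] assms(1) by (simp add: divide_le_eq)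
  have t: "\<bar>(a1 - a2 - a3 + a4) / 2 + a5 + a6\<bar> \<le> 4 * A + 4 * y"
    if "0 \<le> a1" "a1 \<le> A" "0 \<le> a2" "a2 \<le> y + 2 * A" "\<bar>a3\<bar> \<le> A" "0 \<le> a4" "a4 \<le> y" "0 \<le> a5" "a5 \<le> y" "\<bar>a6\<bar> \<le> A" "0 \<le> y"
    for a1 a2 a3 a4 a5 a6 y :: real
    using that A_pos unfolding abs_le_iff by argo
  show ?thesis unfolding \<eta>1_def N1_def by (rule t[OF 1 2 3 4 5 6]) simp
qed

lemma amp_pos: "r \<ge> 0 \<Longrightarrow> amp r > 0"
  unfolding amp_def using \<Psi>_pos[of r] P_pos[of r] by auto

lemma amp_deriv:
  assumes "r > 0" shows "(amp has_real_derivative amp r * \<eta> r) (at r)"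
proof -
  have pp: "\<Psi> r > 0" "P r > 0" "r > 0" using \<Psi>_pos[OF assms] P_pos[of r] assms by auto
  have a: "\<Psi> r / (r * P r) > 0" using pp by simp
  have "((\<lambda>r. \<Psi> r / (r * P r)) has_real_derivative (P r * (r * P r) - \<Psi> r * (P r + P1 r * r)) / ((r * P r) * (r * P r))) (at r)"
    using pp by (auto intro!: derivative_eq_intros \<Psi>_deriv P_deriv)
  moreover have "(P r * (r * P r) - \<Psi> r * (P r + P1 r * r)) / ((r * P r) * (r * P r)) = \<Psi> r / (r * P r) * (2 * \<eta> r)"
    using pp by (simp add: \<eta>_def field_simps power2_eq_square)
  ultimately have d: "((\<lambda>r. \<Psi> r / (r * P r)) has_real_derivative \<Psi> r / (r * P r) * (2 * \<eta> r)) (at r)"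
    by simp
  have d2: "((\<lambda>r. sqrt (\<Psi> r / (r * P r))) has_real_derivative
      (inverse (sqrt (\<Psi> r / (r * P r))) / 2) * (\<Psi> r / (r * P r) * (2 * \<eta> r))) (at r)"
    by (rule DERIV_chain2[OF DERIV_real_sqrt[OF a] d])
  have sq: "(inverse (sqrt y) / 2) * (y * (2 * z)) = sqrt y * z" if "y > 0" for y z :: real
  proof -
    have "inverse t / 2 * (t * t * (2 * z)) = t * z" if "t \<noteq> 0" for t :: real using that by simp
    from this[of "sqrt y"] show ?thesis using that by simp
  qed
  have am: "amp r = sqrt (\<Psi> r / (r * P r))" using assms by (simp add: amp_def)
  have "((\<lambda>r. sqrt (\<Psi> r / (r * P r))) has_real_derivative amp r * \<eta> r) (at r)"
    using d2 unfolding am sq[OF a] .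
  then show ?thesis
    by (rule has_field_derivative_transform_within_open[where S = "{0<..}"]) (use assms in \<open>auto simp: amp_def\<close>)
qed

lemma amp_near_1:
  assumes "r \<ge> 0" shows "\<bar>amp r - 1\<bar> \<le> A * r\<^sup>2"
proof (cases "r = 0")
  case False
  then have r: "r > 0" using assms by simp
  have pp: "\<Psi> r > 0" "P r > 0" using \<Psi>_pos[OF r] P_pos[of r] by auto
  have "(amp r)\<^sup>2 = \<Psi> r / (r * P r)" using False pp r by (simp add: amp_def)
  then have e: "1 - (amp r)\<^sup>2 = (r * P r - \<Psi> r) / (r * P r)" using pp r by (simp add: field_simps)
  have "(r * P r - \<Psi> r) / (r * P r) \<le> (A * s0 * r ^ 3) / (r * s0)"
    by (rule frac_le) (use \<Psi>_gap[of r] P_ge[of r] r A_pos s0_pos in auto)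
  also have "\<dots> = A * r\<^sup>2" using r s0_pos by (simp add: eval_nat_numeral)
  finally have 1: "1 - (amp r)\<^sup>2 \<le> A * r\<^sup>2" unfolding e .
  have 2: "0 \<le> 1 - (amp r)\<^sup>2" unfolding e using \<Psi>_gap[of r] r pp by simp
  have ap: "amp r > 0" using amp_pos[OF assms] .
  have "(1 - amp r) * (1 + amp r) \<ge> 0" using 2 by (simp add: power2_eq_square algebra_simps)
  then have "amp r \<le> 1" using ap by (simp add: zero_le_mult_iff)
  moreover have "1 - amp r \<le> (1 - amp r) * (1 + amp r)" using \<open>amp r \<le> 1\<close> ap by (simp add: algebra_simps mult_left_le)
  moreover have "(1 - amp r) * (1 + amp r) = 1 - (amp r)\<^sup>2" by (simp add: power2_eq_square algebra_simps)
  ultimately show ?thesis using 1 by linarith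
qed (simp add: amp_def)

lemma amp_cont: "continuous_on {0..L} amp"
proof -
  have "continuous (at r within {0..L}) amp" if "r \<in> {0..L}" for r
  proof (cases "r = 0")
    case True
    have "((\<lambda>r. amp r - 1) \<longlongrightarrow> 0) (at 0 within {0..L})"
    proof (rule Lim_null_comparison)
      show "eventually (\<lambda>r. norm (amp r - 1) \<le> A * r\<^sup>2) (at 0 within {0..L})"
        using amp_near_1 by (auto simp: eventually_at intro!: exI[of _ 1])
      have "((\<lambda>r. A * r\<^sup>2) \<longlongrightarrow> A * 0\<^sup>2) (at 0 within {0..L})" by (intro tendsto_intros)
      then show "((\<lambda>r. A * r\<^sup>2) \<longlongrightarrow> 0) (at 0 within {0..L})" by simp
    qed
    then show ?thesis using True by (simp add: continuous_within LIM_zero_iff amp_def[of 0])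
  next
    case False
    then have "isCont amp r" using amp_deriv[of r] that by (intro DERIV_isCont) auto
    then show ?thesis by (rule continuous_at_imp_continuous_at_within)
  qed
  then show ?thesis by (auto simp: continuous_on_eq_continuous_within)
qed

lemma \<eta>_cont: "continuous_on {0..} \<eta>"
  by (rule continuous_on_Ici_if_bound_at_0[OF \<eta>_deriv, where K = A]) (use \<eta>_bound in \<open>auto simp: \<eta>_def[of 0] P1_def[of 0]\<close>)

text \<open>Langer's uniform approximation of the solution that is regular at the origin.\<close>

definition k :: "real \<Rightarrow> real \<Rightarrow> real" where "k h r = I0 (\<Psi> r / h) * amp r"
definition lk :: "real \<Rightarrow> real \<Rightarrow> real" where "lk h r = P r / h * (I1 (\<Psi> r / h) / I0 (\<Psi> r / h)) + \<eta> r"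

lemma \<Psi>_nonneg: "r \<ge> 0 \<Longrightarrow> \<Psi> r \<ge> 0" using \<Psi>_ge[of r] s0_pos by (meson mult_nonneg_nonneg less_imp_le order_trans)

lemma k_pos: "h > 0 \<Longrightarrow> r \<ge> 0 \<Longrightarrow> k h r > 0"
  unfolding k_def using I0_pos \<Psi>_nonneg amp_pos by simp

lemma k_zero [simp]: "k h 0 = 1" by (simp add: k_def amp_def)

lemma k_deriv:
  assumes "h > 0" "r > 0" shows "(k h has_real_derivative k h r * lk h r) (at r)"
proof -
  have i: "I0 (\<Psi> r / h) \<noteq> 0" using I0_pos[of "\<Psi> r / h"] \<Psi>_pos[of r] assms by auto
  have "((\<lambda>r. I0 (\<Psi> r / h)) has_real_derivative I1 (\<Psi> r / h) * (P r / h)) (at r)"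
    by (rule DERIV_chain2[where f = I0, OF I0_deriv]) (rule DERIV_cdivide[OF \<Psi>_deriv[OF assms(2)]])
  from DERIV_mult[OF this amp_deriv[OF assms(2)]]
  have "(k h has_real_derivative I1 (\<Psi> r / h) * (P r / h) * amp r + amp r * \<eta> r * I0 (\<Psi> r / h)) (at r)"
    by (simp add: k_def[abs_def])
  moreover have "I1 (\<Psi> r / h) * (P r / h) * amp r + amp r * \<eta> r * I0 (\<Psi> r / h) = k h r * lk h r"
    using i by (simp add: k_def lk_def algebra_simps)
  ultimately show ?thesis by simp
qed

text \<open>The ratio \<rho> = I1/I0 obeys \<rho>' = 1 - \<rho>/x - \<rho>^2. The amplitude is such
  that P' = P (P/\<Psi> - 1/r - 2 \<eta>), which cancels all terms of order 1/h; the Riccati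
  expression is then the exact coefficient plus the bounded defect from \<eta>.\<close>

lemma lk_deriv:
  assumes "h > 0" "r > 0"
  shows "(lk h has_real_derivative (B\<^sup>2 * r\<^sup>2 / 4 + \<mu>) / h\<^sup>2 + (\<eta>1 r + (\<eta> r)\<^sup>2 + \<eta> r / r) - (lk h r)\<^sup>2 - lk h r / r) (at r)"
proof -
  define x where "x = \<Psi> r / h"
  define \<rho> where "\<rho> = I1 x / I0 x"
  have pp: "\<Psi> r > 0" "P r > 0" "x > 0" using \<Psi>_pos[OF assms(2)] P_pos[of r] assms by (auto simp: x_def)
  have i: "I0 x \<noteq> 0" using I0_pos[of x] pp by auto
  have "((\<lambda>x. I1 x / I0 x) has_real_derivative ((I0 x - I1 x / x) * I0 x - I1 x * I1 x) / (I0 x * I0 x)) (at x)"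
    by (rule DERIV_divide[OF I1_deriv I0_deriv i]) (use pp in auto)
  moreover have "((I0 x - I1 x / x) * I0 x - I1 x * I1 x) / (I0 x * I0 x) = 1 - \<rho> / x - \<rho>\<^sup>2"
    using i pp by (simp add: \<rho>_def field_simps power2_eq_square)
  ultimately have d\<rho>: "((\<lambda>x. I1 x / I0 x) has_real_derivative 1 - \<rho> / x - \<rho>\<^sup>2) (at x)" by simp
  have "((\<lambda>r. I1 (\<Psi> r / h) / I0 (\<Psi> r / h)) has_real_derivative (1 - \<rho> / x - \<rho>\<^sup>2) * (P r / h)) (at r)"
    by (rule DERIV_chain2[where f = "\<lambda>x. I1 x / I0 x" and g = "\<lambda>r. \<Psi> r / h"]) (use d\<rho> DERIV_cdivide[OF \<Psi>_deriv[OF assms(2)]] in \<open>simp_all add: x_def\<close>)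
  from DERIV_add[OF DERIV_mult[OF DERIV_cdivide[OF P_deriv] this] \<eta>_deriv[OF assms(2)]]
  have d: "(lk h has_real_derivative P1 r / h * (I1 (\<Psi> r / h) / I0 (\<Psi> r / h)) + (1 - \<rho> / x - \<rho>\<^sup>2) * (P r / h) * (P r / h) + \<eta>1 r) (at r)"
    by (simp add: lk_def[abs_def])
  have P2: "B\<^sup>2 * r\<^sup>2 / 4 + \<mu> = (P r)\<^sup>2" unfolding P_def using arg_pos[of r] by simp
  have P1: "P1 r = P r * (P r / \<Psi> r - 1 / r - 2 * \<eta> r)" using pp assms by (simp add: \<eta>_def field_simps)
  have lk: "lk h r = P r / h * \<rho> + \<eta> r" by (simp add: lk_def \<rho>_def x_def)
  have r1: "I1 (\<Psi> r / h) / I0 (\<Psi> r / h) = \<rho>" by (simp add: \<rho>_def x_def)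
  have e: "P1 r / h * \<rho> + (1 - \<rho> / x - \<rho>\<^sup>2) * (P r / h) * (P r / h) + \<eta>1 r =
     (P r)\<^sup>2 / h\<^sup>2 + (\<eta>1 r + (\<eta> r)\<^sup>2 + \<eta> r / r) - (P r / h * \<rho> + \<eta> r)\<^sup>2 - (P r / h * \<rho> + \<eta> r) / r"
    unfolding P1 x_def using pp assms by (simp add: field_simps power2_eq_square)
  show ?thesis using d unfolding P2 lk r1 e .
qed

lemma bessel_\<Psi>_cont:
  "continuous_on {0..L} (\<lambda>r. I0 (\<Psi> r / h))" "continuous_on {0..L} (\<lambda>r. I1 (\<Psi> r / h))"
proof -
  have p: "continuous_on {0..L} (\<lambda>r. \<Psi> r / h)"
    unfolding divide_inverse by (intro continuous_intros continuous_on_subset[OF \<Psi>_cont]) auto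
  have "continuous_on UNIV I0" "continuous_on UNIV I1"
    by (rule continuous_at_imp_continuous_on, rule ballI, rule DERIV_isCont[OF I0_deriv],
        rule continuous_at_imp_continuous_on, rule ballI, rule isCont_I1)
  then show "continuous_on {0..L} (\<lambda>r. I0 (\<Psi> r / h))" "continuous_on {0..L} (\<lambda>r. I1 (\<Psi> r / h))"
    using continuous_on_compose2[OF _ p, of UNIV] by auto
qed

lemma k_cont: "continuous_on {0..L} (k h)"
  unfolding k_def[abs_def] by (rule continuous_on_mult[OF bessel_\<Psi>_cont(1) amp_cont])

lemma lk_cont:
  assumes "h > 0" shows "continuous_on {0..L} (lk h)"
proof -
  have nz: "\<forall>r\<in>{0..L}. I0 (\<Psi> r / h) \<noteq> 0"
    using assms I0_pos[of "\<Psi> r / h" for r] \<Psi>_nonneg by (metis atLeastAtMost_iff divide_nonneg_pos less_irrefl)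
  have "continuous_on {0..L} (\<lambda>r. P r / h)"
    unfolding divide_inverse by (rule continuous_on_mult[OF P_cont continuous_on_const])
  moreover have "continuous_on {0..L} \<eta>" by (rule continuous_on_subset[OF \<eta>_cont]) auto
  ultimately show ?thesis unfolding lk_def[abs_def]
    by (intro continuous_on_add continuous_on_mult continuous_on_divide[OF bessel_\<Psi>_cont(2,1) nz])
qed

text \<open>Let S be the maximum of |G/k| on the interval. The Wronskian derivative is at most N1 S
  r k^2, and because r k^2 grows exponentially at rate 1/h its integral is O(h) times its end value.
  So (G/k)' = O(h S), and for small h the maximum S is absorbed by |G(0)|. The same bound at L
  compares the logarithmic derivatives.\<close>

theorem regular_solution_growth:
  assumes h: "h > 0" "2 * A * L * h \<le> s0 * c1" "4 * N2 * L * h \<le> 1" and LR: "L < R"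
    and d: "\<And>r. \<bar>r\<bar> < R \<Longrightarrow> (G has_real_derivative G1 r) (at r)" "\<And>r. \<bar>r\<bar> < R \<Longrightarrow> (G1 has_real_derivative G2 r) (at r)"
    and ode: "\<And>r. 0 < r \<Longrightarrow> r < R \<Longrightarrow> G2 r + G1 r / r = (B\<^sup>2 * r\<^sup>2 / 4 + \<mu>) / h\<^sup>2 * G r"
    and G0: "G 0 \<noteq> 0"
  shows "\<bar>G L / (G 0 * k h L) - 1\<bar> \<le> 2 * N2 * L * h" "\<bar>G1 L / G L - lk h L\<bar> \<le> 4 * N2 * h"
proof -
  have cG: "continuous_on {0..L} G" "continuous_on {0..L} G1"
    by (rule continuous_at_imp_continuous_on, rule ballI, rule DERIV_isCont, rule d, use LR in simp)+
  define q where "q = (\<lambda>r. G r / k h r)"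
  have kn: "k h r \<noteq> 0" if "r \<ge> 0" for r using k_pos[OF h(1) that] by simp
  have cq: "continuous_on {0..L} q"
    unfolding q_def by (intro continuous_intros cG k_cont) (use kn in auto)
  obtain x0 where x0: "x0 \<in> {0..L}" and x0m: "\<And>x. x \<in> {0..L} \<Longrightarrow> \<bar>q x\<bar> \<le> \<bar>q x0\<bar>"
  proof -
    have "continuous_on {0..L} (\<lambda>x. \<bar>q x\<bar>)" by (intro continuous_intros cq)
    then obtain x0 where "x0 \<in> {0..L}" "\<forall>y\<in>{0..L}. \<bar>q y\<bar> \<le> \<bar>q x0\<bar>"
      using continuous_attains_sup[of "{0..L}" "\<lambda>x. \<bar>q x\<bar>"] L_pos by auto
    then show ?thesis using that by blast
  qed
  define S where "S = \<bar>q x0\<bar>"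
  have S0: "S \<ge> 0" by (simp add: S_def)
  define w where "w = (\<lambda>r. r * k h r * (G1 r - G r * lk h r))"
  define z where "z = (\<lambda>r. r * (k h r)\<^sup>2)"
  define w1 where "w1 = (\<lambda>r. r * k h r * G r * (- (\<eta>1 r + (\<eta> r)\<^sup>2 + \<eta> r / r)))"
  have dw: "(w has_real_derivative w1 r) (at r)" if r: "0 < r" "r < L" for r
  proof -
    have "(w has_real_derivative r * k h r * G r * ((B\<^sup>2 * r\<^sup>2 / 4 + \<mu>) / h\<^sup>2 -
        (((B\<^sup>2 * r\<^sup>2 / 4 + \<mu>) / h\<^sup>2 + (\<eta>1 r + (\<eta> r)\<^sup>2 + \<eta> r / r) - (lk h r)\<^sup>2 - lk h r / r) + (lk h r)\<^sup>2 + lk h r / r))) (at r)"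
      unfolding w_def
      by (rule wronskian_deriv[where f = G and ?f1.0 = G1 and ?f2.0 = G2 and \<gamma> = "k h" and l = "lk h" and
          ?l1.0 = "\<lambda>r. (B\<^sup>2 * r\<^sup>2 / 4 + \<mu>) / h\<^sup>2 + (\<eta>1 r + (\<eta> r)\<^sup>2 + \<eta> r / r) - (lk h r)\<^sup>2 - lk h r / r", OF _ d k_deriv lk_deriv ode])
        (use r h LR in auto)
    then show ?thesis by (simp add: w1_def algebra_simps)
  qed
  have dz: "(z has_real_derivative z r * (1 / r + 2 * lk h r)) (at r)" if r: "0 < r" for r
    unfolding z_def using k_deriv[OF h(1) r] r by (auto intro!: derivative_eq_intros simp: field_simps power2_eq_square)
  \<comment> \<open>The logarithmic derivative of \<open>z\<close>. The 1/r cancels against \<eta>,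
    leaving P/h times (1/x + 2 I1/I0) at x = \<Psi>/h, minus P'/P. The first part is at least s0 c1
    / h, and the smallness of h gives up half of it for P'/P <= A L.\<close>
  have zr: "s0 * c1 / (2 * h) \<le> 1 / r + 2 * lk h r" if r: "0 < r" "r < L" for r
  proof -
    have pp: "\<Psi> r > 0" "P r > 0" using \<Psi>_pos[OF r(1)] P_pos[of r] by auto
    have "1 / r + 2 * lk h r = P r / h * (1 / (\<Psi> r / h) + 2 * (I1 (\<Psi> r / h) / I0 (\<Psi> r / h))) - P1 r / P r"
      unfolding lk_def \<eta>_def using pp h(1) by (simp add: field_simps)
    moreover have "P r / h * (1 / (\<Psi> r / h) + 2 * (I1 (\<Psi> r / h) / I0 (\<Psi> r / h))) \<ge> s0 / h * c1"
      by (rule mult_mono) (use c1[of "\<Psi> r / h"] pp h c1_pos P_ge[of r] in \<open>auto intro!: divide_right_mono\<close>)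
    moreover have "P1 r / P r \<le> A * L"
    proof -
      have "A * r \<le> A * L" using A_pos r by (intro mult_left_mono) auto
      then show ?thesis using P1_P_bounds(2)[of r] r by linarith
    qed
    moreover have "A * L \<le> s0 * c1 / (2 * h)" using h by (simp add: field_simps)
    moreover have "s0 / h * c1 = 2 * (s0 * c1 / (2 * h))" by simp
    ultimately show ?thesis by linarith
  qed
  have zpos: "z r > 0" if "0 < r" for r unfolding z_def using k_pos[OF h(1), of r] that by simp
  have GS: "\<bar>G r\<bar> \<le> S * k h r" if "r \<in> {0..L}" for r
  proof -
    have "\<bar>G r\<bar> / k h r \<le> S" using x0m[OF that] k_pos[OF h(1), of r] that by (simp add: q_def S_def)
    then show ?thesis using k_pos[OF h(1), of r] that by (simp add: divide_le_eq)
  qed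
  have w1b: "\<bar>w1 r\<bar> \<le> N2 * h * S * (z r * (1 / r + 2 * lk h r))" if r: "0 < r" "r < L" for r
  proof -
    have "\<bar>w1 r\<bar> = r * k h r * (\<bar>G r\<bar> * \<bar>\<eta>1 r + (\<eta> r)\<^sup>2 + \<eta> r / r\<bar>)"
      unfolding w1_def using r k_pos[OF h(1), of r] by (simp only: abs_mult abs_minus_cancel) simp
    also have "\<dots> \<le> r * k h r * ((S * k h r) * N1)"
      using GS[of r] riccati_\<eta>[of r] r k_pos[OF h(1), of r] S0 by (intro mult_left_mono mult_mono) auto
    also have "\<dots> = N1 * S * z r" by (simp add: z_def power2_eq_square)
    also have "\<dots> = N2 * h * S * (z r * (s0 * c1 / (2 * h)))"
      using h s0_pos c1_pos by (simp add: N2_def)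
    also have "\<dots> \<le> N2 * h * S * (z r * (1 / r + 2 * lk h r))"
      using zr[OF r] zpos[OF r(1)] N2_pos h S0 by (intro mult_left_mono) auto
    finally show ?thesis .
  qed
  have wb: "\<bar>w r\<bar> \<le> N2 * h * S * z r" if r: "0 < r" "r \<le> L" for r
  proof -
    have "\<bar>w r - w 0\<bar> \<le> N2 * h * S * z r - N2 * h * S * z 0"
    proof (rule abs_diff_le_by_derivs[where f' = w1 and G' = "\<lambda>r. N2 * h * S * (z r * (1 / r + 2 * lk h r))"])
      have "continuous_on {0..L} w" unfolding w_def by (intro continuous_intros cG k_cont lk_cont[OF h(1)])
      then show "continuous_on {0..r} w" by (rule continuous_on_subset) (use r in auto)
      have "continuous_on {0..L} z" unfolding z_def by (intro continuous_intros k_cont)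
      then have "continuous_on {0..r} z" by (rule continuous_on_subset) (use r in auto)
      then show "continuous_on {0..r} (\<lambda>r. N2 * h * S * z r)" by (intro continuous_intros)
    qed (use r w1b dw in \<open>auto intro!: DERIV_cmult dz\<close>)
    then show ?thesis by (simp add: w_def z_def)
  qed
  have dq: "(q has_real_derivative w r / z r) (at r)" "w r / z r = (G1 r - G r * lk h r) / k h r" if r: "0 < r" "r \<le> L" for r
  proof -
    have kn': "k h r \<noteq> 0" using kn r by simp
    have dG: "(G has_real_derivative G1 r) (at r)" using d r LR by simp
    have "(q has_real_derivative (G1 r * k h r - G r * (k h r * lk h r)) / (k h r * k h r)) (at r)"
      unfolding q_def using DERIV_divide[OF dG k_deriv[OF h(1) r(1)] kn'] by simp
    moreover have "(G1 r * k h r - G r * (k h r * lk h r)) / (k h r * k h r) = w r / z r"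
      using r kn' by (simp add: w_def z_def field_simps power2_eq_square)
    ultimately show "(q has_real_derivative w r / z r) (at r)" by simp
    show "w r / z r = (G1 r - G r * lk h r) / k h r"
      using r kn' by (simp add: w_def z_def field_simps power2_eq_square)
  qed
  have qb: "\<bar>w r / z r\<bar> \<le> N2 * h * S" if r: "0 < r" "r \<le> L" for r
    using wb[OF r] zpos[OF r(1)] by (simp add: divide_le_eq)
  have q0: "q 0 = G 0" by (simp add: q_def)
  have qd: "\<bar>q r - G 0\<bar> \<le> N2 * h * S * L" if r: "r \<in> {0..L}" for r
  proof -
    have "\<bar>q r - q 0\<bar> \<le> N2 * h * S * r - N2 * h * S * 0"
    proof (rule abs_diff_le_by_derivs[where f' = "\<lambda>r. w r / z r" and G' = "\<lambda>r. N2 * h * S"])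
      show "continuous_on {0..r} q" by (rule continuous_on_subset[OF cq]) (use r in auto)
      show "\<bar>w x / z x\<bar> \<le> N2 * h * S" if "0 < x" "x < r" for x
        by (rule qb) (use that r in auto)
    qed (use r dq in \<open>auto intro!: continuous_intros derivative_eq_intros\<close>)
    moreover have "N2 * h * S * r \<le> N2 * h * S * L" using r N2_pos h S0 by (intro mult_left_mono) auto
    ultimately show ?thesis using q0 by simp
  qed
  \<comment> \<open>The self-improving step: S <= |G(0)| + S/4, hence S <= 2 |G(0)|.\<close>
  have half: "N2 * h * S * L \<le> S / 4" using mult_right_mono[OF h(3) S0] by (simp add: algebra_simps)
  have "S \<le> \<bar>G 0\<bar> + N2 * h * S * L" using qd[OF x0] unfolding S_def by linarith
  then have SG: "S \<le> 2 * \<bar>G 0\<bar>" using half S0 by linarith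
  have G0p: "\<bar>G 0\<bar> > 0" using G0 by simp
  have qL: "\<bar>q L - G 0\<bar> \<le> 2 * N2 * L * h * \<bar>G 0\<bar>"
  proof -
    have "\<bar>q L - G 0\<bar> \<le> N2 * h * S * L" using qd[of L] L_pos by simp
    also have "\<dots> = N2 * h * L * S" by (simp only: mult_ac)
    also have "\<dots> \<le> N2 * h * L * (2 * \<bar>G 0\<bar>)" using SG N2_pos h L_pos by (intro mult_left_mono) auto
    also have "\<dots> = 2 * N2 * L * h * \<bar>G 0\<bar>" by (simp only: mult_ac)
    finally show ?thesis .
  qed
  have "G L / (G 0 * k h L) - 1 = (q L - G 0) / G 0" using G0 by (simp add: q_def field_simps)
  then have "\<bar>G L / (G 0 * k h L) - 1\<bar> = \<bar>q L - G 0\<bar> / \<bar>G 0\<bar>" by simp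
  also have "\<dots> \<le> 2 * N2 * L * h" using qL G0p by (simp add: divide_le_eq)
  finally show "\<bar>G L / (G 0 * k h L) - 1\<bar> \<le> 2 * N2 * L * h" .
  have "2 * N2 * L * h * \<bar>G 0\<bar> \<le> 1 / 2 * \<bar>G 0\<bar>" using h(3) by (intro mult_right_mono) auto
  then have qL2: "\<bar>q L\<bar> \<ge> \<bar>G 0\<bar> / 2" using qL by linarith
  have kL: "k h L > 0" using k_pos[OF h(1)] L_pos by simp
  have GL: "G L \<noteq> 0" using qL2 G0p by (auto simp: q_def)
  have "G1 L / G L - lk h L = (w L / z L) / q L"
    unfolding dq(2)[OF L_pos order_refl] using GL kL by (simp add: q_def field_simps)
  then have "\<bar>G1 L / G L - lk h L\<bar> = \<bar>w L / z L\<bar> / \<bar>q L\<bar>" by (simp add: abs_divide abs_mult)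
  also have "\<dots> \<le> (N2 * h * (2 * \<bar>G 0\<bar>)) / (\<bar>G 0\<bar> / 2)"
  proof (rule frac_le)
    have "N2 * h * S \<le> N2 * h * (2 * \<bar>G 0\<bar>)" using SG N2_pos h by (intro mult_left_mono) auto
    then show "\<bar>w L / z L\<bar> \<le> N2 * h * (2 * \<bar>G 0\<bar>)" using qb[OF L_pos order_refl] by linarith
  qed (use qL2 G0p N2_pos h in auto)
  also have "\<dots> = 4 * N2 * h" using G0p by simp
  finally show "\<bar>G1 L / G L - lk h L\<bar> \<le> 4 * N2 * h" .
qed

end

subsection \<open>Circle averages of magnetic translates\<close>

text \<open>F is the radial profile as a function of the squared radius, and its argument is the
  squared distance of the point with polar coordinates r, \<theta> from (2L, 0). The cosine is the
  real part of the gauge factor of the translation.\<close>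

definition circle_average :: "(real \<Rightarrow> real) \<Rightarrow> real \<Rightarrow> real \<Rightarrow> real \<Rightarrow> real" where
  "circle_average F L k r = integral {0..2 * pi}
     (\<lambda>\<theta>. F (r\<^sup>2 - 4 * L * r * cos \<theta> + 4 * L\<^sup>2) * cos (k * r * sin \<theta>)) / (2 * pi)"

lemma circle_average_zero: "circle_average F L k 0 = F (4 * L\<^sup>2)"
  by (simp add: circle_average_def)

text \<open>The angular derivative produced by the gauge factor integrates to zero over the circle, so the
  average solves the free radial equation.\<close>

theorem circle_average_ode:
  fixes F F1 F2 :: "real \<Rightarrow> real" and a L \<beta> \<Lambda> :: real
  assumes a: "0 \<le> a" "a < L"
    and d1: "\<And>s. s > a\<^sup>2 \<Longrightarrow> (F has_real_derivative F1 s) (at s)"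
    and d2: "\<And>s. s > a\<^sup>2 \<Longrightarrow> (F1 has_real_derivative F2 s) (at s)"
    and ode: "\<And>s. s > a\<^sup>2 \<Longrightarrow> 4 * s * F2 s + 4 * F1 s = (\<beta>\<^sup>2 * s / 4 - \<Lambda>) * F s"
  defines "G \<equiv> circle_average F L (\<beta> * L)"
  shows "\<exists>G1 G2. (\<forall>r. \<bar>r\<bar> < 2 * L - a \<longrightarrow> (G has_real_derivative G1 r) (at r)) \<and>
    (\<forall>r. \<bar>r\<bar> < 2 * L - a \<longrightarrow> (G1 has_real_derivative G2 r) (at r)) \<and>
    (\<forall>r. 0 < r \<and> r < 2 * L - a \<longrightarrow> G2 r + G1 r / r = (\<beta>\<^sup>2 * r\<^sup>2 / 4 - \<Lambda>) * G r)"
proof -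
  define R where "R = 2 * L - a"
  define k where "k = \<beta> * L"
  define s where "s = (\<lambda>r \<theta>. r\<^sup>2 - 4 * L * r * cos \<theta> + 4 * L\<^sup>2)"
  define C where "C = (\<lambda>r \<theta>. cos (k * r * sin \<theta>))"
  define S where "S = (\<lambda>r \<theta>. sin (k * r * sin \<theta>))"
  define D where "D = (\<lambda>r \<theta>. F (s r \<theta>) * C r \<theta>)"
  define Dr where "Dr = (\<lambda>r \<theta>. F1 (s r \<theta>) * (2 * r - 4 * L * cos \<theta>) * C r \<theta> - F (s r \<theta>) * (k * sin \<theta>) * S r \<theta>)"
  define Drr where "Drr = (\<lambda>r \<theta>. F2 (s r \<theta>) * (2 * r - 4 * L * cos \<theta>)\<^sup>2 * C r \<theta> + 2 * F1 (s r \<theta>) * C r \<theta>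
     - 2 * F1 (s r \<theta>) * (2 * r - 4 * L * cos \<theta>) * (k * sin \<theta>) * S r \<theta> - F (s r \<theta>) * (k * sin \<theta>)\<^sup>2 * C r \<theta>)"
  \<comment> \<open>The angular derivative of \<open>D\<close>, plus \<beta> r^2 times F S, where F
    S is the sine counterpart of \<open>D\<close>: the first-order magnetic term couples the cosine
    part to the angular derivative of the sine part.\<close>
  define E where "E = (\<lambda>r \<theta>. F1 (s r \<theta>) * (4 * L * r * sin \<theta>) * C r \<theta> - F (s r \<theta>) * (k * r * cos \<theta>) * S r \<theta>
     + \<beta> * r\<^sup>2 * (F (s r \<theta>) * S r \<theta>))"
  have L: "L > 0" using a by simp
  \<comment> \<open>Circles of radius less than 2L - a around the origin stay outside the disc of
    radius a around (2L, 0), so only the free equation is used.\<close>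
  have sgt: "s r \<theta> > a\<^sup>2" if r: "\<bar>r\<bar> < R" for r \<theta>
  proof -
    have "\<bar>r * cos \<theta>\<bar> \<le> \<bar>r\<bar> * 1" unfolding abs_mult by (intro mult_left_mono) auto
    then have "r * cos \<theta> \<le> \<bar>r\<bar>" by linarith
    then have "4 * L * (r * cos \<theta>) \<le> 4 * L * \<bar>r\<bar>" using L by (intro mult_left_mono) auto
    then have "(2 * L - \<bar>r\<bar>)\<^sup>2 \<le> s r \<theta>" unfolding s_def by (simp add: power2_eq_square algebra_simps)
    moreover have "a\<^sup>2 < (2 * L - \<bar>r\<bar>)\<^sup>2" using r a unfolding R_def by (intro power_strict_mono) auto
    ultimately show ?thesis by linarith
  qed
  have cF: "continuous_on {a\<^sup>2<..} F" "continuous_on {a\<^sup>2<..} F1"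
    using d1 d2 by (auto intro!: continuous_at_imp_continuous_on intro: DERIV_isCont)
  \<comment> \<open>Differentiation under the integral needs a continuous second derivative; the
    equation itself expresses it through F and F', as s > 0 here.\<close>
  have cF2: "continuous_on {a\<^sup>2<..} F2"
  proof -
    have c: "continuous_on {a\<^sup>2<..} (\<lambda>s. ((\<beta>\<^sup>2 * s / 4 - \<Lambda>) * F s - 4 * F1 s) / (4 * s))"
      by (intro continuous_intros cF) (use zero_le_power2[of a] in \<open>auto simp del: zero_le_power2\<close>)
    have e: "F2 s = ((\<beta>\<^sup>2 * s / 4 - \<Lambda>) * F s - 4 * F1 s) / (4 * s)" if "s > a\<^sup>2" for s
    proof -
      have "s > 0" using that zero_le_power2[of a] by linarith
      then show ?thesis using ode[OF that] by (simp add: field_simps)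
    qed
    show ?thesis by (rule continuous_on_eq[OF c]) (use e in simp)
  qed
  have cs: "continuous_on UNIV (\<lambda>(r, \<theta>). s r \<theta>)" "continuous_on UNIV (\<lambda>(r, \<theta>). C r \<theta>)" "continuous_on UNIV (\<lambda>(r, \<theta>). S r \<theta>)"
    unfolding s_def C_def S_def split_beta by (intro continuous_intros)+
  define U where "U = {-R<..<R}"
  have comp: "continuous_on (U \<times> T) (\<lambda>x. H (s (fst x) (snd x)))" if "continuous_on {a\<^sup>2<..} H" for H :: "real \<Rightarrow> real" and T :: "real set"
    by (rule continuous_on_compose2[OF that continuous_on_subset[OF cs(1)[unfolded split_beta]]])
       (use sgt in \<open>auto simp: U_def abs_less_iff\<close>)
  have CS: "continuous_on A (\<lambda>x. C (fst x) (snd x))" "continuous_on A (\<lambda>x. S (fst x) (snd x))" for A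
    using continuous_on_subset[OF cs(2)[unfolded split_beta]] continuous_on_subset[OF cs(3)[unfolded split_beta]] by auto
  have cD: "continuous_on (U \<times> T) (\<lambda>(r, \<theta>). D r \<theta>)" for T
    unfolding D_def split_beta by (intro continuous_intros comp cF CS)
  have cDr: "continuous_on (U \<times> T) (\<lambda>(r, \<theta>). Dr r \<theta>)" for T
    unfolding Dr_def split_beta by (intro continuous_intros comp cF CS)
  have cDrr: "continuous_on (U \<times> T) (\<lambda>(r, \<theta>). Drr r \<theta>)" for T
    unfolding Drr_def split_beta by (intro continuous_intros comp cF cF2 CS)
  have slice: "continuous_on T (H r)" if "continuous_on (U \<times> T) (\<lambda>(r, \<theta>). H r \<theta>)" "r \<in> U" for H :: "real \<Rightarrow> real \<Rightarrow> real" and T r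
  proof -
    have "continuous_on T (\<lambda>\<theta>. (r, \<theta>))" by (intro continuous_intros)
    from continuous_on_compose2[OF that(1) this] that(2) show ?thesis by auto
  qed
  have sr: "((\<lambda>r. s r \<theta>) has_real_derivative 2 * r - 4 * L * cos \<theta>) (at r)" for r \<theta>
    unfolding s_def by (auto intro!: derivative_eq_intros)
  have Cr: "((\<lambda>r. C r \<theta>) has_real_derivative - (k * sin \<theta>) * S r \<theta>) (at r)"
    and Sr: "((\<lambda>r. S r \<theta>) has_real_derivative (k * sin \<theta>) * C r \<theta>) (at r)" for r \<theta>
    unfolding C_def S_def by (auto intro!: derivative_eq_intros simp: mult_ac)
  have s\<theta>: "(s r has_real_derivative 4 * L * r * sin \<theta>) (at \<theta>)" for r \<theta>
    unfolding s_def by (auto intro!: derivative_eq_intros)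
  have C\<theta>: "(C r has_real_derivative - (k * r * cos \<theta>) * S r \<theta>) (at \<theta>)"
    and S\<theta>: "(S r has_real_derivative (k * r * cos \<theta>) * C r \<theta>) (at \<theta>)" for r \<theta>
    unfolding C_def S_def by (auto intro!: derivative_eq_intros)
  have Ur: "\<bar>r\<bar> < R" if "r \<in> U" for r using that by (auto simp: U_def abs_less_iff)
  have dD: "((\<lambda>r. D r \<theta>) has_real_derivative Dr r \<theta>) (at r)" if r: "\<bar>r\<bar> < R" for r \<theta>
  proof -
    note dF = DERIV_chain2[OF d1[OF sgt[OF r]] sr]
    show ?thesis unfolding D_def Dr_def
      by (rule DERIV_cong[OF DERIV_mult[OF dF Cr]]) (simp add: algebra_simps)
  qed
  have dDr: "((\<lambda>r. Dr r \<theta>) has_real_derivative Drr r \<theta>) (at r)" if r: "\<bar>r\<bar> < R" for r \<theta>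
  proof -
    note dF = DERIV_chain2[OF d1[OF sgt[OF r]] sr] and dF1 = DERIV_chain2[OF d2[OF sgt[OF r]] sr]
    have l: "((\<lambda>r. 2 * r - 4 * L * cos \<theta>) has_real_derivative 2) (at r)" by (auto intro!: derivative_eq_intros)
    have "((\<lambda>r. Dr r \<theta>) has_real_derivative
       ((F2 (s r \<theta>) * (2 * r - 4 * L * cos \<theta>)) * (2 * r - 4 * L * cos \<theta>) + 2 * F1 (s r \<theta>)) * C r \<theta>
        + (- (k * sin \<theta>) * S r \<theta>) * (F1 (s r \<theta>) * (2 * r - 4 * L * cos \<theta>))
        - ((F1 (s r \<theta>) * (2 * r - 4 * L * cos \<theta>)) * (k * sin \<theta>) * S r \<theta> + ((k * sin \<theta>) * C r \<theta>) * (F (s r \<theta>) * (k * sin \<theta>)))) (at r)"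
      unfolding Dr_def
      by (rule DERIV_diff[OF DERIV_mult[OF DERIV_mult[OF dF1 l] Cr] DERIV_mult[OF DERIV_cmult_right[OF dF] Sr]])
    then show ?thesis
      by (rule DERIV_cong) (simp add: Drr_def algebra_simps power2_eq_square)
  qed
  define G1 where "G1 = (\<lambda>r. integral {0..2 * pi} (Dr r) / (2 * pi))"
  define G2 where "G2 = (\<lambda>r. integral {0..2 * pi} (Drr r) / (2 * pi))"
  have oU: "open U" "convex U" unfolding U_def by auto
  have Gdef: "G = (\<lambda>r. integral {0..2 * pi} (D r) / (2 * pi))"
    unfolding G_def circle_average_def D_def s_def C_def k_def by (simp add: fun_eq_iff)
  have dG: "(G has_real_derivative G1 r) (at r)" if r: "\<bar>r\<bar> < R" for r
  proof -
    have rU: "r \<in> U" using r by (auto simp: U_def abs_less_iff)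
    have "((\<lambda>x. integral (cbox 0 (2 * pi)) (D x)) has_field_derivative integral (cbox 0 (2 * pi)) (Dr r)) (at r within U)"
    proof (rule leibniz_rule_field_derivative[OF _ _ cDr rU oU(2)])
      show "((\<lambda>x. D x t) has_real_derivative Dr x t) (at x within U)" if "x \<in> U" for x t
        using dD[OF Ur[OF that]] by (rule has_field_derivative_at_within)
      show "D x integrable_on cbox 0 (2 * pi)" if "x \<in> U" for x
        by (rule integrable_continuous) (rule slice[OF cD that])
    qed
    then have "((\<lambda>x. integral {0..2 * pi} (D x)) has_real_derivative integral {0..2 * pi} (Dr r)) (at r)"
      using at_within_open[OF rU oU(1)] by simp
    from DERIV_cdivide[OF this, of "2 * pi"] show ?thesis unfolding Gdef G1_def .
  qed
  have dG1: "(G1 has_real_derivative G2 r) (at r)" if r: "\<bar>r\<bar> < R" for r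
  proof -
    have rU: "r \<in> U" using r by (auto simp: U_def abs_less_iff)
    have "((\<lambda>x. integral (cbox 0 (2 * pi)) (Dr x)) has_field_derivative integral (cbox 0 (2 * pi)) (Drr r)) (at r within U)"
    proof (rule leibniz_rule_field_derivative[OF _ _ cDrr rU oU(2)])
      show "((\<lambda>x. Dr x t) has_real_derivative Drr x t) (at x within U)" if "x \<in> U" for x t
        using dDr[OF Ur[OF that]] by (rule has_field_derivative_at_within)
      show "Dr x integrable_on cbox 0 (2 * pi)" if "x \<in> U" for x
        by (rule integrable_continuous) (rule slice[OF cDr that])
    qed
    then have "((\<lambda>x. integral {0..2 * pi} (Dr x)) has_real_derivative integral {0..2 * pi} (Drr r)) (at r)"
      using at_within_open[OF rU oU(1)] by simp
    from DERIV_cdivide[OF this, of "2 * pi"] show ?thesis unfolding G1_def G2_def .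
  qed
  \<comment> \<open>The two sides differ by a combination, with explicit cofactors, of the free
    equation at s and of sin^2 + cos^2 = 1.\<close>
  have ident: "F2 * (4 * L * r * t)\<^sup>2 * CC + F1 * (4 * L * r * c) * CC - 2 * F1 * (4 * L * r * t) * (k * r * c) * SS
        - F * (k * r * c)\<^sup>2 * CC + F * (k * r * t) * SS + \<beta> * r\<^sup>2 * (F1 * (4 * L * r * t) * SS + F * (k * r * c) * CC) =
      r\<^sup>2 * (\<beta>\<^sup>2 * r\<^sup>2 / 4 - \<Lambda>) * (F * CC)
      - r\<^sup>2 * (F2 * (2 * r - 4 * L * c)\<^sup>2 * CC + 2 * F1 * CC - 2 * F1 * (2 * r - 4 * L * c) * (k * t) * SS - F * (k * t)\<^sup>2 * CC)
      - r * (F1 * (2 * r - 4 * L * c) * CC - F * (k * t) * SS)"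
    if o: "4 * (r\<^sup>2 - 4 * L * r * c + 4 * L\<^sup>2) * F2 + 4 * F1 = (\<beta>\<^sup>2 * (r\<^sup>2 - 4 * L * r * c + 4 * L\<^sup>2) / 4 - \<Lambda>) * F"
      and sc: "t\<^sup>2 + c\<^sup>2 = 1" for F F1 F2 CC SS r t c :: real
  proof -
    have t2: "t\<^sup>2 = 1 - c\<^sup>2" using sc by simp
    have "F2 * (4 * L * r * t)\<^sup>2 * CC + F1 * (4 * L * r * c) * CC - 2 * F1 * (4 * L * r * t) * (k * r * c) * SS
        - F * (k * r * c)\<^sup>2 * CC + F * (k * r * t) * SS + \<beta> * r\<^sup>2 * (F1 * (4 * L * r * t) * SS + F * (k * r * c) * CC)
        - (r\<^sup>2 * (\<beta>\<^sup>2 * r\<^sup>2 / 4 - \<Lambda>) * (F * CC)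
      - r\<^sup>2 * (F2 * (2 * r - 4 * L * c)\<^sup>2 * CC + 2 * F1 * CC - 2 * F1 * (2 * r - 4 * L * c) * (k * t) * SS - F * (k * t)\<^sup>2 * CC)
      - r * (F1 * (2 * r - 4 * L * c) * CC - F * (k * t) * SS)) =
      r\<^sup>2 * CC * (4 * (r\<^sup>2 - 4 * L * r * c + 4 * L\<^sup>2) * F2 + 4 * F1 - (\<beta>\<^sup>2 * (r\<^sup>2 - 4 * L * r * c + 4 * L\<^sup>2) / 4 - \<Lambda>) * F)
      + (t\<^sup>2 + c\<^sup>2 - 1) * (16 * L\<^sup>2 * r\<^sup>2 * F2 * CC - r\<^sup>2 * k\<^sup>2 * F * CC)"
      unfolding k_def by (simp add: field_simps power2_eq_square)
    then show ?thesis using o sc by simp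
  qed
  have ode': "G2 r + G1 r / r = (\<beta>\<^sup>2 * r\<^sup>2 / 4 - \<Lambda>) * G r" if r: "0 < r" "r < R" for r
  proof -
    have rU: "r \<in> U" using r by (auto simp: U_def)
    have ra: "\<bar>r\<bar> < R" using r by simp
    let ?q = "\<beta>\<^sup>2 * r\<^sup>2 / 4 - \<Lambda>"
    have dE: "(E r has_real_derivative r\<^sup>2 * ?q * D r \<theta> - r\<^sup>2 * Drr r \<theta> - r * Dr r \<theta>) (at \<theta>)" for \<theta>
    proof -
      note dF = DERIV_chain2[OF d1[OF sgt[OF ra]] s\<theta>] and dF1 = DERIV_chain2[OF d2[OF sgt[OF ra]] s\<theta>]
      have st: "((\<lambda>\<theta>. 4 * L * r * sin \<theta>) has_real_derivative 4 * L * r * cos \<theta>) (at \<theta>)"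
        and ct: "((\<lambda>\<theta>. k * r * cos \<theta>) has_real_derivative - (k * r * sin \<theta>)) (at \<theta>)" by (auto intro!: derivative_eq_intros)
      have "(E r has_real_derivative
          ((F2 (s r \<theta>) * (4 * L * r * sin \<theta>)) * (4 * L * r * sin \<theta>) + (4 * L * r * cos \<theta>) * F1 (s r \<theta>)) * C r \<theta>
          + (- (k * r * cos \<theta>) * S r \<theta>) * (F1 (s r \<theta>) * (4 * L * r * sin \<theta>))
          - (((F1 (s r \<theta>) * (4 * L * r * sin \<theta>)) * (k * r * cos \<theta>) + (- (k * r * sin \<theta>)) * F (s r \<theta>)) * S r \<theta>
             + ((k * r * cos \<theta>) * C r \<theta>) * (F (s r \<theta>) * (k * r * cos \<theta>)))
          + \<beta> * r\<^sup>2 * ((F1 (s r \<theta>) * (4 * L * r * sin \<theta>)) * S r \<theta> + ((k * r * cos \<theta>) * C r \<theta>) * F (s r \<theta>))) (at \<theta>)"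
        unfolding E_def
        by (rule DERIV_add[OF DERIV_diff[OF DERIV_mult[OF DERIV_mult[OF dF1 st] C\<theta>] DERIV_mult[OF DERIV_mult[OF dF ct] S\<theta>]]
              DERIV_cmult[OF DERIV_mult[OF dF S\<theta>]]])
      then show ?thesis
      proof (rule DERIV_cong)
        have o: "4 * (r\<^sup>2 - 4 * L * r * cos \<theta> + 4 * L\<^sup>2) * F2 (s r \<theta>) + 4 * F1 (s r \<theta>) = (\<beta>\<^sup>2 * (r\<^sup>2 - 4 * L * r * cos \<theta> + 4 * L\<^sup>2) / 4 - \<Lambda>) * F (s r \<theta>)"
          using ode[OF sgt[OF ra, of \<theta>]] by (simp add: s_def)
        show "((F2 (s r \<theta>) * (4 * L * r * sin \<theta>)) * (4 * L * r * sin \<theta>) + (4 * L * r * cos \<theta>) * F1 (s r \<theta>)) * C r \<theta>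
          + (- (k * r * cos \<theta>) * S r \<theta>) * (F1 (s r \<theta>) * (4 * L * r * sin \<theta>))
          - (((F1 (s r \<theta>) * (4 * L * r * sin \<theta>)) * (k * r * cos \<theta>) + (- (k * r * sin \<theta>)) * F (s r \<theta>)) * S r \<theta>
             + ((k * r * cos \<theta>) * C r \<theta>) * (F (s r \<theta>) * (k * r * cos \<theta>)))
          + \<beta> * r\<^sup>2 * ((F1 (s r \<theta>) * (4 * L * r * sin \<theta>)) * S r \<theta> + ((k * r * cos \<theta>) * C r \<theta>) * F (s r \<theta>)) =
          r\<^sup>2 * ?q * D r \<theta> - r\<^sup>2 * Drr r \<theta> - r * Dr r \<theta>"
          unfolding D_def Drr_def Dr_def ident[OF o sin_cos_squared_add, of "C r \<theta>" "S r \<theta>", symmetric]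
          by (simp add: algebra_simps power2_eq_square)
      qed
    qed
    have "((\<lambda>\<theta>. r\<^sup>2 * ?q * D r \<theta> - r\<^sup>2 * Drr r \<theta> - r * Dr r \<theta>) has_integral (E r (2 * pi) - E r 0)) {0..2 * pi}"
      by (rule fundamental_theorem_of_calculus)
        (auto intro!: has_field_derivative_at_within[OF dE] simp: has_real_derivative_iff_has_vector_derivative[symmetric])
    moreover have "E r (2 * pi) - E r 0 = 0" by (simp add: E_def s_def C_def S_def)
    ultimately have "integral {0..2 * pi} (\<lambda>\<theta>. r\<^sup>2 * ?q * D r \<theta> - r\<^sup>2 * Drr r \<theta> - r * Dr r \<theta>) = 0"
      by (simp add: integral_unique)
    moreover have iD: "D r integrable_on {0..2 * pi}" "Dr r integrable_on {0..2 * pi}" "Drr r integrable_on {0..2 * pi}"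
      by (auto intro!: integrable_continuous_real slice[OF cD rU] slice[OF cDr rU] slice[OF cDrr rU])
    ultimately have "r\<^sup>2 * ?q * integral {0..2 * pi} (D r) - r\<^sup>2 * integral {0..2 * pi} (Drr r) - r * integral {0..2 * pi} (Dr r) = 0"
      by (simp add: Henstock_Kurzweil_Integration.integral_diff integrable_diff integrable_on_mult_right)
    then have "(r\<^sup>2 * ?q * integral {0..2 * pi} (D r) - r\<^sup>2 * integral {0..2 * pi} (Drr r) - r * integral {0..2 * pi} (Dr r)) / (2 * pi) = 0" by simp
    then have z: "r\<^sup>2 * ?q * G r - r\<^sup>2 * G2 r - r * G1 r = 0"
      unfolding Gdef G1_def G2_def by (simp add: diff_divide_distrib)
    have "r\<^sup>2 * (?q * G r) = r\<^sup>2 * (G2 r + G1 r / r)"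
      using z r by (simp add: field_simps power2_eq_square)
    then show ?thesis using r by simp
  qed
  show ?thesis
    by (intro exI[of _ G1] exI[of _ G2] conjI allI impI) (use dG dG1 ode' in \<open>auto simp: R_def\<close>)
qed

subsection \<open>Upper bound on the bottom of the spectrum\<close>

text \<open>Smoothness and bounded support bound every radial derivative of v globally, and evenness
  kills the first and third at 0, so the Taylor bounds follow by integrating a bound on the fourth
  derivative downwards. The lower constant B/2 uses only v >= v(0).\<close>

lemma well_potential_of_radial:
  fixes v :: "real \<times> real \<Rightarrow> real" and B a :: real
  assumes sm: "smooth2 v" and rad: "radial v" and B: "B > 0"
    and min: "\<forall>p. v (0, 0) \<le> v p" and a: "\<And>p. norm p > a \<Longrightarrow> v p = 0"
    and nd: "pd [True, True] v (0, 0) > 0"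
  shows "\<exists>K. well_potential (\<lambda>r. B\<^sup>2 * r\<^sup>2 / 4 + v (r, 0) - v (0, 0)) (\<lambda>r. B\<^sup>2 * r / 2 + pd [True] v (r, 0))
     (\<lambda>r. B\<^sup>2 / 2 + pd [True, True] v (r, 0)) (sqrt (B\<^sup>2 / 4 + pd [True, True] v (0, 0) / 2)) (B / 2) K"
proof -
  define D where "D = (\<lambda>n r. pd (replicate n True) v (r, 0))"
  have dD: "(D n has_real_derivative D (Suc n) r) (at r)" for n r
    using smooth2_dx_real[OF sm, of "replicate n True" 0 r] by (simp add: D_def)
  have D0: "D 0 r = v (r, 0)" for r by (simp add: D_def)
  have even: "D n (- r) = (-1) ^ n * D n r" for n r
  proof (induction n arbitrary: r)
    case 0
    then show ?case using radial_even[OF rad] by (simp add: D0)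
  next
    case (Suc n)
    have "D (Suc n) (- r) = - ((-1) ^ n) * D (Suc n) r"
      by (rule deriv_of_parity[OF _ dD]) (rule Suc)
    then show ?case by simp
  qed
  have supp: "D n r = 0" if "\<bar>r\<bar> > a" for n r
    using that
  proof (induction n arbitrary: r)
    case 0
    then show ?case using a[of "(r, 0)"] by (simp add: D0 norm_prod_def)
  next
    case (Suc n)
    have "(D n has_real_derivative 0) (at r)"
    proof (rule has_field_derivative_transform_within_open[where f = "\<lambda>_. 0" and S = "{r. \<bar>r\<bar> > a}"])
      show "open {r::real. \<bar>r\<bar> > a}" by (intro open_Collect_less continuous_intros)
    qed (use Suc in auto)
    then show ?case using dD[of n r] DERIV_unique by blast
  qed
  have bdd: "\<exists>M > 0. \<forall>r. \<bar>D n r\<bar> \<le> M" for n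
  proof -
    have "continuous_on {-a..a} (D n)"
      using dD[of n] by (auto intro!: continuous_at_imp_continuous_on DERIV_isCont)
    then have "bounded (D n ` {-a..a})" by (intro compact_imp_bounded compact_continuous_image) auto
    then obtain M where M: "M > 0" "\<forall>y \<in> D n ` {-a..a}. norm y \<le> M" unfolding bounded_pos by blast
    have "\<bar>D n r\<bar> \<le> M" for r
    proof (cases "\<bar>r\<bar> > a")
      case True
      then show ?thesis using supp M by simp
    next
      case False
      then have "r \<in> {-a..a}" by auto
      then show ?thesis using M(2) by auto
    qed
    then show ?thesis using M(1) by blast
  qed
  obtain M2 where M2: "M2 > 0" "\<And>r. \<bar>D 2 r\<bar> \<le> M2" using bdd by blast
  obtain M4 where M4: "M4 > 0" "\<And>r. \<bar>D 4 r\<bar> \<le> M4" using bdd by blast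
  have odd0: "D (Suc (2 * n)) 0 = 0" for n using even[of "Suc (2 * n)" 0] by simp
  have D10: "D 1 0 = 0" "D 3 0 = 0" using odd0[of 0] odd0[of 1] by (simp_all add: numeral_3_eq_3)
  have cD: "continuous_on A (D n)" for A n
    using dD[of n] by (auto intro!: continuous_at_imp_continuous_on DERIV_isCont)
  have dD2: "(D 1 has_real_derivative D 2 r) (at r)" "(D 2 has_real_derivative D 3 r) (at r)" "(D 3 has_real_derivative D 4 r) (at r)"
    "(D 0 has_real_derivative D 1 r) (at r)" for r
    using dD[of 1 r] dD[of 2 r] dD[of 3 r] dD[of 0 r] by (simp_all add: numeral_2_eq_2 numeral_3_eq_3 eval_nat_numeral)
  have t3: "\<bar>D 3 r\<bar> \<le> M4 * r" if r: "r \<ge> 0" for r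
  proof -
    have "\<bar>D 3 r - D 3 0\<bar> \<le> M4 * r - M4 * 0"
      by (rule abs_diff_le_by_derivs[OF r, where f' = "D 4" and G' = "\<lambda>_. M4"])
        (use M4 dD2 in \<open>auto intro!: continuous_intros cD derivative_eq_intros\<close>)
    then show ?thesis using D10 by simp
  qed
  have t2: "\<bar>D 2 r - D 2 0\<bar> \<le> M4 * r\<^sup>2" if r: "r \<ge> 0" for r
  proof -
    have "\<bar>D 2 r - D 2 0\<bar> \<le> M4 * r\<^sup>2 / 2 - M4 * 0\<^sup>2 / 2"
      by (rule abs_diff_le_by_derivs[OF r, where f' = "D 3" and G' = "\<lambda>r. M4 * r"])
        (use dD2 t3 in \<open>auto intro!: continuous_intros cD derivative_eq_intros\<close>)
    moreover have "M4 * r\<^sup>2 \<ge> 0" using M4 by simp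
    ultimately show ?thesis by simp
  qed
  have t1: "\<bar>D 1 r - D 2 0 * r\<bar> \<le> M4 * r ^ 3" if r: "r \<ge> 0" for r
  proof -
    have "\<bar>(D 1 r - D 2 0 * r) - (D 1 0 - D 2 0 * 0)\<bar> \<le> M4 * r ^ 3 / 3 - M4 * 0 ^ 3 / 3"
    proof (rule abs_diff_le_by_derivs[OF r, where f' = "\<lambda>r. D 2 r - D 2 0" and G' = "\<lambda>r. M4 * r\<^sup>2"])
      show "((\<lambda>r. D 1 r - D 2 0 * r) has_real_derivative D 2 x - D 2 0) (at x)" for x
        using dD2(1)[of x] by (auto intro!: derivative_eq_intros)
    qed (use t2 in \<open>auto intro!: continuous_intros cD derivative_eq_intros\<close>)
    moreover have "M4 * r ^ 3 \<ge> 0" using M4 r by simp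
    ultimately show ?thesis using D10 by simp
  qed
  have t0: "\<bar>D 0 r - D 0 0 - D 2 0 * r\<^sup>2 / 2\<bar> \<le> M4 * r ^ 4" if r: "r \<ge> 0" for r
  proof -
    have "\<bar>(D 0 r - D 2 0 * r\<^sup>2 / 2) - (D 0 0 - D 2 0 * 0\<^sup>2 / 2)\<bar> \<le> M4 * r ^ 4 / 4 - M4 * 0 ^ 4 / 4"
    proof (rule abs_diff_le_by_derivs[OF r, where f' = "\<lambda>r. D 1 r - D 2 0 * r" and G' = "\<lambda>r. M4 * r ^ 3"])
      show "((\<lambda>r. D 0 r - D 2 0 * r\<^sup>2 / 2) has_real_derivative D 1 x - D 2 0 * x) (at x)" for x
        using dD2(4)[of x] by (auto intro!: derivative_eq_intros)
    qed (use t1 in \<open>auto intro!: continuous_intros cD derivative_eq_intros\<close>)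
    then have "\<bar>D 0 r - D 2 0 * r\<^sup>2 / 2 - D 0 0\<bar> \<le> M4 * r ^ 4 / 4" by simp
    moreover have "D 0 r - D 0 0 - D 2 0 * r\<^sup>2 / 2 = D 0 r - D 2 0 * r\<^sup>2 / 2 - D 0 0" by simp
    moreover have "M4 * r ^ 4 \<ge> 0" using M4 r by simp
    ultimately show ?thesis by linarith
  qed
  have b1: "\<bar>D 1 r\<bar> \<le> M2 * r" if r: "r \<ge> 0" for r
  proof -
    have "\<bar>D 1 r - D 1 0\<bar> \<le> M2 * r - M2 * 0"
      by (rule abs_diff_le_by_derivs[OF r, where f' = "D 2" and G' = "\<lambda>_. M2"])
        (use M2 dD2 in \<open>auto intro!: continuous_intros cD derivative_eq_intros\<close>)
    then show ?thesis using D10 by simp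
  qed
  have b0': "\<bar>D 0 r - D 0 0\<bar> \<le> M2 * r\<^sup>2" if r: "r \<ge> 0" for r
  proof -
    have "\<bar>D 0 r - D 0 0\<bar> \<le> M2 * r\<^sup>2 / 2 - M2 * 0\<^sup>2 / 2"
      by (rule abs_diff_le_by_derivs[OF r, where f' = "D 1" and G' = "\<lambda>r. M2 * r"])
        (use b1 dD2 in \<open>auto intro!: continuous_intros cD derivative_eq_intros\<close>)
    moreover have "M2 * r\<^sup>2 \<ge> 0" using M2 by simp
    ultimately show ?thesis by simp
  qed
  have b0: "\<bar>D 0 r - D 0 0\<bar> \<le> M2 * r\<^sup>2" for r
    using b0'[of r] b0'[of "- r"] even[of 0 r] by (cases "r \<ge> 0") auto
  define \<omega> where "\<omega> = sqrt (B\<^sup>2 / 4 + D 2 0 / 2)"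
  have D20: "D 2 0 > 0" using nd by (simp add: D_def numeral_2_eq_2)
  have w2: "\<omega>\<^sup>2 = B\<^sup>2 / 4 + D 2 0 / 2" unfolding \<omega>_def using D20 by simp
  define K where "K = B\<^sup>2 + M2 + M4"
  have "well_potential (\<lambda>r. B\<^sup>2 * r\<^sup>2 / 4 + D 0 r - D 0 0) (\<lambda>r. B\<^sup>2 * r / 2 + D 1 r) (\<lambda>r. B\<^sup>2 / 2 + D 2 r) \<omega> (B / 2) K"
  proof
    show "((\<lambda>r. B\<^sup>2 * r\<^sup>2 / 4 + D 0 r - D 0 0) has_real_derivative B\<^sup>2 * r / 2 + D 1 r) (at r)" for r
      using dD2(4)[of r] by (auto intro!: derivative_eq_intros)
    show "((\<lambda>r. B\<^sup>2 * r / 2 + D 1 r) has_real_derivative B\<^sup>2 / 2 + D 2 r) (at r)" for r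
      using dD2(1)[of r] by (auto intro!: derivative_eq_intros)
    show "\<omega> > 0" unfolding \<omega>_def using D20 by (simp add: add_nonneg_pos)
    show "B / 2 > 0" using B by simp
    show "K > 0" using B M2 M4 by (simp add: K_def add_pos_pos)
    show "(B / 2)\<^sup>2 * r\<^sup>2 \<le> B\<^sup>2 * r\<^sup>2 / 4 + D 0 r - D 0 0" for r
      using min by (simp add: D0 power2_eq_square)
    show "B\<^sup>2 * r\<^sup>2 / 4 + D 0 r - D 0 0 \<le> K * r\<^sup>2" for r
    proof -
      have "K * r\<^sup>2 = B\<^sup>2 * r\<^sup>2 + M2 * r\<^sup>2 + M4 * r\<^sup>2" by (simp add: K_def algebra_simps)
      moreover have "B\<^sup>2 * r\<^sup>2 \<ge> 0" "M4 * r\<^sup>2 \<ge> 0" using M4 by auto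
      ultimately show ?thesis using b0[of r] by linarith
    qed
    show "\<bar>B\<^sup>2 * r / 2 + D 1 r\<bar> \<le> K * r" if "r \<ge> 0" for r
    proof -
      have "K * r = B\<^sup>2 * r + M2 * r + M4 * r" by (simp add: K_def algebra_simps)
      moreover have "B\<^sup>2 * r \<ge> 0" "M4 * r \<ge> 0" using M4 that by auto
      ultimately show ?thesis using b1[OF that] by linarith
    qed
    show "\<bar>B\<^sup>2 * r\<^sup>2 / 4 + D 0 r - D 0 0 - \<omega>\<^sup>2 * r\<^sup>2\<bar> \<le> K * r ^ 4" if "r \<ge> 0" for r
    proof -
      have "B\<^sup>2 * r\<^sup>2 / 4 + D 0 r - D 0 0 - \<omega>\<^sup>2 * r\<^sup>2 = D 0 r - D 0 0 - D 2 0 * r\<^sup>2 / 2"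
        unfolding w2 by (simp add: algebra_simps)
      moreover have "M4 * r ^ 4 \<le> K * r ^ 4" using M2 that unfolding K_def by (intro mult_right_mono) auto
      ultimately show ?thesis using t0[OF that] by linarith
    qed
    show "\<bar>B\<^sup>2 * r / 2 + D 1 r - 2 * \<omega>\<^sup>2 * r\<bar> \<le> K * r ^ 3" if "r \<ge> 0" for r
    proof -
      have "B\<^sup>2 * r / 2 + D 1 r - 2 * \<omega>\<^sup>2 * r = D 1 r - D 2 0 * r"
        unfolding w2 by (simp add: algebra_simps)
      moreover have "M4 * r ^ 3 \<le> K * r ^ 3" using M2 that unfolding K_def by (intro mult_right_mono) auto
      ultimately show ?thesis using t1[OF that] by linarith
    qed
    show "\<bar>B\<^sup>2 / 2 + D 2 r - 2 * \<omega>\<^sup>2\<bar> \<le> K * r\<^sup>2" if "r \<ge> 0" for r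
    proof -
      have "B\<^sup>2 / 2 + D 2 r - 2 * \<omega>\<^sup>2 = D 2 r - D 2 0"
        unfolding w2 by (simp add: algebra_simps)
      moreover have "M4 * r\<^sup>2 \<le> K * r\<^sup>2" using M2 that unfolding K_def by (intro mult_right_mono) auto
      ultimately show ?thesis using t2[OF that] by linarith
    qed
  qed
  then have "\<exists>K. well_potential (\<lambda>r. B\<^sup>2 * r\<^sup>2 / 4 + D 0 r - D 0 0) (\<lambda>r. B\<^sup>2 * r / 2 + D 1 r) (\<lambda>r. B\<^sup>2 / 2 + D 2 r) \<omega> (B / 2) K" by blast
  then show ?thesis by (simp add: D_def \<omega>_def numeral_2_eq_2)
qed

section \<open>Smoothness of the product of a smooth function with a Gaussian\<close>

lemma smooth2_by_closure:
  fixes f :: "real \<times> real \<Rightarrow> real"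
  assumes "f \<in> S"
    and c: "\<And>g. g \<in> S \<Longrightarrow> continuous_on UNIV g"
    and x: "\<And>g. g \<in> S \<Longrightarrow> \<exists>gx \<in> S. \<forall>x y. ((\<lambda>t. g (t, y)) has_real_derivative gx (x, y)) (at x)"
    and y: "\<And>g. g \<in> S \<Longrightarrow> \<exists>gy \<in> S. \<forall>x y. ((\<lambda>t. g (x, t)) has_real_derivative gy (x, y)) (at y)"
  shows "smooth2 f"
proof -
  have px: "pdx g \<in> S" if "g \<in> S" for g
  proof -
    obtain gx where gx: "gx \<in> S" "\<And>x y. ((\<lambda>t. g (t, y)) has_real_derivative gx (x, y)) (at x)" using x[OF \<open>g \<in> S\<close>] by blast
    have "pdx g = gx"
      unfolding pdx_def using gx(2) by (auto simp: fun_eq_iff has_real_derivative_iff_has_vector_derivative intro!: vector_derivative_at)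
    then show ?thesis using gx(1) by simp
  qed
  have py: "pdy g \<in> S" if "g \<in> S" for g
  proof -
    obtain gy where gy: "gy \<in> S" "\<And>x y. ((\<lambda>t. g (x, t)) has_real_derivative gy (x, y)) (at y)" using y[OF \<open>g \<in> S\<close>] by blast
    have "pdy g = gy"
      unfolding pdy_def using gy(2) by (auto simp: fun_eq_iff has_real_derivative_iff_has_vector_derivative intro!: vector_derivative_at)
    then show ?thesis using gy(1) by simp
  qed
  have S: "pd bs f \<in> S" for bs by (induction bs) (auto simp: assms(1) px py)
  show ?thesis unfolding smooth2_def
  proof (intro allI conjI)
    fix bs p
    show "continuous_on UNIV (pd bs f)" by (rule c[OF S])
    show "(\<lambda>t. pd bs f (t, snd p)) differentiable at (fst p)"
      using x[OF S[of bs]] by (meson real_differentiable_def)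
    show "(\<lambda>t. pd bs f (fst p, t)) differentiable at (snd p)"
      using y[OF S[of bs]] by (meson real_differentiable_def)
  qed
qed

lemma smooth2_of_real:
  fixes f :: "real \<times> real \<Rightarrow> real"
  assumes sm: "smooth2 f"
  shows "smooth2 (\<lambda>p. complex_of_real (f p))"
proof -
  have e: "pd bs (\<lambda>p. complex_of_real (f p)) = (\<lambda>p. complex_of_real (pd bs f p))" for bs
  proof (induction bs)
    case (Cons b bs)
    show ?case
    proof (cases b)
      case True
      then show ?thesis unfolding pd.simps Cons
        using pdx_eqI has_vector_derivative_complex_of_real[OF smooth2_dx_real[OF sm, of bs]] by (fastforce simp: fun_eq_iff)
    next
      case False
      then show ?thesis unfolding pd.simps Cons
        using pdy_eqI has_vector_derivative_complex_of_real[OF smooth2_dy_real[OF sm, of bs]] by (fastforce simp: fun_eq_iff)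
    qed
  qed simp
  show ?thesis unfolding smooth2_def e
  proof (intro allI conjI)
    fix bs p
    show "continuous_on UNIV (\<lambda>p. complex_of_real (pd bs f p))" by (intro continuous_intros smooth2_cont[OF sm])
    show "(\<lambda>t. complex_of_real (pd bs f (t, snd p))) differentiable at (fst p)"
      using has_vector_derivative_complex_of_real[OF smooth2_dx_real[OF sm, of bs "snd p" "fst p"]] by (rule differentiableI_vector)
    show "(\<lambda>t. complex_of_real (pd bs f (fst p, t))) differentiable at (snd p)"
      using has_vector_derivative_complex_of_real[OF smooth2_dy_real[OF sm, of bs "fst p" "snd p"]] by (rule differentiableI_vector)
  qed
qed

text \<open>All iterated partial derivatives of f times a Gaussian are sums of terms (derivative of
  f) times monomial times Gaussian. The set of such sums is closed under both partial derivatives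
  and consists of continuous functions, which is what \<open>smooth2_by_closure\<close>
  requires.\<close>

inductive_set gauss_span :: "(real \<times> real \<Rightarrow> real) \<Rightarrow> real \<Rightarrow> (real \<times> real \<Rightarrow> real) set"
  for f :: "real \<times> real \<Rightarrow> real" and k :: real where
  gauss_term: "(\<lambda>p. c * (pd bs f p * (fst p ^ i * snd p ^ j * exp (- k * ((fst p)\<^sup>2 + (snd p)\<^sup>2))))) \<in> gauss_span f k"
| gauss_add: "u \<in> gauss_span f k \<Longrightarrow> w \<in> gauss_span f k \<Longrightarrow> (\<lambda>p. u p + w p) \<in> gauss_span f k"

lemma smooth2_gauss_mult:
  fixes f :: "real \<times> real \<Rightarrow> real"
  assumes sm: "smooth2 f"
  shows "smooth2 (\<lambda>p. f p * exp (- k * ((fst p)\<^sup>2 + (snd p)\<^sup>2)))"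
proof (rule smooth2_by_closure[where S = "gauss_span f k"])
  show "(\<lambda>p. f p * exp (- k * ((fst p)\<^sup>2 + (snd p)\<^sup>2))) \<in> gauss_span f k"
    using gauss_term[of 1 "[]" f 0 0 k] by simp
  fix g assume g: "g \<in> gauss_span f k"
  show "continuous_on UNIV g" using g
    by induction (auto intro!: continuous_intros smooth2_cont[OF sm])
  show "\<exists>gx \<in> gauss_span f k. \<forall>x y. ((\<lambda>t. g (t, y)) has_real_derivative gx (x, y)) (at x)" using g
  proof induction
    case (gauss_term c bs i j)
    let ?e = "\<lambda>p. exp (- k * ((fst p)\<^sup>2 + (snd p)\<^sup>2))"
    \<comment> \<open>For i = 0 the truncated exponent i - 1 is harmless, since its coefficient
      \<open>real i\<close> vanishes.\<close>
    let ?d = "\<lambda>p. c * (pd (True # bs) f p * (fst p ^ i * snd p ^ j * ?e p)) +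
        (c * real i * (pd bs f p * (fst p ^ (i - 1) * snd p ^ j * ?e p)) + (- 2 * k * c) * (pd bs f p * (fst p ^ Suc i * snd p ^ j * ?e p)))"
    have A: "?d \<in> gauss_span f k" by (intro gauss_span.intros)
    have "((\<lambda>t. c * (pd bs f (t, y) * (fst (t, y) ^ i * snd (t, y) ^ j * ?e (t, y)))) has_real_derivative ?d (x, y)) (at x)" for x y
      unfolding fst_conv snd_conv
      by (rule derivative_eq_intros smooth2_dx_real[OF sm] refl)+ (simp add: algebra_simps)
    then show ?case by (intro bexI[OF _ A] allI)
  next
    case (gauss_add u w)
    then obtain ux wx where "ux \<in> gauss_span f k" "\<forall>x y. ((\<lambda>t. u (t, y)) has_real_derivative ux (x, y)) (at x)"
      "wx \<in> gauss_span f k" "\<forall>x y. ((\<lambda>t. w (t, y)) has_real_derivative wx (x, y)) (at x)" by blast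
    then show ?case by (intro bexI[of _ "\<lambda>p. ux p + wx p"]) (auto intro!: DERIV_add gauss_span.intros)
  qed
  show "\<exists>gy \<in> gauss_span f k. \<forall>x y. ((\<lambda>t. g (x, t)) has_real_derivative gy (x, y)) (at y)" using g
  proof induction
    case (gauss_term c bs i j)
    let ?e = "\<lambda>p. exp (- k * ((fst p)\<^sup>2 + (snd p)\<^sup>2))"
    let ?d = "\<lambda>p. c * (pd (False # bs) f p * (fst p ^ i * snd p ^ j * ?e p)) +
        (c * real j * (pd bs f p * (fst p ^ i * snd p ^ (j - 1) * ?e p)) + (- 2 * k * c) * (pd bs f p * (fst p ^ i * snd p ^ Suc j * ?e p)))"
    have A: "?d \<in> gauss_span f k" by (intro gauss_span.intros)
    have "((\<lambda>t. c * (pd bs f (x, t) * (fst (x, t) ^ i * snd (x, t) ^ j * ?e (x, t)))) has_real_derivative ?d (x, y)) (at y)" for x y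
      unfolding fst_conv snd_conv
      by (rule derivative_eq_intros smooth2_dy_real[OF sm] refl)+ (simp add: algebra_simps)
    then show ?case by (intro bexI[OF _ A] allI)
  next
    case (gauss_add u w)
    then obtain uy wy where "uy \<in> gauss_span f k" "\<forall>x y. ((\<lambda>t. u (x, t)) has_real_derivative uy (x, y)) (at y)"
      "wy \<in> gauss_span f k" "\<forall>x y. ((\<lambda>t. w (x, t)) has_real_derivative wy (x, y)) (at y)" by blast
    then show ?case by (intro bexI[of _ "\<lambda>p. uy p + wy p"]) (auto intro!: DERIV_add gauss_span.intros)
  qed
qed

section \<open>Gaussian moments and the trial state\<close>

lemma radial_gauss_moment:
  assumes "\<alpha> > 0"
  shows "has_bochner_integral lborel (\<lambda>p::real \<times> real. ((norm p)\<^sup>2) ^ n * exp (- \<alpha> * (norm p)\<^sup>2)) (pi * (fact n / \<alpha> ^ Suc n))"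
proof -
  note h = exp_moment[OF assms, of n]
  let ?F = "\<lambda>s::real. s ^ n * exp (- \<alpha> * s)"
  have m: "?F \<in> borel_measurable borel" by measurable
  have "set_integrable lborel {0..} ?F" using h unfolding set_integrable_def by (rule integrable.intros)
  then have "integrable lborel (\<lambda>p::real \<times> real. ?F ((norm p)\<^sup>2))" using integrable_radial[OF m] by simp
  moreover have "(LINT p|lborel. ?F ((norm (p::real \<times> real))\<^sup>2)) = pi * (fact n / \<alpha> ^ Suc n)"
    using integral_radial[OF m] has_bochner_integral_integral_eq[OF h] by (simp add: set_lebesgue_integral_def)
  ultimately show ?thesis by (simp add: has_bochner_integral_iff)
qed

text \<open>The chain rule for the norm; multiplying by the norm avoids dividing at the origin,
  where evenness of the profile makes the gradient vanish.\<close>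

lemma radial_gradient:
  fixes v :: "real \<times> real \<Rightarrow> real"
  assumes sm: "smooth2 v" and rad: "radial v"
  shows "norm (x, y) * pdx v (x, y) = x * pd [True] v (norm (x, y), 0)"
    and "norm (x, y) * pdy v (x, y) = y * pd [True] v (norm (x, y), 0)"
    and "pdx v (0, 0) = 0" "pdy v (0, 0) = 0"
proof -
  let ?f = "\<lambda>r. v (r, 0)" let ?f1 = "\<lambda>r. pd [True] v (r, 0)"
  have d1: "(?f has_real_derivative ?f1 x) (at x)" for x using smooth2_dx_real[OF sm, of "[]" 0 x] by simp
  have d\<rho>: "((\<lambda>t. sqrt (t\<^sup>2 + b\<^sup>2)) has_real_derivative a / sqrt (a\<^sup>2 + b\<^sup>2)) (at a)" if "a\<^sup>2 + b\<^sup>2 > 0" for a b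
  proof -
    have "((\<lambda>t. sqrt (t\<^sup>2 + b\<^sup>2)) has_real_derivative (inverse (sqrt (a\<^sup>2 + b\<^sup>2)) / 2) * (2 * a)) (at a)"
      by (rule DERIV_chain2[where f = sqrt and g = "\<lambda>t. t\<^sup>2 + b\<^sup>2"])
        (use that in \<open>auto intro!: derivative_eq_intros DERIV_real_sqrt\<close>)
    then show ?thesis by (simp add: field_simps)
  qed
  have n: "norm (x, y) = sqrt (x\<^sup>2 + y\<^sup>2)" "norm (x, y) = sqrt (y\<^sup>2 + x\<^sup>2)" for x y :: real
    by (simp_all add: norm_prod_def add.commute)
  have xx: "norm (x, y) * pdx v (x, y) = x * ?f1 (norm (x, y))" if "x\<^sup>2 + y\<^sup>2 > 0"
  proof -
    have "((\<lambda>t. v (t, y)) has_real_derivative ?f1 (sqrt (x\<^sup>2 + y\<^sup>2)) * (x / sqrt (x\<^sup>2 + y\<^sup>2))) (at x)"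
      using DERIV_chain2[OF d1 d\<rho>[OF that]] radial_norm[OF rad, of "(t, y)" for t] by (simp add: n(1))
    moreover have "((\<lambda>t. v (t, y)) has_real_derivative pdx v (x, y)) (at x)"
      using smooth2_dx_real[OF sm, of "[]" y x] by simp
    ultimately have "pdx v (x, y) = ?f1 (sqrt (x\<^sup>2 + y\<^sup>2)) * (x / sqrt (x\<^sup>2 + y\<^sup>2))" by (metis DERIV_unique)
    then show ?thesis using that by (simp add: n(1))
  qed
  have yy: "norm (x, y) * pdy v (x, y) = y * ?f1 (norm (x, y))" if "y\<^sup>2 + x\<^sup>2 > 0"
  proof -
    have "((\<lambda>t. v (x, t)) has_real_derivative ?f1 (sqrt (y\<^sup>2 + x\<^sup>2)) * (y / sqrt (y\<^sup>2 + x\<^sup>2))) (at y)"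
      using DERIV_chain2[OF d1 d\<rho>[OF that]] radial_norm[OF rad, of "(x, t)" for t] by (simp add: n(2))
    moreover have "((\<lambda>t. v (x, t)) has_real_derivative pdy v (x, y)) (at y)"
      using smooth2_dy_real[OF sm, of "[]" x y] by simp
    ultimately have "pdy v (x, y) = ?f1 (sqrt (y\<^sup>2 + x\<^sup>2)) * (y / sqrt (y\<^sup>2 + x\<^sup>2))" by (metis DERIV_unique)
    then show ?thesis using that by (simp add: n(2))
  qed
  have z: "x = 0 \<and> y = 0" if "\<not> x\<^sup>2 + y\<^sup>2 > 0"
    using that by (simp add: sum_power2_gt_zero_iff)
  show "norm (x, y) * pdx v (x, y) = x * pd [True] v (norm (x, y), 0)" using xx z by (cases "x\<^sup>2 + y\<^sup>2 > 0") auto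
  show "norm (x, y) * pdy v (x, y) = y * pd [True] v (norm (x, y), 0)" using yy z by (cases "x\<^sup>2 + y\<^sup>2 > 0") (auto simp: add.commute)
  have "?f1 (- 0) = - 1 * ?f1 0"
    by (rule deriv_of_parity[OF _ d1]) (simp add: radial_even[OF rad])
  then have f10: "?f1 0 = 0" by simp
  then show "pdx v (0, 0) = 0" by simp
  have "v (0, t) = v (t, 0)" for t using rad unfolding radial_def by (simp add: norm_prod_def)
  then have "((\<lambda>t. v (0, t)) has_real_derivative ?f1 0) (at 0)" using d1[of 0] by simp
  moreover have "((\<lambda>t. v (0, t)) has_real_derivative pdy v (0, 0)) (at 0)"
    using smooth2_dy_real[OF sm, of "[]" 0 0] by simp
  ultimately show "pdy v (0, 0) = 0" using f10 by (metis DERIV_unique)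
qed

text \<open>The infimum is a lower bound only once the set of quotients is bounded below. Here v0 is
  such a bound, and v0 <= 0 also covers the default values: a quotient is 0 when the norm integral
  is 0 or when the energy density is not integrable.\<close>

lemma spec_bottom_le_quotient:
  assumes v0: "\<And>p. v0 \<le> v p" "v0 \<le> 0"
    and u: "smooth2 u" "compact_supp u" "u p0 \<noteq> 0"
  shows "spec_bottom B h v \<le> magQ B h v u / (LINT p|lborel. (cmod (u p))\<^sup>2)"
  unfolding spec_bottom_def
proof (rule cInf_lower)
  show "magQ B h v u / (LINT p|lborel. (cmod (u p))\<^sup>2) \<in>
    {magQ B h v u / (LINT p|lborel. (cmod (u p))\<^sup>2) | u. smooth2 u \<and> compact_supp u \<and> (\<exists>p. u p \<noteq> 0)}"
    using u by blast
  show "bdd_below {magQ B h v u / (LINT p|lborel. (cmod (u p))\<^sup>2) | u. smooth2 u \<and> compact_supp u \<and> (\<exists>p. u p \<noteq> 0)}"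
  proof (rule bdd_belowI[of _ v0], safe)
    fix u :: "real \<times> real \<Rightarrow> complex"
    define N where "N = (LINT p|lborel. (cmod (u p))\<^sup>2)"
    let ?J = "\<lambda>p. (cmod (magP1 B h u p))\<^sup>2 + (cmod (magP2 B h u p))\<^sup>2 + v p * (cmod (u p))\<^sup>2"
    have N0: "N \<ge> 0" unfolding N_def by (intro integral_nonneg_AE) simp
    have vN: "v0 * N \<le> 0" using v0 N0 by (simp add: mult_nonpos_nonneg)
    have "v0 * N \<le> magQ B h v u" if "N \<noteq> 0"
    proof (cases "integrable lborel ?J")
      case True
      have i: "integrable lborel (\<lambda>p. (cmod (u p))\<^sup>2)" using that not_integrable_integral_eq unfolding N_def by blast
      have "(LINT p|lborel. v0 * (cmod (u p))\<^sup>2) \<le> (LINT p|lborel. ?J p)"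
      proof (rule integral_mono)
        fix p
        have "v0 * (cmod (u p))\<^sup>2 \<le> v p * (cmod (u p))\<^sup>2" using v0 by (intro mult_right_mono) auto
        then show "v0 * (cmod (u p))\<^sup>2 \<le> ?J p"
          using zero_le_power2[of "cmod (magP1 B h u p)"] zero_le_power2[of "cmod (magP2 B h u p)"] by linarith
      qed (use True i in auto)
      then show ?thesis by (simp add: N_def magQ_def)
    next
      case False
      then have "magQ B h v u = 0" unfolding magQ_def by (rule not_integrable_integral_eq)
      then show ?thesis using vN by simp
    qed
    then show "v0 \<le> magQ B h v u / (LINT p|lborel. (cmod (u p))\<^sup>2)"
      using N0 v0(2) unfolding N_def[symmetric] by (cases "N = 0") (auto simp: le_divide_eq)
  qed
qed

text \<open>The error coefficient joins C3 / v2 from the numerator with 2 \<omega> C2 from the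
  deficit of the norm; its factor 2 compensates that 1 - C2 h / \<omega> is only known to be at
  least 1/2.\<close>

lemma trial_quotient_arith:
  fixes \<omega> v2 C2 C3 h Q N :: real
  assumes "\<omega> > 0" "v2 > 0" "C2 \<ge> 0" "C3 \<ge> 0" "0 < h" "C2 * (h / \<omega>) \<le> 1 / 2"
    and Q: "Q \<le> pi * ((h / \<omega>)\<^sup>2 * (2 * \<omega>\<^sup>2 * v2 + C3 * h))" "0 \<le> Q"
    and N: "pi * (v2 * (h / \<omega>) * (1 - C2 * (h / \<omega>))) \<le> N"
  shows "N > 0" "Q / N \<le> 2 * \<omega> * h + (2 * (C3 / v2 + 2 * \<omega> * C2) / \<omega>) * \<omega> * (h / \<omega>) * h"
proof -
  define H where "H = h / \<omega>"
  have H: "H > 0" "h = \<omega> * H" using assms by (auto simp: H_def)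
  define K1 where "K1 = 2 * (C3 / v2 + 2 * \<omega> * C2) / \<omega>"
  have K1: "K1 \<ge> 0" "K1 * \<omega> * v2 = 2 * (C3 + 2 * \<omega> * C2 * v2)"
    using assms by (auto simp: K1_def field_simps)
  have half: "C2 * H \<le> 1 / 2" using assms by (simp add: H_def)
  then have lo: "pi * (v2 * H * (1 - C2 * H)) > 0" using H assms by (intro mult_pos_pos) auto
  then show Np: "N > 0" using N unfolding H_def by linarith
  have "2 * \<omega>\<^sup>2 * v2 + C3 * h \<le> v2 * (1 - C2 * H) * (2 * \<omega>\<^sup>2 + K1 * \<omega> * h)"
  proof -
    have "v2 * (1 - C2 * H) * (2 * \<omega>\<^sup>2 + K1 * \<omega> * h) = 2 * \<omega>\<^sup>2 * v2 - 2 * \<omega>\<^sup>2 * v2 * (C2 * H) + (K1 * \<omega> * v2) * h * (1 - C2 * H)"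
      by (simp add: algebra_simps)
    moreover have "(K1 * \<omega> * v2) * h * (1 - C2 * H) \<ge> (K1 * \<omega> * v2) * h * (1 / 2)"
      using half K1 assms by (intro mult_left_mono) auto
    moreover have "(K1 * \<omega> * v2) * h * (1 / 2) = C3 * h + 2 * \<omega>\<^sup>2 * v2 * (C2 * H)"
      unfolding K1(2) H(2) by (simp add: algebra_simps power2_eq_square)
    ultimately show ?thesis by linarith
  qed
  then have "pi * (H\<^sup>2 * (2 * \<omega>\<^sup>2 * v2 + C3 * h)) \<le> pi * (H\<^sup>2 * (v2 * (1 - C2 * H) * (2 * \<omega>\<^sup>2 + K1 * \<omega> * h)))"
    using H by (intro mult_left_mono) auto
  also have "\<dots> = (H * (2 * \<omega>\<^sup>2 + K1 * \<omega> * h)) * (pi * (v2 * H * (1 - C2 * H)))" by (simp add: power2_eq_square)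
  also have "\<dots> \<le> (H * (2 * \<omega>\<^sup>2 + K1 * \<omega> * h)) * N"
    using N H K1 assms unfolding H_def[symmetric] by (intro mult_left_mono) auto
  finally have "Q \<le> (H * (2 * \<omega>\<^sup>2 + K1 * \<omega> * h)) * N" using Q(1) unfolding H_def[symmetric] by linarith
  then have "Q / N \<le> H * (2 * \<omega>\<^sup>2 + K1 * \<omega> * h)" using Np by (simp add: divide_le_eq)
  also have "\<dots> = 2 * \<omega> * h + K1 * \<omega> * H * h" using H(2) by (simp add: algebra_simps power2_eq_square)
  finally show "Q / N \<le> 2 * \<omega> * h + (2 * (C3 / v2 + 2 * \<omega> * C2) / \<omega>) * \<omega> * (h / \<omega>) * h"
    unfolding K1_def H_def .
qed

text \<open>The trial state is v times the harmonic ground state e^(-\<omega> |p|^2 / (2 h)): v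
  itself is smooth, compactly supported and nonzero at 0, so it serves as the cutoff. Since v is
  stationary at 0, v^2 differs from v(0)^2 by O(|p|^2) and its gradient is O(|p|); under the
  Gaussian each factor |p|^2 is worth h, so these cost O(h^2) in the energy.\<close>

lemma spec_bottom_upper:
  fixes v :: "real \<times> real \<Rightarrow> real" and B :: real
  assumes sm: "smooth2 v" and rad: "radial v" and B: "B > 0" and cs: "compact_supp v"
    and min: "\<forall>p. v (0, 0) \<le> v p" and np: "\<forall>p. v p \<le> 0" and neg: "v (0, 0) < 0"
    and wp: "well_potential (\<lambda>r. B\<^sup>2 * r\<^sup>2 / 4 + v (r, 0) - v (0, 0)) (\<lambda>r. B\<^sup>2 * r / 2 + pd [True] v (r, 0))
     (\<lambda>r. B\<^sup>2 / 2 + pd [True, True] v (r, 0)) \<omega> c K"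
  shows "\<exists>K1. \<exists>h0 > 0. \<forall>h. 0 < h \<and> h < h0 \<longrightarrow> spec_bottom B h v - v (0, 0) \<le> 2 * \<omega> * h + K1 * h\<^sup>2"
proof -
  interpret W: well_potential "\<lambda>r. B\<^sup>2 * r\<^sup>2 / 4 + v (r, 0) - v (0, 0)" "\<lambda>r. B\<^sup>2 * r / 2 + pd [True] v (r, 0)"
     "\<lambda>r. B\<^sup>2 / 2 + pd [True, True] v (r, 0)" \<omega> c K by (rule wp)
  define v0 where "v0 = v (0, 0)"
  have mn: "v0 \<le> v p" "v p \<le> 0" for p using min np unfolding v0_def by blast+
  define v2 where "v2 = v0\<^sup>2"
  define M where "M = K + B\<^sup>2 / 2"
  have \<omega>: "\<omega> > 0" by (rule W.omega_pos)
  have K: "K > 0" by (rule W.K_pos)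
  have M: "M > 0" using K by (simp add: M_def add_pos_nonneg)
  have v2: "v2 > 0" using neg by (simp add: v2_def v0_def)
  define C2 where "C2 = 2 * \<bar>v0\<bar> * K / v2"
  define C3 where "C3 = M\<^sup>2 + 2 * \<omega> * (\<bar>v0\<bar> * M) + 2 * (K * v2) / \<omega>"
  define h0 where "h0 = min 1 (\<omega> / (2 * C2 + 1))"
  have C2: "C2 \<ge> 0" using K v2 by (simp add: C2_def)
  have C3: "C3 \<ge> 0" using K v2 \<omega> M by (simp add: C3_def)
  have h0: "h0 > 0" using \<omega> C2 by (simp add: h0_def)
  define K1 where "K1 = 2 * (C3 / v2 + 2 * \<omega> * C2) / \<omega>"
  have vp: "v p = v (norm p, 0)" for p by (rule radial_norm[OF rad])
  have vabs: "\<bar>v p\<bar> \<le> \<bar>v0\<bar>" for p using mn(1)[of p] mn(2)[of p] by linarith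
  have vsq: "(v p)\<^sup>2 \<le> v2" for p
  proof -
    have "\<bar>v p\<bar> \<le> \<bar>v0\<bar>" by (rule vabs)
    then show ?thesis unfolding v2_def by (simp add: abs_le_square_iff)
  qed
  have vlow: "v2 - 2 * \<bar>v0\<bar> * K * (norm p)\<^sup>2 \<le> (v p)\<^sup>2" for p
  proof -
    have "v p - v0 \<le> K * (norm p)\<^sup>2"
    proof -
      have "B\<^sup>2 * (norm p)\<^sup>2 / 4 \<ge> 0" by simp
      then show ?thesis using W.V_upper[of "norm p"] vp[of p] unfolding v0_def by linarith
    qed
    moreover have "0 \<le> v p - v0" using mn(1)[of p] by simp
    moreover have "0 \<le> - v p - v0" "- v p - v0 \<le> 2 * \<bar>v0\<bar>" using mn(1)[of p] mn(2)[of p] by linarith+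
    ultimately have "(v p - v0) * (- v p - v0) \<le> (K * (norm p)\<^sup>2) * (2 * \<bar>v0\<bar>)" by (intro mult_mono) auto
    then show ?thesis by (simp add: v2_def power2_eq_square algebra_simps)
  qed
  have vr1: "\<bar>pd [True] v (r, 0)\<bar> \<le> M * r" if "r \<ge> 0" for r
  proof -
    have "M * r = K * r + B\<^sup>2 * r / 2" by (simp add: M_def algebra_simps)
    moreover have "B\<^sup>2 * r / 2 \<ge> 0" using that by simp
    ultimately show ?thesis using W.V1_bound[OF that] by linarith
  qed
  have grad: "(pdx v (x, y))\<^sup>2 + (pdy v (x, y))\<^sup>2 \<le> M\<^sup>2 * (x\<^sup>2 + y\<^sup>2)" "\<bar>x * pdx v (x, y) + y * pdy v (x, y)\<bar> \<le> M * (x\<^sup>2 + y\<^sup>2)" for x y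
  proof -
    define r where "r = norm (x, y)"
    define d where "d = pd [True] v (r, 0)"
    have r2: "r\<^sup>2 = x\<^sup>2 + y\<^sup>2" by (simp add: r_def norm_prod_def)
    have r0: "r \<ge> 0" by (simp add: r_def)
    have d: "\<bar>d\<bar> \<le> M * r" unfolding d_def by (rule vr1[OF r0])
    have g: "r * pdx v (x, y) = x * d" "r * pdy v (x, y) = y * d"
      unfolding r_def d_def by (rule radial_gradient[OF sm rad])+
    have "(pdx v (x, y))\<^sup>2 + (pdy v (x, y))\<^sup>2 \<le> M\<^sup>2 * r\<^sup>2 \<and> \<bar>x * pdx v (x, y) + y * pdy v (x, y)\<bar> \<le> M * r\<^sup>2"
    proof (cases "r = 0")
      case True
      then have "x = 0" "y = 0" using r2 by (auto simp: sum_power2_eq_zero_iff)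
      then show ?thesis using radial_gradient(3,4)[OF sm rad] True by simp
    next
      case False
      then have rp: "r > 0" using r0 by simp
      have gx: "pdx v (x, y) = x * d / r" "pdy v (x, y) = y * d / r" using g rp by (auto simp: field_simps)
      have "(pdx v (x, y))\<^sup>2 + (pdy v (x, y))\<^sup>2 = (x\<^sup>2 + y\<^sup>2) * d\<^sup>2 / r\<^sup>2" unfolding gx by (simp add: power_divide power_mult_distrib add_divide_distrib algebra_simps)
      also have "\<dots> = d\<^sup>2" using rp unfolding r2[symmetric] by simp
      also have "\<dots> \<le> (M * r)\<^sup>2" using d M r0 by (metis abs_ge_zero power2_abs power_mono)
      finally have 1: "(pdx v (x, y))\<^sup>2 + (pdy v (x, y))\<^sup>2 \<le> M\<^sup>2 * r\<^sup>2" by (simp add: power_mult_distrib)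
      have "x * pdx v (x, y) + y * pdy v (x, y) = (x\<^sup>2 + y\<^sup>2) * d / r" unfolding gx by (simp add: power2_eq_square add_divide_distrib algebra_simps)
      also have "\<dots> = r * d" using rp unfolding r2[symmetric] by (simp add: power2_eq_square)
      finally have "\<bar>x * pdx v (x, y) + y * pdy v (x, y)\<bar> = r * \<bar>d\<bar>" using rp by (simp add: abs_mult)
      also have "\<dots> \<le> r * (M * r)" using d r0 by (intro mult_left_mono) auto
      finally show ?thesis using 1 by (simp add: power2_eq_square mult_ac)
    qed
    then show "(pdx v (x, y))\<^sup>2 + (pdy v (x, y))\<^sup>2 \<le> M\<^sup>2 * (x\<^sup>2 + y\<^sup>2)" "\<bar>x * pdx v (x, y) + y * pdy v (x, y)\<bar> \<le> M * (x\<^sup>2 + y\<^sup>2)"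
      unfolding r2 by auto
  qed
  have main: "spec_bottom B h v - v0 \<le> 2 * \<omega> * h + K1 * h\<^sup>2" if h: "0 < h" "h < h0" for h
  proof -
    have h1: "h \<le> 1" using h by (simp add: h0_def)
    have C2h: "C2 * (h / \<omega>) \<le> 1 / 2"
    proof -
      have "h \<le> \<omega> / (2 * C2 + 1)" using h by (simp add: h0_def)
      then have "h * (2 * C2 + 1) \<le> \<omega>" using C2 by (simp add: le_divide_eq)
      then have "2 * (C2 * h) \<le> \<omega>" using h by (simp add: algebra_simps)
      then show ?thesis using \<omega> by (simp add: field_simps)
    qed
    \<comment> \<open>Half the rate \<open>\<alpha>\<close>: every quadratic quantity contains the
      square of the Gaussian, whose rate is \<omega> / h.\<close>
    define k where "k = \<omega> / (2 * h)"
    define \<alpha> where "\<alpha> = \<omega> / h"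
    have \<alpha>: "\<alpha> > 0" using \<omega> h by (simp add: \<alpha>_def)
    define w where "w = (\<lambda>p. v p * exp (- k * ((fst p)\<^sup>2 + (snd p)\<^sup>2)))"
    define u where "u = (\<lambda>p. complex_of_real (w p))"
    define e2 where "e2 = (\<lambda>p::real \<times> real. exp (- \<alpha> * (norm p)\<^sup>2))"
    have smw: "smooth2 w" unfolding w_def by (rule smooth2_gauss_mult[OF sm])
    have smu: "smooth2 u" unfolding u_def by (rule smooth2_of_real[OF smw])
    have "{p. u p \<noteq> 0} = {p. v p \<noteq> 0}" by (auto simp: u_def w_def)
    then have csu: "compact_supp u" using cs by (simp add: compact_supp_def)
    have u0: "u (0, 0) \<noteq> 0" using neg by (simp add: u_def w_def)
    have n2: "(norm p)\<^sup>2 = (fst p)\<^sup>2 + (snd p)\<^sup>2" for p :: "real \<times> real" by (simp add: norm_prod_def)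
    have ee: "(exp (- k * ((fst p)\<^sup>2 + (snd p)\<^sup>2)))\<^sup>2 = e2 p" for p
    proof -
      have "- k * ((fst p)\<^sup>2 + (snd p)\<^sup>2) + - k * ((fst p)\<^sup>2 + (snd p)\<^sup>2) = - \<alpha> * ((fst p)\<^sup>2 + (snd p)\<^sup>2)"
        by (simp add: \<alpha>_def k_def)
      then show ?thesis unfolding e2_def n2 by (simp only: power2_eq_square[of "exp _"] mult_exp_exp)
    qed
    have w2: "(w p)\<^sup>2 = (v p)\<^sup>2 * e2 p" for p unfolding w_def power_mult_distrib ee ..
    have wx: "pdx w (x, y) = (pdx v (x, y) - \<omega> / h * x * v (x, y)) * exp (- k * (x\<^sup>2 + y\<^sup>2))" for x y
    proof (rule pdx_eqI)
      have "((\<lambda>t. v (t, y)) has_real_derivative pdx v (x, y)) (at x)" using smooth2_dx_real[OF sm, of "[]" y x] by simp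
      then have "((\<lambda>t. w (t, y)) has_real_derivative (pdx v (x, y) - \<omega> / h * x * v (x, y)) * exp (- k * (x\<^sup>2 + y\<^sup>2))) (at x)"
        unfolding w_def using h by (auto intro!: derivative_eq_intros simp: k_def field_simps)
      then show "((\<lambda>t. w (t, snd (x, y))) has_vector_derivative (pdx v (x, y) - \<omega> / h * x * v (x, y)) * exp (- k * (x\<^sup>2 + y\<^sup>2))) (at (fst (x, y)))"
        by (simp add: has_real_derivative_iff_has_vector_derivative)
    qed
    have wy: "pdy w (x, y) = (pdy v (x, y) - \<omega> / h * y * v (x, y)) * exp (- k * (x\<^sup>2 + y\<^sup>2))" for x y
    proof (rule pdy_eqI)
      have "((\<lambda>t. v (x, t)) has_real_derivative pdy v (x, y)) (at y)" using smooth2_dy_real[OF sm, of "[]" x y] by simp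
      then have "((\<lambda>t. w (x, t)) has_real_derivative (pdy v (x, y) - \<omega> / h * y * v (x, y)) * exp (- k * (x\<^sup>2 + y\<^sup>2))) (at y)"
        unfolding w_def using h by (auto intro!: derivative_eq_intros simp: k_def field_simps)
      then show "((\<lambda>t. w (fst (x, y), t)) has_vector_derivative (pdy v (x, y) - \<omega> / h * y * v (x, y)) * exp (- k * (x\<^sup>2 + y\<^sup>2))) (at (snd (x, y)))"
        by (simp add: has_real_derivative_iff_has_vector_derivative)
    qed
    define J where "J = (\<lambda>p. (cmod (magP1 B h u p))\<^sup>2 + (cmod (magP2 B h u p))\<^sup>2 + v p * (cmod (u p))\<^sup>2)"
    \<comment> \<open>Subtracting the energy at the bottom of the well makes the density nonnegative
      and, after division by the Gaussian, O(|p|^2). Its integral is then bounded by second and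
      fourth Gaussian moments, with leading coefficient 2 \<omega>^2 v(0)^2.\<close>
    define T where "T = (\<lambda>p. J p - v0 * (w p)\<^sup>2)"
    have Tpos: "T p \<ge> 0" for p
    proof -
      have "v0 * (w p)\<^sup>2 \<le> v p * (cmod (u p))\<^sup>2" unfolding u_def using mn(1)[of p] by (simp add: mult_right_mono)
      then show ?thesis unfolding T_def J_def
        using zero_le_power2[of "cmod (magP1 B h u p)"] zero_le_power2[of "cmod (magP2 B h u p)"] by linarith
    qed
    have Teq: "T (x, y) = e2 (x, y) * (h\<^sup>2 * ((pdx v (x, y))\<^sup>2 + (pdy v (x, y))\<^sup>2) - 2 * h * \<omega> * (v (x, y) * (x * pdx v (x, y) + y * pdy v (x, y)))
        + \<omega>\<^sup>2 * (x\<^sup>2 + y\<^sup>2) * (v (x, y))\<^sup>2 + (B\<^sup>2 * (x\<^sup>2 + y\<^sup>2) / 4 + v (x, y) - v0) * (v (x, y))\<^sup>2)" for x y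
    proof -
      define ex where "ex = exp (- k * (x\<^sup>2 + y\<^sup>2))"
      have exx: "ex\<^sup>2 = e2 (x, y)" unfolding ex_def using ee[of "(x, y)"] by simp
      have wv: "w (x, y) = v (x, y) * ex" by (simp add: w_def ex_def)
      have "T (x, y) = (B / 2 * y * w (x, y))\<^sup>2 + (h * pdx w (x, y))\<^sup>2 + ((B / 2 * x * w (x, y))\<^sup>2 + (h * pdy w (x, y))\<^sup>2) + v (x, y) * (w (x, y))\<^sup>2 - v0 * (w (x, y))\<^sup>2"
        unfolding T_def J_def u_def magP_of_real[OF smw] by (simp add: cmod_power2)
      also have "\<dots> = ex\<^sup>2 * (h\<^sup>2 * ((pdx v (x, y))\<^sup>2 + (pdy v (x, y))\<^sup>2) - 2 * h * \<omega> * (v (x, y) * (x * pdx v (x, y) + y * pdy v (x, y)))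
        + \<omega>\<^sup>2 * (x\<^sup>2 + y\<^sup>2) * (v (x, y))\<^sup>2 + (B\<^sup>2 * (x\<^sup>2 + y\<^sup>2) / 4 + v (x, y) - v0) * (v (x, y))\<^sup>2)"
        unfolding wx wy wv ex_def[symmetric] using h by (simp add: field_simps power2_eq_square)
      finally show ?thesis unfolding exx .
    qed
    define c1 where "c1 = h\<^sup>2 * M\<^sup>2 + 2 * h * \<omega> * (\<bar>v0\<bar> * M) + 2 * \<omega>\<^sup>2 * v2"
    define c2 where "c2 = K * v2"
    have Tle: "T p \<le> c1 * ((norm p)\<^sup>2 ^ 1 * e2 p) + c2 * ((norm p)\<^sup>2 ^ 2 * e2 p)" for p
    proof -
      obtain x y where p: "p = (x, y)" by (cases p)
      define s where "s = x\<^sup>2 + y\<^sup>2"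
      have s: "(norm p)\<^sup>2 = s" by (simp add: p norm_prod_def s_def)
      have s0: "s \<ge> 0" by (simp add: s_def)
      have 1: "h\<^sup>2 * ((pdx v (x, y))\<^sup>2 + (pdy v (x, y))\<^sup>2) \<le> h\<^sup>2 * (M\<^sup>2 * s)" unfolding s_def by (intro mult_left_mono grad) auto
      have "\<bar>v (x, y) * (x * pdx v (x, y) + y * pdy v (x, y))\<bar> \<le> \<bar>v0\<bar> * (M * s)" unfolding abs_mult s_def by (intro mult_mono vabs grad) auto
      then have "- (v (x, y) * (x * pdx v (x, y) + y * pdy v (x, y))) \<le> \<bar>v0\<bar> * (M * s)" by linarith
      then have "2 * h * \<omega> * - (v (x, y) * (x * pdx v (x, y) + y * pdy v (x, y))) \<le> 2 * h * \<omega> * (\<bar>v0\<bar> * (M * s))"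
        using h \<omega> by (intro mult_left_mono) auto
      then have 2: "- (2 * h * \<omega> * (v (x, y) * (x * pdx v (x, y) + y * pdy v (x, y)))) \<le> 2 * h * \<omega> * (\<bar>v0\<bar> * (M * s))" by simp
      have 3: "\<omega>\<^sup>2 * s * (v (x, y))\<^sup>2 \<le> \<omega>\<^sup>2 * s * v2" using s0 by (intro mult_left_mono vsq) auto
      have "B\<^sup>2 * s / 4 + v (x, y) - v0 - \<omega>\<^sup>2 * s \<le> K * s\<^sup>2"
      proof -
        have "norm p ^ 4 = s\<^sup>2" using s by (metis mult_2 numeral_Bit0 power_add power2_eq_square)
        then show ?thesis using W.V_taylor[of "norm p"] vp[of "(x, y)"] unfolding v0_def p by (simp add: abs_le_iff s[unfolded p])
      qed
      moreover have "0 \<le> B\<^sup>2 * s / 4 + v (x, y) - v0" 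
      proof -
        have "B\<^sup>2 * s / 4 \<ge> 0" using s0 by simp
        then show ?thesis using mn(1)[of "(x, y)"] by linarith
      qed
      ultimately have 4: "(B\<^sup>2 * s / 4 + v (x, y) - v0) * (v (x, y))\<^sup>2 \<le> (\<omega>\<^sup>2 * s + K * s\<^sup>2) * v2"
        by (intro mult_mono vsq) auto
      have "T p = e2 p * (h\<^sup>2 * ((pdx v (x, y))\<^sup>2 + (pdy v (x, y))\<^sup>2) - 2 * h * \<omega> * (v (x, y) * (x * pdx v (x, y) + y * pdy v (x, y)))
        + \<omega>\<^sup>2 * s * (v (x, y))\<^sup>2 + (B\<^sup>2 * s / 4 + v (x, y) - v0) * (v (x, y))\<^sup>2)" unfolding p Teq s_def ..
      also have "\<dots> \<le> e2 p * (h\<^sup>2 * (M\<^sup>2 * s) + 2 * h * \<omega> * (\<bar>v0\<bar> * (M * s)) + \<omega>\<^sup>2 * s * v2 + (\<omega>\<^sup>2 * s + K * s\<^sup>2) * v2)"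
        using 1 2 3 4 by (intro mult_left_mono) (linarith, simp add: e2_def)
      also have "\<dots> = c1 * ((norm p)\<^sup>2 ^ 1 * e2 p) + c2 * ((norm p)\<^sup>2 ^ 2 * e2 p)" unfolding s c1_def c2_def by (simp add: algebra_simps)
      finally show ?thesis .
    qed
    have mom: "has_bochner_integral lborel (\<lambda>p. (norm p)\<^sup>2 ^ n * e2 p) (pi * (fact n / \<alpha> ^ Suc n))" for n
      unfolding e2_def by (rule radial_gauss_moment[OF \<alpha>])
    have cpd: "continuous_on UNIV (pd bs v)" for bs by (rule smooth2_cont[OF sm])
    have cv: "continuous_on UNIV v" "continuous_on UNIV (pdx v)" "continuous_on UNIV (pdy v)"
      using cpd[of "[]"] cpd[of "[True]"] cpd[of "[False]"] by auto
    have cw: "continuous_on UNIV w" using smooth2_cont[OF smw, of "[]"] by simp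
    have mT: "T \<in> borel_measurable borel"
    proof -
      have "T = (\<lambda>p. e2 p * (h\<^sup>2 * ((pdx v p)\<^sup>2 + (pdy v p)\<^sup>2) - 2 * h * \<omega> * (v p * (fst p * pdx v p + snd p * pdy v p))
        + \<omega>\<^sup>2 * ((fst p)\<^sup>2 + (snd p)\<^sup>2) * (v p)\<^sup>2 + (B\<^sup>2 * ((fst p)\<^sup>2 + (snd p)\<^sup>2) / 4 + v p - v0) * (v p)\<^sup>2))"
        using Teq by (auto simp: fun_eq_iff)
      then show ?thesis unfolding e2_def by (auto intro!: borel_measurable_continuous_onI continuous_intros cv)
    qed
    let ?b = "\<lambda>p. c1 * ((norm p)\<^sup>2 ^ 1 * e2 p) + c2 * ((norm p)\<^sup>2 ^ 2 * e2 p)"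
    have hb: "has_bochner_integral lborel ?b (c1 * (pi * (fact 1 / \<alpha> ^ Suc 1)) + c2 * (pi * (fact 2 / \<alpha> ^ Suc 2)))"
      by (intro has_bochner_integral_add has_bochner_integral_mult_right mom)
    have iT: "integrable lborel T"
    proof (rule Bochner_Integration.integrable_bound[OF integrable.intros[OF hb]])
      show "AE p in lborel. norm (T p) \<le> norm (?b p)" using Tpos Tle by (auto intro!: AE_I2 order_trans[OF Tle])
    qed (use mT in simp)
    have ub: "(LINT p|lborel. T p) \<le> c1 * (pi * (fact 1 / \<alpha> ^ Suc 1)) + c2 * (pi * (fact 2 / \<alpha> ^ Suc 2))"
      using integral_mono[OF iT integrable.intros[OF hb] Tle] has_bochner_integral_integral_eq[OF hb] by simp
    have iw: "integrable lborel (\<lambda>p. (w p)\<^sup>2)"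
    proof (rule Bochner_Integration.integrable_bound)
      show "integrable lborel (\<lambda>p. v2 * ((norm p)\<^sup>2 ^ 0 * e2 p))" using integrable.intros[OF mom[of 0]] by (intro integrable_mult_right)
      show "AE p in lborel. norm ((w p)\<^sup>2) \<le> norm (v2 * ((norm p)\<^sup>2 ^ 0 * e2 p))"
        unfolding w2 using vsq v2 by (auto intro!: AE_I2 mult_right_mono simp: e2_def abs_mult)
      show "(\<lambda>p. (w p)\<^sup>2) \<in> borel_measurable lborel" using borel_measurable_continuous_onI[OF cw] by simp
    qed
    define N where "N = (LINT p|lborel. (w p)\<^sup>2)"
    have lb: "v2 * (pi * (fact 0 / \<alpha> ^ Suc 0)) - 2 * \<bar>v0\<bar> * K * (pi * (fact 1 / \<alpha> ^ Suc 1)) \<le> N"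
    proof -
      let ?l = "\<lambda>p. v2 * ((norm p)\<^sup>2 ^ 0 * e2 p) - 2 * \<bar>v0\<bar> * K * ((norm p)\<^sup>2 ^ 1 * e2 p)"
      have hl: "has_bochner_integral lborel ?l (v2 * (pi * (fact 0 / \<alpha> ^ Suc 0)) - 2 * \<bar>v0\<bar> * K * (pi * (fact 1 / \<alpha> ^ Suc 1)))"
        by (intro has_bochner_integral_diff has_bochner_integral_mult_right mom)
      have "?l p \<le> (w p)\<^sup>2" for p
      proof -
        have "(v2 - 2 * \<bar>v0\<bar> * K * (norm p)\<^sup>2) * e2 p \<le> (v p)\<^sup>2 * e2 p" using vlow[of p] by (intro mult_right_mono) (auto simp: e2_def)
        then show ?thesis unfolding w2 by (simp add: algebra_simps)
      qed
      then have "(LINT p|lborel. ?l p) \<le> N" unfolding N_def by (intro integral_mono integrable.intros[OF hl] iw)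
      then show ?thesis using has_bochner_integral_integral_eq[OF hl] by simp
    qed
    have cN: "(LINT p|lborel. (cmod (u p))\<^sup>2) = N" unfolding N_def u_def by simp
    have "J = (\<lambda>p. T p + v0 * (w p)\<^sup>2)" by (simp add: T_def)
    then have "magQ B h v u = (LINT p|lborel. T p + v0 * (w p)\<^sup>2)" unfolding magQ_def J_def[symmetric] by simp
    also have "\<dots> = (LINT p|lborel. T p) + v0 * N" unfolding N_def using iT iw by simp
    finally have Q: "magQ B h v u = (LINT p|lborel. T p) + v0 * N" .
    have hw: "1 / \<alpha> = h / \<omega>" by (simp add: \<alpha>_def)
    have Tb: "(LINT p|lborel. T p) \<le> pi * ((h / \<omega>)\<^sup>2 * (2 * \<omega>\<^sup>2 * v2 + C3 * h))"
    proof -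
      have "h\<^sup>2 * M\<^sup>2 \<le> h * M\<^sup>2" using h h1 by (intro mult_right_mono) (auto simp: power2_eq_square mult_left_le)
      then have c1': "c1 + 2 * c2 * (h / \<omega>) \<le> 2 * \<omega>\<^sup>2 * v2 + C3 * h"
        unfolding c1_def c2_def C3_def using \<omega> by (simp add: algebra_simps)
      have "c1 * (pi * (fact 1 / \<alpha> ^ Suc 1)) + c2 * (pi * (fact 2 / \<alpha> ^ Suc 2)) = pi * ((1 / \<alpha>)\<^sup>2 * (c1 + 2 * c2 * (1 / \<alpha>)))"
        using \<alpha> by (simp add: field_simps power2_eq_square power3_eq_cube fact_2)
      also have "\<dots> \<le> pi * ((h / \<omega>)\<^sup>2 * (2 * \<omega>\<^sup>2 * v2 + C3 * h))" unfolding hw using c1' by (intro mult_left_mono) auto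
      finally show ?thesis using ub by linarith
    qed
    have Nb: "pi * (v2 * (h / \<omega>) * (1 - C2 * (h / \<omega>))) \<le> N"
    proof -
      have "pi * (v2 * (1 / \<alpha>) * (1 - C2 * (1 / \<alpha>))) = v2 * (pi * (fact 0 / \<alpha> ^ Suc 0)) - 2 * \<bar>v0\<bar> * K * (pi * (fact 1 / \<alpha> ^ Suc 1))"
        using \<alpha> v2 by (simp add: C2_def field_simps power2_eq_square)
      then show ?thesis using lb unfolding hw by linarith
    qed
    have T0: "0 \<le> (LINT p|lborel. T p)" using Tpos by (intro integral_nonneg_AE) auto
    note ar = trial_quotient_arith[OF \<omega> v2 C2 C3 h(1) C2h Tb T0 Nb]
    have "spec_bottom B h v \<le> magQ B h v u / (LINT p|lborel. (cmod (u p))\<^sup>2)"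
      by (rule spec_bottom_le_quotient[where ?v0.0 = v0, OF _ _ smu csu u0]) (use mn neg in \<open>auto simp: v0_def\<close>)
    also have "\<dots> = (LINT p|lborel. T p) / N + v0" unfolding cN Q using ar(1) by (simp add: field_simps)
    also have "\<dots> \<le> 2 * \<omega> * h + K1 * \<omega> * (h / \<omega>) * h + v0" using ar(2) unfolding K1_def by simp
    also have "K1 * \<omega> * (h / \<omega>) * h = K1 * h\<^sup>2" using \<omega> by (simp add: power2_eq_square)
    finally show ?thesis by simp
  qed
  show ?thesis
    by (rule exI[of _ K1], rule exI[of _ h0]) (use h0 main in \<open>auto simp: v0_def\<close>)
qed

subsection \<open>The hopping coefficient as a Wronskian\<close>

lemma integrable_continuous_compact_support:
  fixes f :: "'a::euclidean_space \<Rightarrow> real"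
  assumes "continuous_on UNIV f" "\<And>p. norm p > R \<Longrightarrow> f p = 0"
  shows "integrable lborel f"
proof -
  have "integrable lborel (\<lambda>p. indicator (cball 0 R) p *\<^sub>R f p)"
    by (rule borel_integrable_compact) (auto intro: continuous_on_subset[OF assms(1)])
  moreover have "(\<lambda>p. indicator (cball 0 R) p *\<^sub>R f p) = f"
    using assms(2) by (auto simp: fun_eq_iff indicator_def not_le)
  ultimately show ?thesis by simp
qed

lemma integral_odd_snd:
  fixes f :: "real \<times> real \<Rightarrow> real"
  assumes i: "integrable lborel f" and odd: "\<And>x y. f (x, - y) = - f (x, y)"
  shows "(LINT p|lborel. f p) = 0"
proof -
  have i': "integrable (lborel \<Otimes>\<^sub>M lborel) f" using i by (simp add: lborel_prod)
  have "(LINT y|lborel. f (x, y)) = 0" for x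
  proof -
    have "(LINT y|lborel. f (x, y)) = (LINT y|lborel. f (x, - y))"
      by (subst lborel_integral_real_affine[where c = "-1" and t = 0]) auto
    then show ?thesis by (simp add: odd)
  qed
  then have "(LINT x|lborel. LINT y|lborel. f (x, y)) = 0" by simp
  moreover have "(LINT x|lborel. LINT y|lborel. f (x, y)) = (LINT p|(lborel \<Otimes>\<^sub>M lborel). f p)"
    by (rule lborel_pair.integral_fst'[OF i'])
  ultimately show ?thesis by (simp add: lborel_prod)
qed

text \<open>After the left well is moved to the origin, the two gauge phases combine to e^(-i B L y
  / h). The remaining factors are even in y by radiality, so the sine part integrates to 0 and the
  coefficient is real.\<close>

lemma hop_real:
  fixes v \<phi> :: "real \<times> real \<Rightarrow> real"
  assumes cv: "continuous_on UNIV v" and cp: "continuous_on UNIV \<phi>" and rad: "radial v" "radial \<phi>"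
    and a: "\<And>p. norm p > a \<Longrightarrow> v p = 0"
  shows "hop B L h v \<phi> = complex_of_real (LINT p|lborel. v p * \<phi> p * (\<phi> (fst p - 2 * L, snd p) * cos (B * L / h * snd p)))"
proof -
  define A where "A = (\<lambda>p. v p * \<phi> p * (\<phi> (fst p - 2 * L, snd p) * cos (B * L / h * snd p)))"
  define A' where "A' = (\<lambda>p. v p * \<phi> p * (\<phi> (fst p - 2 * L, snd p) * sin (B * L / h * snd p)))"
  have ct: "continuous_on UNIV (\<lambda>p. \<phi> (fst p - 2 * L, snd p))"
    by (intro continuous_on_compose2[OF cp] continuous_intros) auto
  have cA: "continuous_on UNIV A" unfolding A_def by (intro continuous_intros cv cp ct)
  have cA': "continuous_on UNIV A'" unfolding A'_def by (intro continuous_intros cv cp ct)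
  have iA: "integrable lborel A" by (rule integrable_continuous_compact_support[OF cA, of a]) (simp add: A_def a)
  have iA': "integrable lborel A'" by (rule integrable_continuous_compact_support[OF cA', of a]) (simp add: A'_def a)
  define H where "H = (\<lambda>p. complex_of_real (A p) - \<i> * complex_of_real (A' p))"
  have cH: "continuous_on UNIV H" unfolding H_def by (intro continuous_intros cA cA')
  have "hop B L h v \<phi> = (LINT p|lborel. H ((L, 0) + p))"
    unfolding hop_def
  proof (rule Bochner_Integration.integral_cong)
    fix p :: "real \<times> real"
    obtain x y where p: "p = (x, y)" by (cases p)
    have c: "cis (- (B / 2 * y * (L - x)) / h) * cnj (cis (- (- (B / 2) * y * (L + x)) / h)) = cis (- (B * L / h * y))"
      unfolding cis_cnj cis_mult by (rule arg_cong[where f = cis]) (cases "h = 0"; simp add: field_simps)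
    have "(case p of (x, y) \<Rightarrow> of_real (v (x + L, y)) * (cis (- (B / 2 * y * (L - x)) / h) * of_real (\<phi> (x + L, y)))
      * cnj (cis (- (- (B / 2) * y * (L + x)) / h) * of_real (\<phi> (x - L, y)))) =
       of_real (v (x + L, y) * \<phi> (x + L, y) * \<phi> (x - L, y)) * (cis (- (B / 2 * y * (L - x)) / h) * cnj (cis (- (- (B / 2) * y * (L + x)) / h)))"
      by (simp add: p)
    also have "\<dots> = of_real (v (x + L, y) * \<phi> (x + L, y) * \<phi> (x - L, y)) * cis (- (B * L / h * y))" unfolding c ..
    also have "\<dots> = H ((L, 0) + p)"
      unfolding H_def A_def A'_def p by (simp add: cis.ctr complex_eq_iff add.commute)
    finally show "(case p of (x, y) \<Rightarrow> of_real (v (x + L, y)) * (cis (- (B / 2 * y * (L - x)) / h) * of_real (\<phi> (x + L, y)))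
      * cnj (cis (- (- (B / 2) * y * (L + x)) / h) * of_real (\<phi> (x - L, y)))) = H ((L, 0) + p)" .
  qed simp
  also have "\<dots> = (LINT p|distr lborel borel ((+) (L, 0)). H p)"
    by (subst integral_distr) (auto intro!: borel_measurable_continuous_onI cH)
  also have "\<dots> = (LINT p|lborel. H p)" by (simp only: lborel_distr_plus)
  also have "\<dots> = complex_of_real (LINT p|lborel. A p) - \<i> * complex_of_real (LINT p|lborel. A' p)"
  proof -
    have 1: "integrable lborel (\<lambda>p. complex_of_real (A p))" "integrable lborel (\<lambda>p. complex_of_real (A' p))"
      by (rule integrable_of_real[OF iA], rule integrable_of_real[OF iA'])
    show ?thesis unfolding H_def
      by (simp only: Bochner_Integration.integral_diff[OF 1(1) integrable_mult_right[OF 1(2)]] integral_mult_right_zero integral_complex_of_real)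
  qed
  also have "(LINT p|lborel. A' p) = 0"
  proof (rule integral_odd_snd[OF iA'])
    fix x y :: real
    have ev: "f (x, - y) = f (x, y)" if "radial f" for f :: "real \<times> real \<Rightarrow> real" and x y :: real
    proof -
      have "norm (x, - y) = norm (x, y)" by (simp add: norm_prod_def)
      then show ?thesis using that unfolding radial_def by blast
    qed
    show "A' (x, - y) = - A' (x, y)" by (simp add: A'_def ev[OF rad(1)] ev[OF rad(2)])
  qed
  finally show ?thesis by (simp add: A_def)
qed

text \<open>Green's identity in radial form: the equations of f and G differ by the term v alone, so
  the derivative of r (f' G - f G') is r v f G / h^2. The boundary term at 0 vanishes by the factor
  r, and v = 0 beyond a < L, so the whole integral is the value at L.\<close>

lemma hop_formula:
  fixes v \<phi> :: "real \<times> real \<Rightarrow> real"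
  assumes gs: "ground_state B h v \<phi>" and rad\<phi>: "radial \<phi>" and smv: "smooth2 v" and rad: "radial v"
    and h: "h > 0" and a: "0 < a" "a < L" and supp: "\<And>p. norm p > a \<Longrightarrow> v p = 0"
  shows "\<exists>G G1 G2. (\<forall>r. \<bar>r\<bar> < 2 * L - a \<longrightarrow> (G has_real_derivative G1 r) (at r)) \<and>
    (\<forall>r. \<bar>r\<bar> < 2 * L - a \<longrightarrow> (G1 has_real_derivative G2 r) (at r)) \<and>
    (\<forall>r. 0 < r \<and> r < 2 * L - a \<longrightarrow> G2 r + G1 r / r = (B\<^sup>2 * r\<^sup>2 / 4 + (- spec_bottom B h v)) / h\<^sup>2 * G r) \<and>
    G 0 = \<phi> (2 * L, 0) \<and>
    hop B L h v \<phi> = complex_of_real (2 * pi * h\<^sup>2 * L * (pd [True] \<phi> (L, 0) * G L - \<phi> (L, 0) * G1 L))"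
proof -
  define lam where "lam = spec_bottom B h v"
  define f where "f = (\<lambda>r. \<phi> (r, 0))"
  define f1 where "f1 = (\<lambda>r. pd [True] \<phi> (r, 0))"
  define f2 where "f2 = (\<lambda>r. pd [True, True] \<phi> (r, 0))"
  have sm: "smooth2 \<phi>" using gs by (simp add: ground_state_def)
  have df: "(f has_real_derivative f1 r) (at r)" for r unfolding f_def f1_def using smooth2_dx_real[OF sm, of "[]" 0 r] by simp
  have df1: "(f1 has_real_derivative f2 r) (at r)" for r unfolding f1_def f2_def using smooth2_dx_real[OF sm, of "[True]" 0 r] by simp
  have ode: "f2 r + f1 r / r = (B\<^sup>2 * r\<^sup>2 / 4 + v (r, 0) - lam) / h\<^sup>2 * f r" if "r > 0" for r
    unfolding f_def f1_def f2_def lam_def by (rule ground_state_radial_ode[OF gs rad\<phi> h that])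
  have cp: "continuous_on UNIV \<phi>" using smooth2_cont[OF sm, of "[]"] by simp
  have cv: "continuous_on UNIV v" using smooth2_cont[OF smv, of "[]"] by simp
  \<comment> \<open>The profile in the variable s = r^2, where the free radial equation reads 4 s
    F'' + 4 F' = (B^2 s / 4 - lam) F / h^2.\<close>
  define F where "F = (\<lambda>s. f (sqrt s))"
  define F1 where "F1 = (\<lambda>s. f1 (sqrt s) / (2 * sqrt s))"
  define F2 where "F2 = (\<lambda>s. (f2 (sqrt s) - f1 (sqrt s) / sqrt s) / (4 * s))"
  define G where "G = circle_average F L (B / h * L)"
  have dsq: "(sqrt has_real_derivative 1 / (2 * sqrt s)) (at s)" if "s > 0" for s
    using DERIV_real_sqrt[OF that] by (simp add: field_simps)
  have sp: "s > 0" if "s > a\<^sup>2" for s using that zero_le_power2[of a] by linarith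
  have dF: "(F has_real_derivative F1 s) (at s)" if "s > a\<^sup>2" for s
    unfolding F_def F1_def using DERIV_chain2[OF df dsq[OF sp[OF that]]] by simp
  have dF1: "(F1 has_real_derivative F2 s) (at s)" if "s > a\<^sup>2" for s
  proof -
    have s: "s > 0" by (rule sp[OF that])
    have "(F1 has_real_derivative ((f2 (sqrt s) * (1 / (2 * sqrt s))) * (2 * sqrt s) - f1 (sqrt s) * (2 * (1 / (2 * sqrt s)))) / ((2 * sqrt s) * (2 * sqrt s))) (at s)"
      unfolding F1_def by (rule DERIV_divide[OF DERIV_chain2[OF df1 dsq[OF s]] DERIV_cmult[OF dsq[OF s]]]) (use s in simp)
    moreover have "((f2 (sqrt s) * (1 / (2 * sqrt s))) * (2 * sqrt s) - f1 (sqrt s) * (2 * (1 / (2 * sqrt s)))) / ((2 * sqrt s) * (2 * sqrt s)) = F2 s"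
      unfolding F2_def using s by simp
    ultimately show ?thesis by simp
  qed
  have odeF: "4 * s * F2 s + 4 * F1 s = ((B / h)\<^sup>2 * s / 4 - lam / h\<^sup>2) * F s" if "s > a\<^sup>2" for s
  proof -
    have s: "s > 0" by (rule sp[OF that])
    have "sqrt s > a" using that a by (simp add: real_less_rsqrt)
    then have "v (sqrt s, 0) = 0" using supp[of "(sqrt s, 0)"] a s by (simp add: norm_prod_def)
    then have "f2 (sqrt s) + f1 (sqrt s) / sqrt s = (B\<^sup>2 * s / 4 - lam) / h\<^sup>2 * F s" using ode[of "sqrt s"] s by (simp add: F_def)
    moreover have "4 * s * F2 s + 4 * F1 s = f2 (sqrt s) + f1 (sqrt s) / sqrt s" using s by (simp add: F1_def F2_def field_simps)
    moreover have "(B\<^sup>2 * s / 4 - lam) / h\<^sup>2 = (B / h)\<^sup>2 * s / 4 - lam / h\<^sup>2" by (simp add: power_divide diff_divide_distrib)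
    ultimately show ?thesis by simp
  qed
  obtain G1 G2 where dG: "\<And>r. \<bar>r\<bar> < 2 * L - a \<Longrightarrow> (G has_real_derivative G1 r) (at r)"
    and dG1: "\<And>r. \<bar>r\<bar> < 2 * L - a \<Longrightarrow> (G1 has_real_derivative G2 r) (at r)"
    and odeG0: "\<And>r. 0 < r \<Longrightarrow> r < 2 * L - a \<Longrightarrow> G2 r + G1 r / r = ((B / h)\<^sup>2 * r\<^sup>2 / 4 - lam / h\<^sup>2) * G r"
    using circle_average_ode[where a = a and L = L and F = F and ?F1.0 = F1 and ?F2.0 = F2 and \<beta> = "B / h" and \<Lambda> = "lam / h\<^sup>2", OF _ a(2) dF dF1 odeF] a(1)
    unfolding G_def by fastforce
  have odeG: "G2 r + G1 r / r = (B\<^sup>2 * r\<^sup>2 / 4 + (- lam)) / h\<^sup>2 * G r" if "0 < r" "r < 2 * L - a" for r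
  proof -
    have "(B\<^sup>2 * r\<^sup>2 / 4 + (- lam)) / h\<^sup>2 = (B / h)\<^sup>2 * r\<^sup>2 / 4 - lam / h\<^sup>2" by (simp add: power_divide diff_divide_distrib)
    then show ?thesis using odeG0[OF that] by simp
  qed
  have L0: "L > 0" using a by simp
  have G0: "G 0 = \<phi> (2 * L, 0)"
  proof -
    have "sqrt (4 * L\<^sup>2) = 2 * L" using L0 by (simp add: real_sqrt_mult)
    then show ?thesis by (simp add: G_def circle_average_zero F_def f_def)
  qed
  define \<psi> where "\<psi> = (\<lambda>p. \<phi> (fst p - 2 * L, snd p) * cos (B * L / h * snd p))"
  have c\<psi>: "continuous_on UNIV \<psi>" unfolding \<psi>_def
    by (intro continuous_intros continuous_on_compose2[OF cp]) auto
  have cw: "continuous_on UNIV (\<lambda>p. v p * \<phi> p)" by (intro continuous_intros cv cp)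
  have rw: "radial (\<lambda>p. v p * \<phi> p)" 
  proof -
    have "v p = v q" "\<phi> p = \<phi> q" if "norm p = norm q" for p q
      using that rad rad\<phi> unfolding radial_def by blast+
    then show ?thesis unfolding radial_def by (metis (no_types))
  qed
  have avg: "integral {0..2 * pi} (\<lambda>\<theta>. \<psi> (r * cos \<theta>, r * sin \<theta>)) / (2 * pi) = G r" for r
  proof -
    have "\<psi> (r * cos \<theta>, r * sin \<theta>) = F (r\<^sup>2 - 4 * L * r * cos \<theta> + 4 * L\<^sup>2) * cos (B / h * L * r * sin \<theta>)" for \<theta>
    proof -
      have "(r * cos \<theta> - 2 * L)\<^sup>2 + (r * sin \<theta>)\<^sup>2 = r\<^sup>2 - 4 * L * r * cos \<theta> + 4 * L\<^sup>2"
        using sin_cos_squared_add[of \<theta>] by algebra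
      then have "norm (r * cos \<theta> - 2 * L, r * sin \<theta>) = sqrt (r\<^sup>2 - 4 * L * r * cos \<theta> + 4 * L\<^sup>2)" by (simp add: norm_prod_def)
      then have "\<phi> (r * cos \<theta> - 2 * L, r * sin \<theta>) = F (r\<^sup>2 - 4 * L * r * cos \<theta> + 4 * L\<^sup>2)"
        using radial_norm[OF rad\<phi>, of "(r * cos \<theta> - 2 * L, r * sin \<theta>)"] by (simp add: F_def f_def)
      then show ?thesis by (simp add: \<psi>_def mult_ac)
    qed
    then show ?thesis by (simp add: G_def circle_average_def)
  qed
  define q where "q = (\<lambda>s. v (sqrt s, 0) * f (sqrt s) * G (sqrt s))"
  have srt: "\<bar>sqrt s\<bar> < 2 * L - a" if "s \<in> {0..L\<^sup>2}" for s
  proof -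
    have "sqrt s \<le> L" using that L0 by (intro real_le_lsqrt) auto
    then show ?thesis using that a by simp
  qed
  have cG: "continuous_on {0..L\<^sup>2} (\<lambda>s. G (sqrt s))" "continuous_on {0..L\<^sup>2} (\<lambda>s. G1 (sqrt s))"
  proof -
    have c: "continuous_on {r. \<bar>r\<bar> < 2 * L - a} G" "continuous_on {r. \<bar>r\<bar> < 2 * L - a} G1"
      using dG dG1 by (auto intro!: continuous_at_imp_continuous_on intro: DERIV_isCont)
    show "continuous_on {0..L\<^sup>2} (\<lambda>s. G (sqrt s))" "continuous_on {0..L\<^sup>2} (\<lambda>s. G1 (sqrt s))"
      by (rule continuous_on_compose2[OF c(1)], intro continuous_intros, use srt in force,
          rule continuous_on_compose2[OF c(2)], intro continuous_intros, use srt in force)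
  qed
  have cf: "continuous_on UNIV f" "continuous_on UNIV f1"
    using df df1 by (auto intro!: continuous_at_imp_continuous_on DERIV_isCont)
  have cfs: "continuous_on A (\<lambda>s. f (sqrt s))" "continuous_on A (\<lambda>s. f1 (sqrt s))" "continuous_on A (\<lambda>s. v (sqrt s, 0))" for A
    by (rule continuous_on_compose2[OF cf(1)], intro continuous_intros, simp,
        rule continuous_on_compose2[OF cf(2)], intro continuous_intros, simp,
        rule continuous_on_compose2[OF cv], intro continuous_intros, simp)
  have cq: "continuous_on {0..L\<^sup>2} q" unfolding q_def by (intro continuous_intros cfs cG)
  \<comment> \<open>G is controlled only for |r| < 2L - a, so the integrand is cut off at radius L;
    since a < L < 2L - a the cut lies outside the support of v and inside the domain of G.\<close>
  define Hs where "Hs = (\<lambda>s. indicator {0..L\<^sup>2} s *\<^sub>R q s)"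
  have mH: "Hs \<in> borel_measurable borel"
    unfolding Hs_def by (rule borel_measurable_continuous_on_indicator[OF _ cq]) simp
  have Hp: "v p * \<phi> p * G (norm p) = Hs ((norm p)\<^sup>2)" for p
  proof (cases "norm p \<le> L")
    case True
    then have "(norm p)\<^sup>2 \<in> {0..L\<^sup>2}" by (auto intro!: power_mono)
    moreover have "q ((norm p)\<^sup>2) = v p * \<phi> p * G (norm p)"
      unfolding q_def f_def using radial_norm[OF rad, of p] radial_norm[OF rad\<phi>, of p] by simp
    ultimately show ?thesis by (simp add: Hs_def)
  next
    case False
    then have "v p = 0" using supp[of p] a by simp
    moreover have "(norm p)\<^sup>2 \<notin> {0..L\<^sup>2}" using False L0 by (simp add: not_le power_strict_mono)
    ultimately show ?thesis by (simp add: Hs_def)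
  qed
  have "(LINT p|lborel. v p * \<phi> p * \<psi> p) = (LINT p|lborel. v p * \<phi> p * G (norm p))"
    using radial_integral_circle_average[OF cw rw _ c\<psi>, of a] supp unfolding avg by simp
  also have "\<dots> = (LINT p|lborel. Hs ((norm (p :: real \<times> real))\<^sup>2))" unfolding Hp ..
  also have "\<dots> = pi * (LINT s:{0..}|lborel. Hs s)" by (rule integral_radial[OF mH])
  also have "(LINT s:{0..}|lborel. Hs s) = (LINT s:{0..L\<^sup>2}|lborel. q s)"
    unfolding set_lebesgue_integral_def Hs_def by (rule Bochner_Integration.integral_cong) (auto simp: indicator_def)
  also have "\<dots> = integral {0..L\<^sup>2} q"
    by (rule set_borel_integral_eq_integral(2)) (rule borel_integrable_atLeastAtMost'[OF cq])
  also have "integral {0..L\<^sup>2} q = 2 * h\<^sup>2 * (L * (f1 L * G L - f L * G1 L))"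
  proof -
    define T where "T = (\<lambda>s. 2 * h\<^sup>2 * (sqrt s * (f1 (sqrt s) * G (sqrt s) - f (sqrt s) * G1 (sqrt s))))"
    have "(q has_integral (T (L\<^sup>2) - T 0)) {0..L\<^sup>2}"
    proof (rule fundamental_theorem_of_calculus_interior)
      show "continuous_on {0..L\<^sup>2} T" unfolding T_def by (intro continuous_intros cfs cG)
      fix s assume s: "s \<in> {0<..<L\<^sup>2}"
      define r where "r = sqrt s"
      have r: "r > 0" "\<bar>r\<bar> < 2 * L - a" "r < 2 * L - a" using s srt[of s] by (auto simp: r_def)
      define W where "W = (\<lambda>r. r * (f1 r * G r - f r * G1 r))"
      have "(W has_real_derivative 1 * (f1 r * G r - f r * G1 r) + ((f2 r * G r + G1 r * f1 r) - (f1 r * G1 r + G2 r * f r)) * r) (at r)"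
        unfolding W_def by (rule DERIV_mult[OF DERIV_ident DERIV_diff[OF DERIV_mult[OF df1 dG[OF r(2)]] DERIV_mult[OF df dG1[OF r(2)]]]])
      moreover have "1 * (f1 r * G r - f r * G1 r) + ((f2 r * G r + G1 r * f1 r) - (f1 r * G1 r + G2 r * f r)) * r
          = r * ((f2 r + f1 r / r) * G r - f r * (G2 r + G1 r / r))"
        using r by (simp add: field_simps)
      moreover have "\<dots> = r * (v (r, 0) / h\<^sup>2 * f r * G r)"
        unfolding ode[OF r(1)] odeG[OF r(1,3)] by (simp add: add_divide_distrib diff_divide_distrib algebra_simps)
      ultimately have dW: "(W has_real_derivative r * (v (r, 0) / h\<^sup>2 * f r * G r)) (at r)" by simp
      have "s > 0" using s by simp
      have "((\<lambda>s. W (sqrt s)) has_real_derivative (r * (v (r, 0) / h\<^sup>2 * f r * G r)) * (1 / (2 * sqrt s))) (at s)"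
        by (rule DERIV_chain2[OF _ dsq[OF \<open>s > 0\<close>]]) (use dW in \<open>simp add: r_def\<close>)
      then have "(T has_real_derivative 2 * h\<^sup>2 * ((r * (v (r, 0) / h\<^sup>2 * f r * G r)) * (1 / (2 * sqrt s)))) (at s)"
        unfolding T_def W_def by (rule DERIV_cmult)
      moreover have "2 * h\<^sup>2 * ((r * (v (r, 0) / h\<^sup>2 * f r * G r)) * (1 / (2 * sqrt s))) = q s"
        using r h unfolding q_def r_def[symmetric] by simp
      ultimately show "(T has_vector_derivative q s) (at s)"
        by (simp add: has_real_derivative_iff_has_vector_derivative)
    qed simp
    then show ?thesis using L0 by (simp add: integral_unique T_def)
  qed
  finally have "(LINT p|lborel. v p * \<phi> p * \<psi> p) = 2 * pi * h\<^sup>2 * L * (f1 L * G L - f L * G1 L)" by simp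
  moreover have "hop B L h v \<phi> = complex_of_real (LINT p|lborel. v p * \<phi> p * \<psi> p)"
    unfolding \<psi>_def by (rule hop_real[OF cv cp rad rad\<phi> supp])
  ultimately have "hop B L h v \<phi> = complex_of_real (2 * pi * h\<^sup>2 * L * (pd [True] \<phi> (L, 0) * G L - \<phi> (L, 0) * G1 L))"
    by (simp add: f_def f1_def)
  then show ?thesis using dG dG1 odeG G0 unfolding lam_def by (intro exI[of _ G] exI[of _ G1] exI[of _ G2]) auto
qed

subsection \<open>The tunnelling asymptotics\<close>

text \<open>The quantity \<Psi>(L) as a function of the spectral parameter, stated outside the
  locale so that \<mu> can vary and be differentiated.\<close>

definition phase :: "real \<Rightarrow> real \<Rightarrow> real \<Rightarrow> real" where
  "phase B L \<mu> = integral {0..L} (\<lambda>r. sqrt (B\<^sup>2 * r\<^sup>2 / 4 + \<mu>))"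

definition phase' :: "real \<Rightarrow> real \<Rightarrow> real \<Rightarrow> real" where
  "phase' B L \<mu> = integral {0..L} (\<lambda>r. 1 / (2 * sqrt (B\<^sup>2 * r\<^sup>2 / 4 + \<mu>)))"

text \<open>Needed because the energy sits a distance of about 2 \<omega> h above the bottom of the
  well: dividing by h, the growth exponent changes by a finite amount given by this
  derivative.\<close>

lemma phase_deriv:
  assumes "\<mu> > 0"
  shows "(phase B L has_real_derivative phase' B L \<mu>) (at \<mu>)"
proof -
  have pos: "B\<^sup>2 * r\<^sup>2 / 4 + x > 0" if "x > 0" for r x :: real
    using that by (intro add_nonneg_pos) auto
  have "((\<lambda>x. integral (cbox 0 L) (\<lambda>r. sqrt (B\<^sup>2 * r\<^sup>2 / 4 + x))) has_field_derivative
     integral (cbox 0 L) (\<lambda>r. 1 / (2 * sqrt (B\<^sup>2 * r\<^sup>2 / 4 + \<mu>)))) (at \<mu> within {0<..})"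
  proof (rule leibniz_rule_field_derivative[where fx = "\<lambda>x r. 1 / (2 * sqrt (B\<^sup>2 * r\<^sup>2 / 4 + x))"])
    show "((\<lambda>x. sqrt (B\<^sup>2 * r\<^sup>2 / 4 + x)) has_real_derivative 1 / (2 * sqrt (B\<^sup>2 * r\<^sup>2 / 4 + x))) (at x within {0<..})"
      if "x \<in> {0<..}" for x r
    proof -
      have d: "((\<lambda>x. sqrt (B\<^sup>2 * r\<^sup>2 / 4 + x)) has_real_derivative (inverse (sqrt (B\<^sup>2 * r\<^sup>2 / 4 + x)) / 2) * 1) (at x)"
      proof (rule DERIV_chain2[where f = sqrt and g = "\<lambda>x. B\<^sup>2 * r\<^sup>2 / 4 + x"])
        show "(sqrt has_real_derivative inverse (sqrt (B\<^sup>2 * r\<^sup>2 / 4 + x)) / 2) (at (B\<^sup>2 * r\<^sup>2 / 4 + x))"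
          by (rule DERIV_real_sqrt) (use pos that in simp)
        show "((\<lambda>x. B\<^sup>2 * r\<^sup>2 / 4 + x) has_real_derivative 1) (at x)" by (auto intro!: derivative_eq_intros)
      qed
      have e: "(inverse t / 2) * 1 = 1 / (2 * t)" for t :: real by (simp add: inverse_eq_divide)
      show ?thesis using has_field_derivative_at_within[OF d] unfolding e .
    qed
    show "(\<lambda>r. sqrt (B\<^sup>2 * r\<^sup>2 / 4 + x)) integrable_on cbox 0 L" for x
      by (intro integrable_continuous continuous_intros) auto
    show "continuous_on ({0<..} \<times> cbox 0 L) (\<lambda>(x, r). 1 / (2 * sqrt (B\<^sup>2 * r\<^sup>2 / 4 + x)))"
      unfolding split_beta
    proof (intro continuous_intros ballI)
      fix z :: "real \<times> real" assume "z \<in> {0<..} \<times> cbox 0 L"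
      then have "B\<^sup>2 * (snd z)\<^sup>2 / 4 + fst z > 0" using pos by auto
      then show "2 * sqrt (B\<^sup>2 * (snd z)\<^sup>2 / 4 + fst z) \<noteq> 0" by simp
    qed auto
  qed (use assms in auto)
  then have "((\<lambda>x. integral {0..L} (\<lambda>r. sqrt (B\<^sup>2 * r\<^sup>2 / 4 + x))) has_real_derivative
     integral {0..L} (\<lambda>r. 1 / (2 * sqrt (B\<^sup>2 * r\<^sup>2 / 4 + \<mu>)))) (at \<mu>)"
    using assms at_within_open[of \<mu> "{0<..}"] by simp
  then show ?thesis by (simp add: phase_def[abs_def] phase'_def)
qed

text \<open>Beyond L the well is absent, so after reflection r -> 2L - r the first square root
  integrates to \<Phi>(2L) - \<Phi>(L). What remains is decay to L, plus decay to 2L, minus the free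
  growth from 0 to L.\<close>

lemma (in well_potential) tunnel_exponent:
  assumes V: "\<And>r. V r = B\<^sup>2 * r\<^sup>2 / 4 + v (r, 0) - v (0, 0)" and L: "L > 0" and far: "\<And>r. r \<ge> L \<Longrightarrow> v (r, 0) = 0"
  shows "tunnel_S B L v = \<Phi> L + \<Phi> (2 * L) - phase B L (- v (0, 0))"
proof -
  have d: "dist_agmon B L v = \<Phi> L" unfolding dist_agmon_def \<Phi>_def p_def[abs_def] V ..
  define q where "q = (\<lambda>r. sqrt (B\<^sup>2 * r\<^sup>2 / 4 - v (0, 0)))"
  have pq: "p r = q r" if "r \<ge> L" for r unfolding p_def q_def V far[OF that] by simp
  have cq: "continuous_on A q" for A unfolding q_def by (intro continuous_intros) auto
  have cq2: "continuous_on A (\<lambda>r. q (2 * L - r))" for A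
    by (rule continuous_on_compose2[OF cq[of UNIV]]) (auto intro!: continuous_intros)
  have "((\<lambda>r. q (2 * L - r)) has_integral ((- \<Phi> (2 * L - L)) - (- \<Phi> (2 * L - 0)))) {0..L}"
  proof (rule fundamental_theorem_of_calculus)
    fix r assume r: "r \<in> {0..L}"
    have "((\<lambda>r. - \<Phi> (2 * L - r)) has_real_derivative - (p (2 * L - r) * (- 1))) (at r)"
      by (rule DERIV_minus, rule DERIV_chain2[where f = \<Phi> and g = "\<lambda>r. 2 * L - r"])
        (use r L in \<open>auto intro!: derivative_eq_intros \<Phi>_deriv\<close>)
    then have "((\<lambda>r. - \<Phi> (2 * L - r)) has_real_derivative q (2 * L - r)) (at r)" using pq[of "2 * L - r"] r by simp
    then show "((\<lambda>r. - \<Phi> (2 * L - r)) has_vector_derivative q (2 * L - r)) (at r within {0..L})"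
      by (simp add: has_real_derivative_iff_has_vector_derivative has_vector_derivative_at_within)
  qed (use L in simp)
  then have i2: "integral {0..L} (\<lambda>r. q (2 * L - r)) = \<Phi> (2 * L) - \<Phi> L" by (simp add: integral_unique)
  have "integral {0..L} (\<lambda>r. sqrt (B\<^sup>2 * (2 * L - r)\<^sup>2 / 4 - v (0, 0)) - sqrt (B\<^sup>2 * r\<^sup>2 / 4 - v (0, 0))) =
     integral {0..L} (\<lambda>r. q (2 * L - r)) - integral {0..L} q"
  proof -
    have "(\<lambda>r. sqrt (B\<^sup>2 * (2 * L - r)\<^sup>2 / 4 - v (0, 0)) - sqrt (B\<^sup>2 * r\<^sup>2 / 4 - v (0, 0))) = (\<lambda>r. q (2 * L - r) - q r)"
      by (simp add: q_def)
    then show ?thesis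
      using Henstock_Kurzweil_Integration.integral_diff[OF integrable_continuous_real[OF cq2] integrable_continuous_real[OF cq]] by simp
  qed
  moreover have "integral {0..L} q = phase B L (- v (0, 0))" by (simp add: phase_def q_def)
  ultimately show ?thesis unfolding tunnel_S_def d using i2 by simp
qed

text \<open>The Bessel argument is at least s0 L / h and tends to infinity. Its factor
  (\<Psi>/h)^(-1/2) cancels the square root of \<Psi> in the amplitude and leaves sqrt h; for the
  logarithmic derivative, I1/I0 tends to 1 and the amplitude contributes only O(h).\<close>

lemma growth_limits:
  fixes B L s0 \<mu>0 :: real
  assumes B: "B > 0" and L: "L > 0" and s0: "s0 > 0"
    and \<mu>: "(\<mu> \<longlongrightarrow> \<mu>0) (at_right (0::real))" and ev: "\<forall>\<^sub>F h in at_right 0. s0\<^sup>2 \<le> \<mu> h"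
    and c1: "c1 > 0" "\<And>x. x > 0 \<Longrightarrow> c1 \<le> 1 / x + 2 * (I1 x / I0 x)"
  defines "P0 \<equiv> sqrt (B\<^sup>2 * L\<^sup>2 / 4 + \<mu>0)"
  shows "((\<lambda>h. free_growth.k B (\<mu> h) h L / (sqrt h * exp (phase B L (\<mu> h) / h))) \<longlongrightarrow> (sqrt (pi / 2) / pi) / sqrt (L * P0)) (at_right 0)"
    and "((\<lambda>h. h * free_growth.lk B (\<mu> h) h L) \<longlongrightarrow> P0) (at_right 0)"
proof -
  have fg: "\<forall>\<^sub>F h in at_right 0. free_growth B (\<mu> h) s0 L c1 \<and> h > 0"
    using ev eventually_at_right_less[of "0::real"]
    by eventually_elim (use assms in \<open>auto simp: free_growth_def\<close>)
  define x where "x = (\<lambda>h. phase B L (\<mu> h) / h)"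
  have Psi: "free_growth.\<Psi> B (\<mu> h) L = phase B L (\<mu> h)" if "free_growth B (\<mu> h) s0 L c1" for h
    unfolding free_growth.\<Psi>_def[OF that] phase_def by (simp add: free_growth.P_def[OF that, abs_def])
  have xtop: "filterlim x at_top (at_right 0)"
  proof (rule filterlim_at_top_mono)
    have "0 < s0 * L" using s0 L by simp
    then show "filterlim (\<lambda>h. s0 * L / h) at_top (at_right 0)" by real_asymp
    show "\<forall>\<^sub>F h in at_right 0. s0 * L / h \<le> x h" using fg
    proof eventually_elim
      case (elim h)
      then interpret free_growth B "\<mu> h" s0 L c1 by simp
      show ?case unfolding x_def using \<Psi>_ge[of L] L Psi[OF conjunct1[OF elim]] elim by (auto intro!: divide_right_mono)
    qed
  qed
  have P: "((\<lambda>h. sqrt (B\<^sup>2 * L\<^sup>2 / 4 + \<mu> h)) \<longlongrightarrow> P0) (at_right 0)" unfolding P0_def by (intro tendsto_intros \<mu>)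
  have "s0\<^sup>2 \<le> \<mu>0" by (rule tendsto_lowerbound[OF \<mu> ev]) simp
  then have mu0: "\<mu>0 > 0" using s0 by (meson less_le_trans zero_less_power)
  have P0: "P0 > 0" unfolding P0_def using mu0 by (simp add: add_nonneg_pos)
  have "((\<lambda>h. (sqrt (x h) * exp (- x h) * I0 (x h)) / sqrt (L * sqrt (B\<^sup>2 * L\<^sup>2 / 4 + \<mu> h))) \<longlongrightarrow> (sqrt (pi / 2) / pi) / sqrt (L * P0)) (at_right 0)"
    using L P0 by (intro tendsto_intros P filterlim_compose[OF I0_asymp xtop]) auto
  then show "((\<lambda>h. free_growth.k B (\<mu> h) h L / (sqrt h * exp (phase B L (\<mu> h) / h))) \<longlongrightarrow> (sqrt (pi / 2) / pi) / sqrt (L * P0)) (at_right 0)"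
  proof (rule Lim_transform_eventually)
    show "\<forall>\<^sub>F h in at_right 0. (sqrt (x h) * exp (- x h) * I0 (x h)) / sqrt (L * sqrt (B\<^sup>2 * L\<^sup>2 / 4 + \<mu> h)) =
       free_growth.k B (\<mu> h) h L / (sqrt h * exp (phase B L (\<mu> h) / h))"
      using fg
    proof eventually_elim
      case (elim h)
      then interpret free_growth B "\<mu> h" s0 L c1 by simp
      have ps: "\<Psi> L = phase B L (\<mu> h)" using Psi elim by simp
      have h: "h > 0" using elim by simp
      have "k h L = I0 (x h) * sqrt (phase B L (\<mu> h) / (L * P L))" using L by (simp add: k_def amp_def x_def ps)
      moreover have "sqrt (x h) = sqrt (phase B L (\<mu> h)) / sqrt h" by (simp add: x_def real_sqrt_divide)
      moreover have "exp (- x h) = 1 / exp (phase B L (\<mu> h) / h)" by (simp add: x_def exp_minus field_simps)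
      ultimately show ?case using h by (simp add: P_def real_sqrt_divide mult_ac)
    qed
  qed
  have r: "((\<lambda>h. I1 (x h) / I0 (x h)) \<longlongrightarrow> 1) (at_right 0)" by (rule filterlim_compose[OF I1_I0_ratio xtop])
  have e: "((\<lambda>h. h * free_growth.\<eta> B (\<mu> h) L) \<longlongrightarrow> 0) (at_right 0)"
  proof (rule Lim_null_comparison)
    show "\<forall>\<^sub>F h in at_right 0. norm (h * free_growth.\<eta> B (\<mu> h) L) \<le> h * (free_growth.A B s0 * L)"
      using fg
    proof eventually_elim
      case (elim h)
      then interpret free_growth B "\<mu> h" s0 L c1 by simp
      show ?case using \<eta>_bound[OF L] elim by (auto simp: abs_mult)
    qed
    have "((\<lambda>h. h * (free_growth.A B s0 * L)) \<longlongrightarrow> 0 * (free_growth.A B s0 * L)) (at_right 0)" by (intro tendsto_intros)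
    then show "((\<lambda>h. h * (free_growth.A B s0 * L)) \<longlongrightarrow> 0) (at_right 0)" by simp
  qed
  have "((\<lambda>h. sqrt (B\<^sup>2 * L\<^sup>2 / 4 + \<mu> h) * (I1 (x h) / I0 (x h)) + h * free_growth.\<eta> B (\<mu> h) L) \<longlongrightarrow> P0 * 1 + 0) (at_right 0)"
    by (intro tendsto_intros P r e)
  then have "((\<lambda>h. sqrt (B\<^sup>2 * L\<^sup>2 / 4 + \<mu> h) * (I1 (x h) / I0 (x h)) + h * free_growth.\<eta> B (\<mu> h) L) \<longlongrightarrow> P0) (at_right 0)" by simp
  then show "((\<lambda>h. h * free_growth.lk B (\<mu> h) h L) \<longlongrightarrow> P0) (at_right 0)"
  proof (rule Lim_transform_eventually)
    show "\<forall>\<^sub>F h in at_right 0. sqrt (B\<^sup>2 * L\<^sup>2 / 4 + \<mu> h) * (I1 (x h) / I0 (x h)) + h * free_growth.\<eta> B (\<mu> h) L = h * free_growth.lk B (\<mu> h) h L"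
      using fg
    proof eventually_elim
      case (elim h)
      then interpret free_growth B "\<mu> h" s0 L c1 by simp
      have ps: "\<Psi> L = phase B L (\<mu> h)" using Psi elim by simp
      show ?case using elim by (simp add: lk_def ps x_def P_def ring_distribs)
    qed
  qed
qed

theorem theorem4p1:
  fixes v :: "real \<times> real \<Rightarrow> real" and B L a :: real
  assumes v_smooth: "smooth2 v"
    and v_supp: "compact_supp v"
    and v_nonpos: "\<forall>p. v p \<le> 0"
    and v_radial: "radial v"
    and v_min: "v (0, 0) < 0" "\<forall>p. p \<noteq> (0, 0) \<longrightarrow> v (0, 0) < v p"
    and v_nondeg: "pd [True, True] v (0, 0) > 0"
      "pd [True, True] v (0, 0) * pd [False, False] v (0, 0) - (pd [True, False] v (0, 0))\<^sup>2 > 0"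
    and a_pos: "a > 0"
    and a_supp: "closure {p. v p \<noteq> 0} \<subseteq> cball 0 a"
    and a_least: "\<forall>a'. a' > 0 \<and> closure {p. v p \<noteq> 0} \<subseteq> cball 0 a' \<longrightarrow> a \<le> a'"
    and B_pos: "B > 0"
    and L_gt: "L > a"
  shows "\<exists>C > 0. \<forall>\<phi> :: real \<Rightarrow> real \<times> real \<Rightarrow> real.
           (\<forall>\<^sub>F h in at_right 0. ground_state B h v (\<phi> h) \<and> radial (\<phi> h)) \<longrightarrow>
           ((\<lambda>h. hop B L h v (\<phi> h) / complex_of_real (- C * sqrt h * exp (- tunnel_S B L v / h)))
              \<longlongrightarrow> 1) (at_right 0)"
proof -
  have supp: "v p = 0" if "norm p > a" for p
  proof (rule ccontr)
    assume "v p \<noteq> 0"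
    then have "p \<in> closure {p. v p \<noteq> 0}" using closure_subset[of "{p. v p \<noteq> 0}"] by blast
    then have "p \<in> cball 0 a" using a_supp by blast
    then show False using that by simp
  qed
  have min: "\<forall>p. v (0, 0) \<le> v p" using v_min(2) less_imp_le by (metis order_refl)
  define \<omega> where "\<omega> = sqrt (B\<^sup>2 / 4 + pd [True, True] v (0, 0) / 2)"
  obtain K where wp: "well_potential (\<lambda>r. B\<^sup>2 * r\<^sup>2 / 4 + v (r, 0) - v (0, 0)) (\<lambda>r. B\<^sup>2 * r / 2 + pd [True] v (r, 0))
     (\<lambda>r. B\<^sup>2 / 2 + pd [True, True] v (r, 0)) \<omega> (B / 2) K"
    using well_potential_of_radial[OF v_smooth v_radial B_pos min supp v_nondeg(1)] unfolding \<omega>_def by blast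
  interpret W: well_potential "\<lambda>r. B\<^sup>2 * r\<^sup>2 / 4 + v (r, 0) - v (0, 0)" "\<lambda>r. B\<^sup>2 * r / 2 + pd [True] v (r, 0)"
     "\<lambda>r. B\<^sup>2 / 2 + pd [True, True] v (r, 0)" \<omega> "B / 2" K by (rule wp)
  note pd.simps(2) [simp del]
  obtain K1 h1 where h1: "h1 > 0" and up: "\<And>h. 0 < h \<Longrightarrow> h < h1 \<Longrightarrow> spec_bottom B h v - v (0, 0) \<le> 2 * \<omega> * h + K1 * h\<^sup>2"
    using spec_bottom_upper[OF v_smooth v_radial B_pos v_supp min v_nonpos v_min(1) wp] by blast
  obtain N h2 where N: "N > 0" and h2: "h2 > 0" and asy: "\<And>h E f f1 f2. 0 < h \<and> h < h2 \<and> W.eigenfunction h E f f1 f2 \<and> E \<le> 2 * \<omega> * h + K1 * h\<^sup>2 \<Longrightarrow>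
     \<bar>E - 2 * \<omega> * h\<bar> \<le> N * h\<^sup>2 \<and> f 0 \<noteq> 0 \<and> (\<forall>r \<ge> 0. f r / f 0 > 0) \<and>
     (\<forall>r. 0 \<le> r \<and> r \<le> sqrt h \<longrightarrow> \<bar>f r / (f 0 * W.g h r) - 1\<bar> \<le> N * h) \<and>
     (\<forall>r > sqrt h. \<bar>f1 r / f r - W.lg h r\<bar> \<le> N * h / r)"
    using W.eigenfunction_asymptotics[of K1] by blast
  obtain c1 where c1: "c1 > 0" "\<And>x. x > 0 \<Longrightarrow> c1 \<le> 1 / x + 2 * (I1 x / I0 x)" using I_ratio_lower by blast
  have L: "L > 0" using a_pos L_gt by simp
  have \<omega>: "\<omega> > 0" by (rule W.omega_pos)
  define \<mu>0 where "\<mu>0 = - v (0, 0)"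
  \<comment> \<open>Since \<mu> tends to \<open>\<mu>0\<close>, half of \<open>\<mu>0\<close> is
    eventually a lower bound for it, uniform in h.\<close>
  define s0 where "s0 = sqrt (\<mu>0 / 2)"
  define P0 where "P0 = sqrt (B\<^sup>2 * L\<^sup>2 / 4 + \<mu>0)"
  define J where "J = 2 * \<omega> * phase' B L \<mu>0"
  define bb where "bb = exp (W.\<B> L + W.\<B> (2 * L))"
  define c0 where "c0 = (sqrt (pi / 2) / pi) / sqrt (L * P0)"
  \<comment> \<open>Factors by origin: 2 pi L from the Wronskian identity, \<omega> / pi from the
    normalisation, \<open>bb\<close> from the amplitude at L and 2L, \<open>c0\<close> from the
    Bessel asymptotics, exp (- J) from the energy shift, and 2 P0 from the opposite logarithmic
    derivatives at L.\<close>
  define C where "C = 2 * pi * L * (\<omega> / pi) * bb * c0 * exp (- J) * (2 * P0)"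
  define S where "S = tunnel_S B L v"
  have \<mu>0: "\<mu>0 > 0" using v_min(1) by (simp add: \<mu>0_def)
  have s0: "s0 > 0" "s0\<^sup>2 = \<mu>0 / 2" using \<mu>0 by (auto simp: s0_def)
  have P0: "P0 > 0" unfolding P0_def using \<mu>0 by (simp add: add_nonneg_pos)
  have c0: "c0 > 0" unfolding c0_def using L P0 by simp
  have Cpos: "C > 0" unfolding C_def bb_def using L \<omega> c0 P0 by simp
  have far: "v (r, 0) = 0" if "r \<ge> L" for r using supp[of "(r, 0)"] that L_gt L by (simp add: norm_prod_def)
  have S: "S = W.\<Phi> L + W.\<Phi> (2 * L) - phase B L \<mu>0"
    unfolding S_def \<mu>0_def by (rule W.tunnel_exponent[OF refl L far])
  have pL: "W.p L = P0" unfolding W.p_def P0_def \<mu>0_def using far[of L] by simp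
  show ?thesis
  proof (rule exI[of _ C], rule conjI[OF Cpos], rule allI, rule impI)
    fix \<phi> :: "real \<Rightarrow> real \<times> real \<Rightarrow> real"
    assume ev0: "\<forall>\<^sub>F h in at_right 0. ground_state B h v (\<phi> h) \<and> radial (\<phi> h)"
    define good where "good = (\<lambda>h. ground_state B h v (\<phi> h) \<and> radial (\<phi> h))"
    define E where "E = (\<lambda>h. spec_bottom B h v - v (0, 0))"
    define \<mu> where "\<mu> = (\<lambda>h. - spec_bottom B h v)"
    \<comment> \<open>The default 0 makes every \<open>f h\<close> measurable, including those h at
      which nothing is known about \<open>\<phi> h\<close>.\<close>
    define f where "f = (\<lambda>h r. if good h then \<phi> h (r, 0) else 0)"
    define f1 where "f1 = (\<lambda>h r. pd [True] (\<phi> h) (r, 0))"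
    \<comment> \<open>The factor 2 gives 2 h <= h1 with h > 0, hence the strict inequality h < h1;
      likewise for h2.\<close>
    have ev: "\<forall>\<^sub>F h in at_right 0. good h \<and> 0 < h \<and> h < h1 \<and> h < h2"
      using ev0 eventually_small_at_right[OF h1, of 2] eventually_small_at_right[OF h2, of 2] by eventually_elim (auto simp: good_def)
    have \<mu>E: "\<mu> h = \<mu>0 + (- E h)" for h by (simp add: \<mu>_def \<mu>0_def E_def)
    have key: "\<bar>E h - 2 * \<omega> * h\<bar> \<le> N * h\<^sup>2 \<and> W.wkb N h (f h) (f1 h)" if g: "good h \<and> 0 < h \<and> h < h1 \<and> h < h2" for h
    proof -
      have gs: "ground_state B h v (\<phi> h)" and rad: "radial (\<phi> h)" and h: "h > 0" using g by (auto simp: good_def)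
      have sm: "smooth2 (\<phi> h)" using gs by (simp add: ground_state_def)
      have fe: "f h = (\<lambda>r. \<phi> h (r, 0))" using g by (simp add: f_def)
      have d1: "(f h has_real_derivative f1 h r) (at r)" for r
        unfolding fe f1_def using smooth2_dx_real[OF sm, of "[]" 0 r] by simp
      have "W.eigenfunction h (E h) (f h) (f1 h) (\<lambda>r. pd [True, True] (\<phi> h) (r, 0))"
        unfolding W.eigenfunction_def
      proof (intro conjI allI impI)
        show "(f h has_real_derivative f1 h r) (at r)" for r by (rule d1)
        show "(f1 h has_real_derivative pd [True, True] (\<phi> h) (r, 0)) (at r)" for r
          unfolding f1_def using smooth2_dx_real[OF sm, of "[True]" 0 r] by simp
        show "pd [True, True] (\<phi> h) (r, 0) + f1 h r / r = (B\<^sup>2 * r\<^sup>2 / 4 + v (r, 0) - v (0, 0) - E h) / h\<^sup>2 * f h r" if "r > 0" for r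
          using ground_state_radial_ode[OF gs rad h that] unfolding fe f1_def E_def by simp
        show "\<exists>r > 0. f h r \<noteq> 0" unfolding fe by (rule ground_state_nonzero[OF gs rad])
        show "\<exists>r \<ge> R. (f h r)\<^sup>2 < \<epsilon>" if "\<epsilon> > 0" for \<epsilon> R unfolding fe by (rule ground_state_small[OF gs rad that])
      qed
      then show ?thesis using asy[of h "E h" "f h" "f1 h"] up[of h] g d1 unfolding E_def W.wkb_def by blast
    qed
    have wkb: "\<forall>\<^sub>F h in at_right 0. W.wkb N h (f h) (f1 h)" using ev by eventually_elim (use key in blast)
    have Eb: "\<forall>\<^sub>F h in at_right 0. \<bar>E h - 2 * \<omega> * h\<bar> \<le> N * h\<^sup>2" using ev by eventually_elim (use key in blast)
    have Eh: "((\<lambda>h. E h / h) \<longlongrightarrow> 2 * \<omega>) (at_right 0)"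
    proof -
      have "((\<lambda>h. E h / h - 2 * \<omega>) \<longlongrightarrow> 0) (at_right 0)"
      proof (rule Lim_null_comparison)
        show "\<forall>\<^sub>F h in at_right 0. norm (E h / h - 2 * \<omega>) \<le> N * h"
          using Eb eventually_at_right_less[of "0::real"]
        proof eventually_elim
          case (elim h)
          have "E h / h - 2 * \<omega> = (E h - 2 * \<omega> * h) / h" using elim by (simp add: field_simps)
          then have "norm (E h / h - 2 * \<omega>) = \<bar>E h - 2 * \<omega> * h\<bar> / h" using elim by simp
          also have "\<dots> \<le> N * h\<^sup>2 / h" using elim by (intro divide_right_mono) auto
          finally show ?case using elim by (simp add: power2_eq_square)
        qed
        have "((\<lambda>h. N * h) \<longlongrightarrow> N * 0) (at_right 0)" by (intro tendsto_intros)
        then show "((\<lambda>h. N * h) \<longlongrightarrow> 0) (at_right 0)" by simp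
      qed
      then show ?thesis by (simp add: LIM_zero_iff)
    qed
    have E0: "(E \<longlongrightarrow> 0) (at_right 0)"
    proof -
      have "((\<lambda>h. E h / h * h) \<longlongrightarrow> 2 * \<omega> * 0) (at_right 0)" by (intro tendsto_intros Eh)
      then have "((\<lambda>h. E h / h * h) \<longlongrightarrow> 0) (at_right 0)" by simp
      then show ?thesis
        by (rule Lim_transform_eventually) (use eventually_at_right_less[of "0::real"] in eventually_elim, simp)
    qed
    \<comment> \<open>The difference quotient of \<open>phase\<close> is taken along the increment -
      E h, which has to approach 0 without taking the value 0.\<close>
    have Enz: "\<forall>\<^sub>F h in at_right 0. - E h \<noteq> 0"
    proof -
      have "\<forall>\<^sub>F h in at_right 0. 0 < E h / h" by (rule order_tendstoD(1)[OF Eh]) (use \<omega> in simp)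
      then show ?thesis by eventually_elim auto
    qed
    have \<mu>lim: "(\<mu> \<longlongrightarrow> \<mu>0) (at_right 0)"
    proof -
      have "((\<lambda>h. \<mu>0 + (- E h)) \<longlongrightarrow> \<mu>0 + (- 0)) (at_right 0)" by (intro tendsto_intros E0)
      then show ?thesis unfolding \<mu>E by simp
    qed
    have \<mu>ev: "\<forall>\<^sub>F h in at_right 0. s0\<^sup>2 \<le> \<mu> h"
    proof -
      have "\<forall>\<^sub>F h in at_right 0. \<mu>0 / 2 < \<mu> h" by (rule order_tendstoD(1)[OF \<mu>lim]) (use \<mu>0 in simp)
      then show ?thesis unfolding s0(2) by eventually_elim simp
    qed
    \<comment> \<open>The ratio of the free growth at the true energy to that at the bottom of the
      well; only the latter appears in S.\<close>
    define \<epsilon> where "\<epsilon> = (\<lambda>h. exp (phase B L (\<mu> h) / h - phase B L \<mu>0 / h))"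
    have \<epsilon>lim: "(\<epsilon> \<longlongrightarrow> exp (- J)) (at_right 0)"
    proof -
      have D: "((\<lambda>e. (phase B L (\<mu>0 + e) - phase B L \<mu>0) / e) \<longlongrightarrow> phase' B L \<mu>0) (at 0)"
        using phase_deriv[OF \<mu>0, of B L] by (simp add: DERIV_def)
      have F: "filterlim (\<lambda>h. - E h) (at 0) (at_right 0)"
        using tendsto_minus[OF E0] Enz by (simp add: filterlim_at)
      have "((\<lambda>h. (phase B L (\<mu>0 + (- E h)) - phase B L \<mu>0) / (- E h) * (- (E h / h))) \<longlongrightarrow> phase' B L \<mu>0 * (- (2 * \<omega>))) (at_right 0)"
        by (intro tendsto_intros filterlim_compose[OF D F] Eh)
      moreover have "phase' B L \<mu>0 * (- (2 * \<omega>)) = - J" by (simp add: J_def)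
      ultimately have "((\<lambda>h. (phase B L (\<mu>0 + (- E h)) - phase B L \<mu>0) / (- E h) * (- (E h / h))) \<longlongrightarrow> - J) (at_right 0)" by simp
      then have "((\<lambda>h. phase B L (\<mu> h) / h - phase B L \<mu>0 / h) \<longlongrightarrow> - J) (at_right 0)"
      proof (rule Lim_transform_eventually)
        show "\<forall>\<^sub>F h in at_right 0. (phase B L (\<mu>0 + (- E h)) - phase B L \<mu>0) / (- E h) * (- (E h / h)) = phase B L (\<mu> h) / h - phase B L \<mu>0 / h"
          using Enz
        proof eventually_elim
          case (elim h)
          have "(x - y) / (- e) * (- (e / h)) = x / h - y / h" if "- e \<noteq> 0" for x y e :: real
          proof -
            have "(x - y) / (- e) * (- (e / h)) = (x - y) / e * (e / h)"
              by (simp only: divide_minus_right minus_mult_minus)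
            also have "\<dots> = (x - y) / h" using that by simp
            finally show ?thesis by (simp only: diff_divide_distrib)
          qed
          from this[OF elim] show ?case unfolding \<mu>E .
        qed
      qed
      then show ?thesis unfolding \<epsilon>_def by (intro tendsto_intros)
    qed
    define kk where "kk = (\<lambda>h. free_growth.k B (\<mu> h) h L)"
    define lk where "lk = (\<lambda>h. free_growth.lk B (\<mu> h) h L)"
    define \<kappa> where "\<kappa> = (\<lambda>h. kk h / (sqrt h * exp (phase B L (\<mu> h) / h)))"
    note gl = growth_limits[OF B_pos L s0(1) \<mu>lim \<mu>ev c1]
    have \<kappa>lim: "(\<kappa> \<longlongrightarrow> c0) (at_right 0)" unfolding \<kappa>_def kk_def c0_def P0_def by (rule gl(1))
    have lklim: "((\<lambda>h. h * lk h) \<longlongrightarrow> P0) (at_right 0)" unfolding lk_def P0_def by (rule gl(2))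
    define nk where "nk = free_growth.N2 B s0 L c1"
    \<comment> \<open>z collects G(L) and G'(L). These exist separately for each h, so the required
      properties are bundled in one predicate and functions of h are chosen afterwards.\<close>
    define Q where "Q = (\<lambda>h z. hop B L h v (\<phi> h) = complex_of_real (2 * pi * h\<^sup>2 * L * (f1 h L * fst z - f h L * snd z)) \<and>
        kk h > 0 \<and> \<bar>fst z / (f h (2 * L) * kk h) - 1\<bar> \<le> 2 * nk * L * h \<and> \<bar>snd z / fst z - lk h\<bar> \<le> 4 * nk * h)"
    have small: "\<forall>\<^sub>F h in at_right 0. 2 * free_growth.A B s0 * L * h \<le> s0 * c1 \<and> 4 * nk * L * h \<le> 1"
      using eventually_small_at_right[of "s0 * c1" "2 * free_growth.A B s0 * L"] eventually_small_at_right[OF zero_less_one, of "4 * nk * L"] s0 c1(1)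
      by (auto elim: eventually_elim2)
    have f2L: "\<forall>\<^sub>F h in at_right 0. f h (2 * L) \<noteq> 0" by (rule W.wkb_tendsto(3)[OF wkb N]) (use L in simp)
    have evz: "\<forall>\<^sub>F h in at_right 0. \<exists>z. Q h z"
      using ev small \<mu>ev f2L
    proof eventually_elim
      case (elim h)
      have gs: "ground_state B h v (\<phi> h)" and rad: "radial (\<phi> h)" and h: "h > 0" using elim by (auto simp: good_def)
      have fe: "f h = (\<lambda>r. \<phi> h (r, 0))" using elim by (simp add: f_def)
      interpret FG: free_growth B "\<mu> h" s0 L c1 by unfold_locales (use B_pos s0 elim L c1 in auto)
      obtain G G1 G2 where G: "\<And>r. \<bar>r\<bar> < 2 * L - a \<Longrightarrow> (G has_real_derivative G1 r) (at r)"
        "\<And>r. \<bar>r\<bar> < 2 * L - a \<Longrightarrow> (G1 has_real_derivative G2 r) (at r)"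
        and o: "\<And>r. 0 < r \<Longrightarrow> r < 2 * L - a \<Longrightarrow> G2 r + G1 r / r = (B\<^sup>2 * r\<^sup>2 / 4 + \<mu> h) / h\<^sup>2 * G r"
        and G0: "G 0 = \<phi> h (2 * L, 0)"
        and hop: "hop B L h v (\<phi> h) = complex_of_real (2 * pi * h\<^sup>2 * L * (pd [True] (\<phi> h) (L, 0) * G L - \<phi> h (L, 0) * G1 L))"
        using hop_formula[OF gs rad v_smooth v_radial h a_pos L_gt supp] unfolding \<mu>_def by blast
      have LR: "L < 2 * L - a" using L_gt by simp
      have G0n: "G 0 \<noteq> 0" using G0 elim by (simp add: fe)
      have e1: "2 * FG.A * L * h \<le> s0 * c1" and e2: "4 * FG.N2 * L * h \<le> 1" using elim by (auto simp: nk_def)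
      have rg: "\<bar>G L / (G 0 * FG.k h L) - 1\<bar> \<le> 2 * FG.N2 * L * h" "\<bar>G1 L / G L - FG.lk h L\<bar> \<le> 4 * FG.N2 * h"
        by (rule FG.regular_solution_growth[where R = "2 * L - a" and G = G and ?G1.0 = G1 and ?G2.0 = G2 and h = h];
            use h e1 e2 LR G o G0n in blast)+
      have "Q h (G L, G1 L)" unfolding Q_def fst_conv snd_conv
      proof (intro conjI)
        show "hop B L h v (\<phi> h) = complex_of_real (2 * pi * h\<^sup>2 * L * (f1 h L * G L - f h L * G1 L))"
          unfolding fe f1_def by (rule hop)
        show "kk h > 0" unfolding kk_def using FG.k_pos[OF h, of L] L by simp
        show "\<bar>G L / (f h (2 * L) * kk h) - 1\<bar> \<le> 2 * nk * L * h" using rg(1) unfolding fe kk_def nk_def G0 .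
        show "\<bar>G1 L / G L - lk h\<bar> \<le> 4 * nk * h" using rg(2) unfolding lk_def nk_def .
      qed
      then show ?case by blast
    qed
    obtain Z where Z: "\<And>h. (\<exists>z. Q h z) \<Longrightarrow> Q h (Z h)"
    proof -
      have "\<forall>h. \<exists>z. (\<exists>z. Q h z) \<longrightarrow> Q h z" by blast
      from choice[OF this] show ?thesis using that by blast
    qed
    have evQ: "\<forall>\<^sub>F h in at_right 0. Q h (Z h)" by (rule eventually_mono[OF evz Z])
    define GL where "GL = (\<lambda>h. fst (Z h))"
    define GL1 where "GL1 = (\<lambda>h. snd (Z h))"
    define r1 where "r1 = (\<lambda>h. f h L / (f h 0 * W.g h L))"
    define r2 where "r2 = (\<lambda>h. f h (2 * L) / (f h 0 * W.g h (2 * L)))"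
    define r3 where "r3 = (\<lambda>h. GL h / (f h (2 * L) * kk h))"
    have r1lim: "(r1 \<longlongrightarrow> 1) (at_right 0)" unfolding r1_def by (rule W.wkb_tendsto(1)[OF wkb N L])
    have r2lim: "(r2 \<longlongrightarrow> 1) (at_right 0)" unfolding r2_def by (rule W.wkb_tendsto(1)[OF wkb N]) (use L in simp)
    have lin0: "((\<lambda>h. c * h) \<longlongrightarrow> 0) (at_right 0)" for c :: real
    proof -
      have "((\<lambda>h. c * h) \<longlongrightarrow> c * 0) (at_right 0)" by (intro tendsto_intros)
      then show ?thesis by simp
    qed
    have r3lim: "(r3 \<longlongrightarrow> 1) (at_right 0)"
    proof -
      have "((\<lambda>h. r3 h - 1) \<longlongrightarrow> 0) (at_right 0)"
      proof (rule Lim_null_comparison)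
        show "\<forall>\<^sub>F h in at_right 0. norm (r3 h - 1) \<le> 2 * nk * L * h" using evQ by eventually_elim (simp add: Q_def r3_def GL_def)
      qed (rule lin0)
      then show ?thesis by (simp add: LIM_zero_iff)
    qed
    have flim: "((\<lambda>h. h * (f1 h L / f h L)) \<longlongrightarrow> - P0) (at_right 0)" using W.wkb_tendsto(2)[OF wkb N L] unfolding pL .
    have Glim: "((\<lambda>h. h * (GL1 h / GL h)) \<longlongrightarrow> P0) (at_right 0)"
    proof -
      have "((\<lambda>h. h * (GL1 h / GL h) - h * lk h) \<longlongrightarrow> 0) (at_right 0)"
      proof (rule Lim_null_comparison)
        show "\<forall>\<^sub>F h in at_right 0. norm (h * (GL1 h / GL h) - h * lk h) \<le> (4 * nk * h) * h"
          using evQ eventually_at_right_less[of "0::real"]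
        proof eventually_elim
          case (elim h)
          have "norm (h * (GL1 h / GL h) - h * lk h) = \<bar>GL1 h / GL h - lk h\<bar> * h"
            using elim by (simp add: right_diff_distrib[symmetric] abs_mult mult.commute del: times_divide_eq_right)
          also have "\<dots> \<le> (4 * nk * h) * h" using elim by (intro mult_right_mono) (auto simp: Q_def GL_def GL1_def)
          finally show ?case .
        qed
        have "((\<lambda>h. (4 * nk * h) * h) \<longlongrightarrow> 0 * 0) (at_right 0)" by (intro tendsto_mult lin0 tendsto_ident_at)
        then show "((\<lambda>h. (4 * nk * h) * h) \<longlongrightarrow> 0) (at_right 0)" by simp
      qed
      from tendsto_add[OF this lklim] show ?thesis by simp
    qed
    have nlim: "((\<lambda>h. h * (f h 0)\<^sup>2) \<longlongrightarrow> \<omega> / pi) (at_right 0)"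
    proof (rule W.normalization_limit[OF _ wkb N])
      show "f h \<in> borel_measurable borel" for h
      proof (cases "good h")
        case True
        then have "smooth2 (\<phi> h)" by (simp add: good_def ground_state_def)
        from smooth2_cont[OF this, of "[]"] have c: "continuous_on UNIV (\<phi> h)" by simp
        have "continuous_on UNIV (\<lambda>r. \<phi> h (r, 0))" by (rule continuous_on_compose2[OF c]) (auto intro!: continuous_intros)
        then show ?thesis using True by (simp add: f_def borel_measurable_continuous_onI)
      next
        case False
        then show ?thesis by (simp add: f_def)
      qed
      show "\<forall>\<^sub>F h in at_right 0. pi * (LINT s:{0..}|lborel. (f h (sqrt s))\<^sup>2) = 1"
        using ev by eventually_elim (use ground_state_norm(2) in \<open>auto simp: f_def good_def\<close>)
    qed
    \<comment> \<open>The quotient of the hopping coefficient and the claimed leading term,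
      regrouped so that every factor has a limit. The minus sign of the claim is absorbed by writing
      the growing logarithmic derivative first.\<close>
    define T where "T = (\<lambda>h. 2 * pi * L * (h * (f h 0)\<^sup>2) * bb * \<kappa> h * \<epsilon> h * (r1 h * r2 h * r3 h) * (h * (GL1 h / GL h) - h * (f1 h L / f h L)) / C)"
    have "(T \<longlongrightarrow> 2 * pi * L * (\<omega> / pi) * bb * c0 * exp (- J) * (1 * 1 * 1) * (P0 - (- P0)) / C) (at_right 0)"
      unfolding T_def using Cpos by (intro tendsto_intros nlim \<kappa>lim \<epsilon>lim r1lim r2lim r3lim flim Glim) auto
    moreover have "2 * pi * L * (\<omega> / pi) * bb * c0 * exp (- J) * (1 * 1 * 1) * (P0 - (- P0)) / C = 1"
    proof -
      have "2 * pi * L * (\<omega> / pi) * bb * c0 * exp (- J) * (1 * 1 * 1) * (P0 - (- P0)) = C" by (simp add: C_def)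
      then show ?thesis using Cpos by simp
    qed
    ultimately have "(T \<longlongrightarrow> 1) (at_right 0)" by (simp only:)
    then have "((\<lambda>h. complex_of_real (T h)) \<longlongrightarrow> complex_of_real 1) (at_right 0)" by (rule tendsto_of_real)
    then have Tlim: "((\<lambda>h. complex_of_real (T h)) \<longlongrightarrow> 1) (at_right 0)" by simp
    have "\<forall>\<^sub>F h in at_right 0. complex_of_real (T h) = hop B L h v (\<phi> h) / complex_of_real (- C * sqrt h * exp (- tunnel_S B L v / h))"
      using evQ wkb eventually_at_right_less[of "0::real"] W.wkb_tendsto(3)[OF wkb N L] f2L small
    proof eventually_elim
      case (elim h)
      have f0: "f h 0 \<noteq> 0" using elim(2) unfolding W.wkb_def by blast
      have h: "h > 0" and fL: "f h L \<noteq> 0" and f2: "f h (2 * L) \<noteq> 0" and kp: "kk h > 0"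
        using elim(1,3-5) unfolding Q_def by blast+
      \<comment> \<open>With 4 nk L h <= 1 the right side is at most 1/2, so G(L) is nonzero and its
        logarithmic derivative makes sense.\<close>
      have "\<bar>r3 h - 1\<bar> \<le> 2 * nk * L * h" using elim(1) unfolding Q_def r3_def GL_def by blast
      then have "r3 h \<noteq> 0" using elim(6) by auto
      then have GLn: "GL h \<noteq> 0" by (auto simp: r3_def)
      have a1: "f h L = r1 h * (f h 0 * W.g h L)" using f0 by (simp add: r1_def)
      have a2: "f h (2 * L) = r2 h * (f h 0 * W.g h (2 * L))" using f0 by (simp add: r2_def)
      have a3: "GL h = r3 h * (f h (2 * L) * kk h)" using f2 kp by (simp add: r3_def)
      have a4: "kk h = \<kappa> h * (sqrt h * (\<epsilon> h * exp (phase B L \<mu>0 / h)))"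
        using h by (simp add: \<kappa>_def \<epsilon>_def mult_exp_exp)
      have a5: "W.g h L * W.g h (2 * L) * exp (phase B L \<mu>0 / h) = bb * exp (- S / h)"
        unfolding W.g_def bb_def S mult_exp_exp by (rule arg_cong[where f = exp]) (simp add: diff_divide_distrib add_divide_distrib)
      have prod: "f h L * GL h = (f h 0)\<^sup>2 * (r1 h * r2 h * r3 h) * \<kappa> h * \<epsilon> h * sqrt h * (bb * exp (- S / h))"
        unfolding a5[symmetric] a3 a4 a2 a1 by (simp add: power2_eq_square mult_ac)
      define X where "X = 2 * pi * h\<^sup>2 * L * (f1 h L * GL h - f h L * GL1 h)"
      have hX: "hop B L h v (\<phi> h) = complex_of_real X"
        using elim(1) unfolding Q_def X_def GL_def GL1_def by blast
      \<comment> \<open>One power of h goes with each logarithmic derivative, which has a limit only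
        after this scaling. The remaining h joins f(0)^2 from \<open>prod\<close>, so just sqrt h is
        left over.\<close>
      have "X = 2 * pi * L * h * (f h L * GL h) * (h * (f1 h L / f h L) - h * (GL1 h / GL h))"
        unfolding X_def using fL GLn by (simp add: field_simps power2_eq_square)
      also have "\<dots> = T h * (- C * sqrt h * exp (- S / h))"
        unfolding prod T_def using Cpos by (simp add: field_simps power2_eq_square)
      finally have X: "X = T h * (- C * sqrt h * exp (- S / h))" .
      have nz: "- C * sqrt h * exp (- S / h) \<noteq> 0" using Cpos h by simp
      have "complex_of_real (T h) = complex_of_real (X / (- C * sqrt h * exp (- S / h)))" unfolding X using nz by simp
      also have "\<dots> = complex_of_real X / complex_of_real (- C * sqrt h * exp (- S / h))" by (rule of_real_divide)
      finally show ?case unfolding hX S_def .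
    qed
    then show "((\<lambda>h. hop B L h v (\<phi> h) / complex_of_real (- C * sqrt h * exp (- tunnel_S B L v / h))) \<longlongrightarrow> 1) (at_right 0)"
      by (rule Lim_transform_eventually[OF Tlim])
  qed
qed

end
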